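(* Let $\mathcal C=(\overline{\mathcal C},T_{\mathcal C})$, $\mathcal D=(\overline{\mathcal D},T_{\mathcal D})$ and $\mathcal E$ be $\infty$-bicategories. The restriction functor $$\mathrm{Fun}(\mathcal C\otimes\mathcal D,\mathcal E)\cong \mathrm{Fun}\big((\overline{\mathcal C}\times\overline{\mathcal D},T_{\simeq}),\mathcal E\big)\longrightarrow \mathrm{Fun}_{\mathrm{oplax}}(\mathcal C\times\mathcal D,\mathcal E)$$ is fully faithful, and its essential image consists of those oplax functors $\varphi$ from $\mathcal C\times\mathcal D$ to $\mathcal E$ which satisfy the following conditions: (i) for all objects $x\in\mathcal C$, $y\in\mathcal D$, the restrictions of $\varphi$ to $\{x\}\times\mathcal D$ and to $\mathcal C\times\{y\}$ are maps of scaled simplicial sets (i.e. they send all thin triangles of $\mathcal D$, resp. $\mathcal C$, to thin triangles of $\mathcal E$); (ii) for all arrows $f\colon x\to x'$ in $\mathcal C$ and $g\colon y\to y'$ in $\mathcal D$, the $2$-simplex of $\mathcal C\times\mathcal D$ whose $\mathcal C$-component is the degenerate triangle on $f$ with edges $f$ (on $\Delta^{\{0,1\}}$), $\mathrm{id}_{x'}$ (on $\Delta^{\{1,2\}}$), $f$ (on $\Delta^{\{0,2\}}$), and whose $\mathcal D$-component is the degenerate triangle on $g$ with edges $\mathrm{id}_y$, $g$, $g$ respectively, i.e. the triangle $(x,y)\xrightarrow{(f,y)}(x',y)\xrightarrow{(x',g)}(x',y')$ with long edge $(f,g)$, is mapped by $\varphi$ to a thin triangle in $\mathcal E$.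
   Context: A scaled simplicial set is a pair $(X,T)$ with $X$ a simplicial set and $T\subseteq X_2$ a set of $2$-simplices ("thin triangles") containing all degenerate ones; maps are simplicial maps preserving thin triangles. The category is $\mathrm{Set}_\Delta^{\mathrm{sc}}$. When listing thin triangles, degenerate ones are implicitly included, and for a simplicial subset $L\subseteq X$ the pair $(L,T)$ means $L$ with thin triangles $T\cap L_2$. An $\infty$-bicategory is a scaled simplicial set with the extension property with respect to: (a) $(\Lambda^n_i,\{\Delta^{\{i-1,i,i+1\}}\})\to(\Delta^n,\{\Delta^{\{i-1,i,i+1\}}\})$, $n\ge2$, $0<i<n$; (b) $(\Delta^4,T)\to(\Delta^4,T\cup\{\Delta^{\{0,3,4\}},\Delta^{\{0,1,4\}}\})$ with $T=\{\Delta^{\{0,2,4\}},\Delta^{\{1,2,3\}},\Delta^{\{0,1,3\}},\Delta^{\{1,3,4\}},\Delta^{\{0,1,2\}}\}$; (c) $(\Lambda^n_0\amalg_{\Delta^{\{0,1\}}}\Delta^0,\{\Delta^{\{0,1,n\}}\})\to(\Delta^n\amalg_{\Delta^{\{0,1\}}}\Delta^0,\{\Delta^{\{0,1,n\}}\})$, $n\ge3$. These are the fibrant objects of the bicategorical model structure on $\mathrm{Set}_\Delta^{\mathrm{sc}}$, whose cofibrations are the monomorphisms and which is cartesian closed; $\mathrm{Fun}(X,Y)$ denotes the internal hom for the cartesian product, an $\infty$-bicategory when $Y$ is. For an $\infty$-bicategory $\mathcal C$, $\mathcal C^{\mathrm{th}}$ is the $\infty$-category of simplices all of whose triangles are thin;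 an edge of $\mathcal C$ is invertible if it is an isomorphism in the homotopy category of $\mathcal C^{\mathrm{th}}$. For vertices $x,y$ of an $\infty$-bicategory $\mathcal C$, the mapping $\infty$-category $\mathrm{Hom}_{\mathcal C}(x,y)$ has as $n$-simplices the maps $f\colon\Delta^n\times\Delta^1\to\mathcal C$ constant at $x$ on $\Delta^n\times\{0\}$, constant at $y$ on $\Delta^n\times\{1\}$, with $f|_{\Delta^{\{(i,0),(i,1),(j,1)\}}}$ thin for all $i\le j$. A functor is fully faithful if it induces equivalences on all mapping $\infty$-categories; the essential image is the collection of objects equivalent to (connected by an invertible edge to) an object in the image. Gray product: a $2$-simplex $\sigma$ degenerates along $\Delta^{\{i,i+1\}}$ if $\sigma$ and $\sigma|_{\Delta^{\{i,i+1\}}}$ are both degenerate. $(X,T_X)\otimes(Y,T_Y)$ has underlying simplicial set $X\times Y$, with $(\sigma_X,\sigma_Y)$ thin iff $\sigma_X\in T_X$, $\sigma_Y\in T_Y$, and either $\sigma_X$ degenerates along $\Delta^{\{1,2\}}$ or $\sigma_Y$ degenerates along $\Delta^{\{0,1\}}$. $T_{\simeq}\subseteq T_{\mathcal C}\times T_{\mathcal D}$ is the set of $(\alpha,\beta)$ such that either $\alpha|_{\Delta^{\{1,2\}}}$ is invertible in $\mathcal C$ or $\beta|_{\Delta^{\{0,1\}}}$ is invertible in $\mathcal D$. The inclusion $\mathcal C\otimes\mathcal D\hookrightarrow(\overline{\mathcal C}\times\overline{\mathcal D},T_\simeq)$ is a bicategorical equivalence which is the identity on underlying simplicial sets, so restriction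 along it gives an isomorphism $\mathrm{Fun}((\overline{\mathcal C}\times\overline{\mathcal D},T_{\simeq}),\mathcal E)\cong\mathrm{Fun}(\mathcal C\otimes\mathcal D,\mathcal E)$. Oplax functors: for an $\infty$-bicategory $\mathcal B=(\overline{\mathcal B},T_{\mathcal B})$, let $L_{\mathcal B}\subseteq T_{\mathcal B}$ be the set of thin triangles $\sigma$ such that $\sigma|_{\Delta^{\{0,1\}}}$ or $\sigma|_{\Delta^{\{1,2\}}}$ is invertible in $\mathcal B$. An oplax functor from $\mathcal B$ to $\mathcal E$ is a map of scaled simplicial sets $(\overline{\mathcal B},L_{\mathcal B})\to\mathcal E$, and $\mathrm{Fun}_{\mathrm{oplax}}(\mathcal B,\mathcal E):=\mathrm{Fun}((\overline{\mathcal B},L_{\mathcal B}),\mathcal E)$. Since $L_{\mathcal C\times\mathcal D}\subseteq T_{\simeq}$, restriction along $(\overline{\mathcal C}\times\overline{\mathcal D},L_{\mathcal C\times\mathcal D})\to(\overline{\mathcal C}\times\overline{\mathcal D},T_\simeq)$ gives the functor in the claim. *)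

theory Defs
  imports Main "HOL-Library.FuncSet"
begin

section \<open>Simplicial sets\<close>

text \<open>
  A monotone map \<open>[m] \<rightarrow> [n]\<close> is encoded as the list of its \<open>m + 1\<close> values.  The composite
  \<open>\<theta> \<circ> \<psi>\<close> is then \<open>map ((!) \<theta>) \<psi>\<close>, and the identity of \<open>[n]\<close> is \<open>[0..<Suc n]\<close>.
\<close>

definition mono_maps :: "nat \<Rightarrow> nat \<Rightarrow> nat list set" where
  "mono_maps m n = {\<theta>. length \<theta> = Suc m \<and> sorted \<theta> \<and> set \<theta> \<subseteq> {..n}}"

text \<open>
  \<open>cells X n\<close> is \<open>X\<^sub>n\<close>; for \<open>\<theta> : [m] \<rightarrow> [n]\<close>, \<open>act X n \<theta>\<close> is the induced map \<open>X\<^sub>n \<rightarrow> X\<^sub>m\<close>.  The sets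
  \<open>X\<^sub>n\<close> for different \<open>n\<close> need not be disjoint, hence the explicit \<open>n\<close>.  In particular
  \<open>act X n [i, j, k] \<sigma>\<close> is the restriction of \<open>\<sigma>\<close> along \<open>[i, j, k]\<close>, i.e. \<open>\<sigma>|\<Delta>\<^bsup>{i,j,k}\<^esup>\<close> if
  \<open>i < j < k\<close>.
\<close>

record 'a sset =
  cells :: "nat \<Rightarrow> 'a set"
  act :: "nat \<Rightarrow> nat list \<Rightarrow> 'a \<Rightarrow> 'a"

definition simplicial_set :: "('a, 'z) sset_scheme \<Rightarrow> bool" where
  "simplicial_set X \<longleftrightarrow>
     (\<forall>m n. \<forall>\<theta> \<in> mono_maps m n. \<forall>x \<in> cells X n. act X n \<theta> x \<in> cells X m) \<and>
     (\<forall>n. \<forall>x \<in> cells X n. act X n [0..<Suc n] x = x) \<and>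
     (\<forall>l m n. \<forall>\<psi> \<in> mono_maps l m. \<forall>\<theta> \<in> mono_maps m n. \<forall>x \<in> cells X n.
        act X m \<psi> (act X n \<theta> x) = act X n (map ((!) \<theta>) \<psi>) x)"

definition degenerate :: "('a, 'z) sset_scheme \<Rightarrow> nat \<Rightarrow> 'a \<Rightarrow> bool" where
  "degenerate X n \<sigma> \<longleftrightarrow>
     (\<exists>m < n. \<exists>\<theta> \<in> mono_maps n m. \<exists>\<tau> \<in> cells X m. \<sigma> = act X m \<theta> \<tau>)"

text \<open>The \<open>n\<close>-simplex constant at the vertex \<open>x\<close>.\<close>

definition const_cell :: "('a, 'z) sset_scheme \<Rightarrow> nat \<Rightarrow> 'a \<Rightarrow> 'a" where
  "const_cell X n x = act X 0 (replicate (Suc n) 0) x"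

text \<open>
  Maps are families indexed by the dimension, made extensional (undefined outside \<open>X\<^sub>n\<close>), so that
  equality of maps is equality in the logic.
\<close>

definition smaps :: "('a, 'y) sset_scheme \<Rightarrow> ('b, 'z) sset_scheme \<Rightarrow> (nat \<Rightarrow> 'a \<Rightarrow> 'b) set" where
  "smaps X Y =
     {f. (\<forall>n. f n \<in> cells X n \<rightarrow>\<^sub>E cells Y n) \<and>
         (\<forall>m n. \<forall>\<theta> \<in> mono_maps m n. \<forall>x \<in> cells X n. f m (act X n \<theta> x) = act Y n \<theta> (f n x))}"

definition scomp ::
    "('a, 'z) sset_scheme \<Rightarrow> (nat \<Rightarrow> 'b \<Rightarrow> 'c) \<Rightarrow> (nat \<Rightarrow> 'a \<Rightarrow> 'b) \<Rightarrow> nat \<Rightarrow> 'a \<Rightarrow> 'c" where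
  "scomp X g f = (\<lambda>n. \<lambda>x \<in> cells X n. g n (f n x))"

definition sid :: "('a, 'z) sset_scheme \<Rightarrow> nat \<Rightarrow> 'a \<Rightarrow> 'a" where
  "sid X = (\<lambda>n. \<lambda>x \<in> cells X n. x)"

definition sprod :: "('a, 'y) sset_scheme \<Rightarrow> ('b, 'z) sset_scheme \<Rightarrow> ('a \<times> 'b) sset" where
  "sprod X Y = \<lparr>cells = (\<lambda>n. cells X n \<times> cells Y n),
                act = (\<lambda>n \<theta> (x, y). (act X n \<theta> x, act Y n \<theta> y))\<rparr>"

definition simplex :: "nat \<Rightarrow> nat list sset" where
  "simplex n = \<lparr>cells = (\<lambda>m. mono_maps m n), act = (\<lambda>m \<theta> s. map ((!) s) \<theta>)\<rparr>"

text \<open>\<open>horn n i\<close> is \<open>\<Lambda>\<^sup>n\<^sub>i\<close>, the union of the faces of \<open>\<Delta>\<^sup>n\<close> opposite to the vertices \<open>j \<noteq> i\<close>.\<close>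

definition horn :: "nat \<Rightarrow> nat \<Rightarrow> nat list sset" where
  "horn n i = \<lparr>cells = (\<lambda>m. {s \<in> mono_maps m n. \<exists>j \<le> n. j \<noteq> i \<and> j \<notin> set s}),
               act = act (simplex n)\<rparr>"

text \<open>
  For a simplicial subset \<open>A\<close> of \<open>X\<close>, the pushout \<open>X \<amalg>\<^bsub>A\<^esub> \<Delta>\<^sup>0\<close>, computed degreewise as the disjoint
  union of \<open>X\<^sub>n - A\<^sub>n\<close> and a point \<open>None\<close>.
\<close>

definition collapse :: "('a, 'z) sset_scheme \<Rightarrow> (nat \<Rightarrow> 'a set) \<Rightarrow> 'a option sset" where
  "collapse X A =
     \<lparr>cells = (\<lambda>n. insert None (Some ` (cells X n - A n))),
      act = (\<lambda>n \<theta> s. case s of None \<Rightarrow> None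
               | Some x \<Rightarrow> (if act X n \<theta> x \<in> A (length \<theta> - 1) then None else Some (act X n \<theta> x)))\<rparr>"

text \<open>The simplices of the edge \<open>\<Delta>\<^bsup>{0,1}\<^esup>\<close>, seen inside any \<open>\<Delta>\<^sup>n\<close> with \<open>n \<ge> 1\<close>.\<close>

definition edge01 :: "nat \<Rightarrow> nat list set" where
  "edge01 m = mono_maps m 1"

text \<open>
  The internal hom of simplicial sets: \<open>n\<close>-simplices are the maps \<open>\<Delta>\<^sup>n \<times> X \<rightarrow> Y\<close>, on which
  \<open>\<theta> : [m] \<rightarrow> [n]\<close> acts by precomposition with \<open>\<theta> \<times> X : \<Delta>\<^sup>m \<times> X \<rightarrow> \<Delta>\<^sup>n \<times> X\<close>.
\<close>

definition fun_act ::
    "('a, 'z) sset_scheme \<Rightarrow> nat \<Rightarrow> nat list \<Rightarrow> (nat \<Rightarrow> nat list \<times> 'a \<Rightarrow> 'b) \<Rightarrow> nat \<Rightarrow> nat list \<times> 'a \<Rightarrow> 'b"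
  where
  "fun_act X n \<theta> F =
     scomp (sprod (simplex (length \<theta> - 1)) X) F (\<lambda>k (s, x). (map ((!) \<theta>) s, x))"

definition sFun ::
    "('a, 'y) sset_scheme \<Rightarrow> ('b, 'z) sset_scheme \<Rightarrow> (nat \<Rightarrow> nat list \<times> 'a \<Rightarrow> 'b) sset" where
  "sFun X Y = \<lparr>cells = (\<lambda>n. smaps (sprod (simplex n) X) Y), act = fun_act X\<rparr>"

text \<open>A map \<open>X \<rightarrow> Y\<close> as a vertex \<open>\<Delta>\<^sup>0 \<times> X \<rightarrow> Y\<close> of the internal hom.\<close>

definition as_vertex ::
    "('a, 'z) sset_scheme \<Rightarrow> (nat \<Rightarrow> 'a \<Rightarrow> 'b) \<Rightarrow> nat \<Rightarrow> nat list \<times> 'a \<Rightarrow> 'b" where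
  "as_vertex X f = scomp (sprod (simplex 0) X) f (\<lambda>k (s, x). x)"


section \<open>The homotopy category and equivalences of \<open>\<infinity>\<close>-categories\<close>

definition src :: "('a, 'z) sset_scheme \<Rightarrow> 'a \<Rightarrow> 'a" where
  "src A e = act A 1 [0] e"

definition tgt :: "('a, 'z) sset_scheme \<Rightarrow> 'a \<Rightarrow> 'a" where
  "tgt A e = act A 1 [1] e"

text \<open>
  For an \<open>\<infinity>\<close>-category \<open>A\<close>: morphisms of the homotopy category are homotopy classes of edges, and the
  composite of two classes (in diagrammatic order) is the class of all long edges of triangles whose
  short edges represent them.
\<close>

definition edge_homotopic :: "('a, 'z) sset_scheme \<Rightarrow> 'a \<Rightarrow> 'a \<Rightarrow> bool" where
  "edge_homotopic A f g \<longleftrightarrow>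
     (\<exists>\<sigma> \<in> cells A 2. act A 2 [0,1] \<sigma> = f \<and> act A 2 [1,2] \<sigma> = const_cell A 1 (tgt A f) \<and>
        act A 2 [0,2] \<sigma> = g)"

definition ho_class :: "('a, 'z) sset_scheme \<Rightarrow> 'a \<Rightarrow> 'a set" where
  "ho_class A f = {g. edge_homotopic A f g}"

definition ho_hom :: "('a, 'z) sset_scheme \<Rightarrow> 'a \<Rightarrow> 'a \<Rightarrow> 'a set set" where
  "ho_hom A x y = ho_class A ` {f \<in> cells A 1. src A f = x \<and> tgt A f = y}"

definition ho_comp :: "('a, 'z) sset_scheme \<Rightarrow> 'a set \<Rightarrow> 'a set \<Rightarrow> 'a set" where
  "ho_comp A P Q =
     {act A 2 [0,2] \<sigma> | \<sigma>. \<sigma> \<in> cells A 2 \<and> act A 2 [0,1] \<sigma> \<in> P \<and> act A 2 [1,2] \<sigma> \<in> Q}"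

definition ho_id :: "('a, 'z) sset_scheme \<Rightarrow> 'a \<Rightarrow> 'a set" where
  "ho_id A x = ho_class A (const_cell A 1 x)"

definition ho_iso :: "('a, 'z) sset_scheme \<Rightarrow> 'a \<Rightarrow> bool" where
  "ho_iso A e \<longleftrightarrow> e \<in> cells A 1 \<and>
     (\<exists>Q \<in> ho_hom A (tgt A e) (src A e).
        ho_comp A (ho_class A e) Q = ho_id A (src A e) \<and>
        ho_comp A Q (ho_class A e) = ho_id A (tgt A e))"

definition isomorphic_objects :: "('a, 'z) sset_scheme \<Rightarrow> 'a \<Rightarrow> 'a \<Rightarrow> bool" where
  "isomorphic_objects A x y \<longleftrightarrow> (\<exists>e. ho_iso A e \<and> src A e = x \<and> tgt A e = y)"

text \<open>A functor of \<open>\<infinity>\<close>-categories with an inverse up to isomorphism in the functor categories.\<close>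

definition cat_equivalence ::
    "('a, 'y) sset_scheme \<Rightarrow> ('b, 'z) sset_scheme \<Rightarrow> (nat \<Rightarrow> 'a \<Rightarrow> 'b) \<Rightarrow> bool" where
  "cat_equivalence A B f \<longleftrightarrow> f \<in> smaps A B \<and>
     (\<exists>g \<in> smaps B A.
        isomorphic_objects (sFun A A) (as_vertex A (scomp A g f)) (as_vertex A (sid A)) \<and>
        isomorphic_objects (sFun B B) (as_vertex B (scomp B f g)) (as_vertex B (sid B)))"


section \<open>Scaled simplicial sets\<close>

record 'a scaled = "'a sset" +
  thin :: "'a set"

definition scaled_sset :: "'a scaled \<Rightarrow> bool" where
  "scaled_sset X \<longleftrightarrow> simplicial_set X \<and> thin X \<subseteq> cells X 2 \<and>
     (\<forall>\<sigma> \<in> cells X 2. degenerate X 2 \<sigma> \<longrightarrow> \<sigma> \<in> thin X)"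

text \<open>\<open>scale X T\<close> is \<open>(X, T)\<close>, with degenerate triangles added and triangles outside \<open>X\<close> dropped.\<close>

definition scale :: "('a, 'z) sset_scheme \<Rightarrow> 'a set \<Rightarrow> 'a scaled" where
  "scale X T = \<lparr>cells = cells X, act = act X,
                thin = {\<sigma> \<in> cells X 2. \<sigma> \<in> T \<or> degenerate X 2 \<sigma>}\<rparr>"

definition sc_maps :: "'a scaled \<Rightarrow> 'b scaled \<Rightarrow> (nat \<Rightarrow> 'a \<Rightarrow> 'b) set" where
  "sc_maps X Y = {f \<in> smaps X Y. \<forall>\<sigma> \<in> thin X. f 2 \<sigma> \<in> thin Y}"

definition sc_prod :: "'a scaled \<Rightarrow> 'b scaled \<Rightarrow> ('a \<times> 'b) scaled" where
  "sc_prod X Y = \<lparr>cells = cells (sprod X Y), act = act (sprod X Y), thin = thin X \<times> thin Y\<rparr>"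

text \<open>
  The internal hom for the cartesian product.  By adjunction its \<open>n\<close>-simplices are the maps out of
  \<open>\<Delta>\<^sup>n \<times> X\<close> where \<open>\<Delta>\<^sup>n\<close> has only degenerate thin triangles, and its thin triangles are the maps out
  of \<open>\<Delta>\<^sup>2 \<times> X\<close> where all triangles of \<open>\<Delta>\<^sup>2\<close> are thin.
\<close>

definition FunSc :: "'a scaled \<Rightarrow> 'b scaled \<Rightarrow> (nat \<Rightarrow> nat list \<times> 'a \<Rightarrow> 'b) scaled" where
  "FunSc X Y = \<lparr>cells = (\<lambda>n. sc_maps (sc_prod (scale (simplex n) {}) X) Y),
                act = fun_act X,
                thin = sc_maps (sc_prod (scale (simplex 2) UNIV) X) Y\<rparr>"

text \<open>For \<open>i : X \<rightarrow> X'\<close>, the functor \<open>Fun(X', Y) \<rightarrow> Fun(X, Y)\<close>.\<close>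

definition restriction ::
    "(nat \<Rightarrow> 'a \<Rightarrow> 'a') \<Rightarrow> 'a scaled \<Rightarrow> 'a' scaled \<Rightarrow> 'b scaled \<Rightarrow>
     nat \<Rightarrow> (nat \<Rightarrow> nat list \<times> 'a' \<Rightarrow> 'b) \<Rightarrow> (nat \<Rightarrow> nat list \<times> 'a \<Rightarrow> 'b)" where
  "restriction i X X' Y =
     (\<lambda>n. \<lambda>F \<in> cells (FunSc X' Y) n. scomp (sprod (simplex n) X) F (\<lambda>k (s, x). (s, i k x)))"

definition sc_iso :: "'a scaled \<Rightarrow> 'b scaled \<Rightarrow> (nat \<Rightarrow> 'a \<Rightarrow> 'b) \<Rightarrow> bool" where
  "sc_iso X Y F \<longleftrightarrow> F \<in> sc_maps X Y \<and>
     (\<exists>G \<in> sc_maps Y X. scomp X G F = sid X \<and> scomp Y F G = sid Y)"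

definition sc_inverse :: "'a scaled \<Rightarrow> 'b scaled \<Rightarrow> (nat \<Rightarrow> 'a \<Rightarrow> 'b) \<Rightarrow> nat \<Rightarrow> 'b \<Rightarrow> 'a" where
  "sc_inverse X Y F = (\<lambda>n. \<lambda>y \<in> cells Y n. inv_into (cells X n) (F n) y)"


section \<open>\<open>\<infinity>\<close>-bicategories\<close>

text \<open>The extension property of \<open>C\<close> with respect to an inclusion of \<open>A\<close> into \<open>B\<close>.\<close>

definition has_extensions :: "'c scaled \<Rightarrow> 'a scaled \<Rightarrow> 'a scaled \<Rightarrow> bool" where
  "has_extensions C A B \<longleftrightarrow>
     (\<forall>f \<in> sc_maps A C. \<exists>g \<in> sc_maps B C. \<forall>n. \<forall>x \<in> cells A n. g n x = f n x)"

definition inf_bicategory :: "'a scaled \<Rightarrow> bool" where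
  "inf_bicategory C \<longleftrightarrow> scaled_sset C \<and>
     (\<forall>n i. 2 \<le> n \<and> 0 < i \<and> i < n \<longrightarrow>
        has_extensions C (scale (horn n i) {[i - 1, i, i + 1]})
                         (scale (simplex n) {[i - 1, i, i + 1]})) \<and>
     (let T = {[0,2,4], [1,2,3], [0,1,3], [1,3,4], [0,1,2]}
      in has_extensions C (scale (simplex 4) T) (scale (simplex 4) (T \<union> {[0,3,4], [0,1,4]}))) \<and>
     (\<forall>n \<ge> 3.
        has_extensions C (scale (collapse (horn n 0) edge01) {Some [0, 1, n]})
                         (scale (collapse (simplex n) edge01) {Some [0, 1, n]}))"

text \<open>The simplices all of whose triangles are thin.\<close>

definition thin_core :: "'a scaled \<Rightarrow> 'a sset" where
  "thin_core C = \<lparr>cells = (\<lambda>n. {x \<in> cells C n. \<forall>\<theta> \<in> mono_maps 2 n. act C n \<theta> x \<in> thin C}),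
                  act = act C\<rparr>"

definition invertible :: "'a scaled \<Rightarrow> 'a \<Rightarrow> bool" where
  "invertible C e \<longleftrightarrow> ho_iso (thin_core C) e"

text \<open>
  The mapping \<open>\<infinity>\<close>-category.  The pair \<open>([i, i, j], [0, 1, 1])\<close> is the triangle of \<open>\<Delta>\<^sup>n \<times> \<Delta>\<^sup>1\<close> with
  vertices \<open>(i, 0)\<close>, \<open>(i, 1)\<close>, \<open>(j, 1)\<close>.
\<close>

definition Hom :: "'a scaled \<Rightarrow> 'a \<Rightarrow> 'a \<Rightarrow> (nat \<Rightarrow> nat list \<times> nat list \<Rightarrow> 'a) sset" where
  "Hom C x y =
     \<lparr>cells = (\<lambda>n. {f \<in> smaps (sprod (simplex n) (simplex 1)) C.
         (\<forall>k. \<forall>s \<in> mono_maps k n. f k (s, replicate (Suc k) 0) = const_cell C k x) \<and>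
         (\<forall>k. \<forall>s \<in> mono_maps k n. f k (s, replicate (Suc k) 1) = const_cell C k y) \<and>
         (\<forall>i j. i \<le> j \<and> j \<le> n \<longrightarrow> f 2 ([i, i, j], [0, 1, 1]) \<in> thin C)}),
      act = fun_act (simplex 1)\<rparr>"

definition Hom_map ::
    "'a scaled \<Rightarrow> (nat \<Rightarrow> 'a \<Rightarrow> 'b) \<Rightarrow> 'a \<Rightarrow> 'a \<Rightarrow>
     nat \<Rightarrow> (nat \<Rightarrow> nat list \<times> nat list \<Rightarrow> 'a) \<Rightarrow> (nat \<Rightarrow> nat list \<times> nat list \<Rightarrow> 'b)" where
  "Hom_map C F x y =
     (\<lambda>n. \<lambda>f \<in> cells (Hom C x y) n. scomp (sprod (simplex n) (simplex 1)) F f)"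

definition fully_faithful :: "'a scaled \<Rightarrow> 'b scaled \<Rightarrow> (nat \<Rightarrow> 'a \<Rightarrow> 'b) \<Rightarrow> bool" where
  "fully_faithful C D F \<longleftrightarrow> F \<in> sc_maps C D \<and>
     (\<forall>x \<in> cells C 0. \<forall>y \<in> cells C 0.
        cat_equivalence (Hom C x y) (Hom D (F 0 x) (F 0 y)) (Hom_map C F x y))"

definition essential_image :: "'a scaled \<Rightarrow> 'b scaled \<Rightarrow> (nat \<Rightarrow> 'a \<Rightarrow> 'b) \<Rightarrow> 'b set" where
  "essential_image C D F =
     {y \<in> cells D 0. \<exists>x \<in> cells C 0. \<exists>e. invertible D e \<and> src D e = y \<and> tgt D e = F 0 x}"


section \<open>Gray products and oplax functors\<close>

definition degenerates_along :: "'a scaled \<Rightarrow> nat \<Rightarrow> 'a \<Rightarrow> bool" where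
  "degenerates_along X i \<sigma> \<longleftrightarrow> degenerate X 2 \<sigma> \<and> degenerate X 1 (act X 2 [i, i + 1] \<sigma>)"

definition gray :: "'a scaled \<Rightarrow> 'b scaled \<Rightarrow> ('a \<times> 'b) scaled" where
  "gray X Y = scale (sprod X Y)
     {(\<sigma>, \<tau>). \<sigma> \<in> thin X \<and> \<tau> \<in> thin Y \<and> (degenerates_along X 1 \<sigma> \<or> degenerates_along Y 0 \<tau>)}"

text \<open>The product with the scaling \<open>T\<^sub>\<simeq>\<close>.\<close>

definition prod_simeq :: "'a scaled \<Rightarrow> 'b scaled \<Rightarrow> ('a \<times> 'b) scaled" where
  "prod_simeq C D = scale (sprod C D)
     {(\<alpha>, \<beta>). \<alpha> \<in> thin C \<and> \<beta> \<in> thin D \<and>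
        (invertible C (act C 2 [1,2] \<alpha>) \<or> invertible D (act D 2 [0,1] \<beta>))}"

text \<open>Oplax functors from \<open>B\<close> are the maps out of \<open>oplax_source B\<close>.\<close>

definition oplax_source :: "'a scaled \<Rightarrow> 'a scaled" where
  "oplax_source B = scale B
     {\<sigma> \<in> thin B. invertible B (act B 2 [0,1] \<sigma>) \<or> invertible B (act B 2 [1,2] \<sigma>)}"

definition oplax_functors :: "'a scaled \<Rightarrow> 'b scaled \<Rightarrow> (nat \<Rightarrow> 'a \<Rightarrow> 'b) set" where
  "oplax_functors B E = sc_maps (oplax_source B) E"

definition Fun_oplax :: "'a scaled \<Rightarrow> 'b scaled \<Rightarrow> (nat \<Rightarrow> nat list \<times> 'a \<Rightarrow> 'b) scaled" where
  "Fun_oplax B E = FunSc (oplax_source B) E"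

text \<open>Both restrictions are along maps which are the identity on underlying simplicial sets.\<close>

definition simeq_to_gray ::
    "'c scaled \<Rightarrow> 'd scaled \<Rightarrow> 'e scaled \<Rightarrow>
     nat \<Rightarrow> (nat \<Rightarrow> nat list \<times> 'c \<times> 'd \<Rightarrow> 'e) \<Rightarrow> (nat \<Rightarrow> nat list \<times> 'c \<times> 'd \<Rightarrow> 'e)" where
  "simeq_to_gray C D E = restriction (sid (sprod C D)) (gray C D) (prod_simeq C D) E"

definition simeq_to_oplax ::
    "'c scaled \<Rightarrow> 'd scaled \<Rightarrow> 'e scaled \<Rightarrow>
     nat \<Rightarrow> (nat \<Rightarrow> nat list \<times> 'c \<times> 'd \<Rightarrow> 'e) \<Rightarrow> (nat \<Rightarrow> nat list \<times> 'c \<times> 'd \<Rightarrow> 'e)" where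
  "simeq_to_oplax C D E =
     restriction (sid (sprod C D)) (oplax_source (sc_prod C D)) (prod_simeq C D) E"

definition gray_to_oplax ::
    "'c scaled \<Rightarrow> 'd scaled \<Rightarrow> 'e scaled \<Rightarrow>
     nat \<Rightarrow> (nat \<Rightarrow> nat list \<times> 'c \<times> 'd \<Rightarrow> 'e) \<Rightarrow> (nat \<Rightarrow> nat list \<times> 'c \<times> 'd \<Rightarrow> 'e)" where
  "gray_to_oplax C D E =
     scomp (FunSc (gray C D) E) (simeq_to_oplax C D E)
       (sc_inverse (FunSc (prod_simeq C D) E) (FunSc (gray C D) E) (simeq_to_gray C D E))"

definition restrict_left_vertex ::
    "'c scaled \<Rightarrow> 'd scaled \<Rightarrow> (nat \<Rightarrow> 'c \<times> 'd \<Rightarrow> 'e) \<Rightarrow> 'c \<Rightarrow> nat \<Rightarrow> 'd \<Rightarrow> 'e" where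
  "restrict_left_vertex C D \<phi> x = scomp D \<phi> (\<lambda>n d. (const_cell C n x, d))"

definition restrict_right_vertex ::
    "'c scaled \<Rightarrow> 'd scaled \<Rightarrow> (nat \<Rightarrow> 'c \<times> 'd \<Rightarrow> 'e) \<Rightarrow> 'd \<Rightarrow> nat \<Rightarrow> 'c \<Rightarrow> 'e" where
  "restrict_right_vertex C D \<phi> y = scomp C \<phi> (\<lambda>n c. (c, const_cell D n y))"

end

theory Submission
  imports Defs
begin

text \<open>
  All scalings on \<open>C \<times> D\<close> share one underlying simplicial set, so the theorem is about which triangles a map
  \<open>\<Delta>\<^sup>n \<times> C \<times> D \<rightarrow> E\<close> sends to thin ones.  In a 3-simplex with thin faces 012 and 123,
  the face 013 is thin iff 023 is, and suitable 3-simplices of \<open>C \<times> D\<close> reduce every triangle of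
  \<open>T\<^sub>\<simeq>\<close> to the upper half of a square \<open>f \<times> g\<close> with \<open>f\<close> or \<open>g\<close> invertible.  That half is thin by the
  two-out-of-six property expressed by the saturation axiom for 4-simplices, or by its opposite, applied to a
  chain \<open>e, e\<^sup>-\<^sup>1, e\<close>.  Hence the Gray scaling and \<open>T\<^sub>\<simeq>\<close> define the same functor bicategory.  Prisms
  show that a transformation of oplax functors carries thinness of a triangle from its target to its components, so
  the mapping categories on both sides even coincide, and that an invertible one carries it to its source.

  What remains is that identities are isomorphisms in the functor categories involved, for which inner horns have to
  be filled there.  This amounts to extending maps along
  \<open>\<Lambda>\<^sup>n\<^sub>i \<times> Y \<union> \<Delta>\<^sup>n \<times> Y\<^sub>0 \<subseteq> \<Delta>\<^sup>n \<times> Y\<close>, by pairing the missing non-degenerate simplices: in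
  \<open>(s, y)\<close> let \<open>q\<close> be the first vertex over \<open>i + 1\<close>, and insert or delete the vertex over \<open>i\<close> with
  the same \<open>Y\<close>-coordinate as \<open>q\<close>.  Each pair is attached along an inner horn.
\<close>

section \<open>Simplices and degeneracies\<close>

text \<open>Enlarging a scaling leaves the underlying simplices alone, so the functor in question is
  an inclusion and acts on a mapping category as an identity map. Two things still have to be built.
  First, \<open>cat_equivalence\<close> asks for isomorphisms in functor categories, even from the
  identity functor to itself; \<open>ho_iso\<close> demands equalities of homotopy classes, and
  these rest on associativity of composition, hence on filling inner horns in an exponential.
  Second, invertibility in a functor bicategory is usable only once composition there behaves well.
  \<open>inner_fib\<close> isolates a property weak enough to pass from \<open>E\<close> to
  \<open>FunSc X E\<close> and strong enough for both purposes. In the pairing, the inserted vertex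
  over i is always inner: a vertex over 0 < i precedes it and q follows it. As it shares its second
  coordinate with q, the triangle around it has a degenerate second component, which makes it thin
  as a scaled inner horn demands.\<close>

definition mono_fn :: "nat \<Rightarrow> nat \<Rightarrow> (nat \<Rightarrow> nat) \<Rightarrow> bool" where
  "mono_fn m n f \<longleftrightarrow> (\<forall>p q. p \<le> q \<longrightarrow> q \<le> m \<longrightarrow> f p \<le> f q) \<and> (\<forall>q\<le>m. f q \<le> n)"

definition tab :: "nat \<Rightarrow> (nat \<Rightarrow> nat) \<Rightarrow> nat list" where
  "tab m f = map f [0..<Suc m]"

lemma length_tab [simp]: "length (tab m f) = Suc m"
  by (simp add: tab_def)

lemma nth_tab [simp]: "q \<le> m \<Longrightarrow> tab m f ! q = f q"
  by (simp add: tab_def del: upt_Suc)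

lemma set_tab: "set (tab m f) = f ` {..m}"
  by (auto simp: tab_def simp del: upt_Suc)

lemma tab_in_iff: "tab m f \<in> mono_maps m n \<longleftrightarrow> mono_fn m n f"
  by (auto simp: mono_maps_def mono_fn_def sorted_iff_nth_mono set_tab image_subset_iff less_Suc_eq_le)

lemma mono_maps_nth: "\<theta> \<in> mono_maps m n \<Longrightarrow> mono_fn m n ((!) \<theta>)"
  by (auto simp: mono_maps_def mono_fn_def sorted_iff_nth_mono less_Suc_eq_le subset_iff)

lemma tab_nth: "length \<theta> = Suc m \<Longrightarrow> tab m ((!) \<theta>) = \<theta>"
  by (metis map_nth tab_def)

lemma length_mono_maps: "\<theta> \<in> mono_maps m n \<Longrightarrow> length \<theta> = Suc m"
  by (simp add: mono_maps_def)

lemma mono_maps_eqI: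
  assumes "\<theta> \<in> mono_maps m n" "\<theta>' \<in> mono_maps m n'" "\<And>q. q \<le> m \<Longrightarrow> \<theta> ! q = \<theta>' ! q"
  shows "\<theta> = \<theta>'"
  using assms by (auto intro!: nth_equalityI simp: mono_maps_def less_Suc_eq_le)

lemma map_tab: "mono_fn l m g \<Longrightarrow> map ((!) (tab m f)) (tab l g) = tab l (f \<circ> g)"
  by (rule nth_equalityI) (auto simp: mono_fn_def less_Suc_eq_le)

lemma map_nth_tab: "map ((!) \<theta>) (tab l g) = tab l (\<lambda>q. \<theta> ! g q)"
  by (rule nth_equalityI) (auto simp: less_Suc_eq_le)

lemma mono_fn_comp: "mono_fn l m g \<Longrightarrow> mono_fn m n f \<Longrightarrow> mono_fn l n (f \<circ> g)"
  by (auto simp: mono_fn_def)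

lemma mono_maps_comp:
  assumes "\<psi> \<in> mono_maps l m" "\<theta> \<in> mono_maps m n"
  shows "map ((!) \<theta>) \<psi> \<in> mono_maps l n"
proof -
  have "map ((!) \<theta>) \<psi> = tab l ((!) \<theta> \<circ> (!) \<psi>)"
    using assms by (auto intro!: nth_equalityI simp: mono_maps_def less_Suc_eq_le)
  with mono_fn_comp[OF mono_maps_nth[OF assms(1)] mono_maps_nth[OF assms(2)]] show ?thesis
    by (simp add: tab_in_iff)
qed

lemma id_mono_maps [simp]: "[0..<Suc n] \<in> mono_maps n n"
  by (auto simp: mono_maps_def simp del: upt_Suc)

lemma map_nth_id: "\<psi> \<in> mono_maps l m \<Longrightarrow> map ((!) [0..<Suc m]) \<psi> = \<psi>"
proof (rule nth_equalityI)
  fix q assume "\<psi> \<in> mono_maps l m" "q < length (map ((!) [0..<Suc m]) \<psi>)"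
  then show "map ((!) [0..<Suc m]) \<psi> ! q = \<psi> ! q"
    using mono_maps_nth[of \<psi> l m] by (auto simp: mono_maps_def mono_fn_def less_Suc_eq_le nth_upt simp del: upt_Suc)
qed simp

lemma map_id_nth: "\<psi> \<in> mono_maps l m \<Longrightarrow> map ((!) \<psi>) [0..<Suc l] = \<psi>"
  using map_nth[of \<psi>] by (simp add: mono_maps_def)

lemma replicate_mono_maps: "v \<le> n \<Longrightarrow> replicate (Suc m) v \<in> mono_maps m n"
  by (auto simp: mono_maps_def sorted_replicate)

text \<open>The coface map omitting \<open>l\<close>; \<open>sigma l\<close> below is the
  codegeneracy that takes the value \<open>l\<close> twice.\<close>

definition delta :: "nat \<Rightarrow> nat \<Rightarrow> nat" where
  "delta l q = (if q < l then q else Suc q)"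

definition sigma :: "nat \<Rightarrow> nat \<Rightarrow> nat" where
  "sigma l q = (if q \<le> l then q else q - 1)"

text \<open>A simplex is degenerate iff one of the idempotents \<open>squash l\<close> fixes it, see \<open>degenerate_iff\<close> below.\<close>

definition squash :: "nat \<Rightarrow> nat \<Rightarrow> nat" where
  "squash l q = (if q = Suc l then l else q)"

lemma delta_mono: "mono_fn n (Suc n) (delta l)"
  by (auto simp: mono_fn_def delta_def)

lemma sigma_mono: "l \<le> n \<Longrightarrow> mono_fn (Suc n) n (sigma l)"
  by (auto simp: mono_fn_def sigma_def)

lemma squash_mono: "l < n \<Longrightarrow> mono_fn n n (squash l)"
  by (auto simp: mono_fn_def squash_def)

lemma tab_id: "tab n (\<lambda>q. q) = [0..<Suc n]"
  by (simp add: tab_def)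

text \<open>Operators given by functions instead of lists: composites are compositions of functions,
  identities between them reduce to case distinctions, and values beyond \<open>m\<close> are
  irrelevant by \<open>ac_cong\<close>.\<close>

definition ac :: "('a, 'z) sset_scheme \<Rightarrow> nat \<Rightarrow> nat \<Rightarrow> (nat \<Rightarrow> nat) \<Rightarrow> 'a \<Rightarrow> 'a" where
  "ac X n m f x = act X n (tab m f) x"

lemma act_cells: "simplicial_set X \<Longrightarrow> \<theta> \<in> mono_maps m n \<Longrightarrow> x \<in> cells X n \<Longrightarrow> act X n \<theta> x \<in> cells X m"
  by (auto simp: simplicial_set_def)

lemma act_id: "simplicial_set X \<Longrightarrow> x \<in> cells X n \<Longrightarrow> act X n [0..<Suc n] x = x"
  by (auto simp: simplicial_set_def)

lemma act_act: "simplicial_set X \<Longrightarrow> \<psi> \<in> mono_maps l m \<Longrightarrow> \<theta> \<in> mono_maps m n \<Longrightarrow> x \<in> cells X n \<Longrightarrow>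
    act X m \<psi> (act X n \<theta> x) = act X n (map ((!) \<theta>) \<psi>) x"
  unfolding simplicial_set_def by blast

lemma ac_cells: "simplicial_set X \<Longrightarrow> mono_fn m n f \<Longrightarrow> x \<in> cells X n \<Longrightarrow> ac X n m f x \<in> cells X m"
  by (simp add: ac_def act_cells tab_in_iff)

lemma ac_ac: "simplicial_set X \<Longrightarrow> mono_fn l m g \<Longrightarrow> mono_fn m n f \<Longrightarrow> x \<in> cells X n \<Longrightarrow>
    ac X m l g (ac X n m f x) = ac X n l (f \<circ> g) x"
  by (simp add: ac_def act_act[where l=l] tab_in_iff map_tab)

lemma ac_cong: "(\<And>q. q \<le> m \<Longrightarrow> f q = g q) \<Longrightarrow> ac X n m f x = ac X n m g x"
proof -
  assume "\<And>q. q \<le> m \<Longrightarrow> f q = g q"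
  then have "tab m f = tab m g" by (intro nth_equalityI) (auto simp: less_Suc_eq_le)
  then show ?thesis by (simp add: ac_def)
qed

lemma ac_ident: "simplicial_set X \<Longrightarrow> x \<in> cells X n \<Longrightarrow> (\<And>q. q \<le> n \<Longrightarrow> f q = q) \<Longrightarrow> ac X n n f x = x"
  using ac_cong[of n f "\<lambda>q. q" X n x] by (simp add: ac_def tab_id act_id del: upt_Suc)

lemma act_ac: "\<theta> \<in> mono_maps m n \<Longrightarrow> act X n \<theta> x = ac X n m ((!) \<theta>) x"
  by (simp add: ac_def tab_nth length_mono_maps)

section \<open>Monotone maps, degenerate simplices and the Eilenberg-Zilber lemma\<close>

lemma noninj_squash:
  assumes "mono_fn m n f" "\<not> inj_on f {..m}"
  shows "\<exists>p<m. f p = f (Suc p)"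
proof -
  obtain a b where ab: "a \<le> m" "b \<le> m" "f a = f b" "a < b"
    using assms(2) unfolding inj_on_def by (metis atMost_iff linorder_neqE_nat)
  have "f a \<le> f (Suc a)" "f (Suc a) \<le> f b"
    using assms(1) ab unfolding mono_fn_def by (meson Suc_leI le_SucI order_refl order_trans)+
  with ab show ?thesis by (intro exI[of _ a]) auto
qed

lemma inj_mono_ge:
  assumes "mono_fn m n f" "inj_on f {..m}" "q \<le> m"
  shows "q \<le> f q"
  using assms(3)
proof (induction q)
  case (Suc q)
  have "f q \<le> f (Suc q)" "f q \<noteq> f (Suc q)"
    using assms(1) Suc.prems inj_onD[OF assms(2), of q "Suc q"] by (auto simp: mono_fn_def)
  with Suc show ?case by simp
qed simp

lemma inj_mono_le_dim: "mono_fn m n f \<Longrightarrow> inj_on f {..m} \<Longrightarrow> m \<le> n"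
  using inj_mono_ge[of m n f m] by (force simp: mono_fn_def)

lemma inj_mono_id:
  assumes "mono_fn n n f" "inj_on f {..n}" "q \<le> n"
  shows "f q = q"
proof -
  have *: "q \<le> f q" using assms inj_mono_ge by blast
  \<comment> \<open>Downward induction on the position, phrased as upward induction on its distance
    \<open>p\<close> from \<open>n\<close>.\<close>
  have "n - p \<le> n \<Longrightarrow> f (n - p) \<le> n - p" for p
  proof (induction p)
    case 0 show ?case using assms(1) by (auto simp: mono_fn_def)
  next
    case (Suc p)
    show ?case
    proof (cases "p < n")
      case True
      then have "f (n - Suc p) \<le> f (n - p)" "f (n - Suc p) \<noteq> f (n - p)"
        using assms(1) True inj_onD[OF assms(2), of "n - Suc p" "n - p"] by (auto simp: mono_fn_def)
      with Suc True show ?thesis by simp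
    next
      case False with Suc show ?thesis by simp
    qed
  qed
  from this[of "n - q"] * assms(3) show ?thesis by simp
qed

text \<open>A degenerate simplex comes from a lower dimension along a map that cannot be injective,
  hence identifies two neighbours and absorbs the corresponding \<open>squash\<close>. Conversely
  \<open>squash p\<close> is \<open>delta (Suc p)\<close> after \<open>sigma p\<close>, so it
  factors through dimension n - 1. Being an equation in a fixed dimension, the criterion can be
  tested componentwise in products.\<close>

lemma degenerate_iff:
  assumes X: "simplicial_set X" and x: "x \<in> cells X n"
  shows "degenerate X n x \<longleftrightarrow> (\<exists>p<n. ac X n n (squash p) x = x)"
proof
  assume "degenerate X n x"
  then obtain m \<theta> z where m: "m < n" and \<theta>: "\<theta> \<in> mono_maps n m" and z: "z \<in> cells X m"
    and xe: "x = act X m \<theta> z" by (auto simp: degenerate_def)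
  have mo: "mono_fn n m ((!) \<theta>)" by (rule mono_maps_nth[OF \<theta>])
  have "\<not> inj_on ((!) \<theta>) {..n}" using inj_mono_le_dim[OF mo] m by auto
  from noninj_squash[OF mo this] obtain p where p: "p < n" "\<theta> ! p = \<theta> ! Suc p" by blast
  have xe': "x = ac X m n ((!) \<theta>) z" using xe act_ac[OF \<theta>] by metis
  have "ac X n n (squash p) x = ac X m n ((!) \<theta> \<circ> squash p) z"
    unfolding xe' by (rule ac_ac[OF X squash_mono mo z]) (rule p)
  also have "\<dots> = x" unfolding xe' by (rule ac_cong) (use p in \<open>auto simp: squash_def\<close>)
  finally show "\<exists>p<n. ac X n n (squash p) x = x" using p by blast
next
  assume "\<exists>p<n. ac X n n (squash p) x = x"
  then obtain p where p: "p < n" "ac X n n (squash p) x = x" by blast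
  then obtain n' where n: "n = Suc n'" by (cases n) auto
  have "ac X n' n (sigma p) (ac X n n' (delta (Suc p)) x) = ac X n n (delta (Suc p) \<circ> sigma p) x"
    using X x p n by (intro ac_ac) (auto intro: sigma_mono delta_mono)
  also have "\<dots> = x"
  proof -
    have "ac X n n (delta (Suc p) \<circ> sigma p) x = ac X n n (squash p) x"
      by (rule ac_cong) (auto simp: delta_def sigma_def squash_def)
    then show ?thesis using p by simp
  qed
  finally show "degenerate X n x"
    unfolding degenerate_def
    using p n X x by (intro exI[of _ n'] conjI bexI[of _ "tab n (sigma p)"] bexI[of _ "ac X n n' (delta (Suc p)) x"])
      (auto simp: ac_def tab_in_iff intro!: sigma_mono act_cells delta_mono)
qed

lemma act_noninj_degenerate:
  assumes X: "simplicial_set X" and z: "z \<in> cells X m" and f: "mono_fn n m f" and p: "p < n" "f p = f (Suc p)"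
  shows "degenerate X n (ac X m n f z)"
proof -
  have "ac X n n (squash p) (ac X m n f z) = ac X m n (f \<circ> squash p) z"
    by (rule ac_ac[OF X squash_mono f z]) (rule p)
  also have "\<dots> = ac X m n f z" by (rule ac_cong) (use p in \<open>auto simp: squash_def\<close>)
  finally show ?thesis using degenerate_iff[OF X ac_cells[OF X f z]] p(1) by auto
qed

lemma degenerate_act:
  assumes X: "simplicial_set X" and z: "z \<in> cells X m" and \<theta>: "\<theta> \<in> mono_maps n m" and "\<not> distinct \<theta>"
  shows "degenerate X n (act X m \<theta> z)"
proof -
  have "\<not> inj_on ((!) \<theta>) {..n}"
    using assms(4) length_mono_maps[OF \<theta>] by (auto simp: distinct_conv_nth inj_on_def less_Suc_eq_le)
  from noninj_squash[OF mono_maps_nth[OF \<theta>] this] show ?thesis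
    unfolding act_ac[OF \<theta>] using act_noninj_degenerate[OF X z mono_maps_nth[OF \<theta>]] by blast
qed

text \<open>Take \<open>m\<close> least such that \<open>x\<close> comes from an
  \<open>m\<close>-simplex: if that simplex were degenerate, or if the operator missed a vertex,
  \<open>x\<close> would come from a lower dimension.\<close>

lemma exists_nondegenerate:
  assumes X: "simplicial_set X" and x: "x \<in> cells X n"
  shows "\<exists>m f z. m \<le> n \<and> mono_fn n m f \<and> f ` {..n} = {..m} \<and> z \<in> cells X m \<and> \<not> degenerate X m z
      \<and> x = ac X m n f z"
proof -
  let ?P = "\<lambda>m. \<exists>f z. mono_fn n m f \<and> z \<in> cells X m \<and> x = ac X m n f z"
  have "?P n" using ac_ident[OF X x, of "\<lambda>q. q"] x by (intro exI[of _ "\<lambda>q. q"] exI[of _ x]) (auto simp: mono_fn_def)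
  define m where "m = (LEAST m. ?P m)"
  have "?P m" unfolding m_def by (rule LeastI[of ?P]) fact
  then obtain f z where f: "mono_fn n m f" and z: "z \<in> cells X m" and xe: "x = ac X m n f z" by blast
  have least: "\<not> ?P k" if "k < m" for k using that not_less_Least unfolding m_def by blast
  have "m \<le> n" unfolding m_def by (rule Least_le) fact
  have nd: "\<not> degenerate X m z"
  proof
    assume "degenerate X m z"
    then obtain k \<theta> w where k: "k < m" "\<theta> \<in> mono_maps m k" "w \<in> cells X k" "z = act X k \<theta> w"
      by (auto simp: degenerate_def)
    have "x = ac X k n ((!) \<theta> \<circ> f) w"
      unfolding xe k(4) act_ac[OF k(2)] by (rule ac_ac[OF X f mono_maps_nth[OF k(2)] k(3)])
    with k least[OF k(1)] mono_fn_comp[OF f mono_maps_nth[OF k(2)]] show False by blast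
  qed
  have surj: "f ` {..n} = {..m}"
  proof (rule ccontr)
    assume "f ` {..n} \<noteq> {..m}"
    then obtain l where l: "l \<le> m" "l \<notin> f ` {..n}" using f by (auto simp: mono_fn_def)
    have "m \<noteq> 0"
    proof
      assume "m = 0"
      then have "f 0 = l" using f l by (auto simp: mono_fn_def)
      with l show False by auto
    qed
    then obtain m' where m': "m = Suc m'" by (cases m) auto
    define g where "g q = (if f q < l then f q else f q - 1)" for q
    have ne: "f q \<noteq> l" if "q \<le> n" for q using l that by auto
    have g: "mono_fn n m' g"
      unfolding mono_fn_def
    proof (intro conjI allI impI)
      fix p q assume "p \<le> q" "q \<le> n"
      then have "f p \<le> f q" "f p \<noteq> l" "f q \<noteq> l" using f ne by (auto simp: mono_fn_def)
      then show "g p \<le> g q" by (auto simp: g_def)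
    next
      fix q assume "q \<le> n"
      then have "f q \<le> m" "f q \<noteq> l" using f ne by (auto simp: mono_fn_def)
      then show "g q \<le> m'" using m' l(1) by (auto simp: g_def)
    qed
    have d: "mono_fn m' m (delta l)" using delta_mono m' by simp
    have "ac X m' n g (ac X m m' (delta l) z) = ac X m n (delta l \<circ> g) z" by (rule ac_ac[OF X g d z])
    also have "\<dots> = x" unfolding xe
      by (rule ac_cong) (use ne in \<open>force simp: delta_def g_def\<close>)
    finally show False using least[of m'] m' g ac_cells[OF X d z] by fastforce
  qed
  show ?thesis using \<open>m \<le> n\<close> f z xe nd surj by blast
qed

text \<open>Preimages chosen arbitrarily are automatically monotone, because \<open>f\<close> is.
  The freedom to pass through a given \<open>p\<close> is what determines the operator in
  \<open>eilenberg_zilber\<close>.\<close>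

lemma mono_section:
  assumes f: "mono_fn k n f" and surj: "f ` {..k} = {..n}" and p: "p \<le> k"
  shows "\<exists>g. mono_fn n k g \<and> (\<forall>q\<le>n. f (g q) = q) \<and> g (f p) = p"
proof -
  define h where "h q = (SOME r. r \<le> k \<and> f r = q)" for q
  have h: "h q \<le> k \<and> f (h q) = q" if "q \<le> n" for q
  proof -
    have "q \<in> f ` {..k}" using surj that by simp
    then have "\<exists>r. r \<le> k \<and> f r = q" by auto
    then show ?thesis unfolding h_def by (rule someI_ex)
  qed
  define g where "g q = (if q = f p then p else h q)" for q
  have g: "g q \<le> k \<and> f (g q) = q" if "q \<le> n" for q using h that p by (auto simp: g_def)
  have "g a \<le> g b" if "a \<le> b" "b \<le> n" for a b
  proof (cases "a = b")
    case False
    show ?thesis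
    proof (rule ccontr)
      assume "\<not> g a \<le> g b"
      moreover have "g a \<le> k" using g[of a] that by simp
      ultimately have "f (g b) \<le> f (g a)" using f unfolding mono_fn_def by (meson nat_le_linear)
      then show False using g[of a] g[of b] that False by auto
    qed
  qed simp
  then show ?thesis using g by (intro exI[of _ g]) (auto simp: mono_fn_def g_def)
qed

lemma nondegenerate_inj:
  assumes "simplicial_set X" "z \<in> cells X m" "mono_fn n m f" "\<not> degenerate X n (ac X m n f z)"
  shows "inj_on f {..n}"
  using noninj_squash[OF assms(3)] act_noninj_degenerate[OF assms(1-3)] assms(4) by blast

text \<open>Applying a section \<open>g\<close> of \<open>f\<close> to the common degeneracy
  exhibits \<open>x\<close> as the image of \<open>x'\<close> under \<open>f' \<circ> g\<close>.
  Nondegeneracy of \<open>x\<close> makes this map injective, so n is at most n'; by symmetry the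
  dimensions agree and \<open>f' \<circ> g\<close> is the identity. This holds for every section, in
  particular for one with g (f p) = p, whence f' p = f p.\<close>

lemma eilenberg_zilber:
  assumes X: "simplicial_set X"
    and x: "x \<in> cells X n" "\<not> degenerate X n x" and x': "x' \<in> cells X n'" "\<not> degenerate X n' x'"
    and f: "mono_fn k n f" "f ` {..k} = {..n}" and f': "mono_fn k n' f'" "f' ` {..k} = {..n'}"
    and eq: "ac X n k f x = ac X n' k f' x'"
  shows "n = n'" "x = x'" "p \<le> k \<Longrightarrow> f p = f' p"
proof -
  have *: "x = ac X n' n (f' \<circ> g) x'" "inj_on (f' \<circ> g) {..n}" "mono_fn n n' (f' \<circ> g)"
    if g: "mono_fn n k g" "\<forall>q\<le>n. f (g q) = q"
      and x: "x \<in> cells X n" "\<not> degenerate X n x" and x': "x' \<in> cells X n'"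
      and f: "mono_fn k n f" and f': "mono_fn k n' f'"
      and eq: "ac X n k f x = ac X n' k f' x'" for x x' n n' f f' g
  proof -
    have "x = ac X n n (f \<circ> g) x" using ac_ident[OF X x(1), of "f \<circ> g"] g by simp
    also have "\<dots> = ac X k n g (ac X n k f x)" by (rule ac_ac[symmetric, OF X g(1) f x(1)])
    also have "\<dots> = ac X n' n (f' \<circ> g) x'" unfolding eq by (rule ac_ac[OF X g(1) f' x'])
    finally show 1: "x = ac X n' n (f' \<circ> g) x'" .
    show "mono_fn n n' (f' \<circ> g)" by (rule mono_fn_comp[OF g(1) f'])
    then show "inj_on (f' \<circ> g) {..n}" using nondegenerate_inj[OF X x'] 1 x by metis
  qed
  obtain g where g: "mono_fn n k g" "\<forall>q\<le>n. f (g q) = q" using mono_section[OF f, of 0] by auto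
  obtain g' where g': "mono_fn n' k g'" "\<forall>q\<le>n'. f' (g' q) = q" using mono_section[OF f', of 0] by auto
  note A = *[OF g x x'(1) f(1) f'(1) eq]
  note B = *[OF g' x' x(1) f'(1) f(1) eq[symmetric]]
  show nn: "n = n'" using inj_mono_le_dim[OF A(3,2)] inj_mono_le_dim[OF B(3,2)] by simp
  have id: "(f' \<circ> h) q = q" if "mono_fn n k h" "\<forall>q\<le>n. f (h q) = q" "q \<le> n" for h q
    using inj_mono_id[of n "f' \<circ> h" q] *[OF that(1,2) x x'(1) f(1) f'(1) eq] nn that by auto
  show "x = x'" using A(1) ac_ident[OF X x'(1), of "f' \<circ> g"] id[OF g] nn by simp
  assume p: "p \<le> k"
  obtain h where h: "mono_fn n k h" "\<forall>q\<le>n. f (h q) = q" "h (f p) = p" using mono_section[OF f p] by auto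
  have "f p \<le> n" using f(1) p by (auto simp: mono_fn_def)
  from id[OF h(1,2) this] h(3) show "f p = f' p" by simp
qed

section \<open>Extension along inner horns\<close>

lemma smaps_cells: "f \<in> smaps X Y \<Longrightarrow> x \<in> cells X n \<Longrightarrow> f n x \<in> cells Y n"
  by (auto simp: smaps_def)

lemma smaps_act: "f \<in> smaps X Y \<Longrightarrow> x \<in> cells X n \<Longrightarrow> \<theta> \<in> mono_maps m n \<Longrightarrow>
    f m (act X n \<theta> x) = act Y n \<theta> (f n x)"
  unfolding smaps_def by blast

lemma smapsI:
  assumes "\<And>n x. x \<in> cells X n \<Longrightarrow> f n x \<in> cells Y n" "\<And>n x. x \<notin> cells X n \<Longrightarrow> f n x = undefined"
    "\<And>m n \<theta> x. \<theta> \<in> mono_maps m n \<Longrightarrow> x \<in> cells X n \<Longrightarrow> f m (act X n \<theta> x) = act Y n \<theta> (f n x)"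
  shows "f \<in> smaps X Y"
  using assms by (auto simp: smaps_def PiE_def extensional_def)

lemma smaps_ext: "f \<in> smaps X Y \<Longrightarrow> x \<notin> cells X n \<Longrightarrow> f n x = undefined"
  by (auto simp: smaps_def PiE_def extensional_def)

lemma smaps_eqI: "f \<in> smaps X Y \<Longrightarrow> g \<in> smaps X Y' \<Longrightarrow> (\<And>n x. x \<in> cells X n \<Longrightarrow> f n x = g n x) \<Longrightarrow> f = g"
  by (intro ext) (metis smaps_ext)

lemma smaps_degenerate:
  assumes "f \<in> smaps X Y" "x \<in> cells X n" "degenerate X n x"
  shows "degenerate Y n (f n x)"
proof -
  obtain m \<theta> \<tau> where "m < n" "\<theta> \<in> mono_maps n m" "\<tau> \<in> cells X m" "x = act X m \<theta> \<tau>"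
    using assms(3) by (auto simp: degenerate_def)
  then show ?thesis using smaps_act[OF assms(1)] smaps_cells[OF assms(1)]
    unfolding degenerate_def by (intro exI[of _ m] conjI bexI[of _ \<theta>] bexI[of _ "f m \<tau>"]) auto
qed

lemma simplex_cells [simp]: "cells (simplex n) m = mono_maps m n"
  by (simp add: simplex_def)

lemma simplex_act [simp]: "act (simplex n) m \<theta> s = map ((!) s) \<theta>"
  by (simp add: simplex_def)

lemma horn_cells: "cells (horn n i) m = {s \<in> mono_maps m n. \<exists>j \<le> n. j \<noteq> i \<and> j \<notin> set s}"
  by (simp add: horn_def)

lemma horn_act [simp]: "act (horn n i) m \<theta> s = map ((!) s) \<theta>"
  by (simp add: horn_def)

lemma sprod_cells [simp]: "cells (sprod X Y) n = cells X n \<times> cells Y n"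
  by (simp add: sprod_def)

lemma sprod_act [simp]: "act (sprod X Y) n \<theta> (x, y) = (act X n \<theta> x, act Y n \<theta> y)"
  by (simp add: sprod_def)

lemma sc_prod_sel [simp]: "cells (sc_prod X Y) n = cells X n \<times> cells Y n"
  "act (sc_prod X Y) n \<theta> (x, y) = (act X n \<theta> x, act Y n \<theta> y)" "thin (sc_prod X Y) = thin X \<times> thin Y"
  by (simp_all add: sc_prod_def)

lemma scale_sel [simp]: "cells (scale X T) = cells X" "act (scale X T) = act X"
  "thin (scale X T) = {\<sigma> \<in> cells X 2. \<sigma> \<in> T \<or> degenerate X 2 \<sigma>}"
  by (simp_all add: scale_def)

lemma simplicial_set_cong: "cells X = cells Y \<Longrightarrow> act X = act Y \<Longrightarrow> simplicial_set X \<longleftrightarrow> simplicial_set Y"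
  by (simp add: simplicial_set_def)

lemma degenerate_cong: "cells X = cells Y \<Longrightarrow> act X = act Y \<Longrightarrow> degenerate X n x \<longleftrightarrow> degenerate Y n x"
  by (simp add: degenerate_def)

lemma smaps_cong: "cells X = cells X' \<Longrightarrow> act X = act X' \<Longrightarrow> cells Y = cells Y' \<Longrightarrow> act Y = act Y' \<Longrightarrow>
    smaps X Y = smaps X' Y'"
  by (simp add: smaps_def)

lemma simplicial_simplex: "simplicial_set (simplex n)"
proof -
  have "map ((!) (map ((!) s) \<theta>)) \<psi> = map ((!) s) (map ((!) \<theta>) \<psi>)"
    if "\<psi> \<in> mono_maps l m" "\<theta> \<in> mono_maps m k" for l m k s \<psi> \<theta>
    using that by (auto simp: mono_maps_def less_Suc_eq_le)
  then show ?thesis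
    unfolding simplicial_set_def simplex_cells simplex_act by (metis mono_maps_comp map_id_nth)
qed

lemma set_map_nth: "\<theta> \<in> mono_maps m k \<Longrightarrow> s \<in> mono_maps k n \<Longrightarrow> set (map ((!) s) \<theta>) \<subseteq> set s"
  by (auto simp: mono_maps_def subset_iff less_Suc_eq_le intro!: nth_mem)

lemma horn_act_closed: "\<theta> \<in> mono_maps m k \<Longrightarrow> s \<in> cells (horn n i) k \<Longrightarrow> map ((!) s) \<theta> \<in> cells (horn n i) m"
  using set_map_nth[of \<theta> m k s n] mono_maps_comp[of \<theta> m k s n] by (auto simp: horn_cells)

lemma simplicial_subset:
  assumes "simplicial_set X" "\<And>n. cells Y n \<subseteq> cells X n" "act Y = act X"
    "\<And>m n \<theta> x. \<theta> \<in> mono_maps m n \<Longrightarrow> x \<in> cells Y n \<Longrightarrow> act X n \<theta> x \<in> cells Y m"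
  shows "simplicial_set Y"
  unfolding simplicial_set_def assms(3)
  using assms(1,2,4) unfolding simplicial_set_def by (meson subsetD)

lemma simplicial_horn: "simplicial_set (horn n i)"
proof (rule simplicial_subset[OF simplicial_simplex[of n]])
  show "act (horn n i) = act (simplex n)" by (simp add: horn_def)
  fix m k \<theta> s assume "\<theta> \<in> mono_maps m k" "s \<in> cells (horn n i) k"
  then show "act (simplex n) k \<theta> s \<in> cells (horn n i) m" using horn_act_closed by simp
qed (auto simp: horn_cells)

lemma simplicial_sprod: "simplicial_set X \<Longrightarrow> simplicial_set Y \<Longrightarrow> simplicial_set (sprod X Y)"
  unfolding simplicial_set_def sprod_cells by (intro conjI allI ballI; clarsimp simp del: upt_Suc)

lemma ac_sprod: "ac (sprod X Y) n m f (x, y) = (ac X n m f x, ac Y n m f y)"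
  by (simp add: ac_def)

text \<open>The last clause consists of two degenerate cases of the saturation axiom for 4-simplices.\<close>

definition inner_fib :: "'a scaled \<Rightarrow> bool" where
  "inner_fib Z \<longleftrightarrow> scaled_sset Z \<and>
     (\<forall>n i. 2 \<le> n \<and> 0 < i \<and> i < n \<longrightarrow>
        has_extensions Z (scale (horn n i) {[i - 1, i, i + 1]})
                         (scale (simplex n) {[i - 1, i, i + 1]})) \<and>
     (\<forall>\<rho> \<in> cells Z 3. act Z 3 [0,1,2] \<rho> \<in> thin Z \<and> act Z 3 [1,2,3] \<rho> \<in> thin Z \<longrightarrow>
        (act Z 3 [0,1,3] \<rho> \<in> thin Z \<longleftrightarrow> act Z 3 [0,2,3] \<rho> \<in> thin Z))"

lemma inner_fib_simplicial: "inner_fib Z \<Longrightarrow> simplicial_set Z"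
  by (simp add: inner_fib_def scaled_sset_def)

lemma thin_cells: "scaled_sset Z \<Longrightarrow> \<sigma> \<in> thin Z \<Longrightarrow> \<sigma> \<in> cells Z 2"
  by (auto simp: scaled_sset_def)

lemma inner_fib_scaled: "inner_fib Z \<Longrightarrow> scaled_sset Z"
  by (simp add: inner_fib_def)

lemma inner_fib_degenerate: "inner_fib Z \<Longrightarrow> \<sigma> \<in> cells Z 2 \<Longrightarrow> degenerate Z 2 \<sigma> \<Longrightarrow> \<sigma> \<in> thin Z"
  by (simp add: inner_fib_def scaled_sset_def)

lemma inner_fib_sat: "inner_fib Z \<Longrightarrow> \<rho> \<in> cells Z 3 \<Longrightarrow> act Z 3 [0,1,2] \<rho> \<in> thin Z \<Longrightarrow>
    act Z 3 [1,2,3] \<rho> \<in> thin Z \<Longrightarrow> act Z 3 [0,1,3] \<rho> \<in> thin Z \<longleftrightarrow> act Z 3 [0,2,3] \<rho> \<in> thin Z"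
  by (simp add: inner_fib_def)

lemma yoneda: "simplicial_set X \<Longrightarrow> x \<in> cells X n \<Longrightarrow> (\<lambda>k. \<lambda>s\<in>mono_maps k n. act X n s x) \<in> smaps (simplex n) X"
  by (rule smapsI) (auto simp: act_cells mono_maps_comp act_act)

text \<open>The extension axiom read through the Yoneda lemma: the extension is a simplex
  \<open>y\<close>. Thinness of the triangle around \<open>i\<close> is assumed only if it lies in
  the horn, since for n = 2 it is the whole simplex; in every case it is thin in the filler.\<close>

lemma horn_fill:
  assumes Z: "inner_fib Z" and i: "2 \<le> n" "0 < i" "i < n" and h: "h \<in> smaps (horn n i) Z"
    and t: "[i - 1, i, i + 1] \<in> cells (horn n i) 2 \<Longrightarrow> h 2 [i - 1, i, i + 1] \<in> thin Z"
  shows "\<exists>y \<in> cells Z n. (\<forall>k. \<forall>s \<in> cells (horn n i) k. act Z n s y = h k s) \<and> act Z n [i - 1, i, i + 1] y \<in> thin Z"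
proof -
  let ?T = "{[i - 1, i, i + 1]}"
  have hsc: "h \<in> sc_maps (scale (horn n i) ?T) Z"
    unfolding sc_maps_def
  proof (intro CollectI conjI ballI)
    show "h \<in> smaps (scale (horn n i) ?T) Z" using h smaps_cong[of "scale (horn n i) ?T" "horn n i" Z Z] by simp
    fix \<sigma> assume "\<sigma> \<in> thin (scale (horn n i) ?T)"
    then show "h 2 \<sigma> \<in> thin Z"
      using t smaps_cells[OF h, of \<sigma> 2] smaps_degenerate[OF h, of \<sigma> 2] inner_fib_degenerate[OF Z]
      by auto
  qed
  then obtain g where g: "g \<in> sc_maps (scale (simplex n) ?T) Z"
    and gh: "\<And>k s. s \<in> cells (horn n i) k \<Longrightarrow> g k s = h k s"
  proof -
    have "has_extensions Z (scale (horn n i) ?T) (scale (simplex n) ?T)"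
      using Z i by (simp add: inner_fib_def)
    with hsc have "\<exists>g\<in>sc_maps (scale (simplex n) ?T) Z. \<forall>k. \<forall>s\<in>cells (horn n i) k. g k s = h k s"
      unfolding has_extensions_def scale_sel by blast
    with that show thesis by blast
  qed
  have gs: "g \<in> smaps (simplex n) Z"
    using g smaps_cong[of "scale (simplex n) ?T" "simplex n" Z Z] by (simp add: sc_maps_def)
  have gact: "act Z n s (g n [0..<Suc n]) = g k s" if "s \<in> mono_maps k n" for k s
    using smaps_act[OF gs, of "[0..<Suc n]" n s k] that map_nth_id[OF that] by (simp del: upt_Suc)
  have m: "[i - 1, i, i + 1] \<in> mono_maps 2 n" using i by (auto simp: mono_maps_def)
  have "g 2 [i - 1, i, i + 1] \<in> thin Z" using g m by (auto simp: sc_maps_def)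
  then show ?thesis
    using gact m gh smaps_cells[OF gs, of "[0..<Suc n]" n]
    by (intro bexI[of _ "g n [0..<Suc n]"] conjI allI ballI)
      (simp_all add: horn_cells del: upt_Suc, metis)
qed

text \<open>
  Maps defined on a simplicial subset of \<open>W\<close> that send \<open>S\<close> to thin triangles, as sets of triples
  (dimension, simplex, value): the union of a chain of them is a plain union, as Zorn's lemma requires.
\<close>

definition pmap :: "('w, 'z) sset_scheme \<Rightarrow> 'e scaled \<Rightarrow> 'w set \<Rightarrow> (nat \<times> 'w \<times> 'e) set \<Rightarrow> bool" where
  "pmap W Z S R \<longleftrightarrow>
     (\<forall>n x y. (n, x, y) \<in> R \<longrightarrow> x \<in> cells W n \<and> y \<in> cells Z n) \<and>
     (\<forall>n x y y'. (n, x, y) \<in> R \<longrightarrow> (n, x, y') \<in> R \<longrightarrow> y = y') \<and>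
     (\<forall>m n \<theta> x y. \<theta> \<in> mono_maps m n \<longrightarrow> (n, x, y) \<in> R \<longrightarrow> (m, act W n \<theta> x, act Z n \<theta> y) \<in> R) \<and>
     (\<forall>x y. (2, x, y) \<in> R \<longrightarrow> x \<in> S \<longrightarrow> y \<in> thin Z)"

definition pdom :: "(nat \<times> 'w \<times> 'e) set \<Rightarrow> (nat \<times> 'w) set" where
  "pdom R = {(n, x). \<exists>y. (n, x, y) \<in> R}"

section \<open>Partial maps and the attachment of cells\<close>

lemma pmapD:
  assumes "pmap W Z S R"
  shows "(n, x, y) \<in> R \<Longrightarrow> x \<in> cells W n" "(n, x, y) \<in> R \<Longrightarrow> y \<in> cells Z n"
    "(n, x, y) \<in> R \<Longrightarrow> (n, x, y') \<in> R \<Longrightarrow> y = y'"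
    "\<theta> \<in> mono_maps m n \<Longrightarrow> (n, x, y) \<in> R \<Longrightarrow> (m, act W n \<theta> x, act Z n \<theta> y) \<in> R"
    "(2, x, y) \<in> R \<Longrightarrow> x \<in> S \<Longrightarrow> y \<in> thin Z"
  using assms unfolding pmap_def by blast+

lemma pdom_act: "pmap W Z S R \<Longrightarrow> \<theta> \<in> mono_maps m n \<Longrightarrow> (n, x) \<in> pdom R \<Longrightarrow> (m, act W n \<theta> x) \<in> pdom R"
  unfolding pdom_def using pmapD(4) by fast

abbreviation face :: "('w, 'z) sset_scheme \<Rightarrow> nat \<Rightarrow> nat \<Rightarrow> 'w \<Rightarrow> 'w" where
  "face W n l \<equiv> ac W n (n - 1) (delta l)"

lemma delta_mono': "0 < n \<Longrightarrow> mono_fn (n - 1) n (delta l)"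
  using delta_mono[of "n - 1" l] by simp

lemma avoid_factor:
  assumes f: "mono_fn m n f" and l: "l \<le> n" "0 < n" "l \<notin> f ` {..m}"
  defines "g \<equiv> \<lambda>q. if f q < l then f q else f q - 1"
  shows "mono_fn m (n - 1) g" "\<And>q. q \<le> m \<Longrightarrow> delta l (g q) = f q"
proof -
  have ne: "f q \<noteq> l" if "q \<le> m" for q using l that by auto
  show "mono_fn m (n - 1) g"
    unfolding mono_fn_def
  proof (intro conjI allI impI)
    fix p q assume "p \<le> q" "q \<le> m"
    then have "f p \<le> f q" "f p \<noteq> l" "f q \<noteq> l" using f ne by (auto simp: mono_fn_def)
    then show "g p \<le> g q" by (auto simp: g_def)
  next
    fix q assume "q \<le> m"
    then have "f q \<le> n" "f q \<noteq> l" using f ne by (auto simp: mono_fn_def)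
    then show "g q \<le> n - 1" using l(1) by (auto simp: g_def)
  qed
  show "delta l (g q) = f q" if "q \<le> m" for q using ne[OF that] by (auto simp: delta_def g_def)
qed

lemma act_avoid_face:
  assumes W: "simplicial_set W" and c: "c \<in> cells W n" and \<theta>: "\<theta> \<in> mono_maps m n"
    and l: "l \<le> n" "0 < n" "l \<notin> set \<theta>"
  defines "g \<equiv> \<lambda>q. if \<theta> ! q < l then \<theta> ! q else \<theta> ! q - 1"
  shows "act W n \<theta> c = ac W (n - 1) m g (face W n l c)" "mono_fn m (n - 1) g"
    "\<And>q. q \<le> m \<Longrightarrow> delta l (g q) = \<theta> ! q"
proof -
  have l': "l \<notin> (!) \<theta> ` {..m}" using l(3) length_mono_maps[OF \<theta>] by (auto simp: less_Suc_eq_le)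
  note A = avoid_factor[OF mono_maps_nth[OF \<theta>] l(1,2) l', folded g_def]
  show "mono_fn m (n - 1) g" "\<And>q. q \<le> m \<Longrightarrow> delta l (g q) = \<theta> ! q"
    using A unfolding g_def by auto
  have A2: "delta l (g q) = \<theta> ! q" if "q \<le> m" for q using A(2)[OF that] by (simp add: g_def)
  have "ac W (n - 1) m g (face W n l c) = ac W n m (delta l \<circ> g) c"
    by (rule ac_ac[OF W A(1) delta_mono'[OF l(2)] c])
  also have "\<dots> = act W n \<theta> c" unfolding act_ac[OF \<theta>] by (rule ac_cong) (simp add: A2)
  finally show "act W n \<theta> c = ac W (n - 1) m g (face W n l c)" by simp
qed

lemma tab2: "tab 2 f = [f 0, f 1, f 2]"
  by (simp add: tab_def numeral_2_eq_2)

text \<open>On the faces other than the j-th, which form an inner horn, \<open>R\<close> is already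
  defined; a filler \<open>y\<close> becomes the value at \<open>c\<close>, and everything generated
  by \<open>c\<close> is added. Consistency is the Eilenberg-Zilber lemma: new simplices are
  degeneracies of \<open>c\<close> or of its j-th face, two nondegenerate simplices outside the
  domain, so each arises from exactly one operator. New triangles with three distinct vertices occur
  only for n = 2 (the filler itself) and n = 3 (the j-th face, thin by saturation if the three other
  faces are, which \<open>S3\<close> ensures).\<close>

lemma attach_cell:
  assumes Z: "inner_fib Z" and W: "simplicial_set W" and R: "pmap W Z S R"
    and c: "c \<in> cells W n" "\<not> degenerate W n c" and j: "2 \<le> n" "0 < j" "j < n"
    and dj: "\<not> degenerate W (n - 1) (face W n j c)" "(n - 1, face W n j c) \<notin> pdom R"
    and dl: "\<And>l. l \<le> n \<Longrightarrow> l \<noteq> j \<Longrightarrow> (n - 1, face W n l c) \<in> pdom R"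
    and tri: "act W n [j - 1, j, j + 1] c \<in> S"
    and S3: "\<And>l. n = 3 \<Longrightarrow> face W n j c \<in> S \<Longrightarrow> l \<le> 3 \<Longrightarrow> face W n l c \<in> S"
  shows "\<exists>y \<in> cells Z n. pmap W Z S (R \<union> {(m, act W n \<theta> c, act Z n \<theta> y) | m \<theta>. \<theta> \<in> mono_maps m n})"
proof -
  have Zs: "simplicial_set Z" by (rule inner_fib_simplicial[OF Z])
  note RD = pmapD[OF R]
  have n0: "0 < n" using j by simp
  define h where "h m = (\<lambda>s\<in>cells (horn n j) m. THE v. (m, act W n s c, v) \<in> R)" for m
  have hR: "(m, act W n s c, h m s) \<in> R" if s: "s \<in> cells (horn n j) m" for m s
  proof -
    obtain l where l: "l \<le> n" "l \<noteq> j" "l \<notin> set s" and sm: "s \<in> mono_maps m n"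
      using s by (auto simp: horn_cells)
    note A = act_avoid_face[OF W c(1) sm l(1) n0 l(3)]
    have "(m, act W n s c) \<in> pdom R"
      unfolding A(1) ac_def[of W "n - 1" m] by (rule pdom_act[OF R _ dl[OF l(1,2)]]) (use A(2) in \<open>simp add: tab_in_iff\<close>)
    then have "\<exists>!v. (m, act W n s c, v) \<in> R" using RD(3) by (auto simp: pdom_def)
    from theI'[OF this] show ?thesis using s by (simp add: h_def)
  qed
  have h: "h \<in> smaps (horn n j) Z"
  proof (rule smapsI)
    fix m k \<theta> s assume \<theta>: "\<theta> \<in> mono_maps m k" and s: "s \<in> cells (horn n j) k"
    have sm: "s \<in> mono_maps k n" using s by (simp add: horn_cells)
    have "(m, act W k \<theta> (act W n s c), act Z k \<theta> (h k s)) \<in> R" by (rule RD(4)[OF \<theta> hR[OF s]])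
    then have "(m, act W n (map ((!) s) \<theta>) c, act Z k \<theta> (h k s)) \<in> R"
      unfolding act_act[OF W \<theta> sm c(1)] .
    with hR[OF horn_act_closed[OF \<theta> s]] show "h m (act (horn n j) k \<theta> s) = act Z k \<theta> (h k s)"
      using RD(3) by (simp only: horn_act)
  next
    fix m s assume "s \<in> cells (horn n j) m"
    then show "h m s \<in> cells Z m" using RD(2)[OF hR] by blast
  qed (simp add: h_def)
  have "h 2 [j - 1, j, j + 1] \<in> thin Z" if "[j - 1, j, j + 1] \<in> cells (horn n j) 2"
    using RD(5)[OF hR[OF that] tri] .
  from horn_fill[OF Z j h this] obtain y where y: "y \<in> cells Z n"
    and yh: "\<And>k s. s \<in> cells (horn n j) k \<Longrightarrow> act Z n s y = h k s"
    and yt: "act Z n [j - 1, j, j + 1] y \<in> thin Z" by blast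
  define N where "N = {(m, act W n \<theta> c, act Z n \<theta> y) | m \<theta>. \<theta> \<in> mono_maps m n}"
  have NR: "(m, act W n \<theta> c, act Z n \<theta> y) \<in> R" if "\<theta> \<in> cells (horn n j) m" for m \<theta>
    using hR[OF that] yh[OF that] by simp
  have cov: "{..n} - {j} \<subseteq> set \<theta>" if "\<theta> \<in> mono_maps m n" "\<theta> \<notin> cells (horn n j) m" for m \<theta>
    using that by (auto simp: horn_cells)
  have dc: "face W n j c \<in> cells W (n - 1)" by (rule ac_cells[OF W delta_mono'[OF n0] c(1)])
  text \<open>New simplices are degeneracies of \<open>c\<close> or of its \<open>j\<close>-th face.\<close>
  have fac: "\<exists>k e g. (k = n \<and> e = c \<and> (\<forall>q\<le>m. \<theta> ! q = g q) \<or>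
        k = n - 1 \<and> e = face W n j c \<and> (\<forall>q\<le>m. \<theta> ! q = delta j (g q))) \<and>
        mono_fn m k g \<and> g ` {..m} = {..k} \<and> act W n \<theta> c = ac W k m g e"
    if \<theta>: "\<theta> \<in> mono_maps m n" "\<theta> \<notin> cells (horn n j) m" for m \<theta>
  proof (cases "j \<in> set \<theta>")
    case True
    have "set \<theta> = {..n}" using True cov[OF \<theta>] \<theta>(1) by (auto simp: mono_maps_def)
    moreover have "set \<theta> = (!) \<theta> ` {..m}"
      using length_mono_maps[OF \<theta>(1)] by (auto simp: set_conv_nth less_Suc_eq_le)
    ultimately have s: "(!) \<theta> ` {..m} = {..n}" by simp
    show ?thesis
      by (intro exI[of _ n] exI[of _ c] exI[of _ "(!) \<theta>"] conjI mono_maps_nth[OF \<theta>(1)] s act_ac[OF \<theta>(1)]) simp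
  next
    case False
    define g where "g = (\<lambda>q. if \<theta> ! q < j then \<theta> ! q else \<theta> ! q - 1)"
    have jn: "j \<le> n" using j by simp
    note A = act_avoid_face[OF W c(1) \<theta>(1) jn n0 False, folded g_def]
    have A: "act W n \<theta> c = ac W (n - 1) m g (face W n j c)" "mono_fn m (n - 1) g"
      "\<And>q. q \<le> m \<Longrightarrow> delta j (g q) = \<theta> ! q" using A(1,2) A(3)[folded fun_cong[OF g_def]] by auto
    have "q \<in> g ` {..m}" if "q \<le> n - 1" for q
    proof -
      have "delta j q \<in> set \<theta>" using cov[OF \<theta>] that j by (auto simp: delta_def subset_iff)
      then obtain p where p: "p \<le> m" "\<theta> ! p = delta j q"
        using length_mono_maps[OF \<theta>(1)] by (auto simp: in_set_conv_nth less_Suc_eq_le)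
      have "delta j (g p) = delta j q" using A(3)[OF p(1)] p(2) by simp
      then have "g p = q" by (auto simp: delta_def split: if_splits)
      with p show ?thesis by auto
    qed
    then have "g ` {..m} = {..n - 1}" using A(2) by (auto simp: mono_fn_def)
    with A show ?thesis by (intro exI[of _ "n - 1"] exI[of _ "face W n j c"] exI[of _ g]) auto
  qed
  have cR: "(n, c) \<notin> pdom R"
  proof
    assume "(n, c) \<in> pdom R"
    then have "(n - 1, face W n j c) \<in> pdom R"
      unfolding ac_def by (rule pdom_act[OF R, rotated]) (use delta_mono'[OF n0] in \<open>simp add: tab_in_iff\<close>)
    with dj show False by simp
  qed
  \<comment> \<open>If a degeneracy of \<open>e\<close> were in the domain, a section of that
    degeneracy would put \<open>e\<close> itself there.\<close>
  have fresh: "(m, act W n \<theta> c) \<notin> pdom R" if \<theta>: "\<theta> \<in> mono_maps m n" "\<theta> \<notin> cells (horn n j) m" for m \<theta>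
  proof
    assume a: "(m, act W n \<theta> c) \<in> pdom R"
    obtain k e g where e: "k = n \<and> e = c \<or> k = n - 1 \<and> e = face W n j c"
      and g: "mono_fn m k g" "g ` {..m} = {..k}" and eq: "act W n \<theta> c = ac W k m g e"
      using fac[OF \<theta>] by blast
    have ec: "e \<in> cells W k" using e c dc by auto
    obtain f where f: "mono_fn k m f" "\<forall>q\<le>k. g (f q) = q" using mono_section[OF g, of 0] by auto
    have "ac W m k f (act W n \<theta> c) = ac W k k (g \<circ> f) e" unfolding eq by (rule ac_ac[OF W f(1) g(1) ec])
    also have "\<dots> = e" by (rule ac_ident[OF W ec]) (simp add: f(2))
    finally have "(k, e) \<in> pdom R" using pdom_act[OF R _ a, of "tab k f" k] f(1) by (simp add: ac_def tab_in_iff)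
    with e dj cR show False by auto
  qed
  have uniq: "\<theta> = \<theta>'" if \<theta>: "\<theta> \<in> mono_maps m n" "\<theta> \<notin> cells (horn n j) m"
    and \<theta>': "\<theta>' \<in> mono_maps m n" "\<theta>' \<notin> cells (horn n j) m" and eq: "act W n \<theta> c = act W n \<theta>' c" for m \<theta> \<theta>'
  proof -
    obtain k e g where e: "k = n \<and> e = c \<and> (\<forall>q\<le>m. \<theta> ! q = g q) \<or>
        k = n - 1 \<and> e = face W n j c \<and> (\<forall>q\<le>m. \<theta> ! q = delta j (g q))"
      and g: "mono_fn m k g" "g ` {..m} = {..k}" and eq1: "act W n \<theta> c = ac W k m g e"
      using fac[OF \<theta>] by blast
    obtain k' e' g' where e': "k' = n \<and> e' = c \<and> (\<forall>q\<le>m. \<theta>' ! q = g' q) \<or>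
        k' = n - 1 \<and> e' = face W n j c \<and> (\<forall>q\<le>m. \<theta>' ! q = delta j (g' q))"
      and g': "mono_fn m k' g'" "g' ` {..m} = {..k'}" and eq2: "act W n \<theta>' c = ac W k' m g' e'"
      using fac[OF \<theta>'] by blast
    have ec: "e \<in> cells W k" "\<not> degenerate W k e" "e' \<in> cells W k'" "\<not> degenerate W k' e'"
      using e e' c dc dj by auto
    have eq': "ac W k m g e = ac W k' m g' e'" using eq eq1 eq2 by simp
    note E = eilenberg_zilber[OF W ec g g' eq']
    show ?thesis
    proof (rule mono_maps_eqI[OF \<theta>(1) \<theta>'(1)])
      fix q assume q: "q \<le> m"
      show "\<theta> ! q = \<theta>' ! q" using E(1) E(3)[OF q] e e' q n0 by auto
    qed
  qed
  have thinN: "act Z n \<theta> y \<in> thin Z" if \<theta>: "\<theta> \<in> mono_maps 2 n" "\<theta> \<notin> cells (horn n j) 2" and "act W n \<theta> c \<in> S" for \<theta>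
  proof (cases "distinct \<theta>")
    case False
    then show ?thesis
      using inner_fib_degenerate[OF Z act_cells[OF Zs \<theta>(1) y]] degenerate_act[OF Zs y \<theta>(1)] by simp
  next
    case True
    \<comment> \<open>Three distinct values cover all vertices but possibly \<open>j\<close>, which
      bounds n by 3.\<close>
    have "card (set \<theta>) = 3" using True length_mono_maps[OF \<theta>(1)] by (simp add: distinct_card)
    moreover have "card ({..n} - {j}) \<le> card (set \<theta>)" by (rule card_mono) (use cov[OF \<theta>] in auto)
    ultimately have "n \<le> 3" using j by simp
    then have n23: "n = 2 \<or> n = 3" using j by auto
    have ss: "sorted \<theta>" using \<theta>(1) by (simp add: mono_maps_def)
    from n23 show ?thesis
    proof
      assume n: "n = 2"
      have j1: "j = 1" using j n by simp
      have "set \<theta> = {..2}"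
        by (rule card_subset_eq) (use \<open>card (set \<theta>) = 3\<close> \<theta>(1) n in \<open>simp_all add: mono_maps_def\<close>)
      moreover have "{..2::nat} = {0,1,2}" by auto
      ultimately have "\<theta> = [0,1,2]" by (intro sorted_distinct_set_unique) (use True ss in simp_all)
      moreover have "[j - 1, j, j + 1] = [0,1,2]" using j1 by simp
      ultimately show ?thesis using yt n by metis
    next
      assume n: "n = 3"
      have sub: "{..3} - {j} \<subseteq> set \<theta>" using cov[OF \<theta>] n by simp
      have "card ({..3} - {j}) = 3" using j n by simp
      then have st: "set \<theta> = {..3} - {j}"
        using card_subset_eq[OF _ sub] \<open>card (set \<theta>) = 3\<close> by simp
      have d: "tab 2 (delta 0) = [1,2,3]" "tab 2 (delta 1) = [0,2,3]" "tab 2 (delta 2) = [0,1,3]" "tab 2 (delta 3) = [0,1,2]"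
        by (simp_all add: tab2 delta_def)
      have j12: "j = 1 \<or> j = 2" using j n by auto
      have e3: "{..3::nat} = {0,1,2,3}" by auto
      have "set \<theta> = set (tab 2 (delta j))" using j12
      proof
        assume j1: "j = 1"
        show ?thesis unfolding st e3 j1 d by auto
      next
        assume j2: "j = 2"
        show ?thesis unfolding st e3 j2 d by auto
      qed
      moreover have "sorted (tab 2 (delta j))" "distinct (tab 2 (delta j))"
        using j12 d by (elim disjE; simp)+
      ultimately have \<theta>j: "\<theta> = tab 2 (delta j)" by (intro sorted_distinct_set_unique) (use True ss in simp_all)
      then have "face W n j c \<in> S" using that(3) n by (simp add: ac_def)
      then have Sl: "act W 3 (tab 2 (delta l)) c \<in> S" if "l \<le> 3" for l
        using S3[OF n _ that] n by (simp add: ac_def)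
      have "l \<notin> set (tab 2 (delta l))" for l by (auto simp: set_tab delta_def)
      moreover have "mono_fn 2 3 (delta l)" for l using delta_mono[of 2 l] by simp
      ultimately have hl: "tab 2 (delta l) \<in> cells (horn n j) 2" if "l \<le> 3" "l \<noteq> j" for l
        using that n by (auto simp: horn_cells tab_in_iff)
      have tl: "act Z 3 (tab 2 (delta l)) y \<in> thin Z" if "l \<le> 3" "l \<noteq> j" for l
        using RD(5)[OF NR[OF hl[OF that]]] Sl[OF that(1)] n by simp
      have y3: "y \<in> cells Z 3" using y n by simp
      have tl0: "act Z 3 [1,2,3] y \<in> thin Z" "act Z 3 [0,1,2] y \<in> thin Z"
        using tl[of 0] tl[of 3] j n unfolding d by simp_all
      from j12 show ?thesis
      proof
        assume j1: "j = 1"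
        then have "act Z 3 [0,1,3] y \<in> thin Z" using tl[of 2] unfolding d by simp
        then show ?thesis using inner_fib_sat[OF Z y3 tl0(2,1)] d(2) \<theta>j j1 n by simp
      next
        assume j2: "j = 2"
        then have "act Z 3 [0,2,3] y \<in> thin Z" using tl[of 1] unfolding d by simp
        then show ?thesis using inner_fib_sat[OF Z y3 tl0(2,1)] d(3) \<theta>j j2 n by simp
      qed
    qed
  qed
  have "pmap W Z S (R \<union> N)"
    unfolding pmap_def
  proof (intro conjI allI impI)
    fix k x v assume "(k, x, v) \<in> R \<union> N"
    then show "x \<in> cells W k" "v \<in> cells Z k"
      using RD(1,2) act_cells[OF W _ c(1)] act_cells[OF Zs _ y] by (auto simp: N_def)
  next
    fix k x v v' assume a: "(k, x, v) \<in> R \<union> N" "(k, x, v') \<in> R \<union> N"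
    \<comment> \<open>Operators in the horn only reproduce triples of \<open>R\<close>, by
      \<open>NR\<close>, so single-valuedness concerns the others alone.\<close>
    have *: "(k, x, v) \<in> R \<or> (\<exists>\<theta>. \<theta> \<in> mono_maps k n \<and> \<theta> \<notin> cells (horn n j) k \<and> x = act W n \<theta> c \<and> v = act Z n \<theta> y)"
      if "(k, x, v) \<in> R \<union> N" for v using that NR unfolding N_def by blast
    show "v = v'"
    proof (cases "(k, x) \<in> pdom R")
      case True
      then have "(k, x, v) \<in> R" "(k, x, v') \<in> R" using *[OF a(1)] *[OF a(2)] fresh by blast+
      then show ?thesis by (rule RD(3))
    next
      case False
      then have n: "(k, x, v) \<notin> R" "(k, x, v') \<notin> R" by (auto simp: pdom_def)
      obtain \<theta> where 1: "\<theta> \<in> mono_maps k n" "\<theta> \<notin> cells (horn n j) k" "x = act W n \<theta> c" "v = act Z n \<theta> y"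
        using *[OF a(1)] n by blast
      obtain \<theta>' where 2: "\<theta>' \<in> mono_maps k n" "\<theta>' \<notin> cells (horn n j) k" "x = act W n \<theta>' c" "v' = act Z n \<theta>' y"
        using *[OF a(2)] n by blast
      have "\<theta> = \<theta>'" by (rule uniq[OF 1(1,2) 2(1,2)]) (use 1(3) 2(3) in simp)
      then show ?thesis using 1 2 by simp
    qed
  next
    fix m k \<theta> x v assume \<theta>: "\<theta> \<in> mono_maps m k" and "(k, x, v) \<in> R \<union> N"
    then consider "(k, x, v) \<in> R" | \<theta>' where "\<theta>' \<in> mono_maps k n" "x = act W n \<theta>' c" "v = act Z n \<theta>' y"
      by (auto simp: N_def)
    then show "(m, act W k \<theta> x, act Z k \<theta> v) \<in> R \<union> N"
    proof cases
      case 1 then show ?thesis using RD(4)[OF \<theta>] by blast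
    next
      case 2
      then show ?thesis
        using act_act[OF W \<theta> 2(1) c(1)] act_act[OF Zs \<theta> 2(1) y] mono_maps_comp[OF \<theta> 2(1)] unfolding N_def by blast
    qed
  next
    fix x v assume "(2, x, v) \<in> R \<union> N" "x \<in> S"
    then consider "(2, x, v) \<in> R" | \<theta> where "\<theta> \<in> mono_maps 2 n" "x = act W n \<theta> c" "v = act Z n \<theta> y"
      by (auto simp: N_def)
    then show "v \<in> thin Z"
    proof cases
      case 1 then show ?thesis using RD(5) \<open>x \<in> S\<close> by blast
    next
      case 2
      show ?thesis
      proof (cases "\<theta> \<in> cells (horn n j) 2")
        case True
        then show ?thesis using RD(5)[OF NR[OF True]] 2 \<open>x \<in> S\<close> by simp
      next
        case False
        then show ?thesis using thinN[OF 2(1) False] 2 \<open>x \<in> S\<close> by simp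
      qed
    qed
  qed
  then show ?thesis using y unfolding N_def by blast
qed

text \<open>
  The cells of \<open>M\<close> are attached by increasing \<open>\<rho>\<close>, each along the inner horn \<open>\<Lambda>\<^sub>j\<close>; the face
  opposite to the vertex \<open>j\<close> becomes available at the same time.
\<close>

theorem extend_pmap:
  fixes M :: "(nat \<times> 'w) set" and \<rho> :: "nat \<Rightarrow> 'w \<Rightarrow> nat"
  assumes Z: "inner_fib Z" and W: "simplicial_set W" and R0: "pmap W Z S R0"
    and M: "\<And>n c. (n, c) \<in> M \<Longrightarrow> c \<in> cells W n \<and> \<not> degenerate W n c \<and> 2 \<le> n \<and> 0 < j n c \<and> j n c < n"
    and dj: "\<And>n c. (n, c) \<in> M \<Longrightarrow> \<not> degenerate W (n - 1) (face W n (j n c) c) \<and>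
        (n - 1, face W n (j n c) c) \<notin> pdom R0 \<and> (n - 1, face W n (j n c) c) \<notin> M"
    and inj: "\<And>n c c'. (n, c) \<in> M \<Longrightarrow> (n, c') \<in> M \<Longrightarrow> face W n (j n c) c = face W n (j n c') c' \<Longrightarrow> c = c'"
    and dl: "\<And>n c l. (n, c) \<in> M \<Longrightarrow> l \<le> n \<Longrightarrow> l \<noteq> j n c \<Longrightarrow> \<exists>k x \<theta>. \<theta> \<in> mono_maps (n - 1) k \<and>
        face W n l c = act W k \<theta> x \<and> ((k, x) \<in> pdom R0 \<or> (k, x) \<in> M \<and> \<rho> k x < \<rho> n c)"
    and tri: "\<And>n c. (n, c) \<in> M \<Longrightarrow> act W n [j n c - 1, j n c, j n c + 1] c \<in> S"
    and S3: "\<And>c l. (3, c) \<in> M \<Longrightarrow> face W 3 (j 3 c) c \<in> S \<Longrightarrow> l \<le> 3 \<Longrightarrow> face W 3 l c \<in> S"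
  shows "\<exists>R. R0 \<subseteq> R \<and> pmap W Z S R \<and> M \<subseteq> pdom R"
proof -
  \<comment> \<open>The last condition keeps partners together: a cell of \<open>M\<close> is
    present as soon as its distinguished face is. For a missing cell that face is then missing too,
    as \<open>attach_cell\<close> requires. With a maximal element of \<open>A\<close>, cells of
    equal rank need no order.\<close>
  define A where "A = {R. R0 \<subseteq> R \<and> pmap W Z S R \<and>
      (\<forall>n c. (n, c) \<in> M \<longrightarrow> (n - 1, face W n (j n c) c) \<in> pdom R \<longrightarrow> (n, c) \<in> pdom R)}"
  have R0A: "R0 \<in> A" using R0 dj unfolding A_def by blast
  have chain: "\<Union>C \<in> A" if C: "C \<noteq> {}" "subset.chain A C" for C
  proof -
    have sub: "C \<subseteq> A" and tot: "\<And>X Y. X \<in> C \<Longrightarrow> Y \<in> C \<Longrightarrow> X \<subseteq> Y \<or> Y \<subseteq> X"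
      using C(2) by (auto simp: subset_chain_def)
    have CD: "pmap W Z S X" "R0 \<subseteq> X" if "X \<in> C" for X using sub that unfolding A_def by auto
    have "pmap W Z S (\<Union>C)"
      unfolding pmap_def
    proof (intro conjI allI impI)
      fix n x y assume "(n, x, y) \<in> \<Union>C"
      then show "x \<in> cells W n" "y \<in> cells Z n" using pmapD(1,2)[OF CD(1)] by blast+
    next
      fix n x y y' assume "(n, x, y) \<in> \<Union>C" "(n, x, y') \<in> \<Union>C"
      then obtain X X' where X: "X \<in> C" "X' \<in> C" "(n, x, y) \<in> X" "(n, x, y') \<in> X'" by blast
      with tot[OF X(1,2)] pmapD(3)[OF CD(1)[OF X(1)]] pmapD(3)[OF CD(1)[OF X(2)]] show "y = y'" by blast
    next
      fix m n \<theta> x y assume "\<theta> \<in> mono_maps m n" "(n, x, y) \<in> \<Union>C"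
      then show "(m, act W n \<theta> x, act Z n \<theta> y) \<in> \<Union>C" using pmapD(4)[OF CD(1)] by blast
    next
      fix x y assume "(2, x, y) \<in> \<Union>C" "x \<in> S"
      then show "y \<in> thin Z" using pmapD(5)[OF CD(1)] by blast
    qed
    moreover have "(n, c) \<in> pdom (\<Union>C)" if "(n, c) \<in> M" and p: "(n - 1, face W n (j n c) c) \<in> pdom (\<Union>C)" for n c
    proof -
      obtain X where X: "X \<in> C" "(n - 1, face W n (j n c) c) \<in> pdom X" using p by (auto simp: pdom_def)
      then have "(n, c) \<in> pdom X" using sub \<open>(n, c) \<in> M\<close> unfolding A_def by blast
      with X show ?thesis by (auto simp: pdom_def)
    qed
    ultimately show ?thesis using C(1) CD(2) unfolding A_def by blast
  qed
  have ne: "A \<noteq> {}" using R0A by blast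
  obtain R where RA: "R \<in> A" and max: "\<And>X. X \<in> A \<Longrightarrow> R \<subseteq> X \<Longrightarrow> X = R"
  proof -
    have "\<exists>R\<in>A. \<forall>X\<in>A. R \<subseteq> X \<longrightarrow> X = R" by (rule subset_Zorn_nonempty[OF ne chain])
    then show ?thesis using that by blast
  qed
  have R: "R0 \<subseteq> R" "pmap W Z S R"
    and RM: "\<And>n c. (n, c) \<in> M \<Longrightarrow> (n - 1, face W n (j n c) c) \<in> pdom R \<Longrightarrow> (n, c) \<in> pdom R"
    using RA unfolding A_def by blast+
  have R0p: "a \<in> pdom R0 \<Longrightarrow> a \<in> pdom R" for a using R(1) by (auto simp: pdom_def)
  have "(n, c) \<in> pdom R" if "(n, c) \<in> M" for n c
    using that
  proof (induction "\<rho> n c" arbitrary: n c rule: less_induct)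
    case less
    note Mc = less.prems
    show ?case
    proof (rule ccontr)
      assume new: "(n, c) \<notin> pdom R"
      have fresh: "(n - 1, face W n (j n c) c) \<notin> pdom R" using RM[OF Mc] new by blast
      have faces: "(n - 1, face W n l c) \<in> pdom R" if l: "l \<le> n" "l \<noteq> j n c" for l
      proof -
        obtain k x \<theta> where k: "\<theta> \<in> mono_maps (n - 1) k" "face W n l c = act W k \<theta> x"
          "(k, x) \<in> pdom R0 \<or> (k, x) \<in> M \<and> \<rho> k x < \<rho> n c" using dl[OF Mc l] by blast
        then have "(k, x) \<in> pdom R" using R0p less.hyps by blast
        with pdom_act[OF R(2) k(1)] k(2) show ?thesis by simp
      qed
      have Mc': "c \<in> cells W n" "\<not> degenerate W n c" "2 \<le> n" "0 < j n c" "j n c < n" using M[OF Mc] by auto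
      have "\<exists>y \<in> cells Z n. pmap W Z S (R \<union> {(m, act W n \<theta> c, act Z n \<theta> y) | m \<theta>. \<theta> \<in> mono_maps m n})"
      proof (rule attach_cell[OF Z W R(2) Mc' _ fresh faces tri[OF Mc]])
        fix l :: nat assume "n = 3" "face W n (j n c) c \<in> S" "l \<le> 3"
        then show "face W n l c \<in> S" using S3 Mc by blast
      qed (use dj[OF Mc] in auto)
      then obtain y where pm: "pmap W Z S (R \<union> {(m, act W n \<theta> c, act Z n \<theta> y) | m \<theta>. \<theta> \<in> mono_maps m n})"
        and y: "y \<in> cells Z n" by blast
      define N where "N = {(m, act W n \<theta> c, act Z n \<theta> y) | m \<theta>. \<theta> \<in> mono_maps m n}"
      have cN: "(n, c, y) \<in> N"
        unfolding N_def using act_id[OF W Mc'(1)] act_id[OF inner_fib_simplicial[OF Z] y]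
        by (intro CollectI exI[of _ n] exI[of _ "[0..<Suc n]"]) (simp del: upt_Suc)
      \<comment> \<open>The enlarged map must keep partners together as well. A distinguished face
        that has just entered the domain is nondegenerate and outside the horn, so it is
        \<open>c\<close> or the distinguished face of \<open>c\<close>. The first is excluded
        because distinguished faces are not in \<open>M\<close>; in the second case c' = c by
        \<open>inj\<close>.\<close>
      have "(n', c') \<in> pdom (R \<union> N)"
        if M': "(n', c') \<in> M" and p: "(n' - 1, face W n' (j n' c') c') \<in> pdom (R \<union> N)" for n' c'
      proof (cases "(n' - 1, face W n' (j n' c') c') \<in> pdom R")
        case True then show ?thesis using RM[OF M'] by (auto simp: pdom_def)
      next
        case False
        let ?x = "face W n' (j n' c') c'"
        obtain \<theta> where \<theta>: "\<theta> \<in> mono_maps (n' - 1) n" and xe: "?x = act W n \<theta> c"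
          using p False by (auto simp: pdom_def N_def)
        have nd: "\<not> degenerate W (n' - 1) ?x" using dj[OF M'] by blast
        have dis: "distinct \<theta>" using degenerate_act[OF W Mc'(1) \<theta>] nd xe by auto
        have miss: "l \<in> set \<theta>" if l: "l \<le> n" "l \<noteq> j n c" for l
        proof (rule ccontr)
          assume "l \<notin> set \<theta>"
          from act_avoid_face[OF W Mc'(1) \<theta> l(1) _ this] Mc'(3)
          have "\<exists>g. mono_fn (n' - 1) (n - 1) g \<and> ?x = ac W (n - 1) (n' - 1) g (face W n l c)"
            using xe by auto
          then have "(n' - 1, ?x) \<in> pdom R"
            using pdom_act[OF R(2) _ faces[OF l]] by (auto simp: ac_def tab_in_iff)
          with False show False by simp
        qed
        have \<theta>n: "set \<theta> \<subseteq> {..n}" "sorted \<theta>" using \<theta> by (auto simp: mono_maps_def)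
        show ?thesis
        proof (cases "j n c \<in> set \<theta>")
          case True
          then have "q \<in> set \<theta>" if "q \<le> n" for q using miss that by (cases "q = j n c") auto
          then have st: "set \<theta> = set [0..<Suc n]" using \<theta>n by (auto simp: less_Suc_eq_le simp del: upt_Suc)
          have t: "\<theta> = [0..<Suc n]"
            by (rule sorted_distinct_set_unique) (use \<theta>n dis st in \<open>auto simp del: upt_Suc\<close>)
          then have "n' - 1 = n" using length_mono_maps[OF \<theta>] by simp
          moreover have "?x = c" using xe t act_id[OF W Mc'(1)] by metis
          ultimately show ?thesis using dj[OF M'] Mc by auto
        next
          case f: False
          have n0: "0 < n" using Mc' by simp
          have st: "set \<theta> = set (tab (n - 1) (delta (j n c)))"
          proof -
            have "set (tab (n - 1) (delta (j n c))) = {..n} - {j n c}"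
            proof (intro set_eqI iffI)
              fix q assume q: "q \<in> {..n} - {j n c}"
              show "q \<in> set (tab (n - 1) (delta (j n c)))"
                unfolding set_tab
                by (rule image_eqI[of _ _ "if q < j n c then q else q - 1"])
                   (use q Mc' in \<open>auto simp: delta_def\<close>)
            qed (use Mc' in \<open>auto simp: set_tab delta_def split: if_splits\<close>)
            then show ?thesis using miss \<theta>n f by auto
          qed
          have "distinct (tab (n - 1) (delta (j n c)))"
            by (auto simp: distinct_conv_nth less_Suc_eq_le delta_def)
          moreover have "sorted (tab (n - 1) (delta (j n c)))"
            using delta_mono'[OF n0, of "j n c"] by (simp add: mono_maps_def flip: tab_in_iff)
          ultimately have t: "\<theta> = tab (n - 1) (delta (j n c))"
            by (intro sorted_distinct_set_unique) (use \<theta>n dis st in auto)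
          have "n' - 1 = n - 1" using length_mono_maps[OF \<theta>] t by simp
          then have nn: "n' = n" using Mc'(3) M[OF M'] by simp
          have "?x = face W n (j n c) c" using xe t by (simp add: ac_def)
          then have "c' = c" using inj[of n c' c] M' Mc nn by auto
          then show ?thesis using cN nn by (auto simp: pdom_def)
        qed
      qed
      then have "R \<union> N \<in> A" using R(1) pm unfolding A_def N_def[symmetric] by blast
      from max[OF this] have "R \<union> N = R" by blast
      then have "(n, c) \<in> pdom R" using cN by (auto simp: pdom_def)
      with new show False by simp
    qed
  qed
  then show ?thesis using R by (intro exI[of _ R]) auto
qed

section \<open>Prisms\<close>

lemma ac_simplex: "ac (simplex n) k m f s = tab m (\<lambda>q. s ! f q)"
  by (simp add: ac_def map_nth_tab)

text \<open>A simplex fixed by \<open>squash p\<close> cannot tell the vertices p and p + 1 apart,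
  so operators may be changed between these two values.\<close>

lemma squash_invariant:
  assumes X: "simplicial_set X" and x: "x \<in> cells X k" and inv: "ac X k k (squash p) x = x" and p: "p < k"
    and f: "mono_fn m k f" and g: "mono_fn m k g" and eq: "\<And>q. q \<le> m \<Longrightarrow> squash p (f q) = squash p (g q)"
  shows "ac X k m f x = ac X k m g x"
proof -
  have "ac X k m f x = ac X k m f (ac X k k (squash p) x)" using inv by simp
  also have "\<dots> = ac X k m (squash p \<circ> f) x" by (rule ac_ac[OF X f squash_mono[OF p] x])
  also have "\<dots> = ac X k m (squash p \<circ> g) x" by (rule ac_cong) (simp add: eq)
  also have "\<dots> = ac X k m g (ac X k k (squash p) x)" by (rule ac_ac[symmetric, OF X g squash_mono[OF p] x])
  finally show ?thesis using inv by simp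
qed

text \<open>Both components must be fixed by the same \<open>squash p\<close>; for a list of
  vertices this means equal neighbouring entries.\<close>

lemma degenerate_prod_simplex:
  assumes Y: "simplicial_set Y" and s: "s \<in> mono_maps k n" and y: "y \<in> cells Y k"
  shows "degenerate (sprod (simplex n) Y) k (s, y) \<longleftrightarrow> (\<exists>p<k. s ! p = s ! Suc p \<and> ac Y k k (squash p) y = y)"
proof -
  have *: "tab k (\<lambda>q. s ! squash p q) = s \<longleftrightarrow> s ! p = s ! Suc p" if "p < k" for p
  proof
    assume "tab k (\<lambda>q. s ! squash p q) = s"
    then have "tab k (\<lambda>q. s ! squash p q) ! Suc p = s ! Suc p" by simp
    then show "s ! p = s ! Suc p" using that by (simp add: squash_def)
  next
    assume "s ! p = s ! Suc p"
    then show "tab k (\<lambda>q. s ! squash p q) = s"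
      using length_mono_maps[OF s] by (intro nth_equalityI) (auto simp: squash_def less_Suc_eq_le)
  qed
  show ?thesis
    using degenerate_iff[OF simplicial_sprod[OF simplicial_simplex Y], of "(s, y)" n k] s y *
    by (auto simp: ac_sprod ac_simplex)
qed

text \<open>If \<open>s\<close> meets the vertex i + 1, this is the first position over it: by
  monotonicity the first value above \<open>i\<close> is then i + 1.\<close>

definition cross :: "nat \<Rightarrow> nat list \<Rightarrow> nat" where
  "cross i s = (LEAST p. i < s ! p)"

lemma cross_eqI: "i < s ! p \<Longrightarrow> (\<And>q. q < p \<Longrightarrow> s ! q \<le> i) \<Longrightarrow> cross i s = p"
  unfolding cross_def by (rule Least_equality) (auto simp: not_le[symmetric])

lemma cross_props:
  assumes s: "s \<in> mono_maps k n" and i: "Suc i \<in> set s"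
  shows "cross i s \<le> k" "s ! cross i s = Suc i" "q < cross i s \<Longrightarrow> s ! q \<le> i"
proof -
  obtain r where r: "r \<le> k" "s ! r = Suc i"
    using i length_mono_maps[OF s] by (auto simp: in_set_conv_nth less_Suc_eq_le)
  have a: "i < s ! cross i s" unfolding cross_def by (rule LeastI[of _ r]) (simp add: r)
  have b: "cross i s \<le> r" unfolding cross_def by (rule Least_le) (simp add: r)
  show "cross i s \<le> k" using b r by simp
  have "s ! cross i s \<le> s ! r" using mono_maps_nth[OF s] b r(1) unfolding mono_fn_def by blast
  then show "s ! cross i s = Suc i" using a r by simp
  show "s ! q \<le> i" if "q < cross i s" using not_less_Least[of q "\<lambda>p. i < s ! p"] that
    by (simp add: cross_def)
qed

text \<open>\<open>S1\<close> provides the thin triangle around the inserted vertex, whose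
  \<open>Y\<close>-component repeats its last vertex. \<open>S2\<close> serves the case that the
  deleted face is a triangle in \<open>S\<close>: \<open>j\<close> is its first position over i + 1,
  the list with entry \<open>i\<close> at \<open>j\<close> describes the 3-simplex obtained by the
  insertion, and all faces of that simplex have to be in \<open>S\<close> for saturation to
  apply.\<close>

locale prism_extension =
  fixes Z :: "'z scaled" and Y :: "('y, 'r) sset_scheme" and n i :: nat
    and S :: "(nat list \<times> 'y) set" and R0 :: "(nat \<times> (nat list \<times> 'y) \<times> 'z) set" and Y0 :: "nat \<Rightarrow> 'y set"
  assumes Z: "inner_fib Z" and Y: "simplicial_set Y" and i: "0 < i" "i < n"
    and R0: "pmap (sprod (simplex n) Y) Z S R0"
    and Y0: "\<And>m k \<theta> y. \<theta> \<in> mono_maps m k \<Longrightarrow> y \<in> Y0 k \<Longrightarrow> act Y k \<theta> y \<in> Y0 m"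
    and dom: "\<And>k s y. s \<in> mono_maps k n \<Longrightarrow> y \<in> cells Y k \<Longrightarrow>
        (k, s, y) \<in> pdom R0 \<longleftrightarrow> s \<in> cells (horn n i) k \<or> y \<in> Y0 k"
    and S1: "\<And>a y. y \<in> cells Y 1 \<Longrightarrow> a = i - 1 \<or> a = i \<Longrightarrow> ([a, i, i + 1], act Y 1 [0,1,1] y) \<in> S"
    and S2: "\<And>s y j l. (s, y) \<in> S \<Longrightarrow> s \<in> mono_maps 2 n \<Longrightarrow> s \<notin> cells (horn n i) 2 \<Longrightarrow> y \<in> cells Y 2 \<Longrightarrow>
        0 < j \<Longrightarrow> j \<le> 2 \<Longrightarrow> s ! (j - 1) \<le> i \<Longrightarrow> s ! j = Suc i \<Longrightarrow> l \<le> 3 \<Longrightarrow>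
        (tab 2 (\<lambda>q. tab 3 (\<lambda>q. if q = j then i else s ! sigma j q) ! delta l q),
          ac Y 2 2 (sigma j \<circ> delta l) y) \<in> S"
begin

abbreviation "W \<equiv> sprod (simplex n) Y"

lemma W: "simplicial_set W"
  by (rule simplicial_sprod[OF simplicial_simplex Y])

text \<open>The cells that contain the inserted vertex; \<open>piv\<close> is its position.\<close>

definition M :: "(nat \<times> nat list \<times> 'y) set" where
  "M = {(k, s, y). s \<in> mono_maps k n \<and> y \<in> cells Y k \<and> \<not> degenerate W k (s, y) \<and>
     s \<notin> cells (horn n i) k \<and> y \<notin> Y0 k \<and> s ! (cross i s - 1) = i \<and>
     ac Y k k (squash (cross i s - 1)) y = y}"

definition piv :: "nat \<Rightarrow> nat list \<times> 'y \<Rightarrow> nat" where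
  "piv k x = cross i (fst x) - 1"

text \<open>Dimension decides first, because the crossing position is at most k and k^2 < (k + 1)^2
  - k; within a dimension, cells that cross later are attached earlier.\<close>

definition rk :: "nat \<Rightarrow> nat list \<times> 'y \<Rightarrow> nat" where
  "rk k x = (k + 1) * (k + 1) - cross i (fst x)"

text \<open>A simplex outside the horn meets every vertex except possibly \<open>i\<close>. In
  particular it starts at 0 and meets i - 1 before the crossing, so the vertex just before the
  crossing lies over i - 1 or i.\<close>

lemma covers:
  assumes s: "s \<in> mono_maps k n" "s \<notin> cells (horn n i) k"
  shows "v \<le> n \<Longrightarrow> v \<noteq> i \<Longrightarrow> \<exists>q\<le>k. s ! q = v" "cross i s \<le> k" "s ! cross i s = Suc i"
    "q < cross i s \<Longrightarrow> s ! q \<le> i" "s ! 0 = 0" "0 < cross i s" "i - 1 \<le> s ! (cross i s - 1)"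
proof -
  have c: "\<exists>q\<le>k. s ! q = v" if "v \<le> n" "v \<noteq> i" for v
    using s that length_mono_maps[OF s(1)] by (auto simp: horn_cells in_set_conv_nth less_Suc_eq_le)
  then show "v \<le> n \<Longrightarrow> v \<noteq> i \<Longrightarrow> \<exists>q\<le>k. s ! q = v" .
  have "Suc i \<in> set s" using s i by (auto simp: horn_cells dest: spec[of _ "Suc i"])
  note cp = cross_props[OF s(1) this]
  show "cross i s \<le> k" "s ! cross i s = Suc i" "q < cross i s \<Longrightarrow> s ! q \<le> i" by (rule cp; assumption?)+
  have mon: "s ! p \<le> s ! q" if "p \<le> q" "q \<le> k" for p q
    using mono_maps_nth[OF s(1)] that by (auto simp: mono_fn_def)
  obtain q where "q \<le> k" "s ! q = 0" using c[of 0] i by auto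
  then show s0: "s ! 0 = 0" using mon[of 0 q] by simp
  show pos: "0 < cross i s" using s0 cp(2) by (cases "cross i s") auto
  obtain r where r: "r \<le> k" "s ! r = i - 1" using c[of "i - 1"] i by (metis Suc_pred' diff_le_self less_or_eq_imp_le n_not_Suc_n order_trans)
  have "r < cross i s"
  proof (rule ccontr)
    assume "\<not> r < cross i s"
    then have "Suc i \<le> s ! r" using mon[of "cross i s" r] r cp(2) by simp
    with r i show False by simp
  qed
  then have "r \<le> cross i s - 1" "cross i s - 1 \<le> k" using cp(1) by auto
  then show "i - 1 \<le> s ! (cross i s - 1)" using mon r by metis
qed

lemma MD:
  assumes "(k, s, y) \<in> M"
  shows "s \<in> mono_maps k n" "y \<in> cells Y k" "\<not> degenerate W k (s, y)" "s \<notin> cells (horn n i) k" "y \<notin> Y0 k"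
    "s ! (cross i s - 1) = i" "ac Y k k (squash (cross i s - 1)) y = y"
    "2 \<le> k" "0 < cross i s - 1" "cross i s - 1 < k" "Suc (cross i s - 1) = cross i s"
proof -
  show a: "s \<in> mono_maps k n" "y \<in> cells Y k" "\<not> degenerate W k (s, y)" "s \<notin> cells (horn n i) k" "y \<notin> Y0 k"
    "s ! (cross i s - 1) = i" "ac Y k k (squash (cross i s - 1)) y = y" using assms by (auto simp: M_def)
  note C = covers[OF a(1,4)]
  show b: "0 < cross i s - 1" using a(6) C(5) i by (cases "cross i s - 1") auto
  then show "2 \<le> k" "cross i s - 1 < k" "Suc (cross i s - 1) = cross i s" using C(2) by auto
qed

lemma face_cells: "s \<in> mono_maps k n \<Longrightarrow> y \<in> cells Y k \<Longrightarrow> 0 < k \<Longrightarrow>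
    tab (k - 1) (\<lambda>q. s ! delta l q) \<in> mono_maps (k - 1) n \<and> face Y k l y \<in> cells Y (k - 1)"
  using ac_cells[OF W delta_mono'[of k l], of "(s, y)"] by (simp add: ac_sprod ac_simplex)

text \<open>Deleting the vertex p loses nothing when p + 1 is a copy of it. This recovers a cell of
  \<open>M\<close> from its distinguished face.\<close>

lemma unsquash:
  assumes "y \<in> cells Y k" "ac Y k k (squash p) y = y" "p < k"
  shows "ac Y (k - 1) k (sigma p) (face Y k p y) = y"
proof -
  have k: "mono_fn k (k - 1) (sigma p)" "mono_fn (k - 1) k (delta p)"
    using sigma_mono[of p "k - 1"] delta_mono'[of k p] assms by auto
  have "ac Y (k - 1) k (sigma p) (face Y k p y) = ac Y k k (delta p \<circ> sigma p) y"
    by (rule ac_ac[OF Y k assms(1)])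
  also have "\<dots> = ac Y k k (\<lambda>q. q) y"
    by (rule squash_invariant[OF Y assms mono_fn_comp[OF k]])
      (auto simp: mono_fn_def squash_def delta_def sigma_def)
  also have "\<dots> = y" by (rule ac_ident[OF Y assms(1)]) simp
  finally show ?thesis .
qed

text \<open>The pivot is removed. Degenerate neighbours in the face would lift to degenerate
  neighbours in the cell; the only positions without such a lift are j - 1 and j, where
  \<open>s'\<close> jumps from at most i to i + 1. If the face were again in \<open>M\<close>, the
  pivot and the vertex before it would be degenerate neighbours in the cell.\<close>

lemma M_face:
  assumes "(k, s, y) \<in> M"
  defines "j \<equiv> cross i s - 1" and "s' \<equiv> tab (k - 1) (\<lambda>q. s ! delta (cross i s - 1) q)"
    and "z \<equiv> face Y k (cross i s - 1) y"
  shows "s' \<in> mono_maps (k - 1) n" "z \<in> cells Y (k - 1)" "cross i s' = j" "s' \<notin> cells (horn n i) (k - 1)" "z \<notin> Y0 (k - 1)"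
    "\<not> degenerate W (k - 1) (s', z)" "(k - 1, s', z) \<notin> M" "y = ac Y (k - 1) k (sigma j) z"
    "q \<le> k \<Longrightarrow> s ! q = (if q = j then i else s' ! sigma j q)"
proof -
  note D = MD[OF assms(1), folded j_def]
  note C = covers[OF D(1,4)]
  have k0: "0 < k" using D by simp
  have s'q: "s' ! q = s ! delta j q" if "q \<le> k - 1" for q using that by (simp add: s'_def j_def)
  have jc: "cross i s = Suc j" using D by simp
  show s': "s' \<in> mono_maps (k - 1) n" and z: "z \<in> cells Y (k - 1)"
    using face_cells[OF D(1,2) k0] by (auto simp: s'_def z_def)
  have jk: "j \<le> k - 1" using D by simp
  show cr: "cross i s' = j"
  proof (rule cross_eqI)
    show "i < s' ! j" using s'q[OF jk] C(3) jc by (simp add: delta_def)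
    show "s' ! q \<le> i" if "q < j" for q using s'q[of q] C(4)[of q] that jk jc by (simp add: delta_def)
  qed
  show sq: "s ! q = (if q = j then i else s' ! sigma j q)" if "q \<le> k" for q
    using s'q[of "sigma j q"] that D by (auto simp: sigma_def delta_def)
  show yz: "y = ac Y (k - 1) k (sigma j) z"
    unfolding z_def j_def[symmetric] by (rule unsquash[symmetric, OF D(2,7,10)])
  show "s' \<notin> cells (horn n i) (k - 1)"
  proof -
    have "v \<in> set s'" if v: "v \<le> n" "v \<noteq> i" for v
    proof -
      obtain q where q: "q \<le> k" "s ! q = v" using C(1) v by blast
      then have "s' ! sigma j q = v" using sq[of q] v by (auto split: if_splits)
      moreover have "sigma j q < length s'" using q D by (auto simp: s'_def sigma_def)
      ultimately show ?thesis by (metis nth_mem)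
    qed
    then show ?thesis by (auto simp: horn_cells)
  qed
  show "z \<notin> Y0 (k - 1)"
  proof
    assume "z \<in> Y0 (k - 1)"
    then have "y \<in> Y0 k" unfolding yz ac_def
      by (rule Y0[rotated]) (use sigma_mono[of j "k - 1"] D in \<open>simp add: tab_in_iff\<close>)
    with D show False by simp
  qed
  have sm: "mono_fn k (k - 1) (sigma j)" using sigma_mono[of j "k - 1"] D by simp
  \<comment> \<open>\<open>p\<close> is a position in the face and \<open>r\<close> the matching
    position in the cell: \<open>p\<close> itself before the pivot, \<open>Suc p\<close> from the
    pivot on.\<close>
  have nd: "False" if p: "p < k - 1" "s' ! p = s' ! Suc p" "ac Y (k - 1) (k - 1) (squash p) z = z"
    and r: "r < k" "s ! r = s ! Suc r" "\<And>q. q \<le> k \<Longrightarrow> squash p (sigma j (squash r q)) = squash p (sigma j q)" for p r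
  proof -
    have "ac Y k k (squash r) y = ac Y (k - 1) k (sigma j \<circ> squash r) z"
      unfolding yz by (rule ac_ac[OF Y squash_mono[OF r(1)] sm z])
    also have "\<dots> = ac Y (k - 1) k (sigma j) z"
      by (rule squash_invariant[OF Y z p(3,1) mono_fn_comp[OF squash_mono[OF r(1)] sm] sm]) (simp add: r(3))
    finally have "ac Y k k (squash r) y = y" using yz by simp
    then show False using D(3) degenerate_prod_simplex[OF Y D(1,2)] r by blast
  qed
  have c1: "p \<noteq> j - 1" if "s' ! p = s' ! Suc p" for p
  proof
    assume "p = j - 1"
    then have "s' ! p = s ! (j - 1)" "s' ! Suc p = s ! Suc j"
      using s'q[of p] s'q[of "Suc p"] D by (auto simp: delta_def)
    moreover have "j - 1 < cross i s" using jc by simp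
    ultimately show False using that C(3) C(4)[of "j - 1"] jc by simp
  qed
  show "\<not> degenerate W (k - 1) (s', z)"
  proof
    assume "degenerate W (k - 1) (s', z)"
    then obtain p where p: "p < k - 1" "s' ! p = s' ! Suc p" "ac Y (k - 1) (k - 1) (squash p) z = z"
      using degenerate_prod_simplex[OF Y s' z] by blast
    have "p < j - 1 \<or> j \<le> p" using c1[OF p(2)] by auto
    then show False
    proof
      assume a: "p < j - 1"
      show False
      proof (rule nd[OF p, of p])
        have "p < j" "Suc p < j" "p \<le> k - 1" "Suc p \<le> k - 1" using a jk by auto
        then show "s ! p = s ! Suc p" using p(2) s'q[of p] s'q[of "Suc p"] by (simp add: delta_def)
      qed (use a p in \<open>auto simp: squash_def sigma_def\<close>)
    next
      assume a: "j \<le> p"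
      show False
      proof (rule nd[OF p, of "Suc p"])
        have "\<not> p < j" "\<not> Suc p < j" "p \<le> k - 1" "Suc p \<le> k - 1" using a p(1) by auto
        then show "s ! Suc p = s ! Suc (Suc p)" using p(2) s'q[of p] s'q[of "Suc p"] by (simp add: delta_def)
      qed (use a p in \<open>auto simp: squash_def sigma_def\<close>)
    qed
  qed
  show "(k - 1, s', z) \<notin> M"
  proof
    assume m: "(k - 1, s', z) \<in> M"
    have "s' ! (j - 1) = i" "ac Y (k - 1) (k - 1) (squash (j - 1)) z = z" using MD(6,7)[OF m] cr by auto
    moreover have "s' ! (j - 1) = s ! (j - 1)" using s'q[of "j - 1"] jk D by (simp add: delta_def)
    ultimately have e: "s ! (j - 1) = s ! Suc (j - 1)" "ac Y (k - 1) (k - 1) (squash (j - 1)) z = z"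
      using D by auto
    have "ac Y k k (squash (j - 1)) y = ac Y (k - 1) k (sigma j \<circ> squash (j - 1)) z"
      unfolding yz by (rule ac_ac[OF Y squash_mono sm z]) (use D in simp)
    also have "\<dots> = ac Y (k - 1) k (sigma j) z"
      by (rule squash_invariant[OF Y z e(2) _ mono_fn_comp[OF squash_mono sm] sm])
        (use D in \<open>auto simp: squash_def sigma_def\<close>)
    finally have "ac Y k k (squash (j - 1)) y = y" using yz by simp
    moreover have "j - 1 < k" using D by simp
    ultimately show False using D(3) degenerate_prod_simplex[OF Y D(1,2)] e by blast
  qed
qed

text \<open>Inverse to deleting the pivot: a vertex over \<open>i\<close> is inserted just before
  the crossing \<open>p\<close>, with the \<open>Y\<close>-coordinate of the vertex there.
  Degenerate neighbours in the result at p would equate i and i + 1; at p - 1 they would put (s, y)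
  into \<open>M\<close>; elsewhere they descend to (s, y).\<close>

lemma partner:
  assumes s: "s \<in> mono_maps k n" "s \<notin> cells (horn n i) k" and y: "y \<in> cells Y k" "y \<notin> Y0 k"
    and nd: "\<not> degenerate W k (s, y)" and nM: "(k, s, y) \<notin> M"
  shows "\<exists>c. (Suc k, c) \<in> M \<and> cross i (fst c) = Suc (cross i s) \<and> (s, y) = face W (Suc k) (cross i s) c"
proof -
  define p where "p = cross i s"
  note C = covers[OF s, folded p_def]
  define s' where "s' = tab (Suc k) (\<lambda>q. if q = p then i else s ! sigma p q)"
  define y' where "y' = ac Y k (Suc k) (sigma p) y"
  have sm: "mono_fn (Suc k) k (sigma p)" using sigma_mono C by blast
  have dm: "mono_fn k (Suc k) (delta p)" by (rule delta_mono)
  have mon: "s ! a \<le> s ! b" if "a \<le> b" "b \<le> k" for a b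
    using mono_maps_nth[OF s(1)] that by (auto simp: mono_fn_def)
  have sn: "s ! a \<le> n" if "a \<le> k" for a
    using mono_maps_nth[OF s(1)] that by (auto simp: mono_fn_def)
  have s'q: "s' ! q = (if q = p then i else s ! sigma p q)" if "q \<le> Suc k" for q using that by (simp add: s'_def)
  have hi: "Suc i \<le> s ! a" if "p \<le> a" "a \<le> k" for a using mon[OF that] C by simp
  have "mono_fn (Suc k) n (\<lambda>q. if q = p then i else s ! sigma p q)"
    unfolding mono_fn_def
  proof (intro conjI allI impI)
    fix a b assume ab: "a \<le> b" "b \<le> Suc k"
    have hi': "i \<le> s ! (b - 1)" if "p < b"
    proof -
      have "p \<le> b - 1" "b - 1 \<le> k" using that ab by auto
      from hi[OF this] show ?thesis by simp
    qed
    from ab show "(if a = p then i else s ! sigma p a) \<le> (if b = p then i else s ! sigma p b)"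
      using C(4)[of a] hi' mon[of a b] mon[of a "b - 1"] mon[of "a - 1" "b - 1"] C(2)
      by (cases "a < p"; cases "a = p"; cases "b < p"; cases "b = p") (auto simp: sigma_def)
  next
    fix q assume "q \<le> Suc k"
    then show "(if q = p then i else s ! sigma p q) \<le> n" using i sn[of "sigma p q"] sm by (auto simp: mono_fn_def)
  qed
  then have s': "s' \<in> mono_maps (Suc k) n" by (simp add: s'_def tab_in_iff)
  have y': "y' \<in> cells Y (Suc k)" unfolding y'_def by (rule ac_cells[OF Y sm y(1)])
  have fs: "tab k (\<lambda>q. s' ! delta p q) = s"
    using length_mono_maps[OF s(1)] C(2)
    by (intro nth_equalityI) (auto simp: less_Suc_eq_le s'q delta_def sigma_def)
  have fy: "ac Y (Suc k) k (delta p) y' = y"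
  proof -
    have "ac Y (Suc k) k (delta p) y' = ac Y k k (sigma p \<circ> delta p) y"
      unfolding y'_def by (rule ac_ac[OF Y dm sm y(1)])
    also have "\<dots> = y" by (rule ac_ident[OF Y y(1)]) (auto simp: sigma_def delta_def)
    finally show ?thesis .
  qed
  have f: "(s, y) = face W (Suc k) p (s', y')" using fs fy by (simp add: ac_sprod ac_simplex)
  have cr: "cross i s' = Suc p"
  proof (rule cross_eqI)
    show "i < s' ! Suc p" using C by (simp add: s'q sigma_def)
    show "s' ! q \<le> i" if "q < Suc p" for q using that C by (auto simp: s'q sigma_def less_Suc_eq)
  qed
  have nh: "s' \<notin> cells (horn n i) (Suc k)"
  proof -
    have "v \<in> set s'" if v: "v \<le> n" "v \<noteq> i" for v
    proof -
      obtain q where q: "q \<le> k" "s ! q = v" using C(1) v by blast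
      then have "s' ! delta p q = v" using s'q[of "delta p q"] by (auto simp: delta_def sigma_def)
      moreover have "delta p q < length s'" using q by (auto simp: s'_def delta_def)
      ultimately show ?thesis by (metis nth_mem)
    qed
    then show ?thesis by (auto simp: horn_cells)
  qed
  have n0: "y' \<notin> Y0 (Suc k)"
  proof
    assume "y' \<in> Y0 (Suc k)"
    then have "y \<in> Y0 k" using Y0[of "tab k (delta p)" k "Suc k" y'] fy dm by (simp add: ac_def tab_in_iff)
    with y show False by simp
  qed
  have inv: "ac Y (Suc k) (Suc k) (squash p) y' = y'"
  proof -
    have "ac Y (Suc k) (Suc k) (squash p) y' = ac Y k (Suc k) (sigma p \<circ> squash p) y"
      unfolding y'_def by (rule ac_ac[OF Y squash_mono sm y(1)]) (use C in simp)
    also have "\<dots> = y'" unfolding y'_def by (rule ac_cong) (auto simp: sigma_def squash_def)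
    finally show ?thesis .
  qed
  have contra: False if r: "r < k" "s ! r = s ! Suc r" and t: "t < Suc k" "ac Y (Suc k) (Suc k) (squash t) y' = y'"
    and eq: "\<And>q. q \<le> k \<Longrightarrow> sigma p (squash t (delta p (squash r q))) = sigma p (squash t (delta p q))" for r t
  proof -
    have y2: "y = ac Y k k (sigma p \<circ> squash t \<circ> delta p) y"
    proof -
      have "y = ac Y (Suc k) k (delta p) (ac Y (Suc k) (Suc k) (squash t) y')" using fy t by simp
      also have "\<dots> = ac Y (Suc k) k (squash t \<circ> delta p) y'" by (rule ac_ac[OF Y dm squash_mono[OF t(1)] y'])
      also have "\<dots> = ac Y k k (sigma p \<circ> (squash t \<circ> delta p)) y"
        unfolding y'_def by (rule ac_ac[OF Y mono_fn_comp[OF dm squash_mono[OF t(1)]] sm y(1)])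
      finally show ?thesis by (simp add: comp_assoc)
    qed
    have mm: "mono_fn k k (sigma p \<circ> squash t \<circ> delta p)"
      using mono_fn_comp[OF mono_fn_comp[OF dm squash_mono[OF t(1)]] sm] by (simp add: comp_assoc)
    have "ac Y k k (squash r) y = ac Y k k (squash r) (ac Y k k (sigma p \<circ> squash t \<circ> delta p) y)" using y2 by simp
    also have "\<dots> = ac Y k k ((sigma p \<circ> squash t \<circ> delta p) \<circ> squash r) y" by (rule ac_ac[OF Y squash_mono[OF r(1)] mm y(1)])
    also have "\<dots> = ac Y k k (sigma p \<circ> squash t \<circ> delta p) y" by (rule ac_cong) (simp add: eq)
    finally have "ac Y k k (squash r) y = y" using y2 by simp
    then show False using nd degenerate_prod_simplex[OF Y s(1) y(1)] r by blast
  qed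
  have nd': "\<not> degenerate W (Suc k) (s', y')"
  proof
    assume "degenerate W (Suc k) (s', y')"
    then obtain t where t: "t < Suc k" "s' ! t = s' ! Suc t" "ac Y (Suc k) (Suc k) (squash t) y' = y'"
      using degenerate_prod_simplex[OF Y s' y'] by blast
    consider "t = p" | "Suc p \<le> t" | "t < p - 1" | "t = p - 1" "t \<noteq> p" by linarith
    then show False
    proof cases
      case 1
      then show False using t(1,2) s'q[of p] s'q[of "Suc p"] C(3) by (auto simp: sigma_def)
    next
      case 2
      then have r: "s ! (t - 1) = s ! Suc (t - 1)" using t(1,2) s'q[of t] s'q[of "Suc t"] by (auto simp: sigma_def)
      show False
        by (rule contra[OF _ r t(1,3)]) (use 2 t(1) in \<open>auto simp: sigma_def squash_def delta_def\<close>)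
    next
      case 3
      then have "t < p" "Suc t < p" by auto
      then have r: "s ! t = s ! Suc t" using t(1,2) s'q[of t] s'q[of "Suc t"] by (simp add: sigma_def)
      show False
        by (rule contra[OF _ r t(1,3)]) (use 3 C(2) in \<open>auto simp: sigma_def squash_def delta_def\<close>)
    next
      case 4
      have st: "s ! (p - 1) = i" using t(1,2) s'q[of t] s'q[of "Suc t"] 4 by (auto simp: sigma_def)
      have tp: "t < k" "Suc t = p" using 4 C(2) by auto
      \<comment> \<open>In \<open>y'\<close> the vertices p - 1, p and p + 1 are all identified, by
        \<open>t\<close> and by the insertion. As \<open>y\<close> is the face omitting p, its
        vertices p - 1 and p are identified too.\<close>
      have "ac Y k k (squash t) y = y"
      proof -
        have "ac Y k k (squash t) y = ac Y k k (squash t) (ac Y (Suc k) k (delta p) y')" using fy by simp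
        also have "\<dots> = ac Y (Suc k) k (delta p \<circ> squash t) y'" by (rule ac_ac[OF Y squash_mono[OF tp(1)] dm y'])
        also have "\<dots> = ac Y (Suc k) k (squash p \<circ> (delta p \<circ> squash t)) y'"
          using ac_ac[OF Y mono_fn_comp[OF squash_mono[OF tp(1)] dm] squash_mono[of p "Suc k"] y'] inv C(2) by simp
        also have "\<dots> = ac Y (Suc k) k (squash t \<circ> (squash p \<circ> delta p)) y'"
          by (rule ac_cong) (use tp in \<open>auto simp: squash_def delta_def\<close>)
        also have "\<dots> = ac Y (Suc k) k (squash p \<circ> delta p) y'"
          using ac_ac[OF Y mono_fn_comp[OF dm squash_mono[of p "Suc k"]] squash_mono[OF t(1)] y'] t(3) C(2) by simp
        also have "\<dots> = ac Y (Suc k) k (delta p) y'"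
          using ac_ac[OF Y dm squash_mono[of p "Suc k"] y'] inv C(2) by simp
        finally show ?thesis using fy by simp
      qed
      moreover have "cross i s - 1 = t" using tp by (simp add: p_def)
      ultimately have "(k, s, y) \<in> M" using s y nd st unfolding M_def p_def by simp
      with nM show False by simp
    qed
  qed
  have "s' ! p = i" using C(2) by (simp add: s'q)
  then have "(Suc k, s', y') \<in> M" using s' y' nd' nh n0 inv cr by (simp add: M_def)
  then show ?thesis using f cr unfolding p_def by (intro exI[of _ "(s', y')"]) simp
qed

lemma pdom_R0_iff: "s \<in> mono_maps k n \<Longrightarrow> y \<in> cells Y k \<Longrightarrow>
    (k, s, y) \<notin> pdom R0 \<longleftrightarrow> s \<notin> cells (horn n i) k \<and> y \<notin> Y0 k"
  using dom by blast

lemma generated_nondegenerate: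
  assumes s: "s \<in> mono_maps k n" and y: "y \<in> cells Y k" and nd: "\<not> degenerate W k (s, y)"
  shows "(k, s, y) \<in> pdom R0 \<or> (\<exists>k' c \<theta>. (k', c) \<in> M \<and> k' \<le> Suc k \<and> \<theta> \<in> mono_maps k k' \<and> (s, y) = act W k' \<theta> c)"
proof (cases "(k, s, y) \<in> pdom R0")
  case False
  then have f: "s \<notin> cells (horn n i) k" "y \<notin> Y0 k" using pdom_R0_iff[OF s y] by auto
  show ?thesis
  proof (cases "(k, s, y) \<in> M")
    case True
    have "(s, y) = act W k [0..<Suc k] (s, y)" using act_id[OF W, of "(s, y)" k] s y by (simp del: upt_Suc)
    then show ?thesis using True by (intro disjI2 exI[of _ k] exI[of _ "(s, y)"] exI[of _ "[0..<Suc k]"]) (simp del: upt_Suc)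
  next
    case False
    from partner[OF s f(1) y f(2) nd False] obtain c where c: "(Suc k, c) \<in> M" "(s, y) = face W (Suc k) (cross i s) c" by blast
    then show ?thesis
      by (intro disjI2 exI[of _ "Suc k"] exI[of _ c] exI[of _ "tab k (delta (cross i s))"])
        (simp add: ac_def tab_in_iff delta_mono)
  qed
qed simp

text \<open>The bound on \<open>k'\<close> matters in \<open>M_faces\<close>: a degenerate face of a
  k-dimensional cell has a core of dimension below k - 1, so it is generated in dimension below k
  and at lower rank.\<close>

lemma generated:
  assumes s: "s \<in> mono_maps k n" and y: "y \<in> cells Y k"
  obtains m k' x \<theta> where "m \<le> k" "m < k \<longleftrightarrow> degenerate W k (s, y)" "\<theta> \<in> mono_maps k k'" "(s, y) = act W k' \<theta> x"
    "(k', x) \<in> pdom R0 \<or> (k', x) \<in> M \<and> k' \<le> Suc m"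
proof -
  have sy: "(s, y) \<in> cells W k" using s y by simp
  obtain m f z where m: "m \<le> k" "mono_fn k m f" "f ` {..k} = {..m}" "z \<in> cells W m" "\<not> degenerate W m z"
    "(s, y) = ac W m k f z" using exists_nondegenerate[OF W sy] by blast
  have iff: "m < k \<longleftrightarrow> degenerate W k (s, y)"
  proof
    assume "m < k"
    then show "degenerate W k (s, y)" using m unfolding degenerate_def ac_def
      by (intro exI[of _ m] conjI bexI[of _ "tab k f"] bexI[of _ z]) (auto simp: tab_in_iff)
  next
    assume d: "degenerate W k (s, y)"
    show "m < k"
    proof (rule ccontr)
      assume "\<not> m < k"
      then have mk: "m = k" using m by simp
      have "inj_on f {..k}" using m(3) mk by (intro eq_card_imp_inj_on) auto
      then have "(s, y) = z" using ac_ident[OF W m(4), of f] inj_mono_id[of k f] m mk by auto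
      with d m mk show False by simp
    qed
  qed
  obtain s' y' where z: "z = (s', y')" by (cases z)
  have t: "tab k f \<in> mono_maps k m" using m by (simp add: tab_in_iff)
  have "(m, z) \<in> pdom R0 \<or> (\<exists>k' c \<theta>. (k', c) \<in> M \<and> k' \<le> Suc m \<and> \<theta> \<in> mono_maps m k' \<and> z = act W k' \<theta> c)"
    using generated_nondegenerate[of s' m y'] m z by auto
  then show thesis
  proof
    assume "(m, z) \<in> pdom R0"
    then show thesis using that[of m "tab k f" m z] m t iff by (simp add: ac_def)
  next
    assume "\<exists>k' c \<theta>. (k', c) \<in> M \<and> k' \<le> Suc m \<and> \<theta> \<in> mono_maps m k' \<and> z = act W k' \<theta> c"
    then obtain k' c \<theta> where c: "(k', c) \<in> M" "k' \<le> Suc m" "\<theta> \<in> mono_maps m k'" "z = act W k' \<theta> c" by blast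
    have cW: "c \<in> cells W k'" using c(1) by (auto simp: M_def)
    have "(s, y) = act W k' (map ((!) \<theta>) (tab k f)) c"
      using act_act[OF W t c(3) cW] m(6) c(4) by (simp add: ac_def)
    then show thesis using that[of m _ k' c] m(1) iff mono_maps_comp[OF t c(3)] c by blast
  qed
qed

text \<open>A degenerate face, or one in \<open>M\<close>, is generated in lower dimension. Any
  other face outside the initial domain has a partner of the same dimension k, whose crossing lies
  after that of the cell, so its rank is lower. The crossing could have moved back only if a vertex
  before the pivot was deleted, but then the pivot survives and the face is in
  \<open>M\<close>.\<close>

lemma M_faces:
  assumes M: "(k, s, y) \<in> M" and l: "l \<le> k" "l \<noteq> cross i s - 1"
  shows "\<exists>k' x \<theta>. \<theta> \<in> mono_maps (k - 1) k' \<and> face W k l (s, y) = act W k' \<theta> x \<and>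
      ((k', x) \<in> pdom R0 \<or> (k', x) \<in> M \<and> rk k' x < rk k (s, y))"
proof -
  define j where "j = cross i s - 1"
  note D = MD[OF M, folded j_def]
  note C = covers[OF D(1,4)]
  define s' where "s' = tab (k - 1) (\<lambda>q. s ! delta l q)"
  define y' where "y' = face Y k l y"
  have k0: "0 < k" using D by simp
  have s': "s' \<in> mono_maps (k - 1) n" and y': "y' \<in> cells Y (k - 1)"
    using face_cells[OF D(1,2) k0] by (auto simp: s'_def y'_def)
  have f: "face W k l (s, y) = (s', y')" by (simp add: ac_sprod ac_simplex s'_def y'_def)
  have jc: "cross i s = Suc j" using D by simp
  have small: "rk k' x < rk k (s, y)" if x: "(k', x) \<in> M" "k' < k" for k' x
  proof -
    have "(k' + 1) * (k' + 1) \<le> k * k" using x(2) by (intro mult_le_mono) auto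
    then show ?thesis using C(2) unfolding rk_def by simp
  qed
  have idf: "(s', y') = act W (k - 1) [0..<Suc (k - 1)] (s', y')"
    using act_id[OF W, of "(s', y')" "k - 1"] s' y' by (simp del: upt_Suc)
  show ?thesis
  proof (cases "(k - 1, s', y') \<in> pdom R0")
    case True
    then show ?thesis unfolding f using idf id_mono_maps by blast
  next
    case nR: False
    then have nR': "s' \<notin> cells (horn n i) (k - 1)" "y' \<notin> Y0 (k - 1)" using pdom_R0_iff[OF s' y'] by auto
    show ?thesis
    proof (cases "degenerate W (k - 1) (s', y')")
      case True
      obtain m k' x \<theta> where g: "m \<le> k - 1" "m < k - 1 \<longleftrightarrow> degenerate W (k - 1) (s', y')" "\<theta> \<in> mono_maps (k - 1) k'"
        "(s', y') = act W k' \<theta> x" "(k', x) \<in> pdom R0 \<or> (k', x) \<in> M \<and> k' \<le> Suc m"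
        by (rule generated[OF s' y'])
      then have "m < k - 1" using True by simp
      then have "k' < k" if "k' \<le> Suc m" using that by simp
      then show ?thesis using g small unfolding f by blast
    next
      case nd: False
      show ?thesis
      proof (cases "(k - 1, s', y') \<in> M")
        case True
        then show ?thesis unfolding f using idf id_mono_maps small k0 by (metis diff_less zero_less_one)
      next
        case nM: False
        obtain c where c: "(Suc (k - 1), c) \<in> M" "cross i (fst c) = Suc (cross i s')"
          "(s', y') = face W (Suc (k - 1)) (cross i s') c"
          using partner[OF s' nR'(1) y' nR'(2) nd nM] by blast
        have sk: "Suc (k - 1) = k" using k0 by simp
        have s'q: "s' ! q = s ! delta l q" if "q \<le> k - 1" for q using that by (simp add: s'_def)
        note C' = covers[OF s' nR'(1)]
        have inM: "(k - 1, s', y') \<in> M" if e: "cross i s' = Suc p" "s' ! p = i" and p: "p < k - 1"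
          and eq: "\<And>q. q \<le> k - 1 \<Longrightarrow> squash j (delta l (squash p q)) = squash j (delta l q)" for p
        proof -
          have dm: "mono_fn (k - 1) k (delta l)" by (rule delta_mono'[OF k0])
          have "ac Y (k - 1) (k - 1) (squash p) y' = ac Y k (k - 1) (delta l \<circ> squash p) y"
            unfolding y'_def by (rule ac_ac[OF Y squash_mono[OF p] dm D(2)])
          also have "\<dots> = y'"
            unfolding y'_def
            by (rule squash_invariant[OF Y D(2,7,10) mono_fn_comp[OF squash_mono[OF p] dm] dm]) (simp add: eq)
          finally show ?thesis using e s' y' nd nR' by (simp add: M_def)
        qed
        have "cross i s \<le> cross i s'"
        proof (rule ccontr)
          assume a: "\<not> cross i s \<le> cross i s'"
          define p' where "p' = cross i s'"
          have p': "p' \<le> k - 1" "s' ! p' = Suc i" using C'(2,3) by (auto simp: p'_def)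
          have "i < s ! delta l p'" using s'q p' by simp
          then have "\<not> delta l p' < cross i s" using C(4)[of "delta l p'"] by auto
          then have lj: "l < j" and p'j: "p' = j" using a l jc unfolding p'_def[symmetric] j_def[symmetric]
            by (auto simp: delta_def split: if_splits)
          have j1: "Suc (j - 1) = j" using D by simp
          have "(k - 1, s', y') \<in> M"
          proof (rule inM[of "j - 1"])
            show "cross i s' = Suc (j - 1)" using p'j j1 p'_def by simp
            have "delta l (j - 1) = j" using lj by (auto simp: delta_def)
            then show "s' ! (j - 1) = i" using s'q[of "j - 1"] D by simp
            show "j - 1 < k - 1" using D by simp
            show "squash j (delta l (squash (j - 1) q)) = squash j (delta l q)" for q
              using lj by (auto simp: squash_def delta_def)
          qed
          with nM show False by simp
        qed
        moreover have "cross i (fst c) \<le> k"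
        proof -
          have "(k, fst c, snd c) \<in> M" using c(1) sk by simp
          note E = MD(1,4)[OF this]
          show ?thesis using covers(2)[OF E] .
        qed
        ultimately have "rk k c < rk k (s, y)"
        proof -
          assume a: "cross i s \<le> cross i s'" "cross i (fst c) \<le> k"
          have "k \<le> (k + 1) * (k + 1)" by simp
          then have "cross i (fst c) \<le> (k + 1) * (k + 1)" using a(2) by linarith
          moreover have "cross i s < cross i (fst c)" using a(1) c(2) by simp
          ultimately show ?thesis unfolding rk_def fst_conv by linarith
        qed
        moreover have "face W k (cross i s') c = act W k (tab (k - 1) (delta (cross i s'))) c" by (simp add: ac_def)
        moreover have "tab (k - 1) (delta (cross i s')) \<in> mono_maps (k - 1) k"
          unfolding tab_in_iff by (rule delta_mono'[OF k0])
        ultimately show ?thesis unfolding f using c(1,3) unfolding sk by metis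
      qed
    qed
  qed
qed

text \<open>The vertex before the pivot lies over i - 1 or i, and the pivot shares its
  \<open>Y\<close>-coordinate with its successor, so this triangle is one of those in
  \<open>S1\<close>.\<close>

lemma M_triangle:
  assumes M: "(k, s, y) \<in> M"
  shows "act W k [cross i s - 1 - 1, cross i s - 1, cross i s - 1 + 1] (s, y) \<in> S"
proof -
  define j where "j = cross i s - 1"
  note D = MD[OF M, folded j_def]
  note C = covers[OF D(1,4)]
  have jc: "cross i s = Suc j" using D by simp
  let ?a = "s ! (j - 1)"
  have "?a \<le> i" using C(4)[of "j - 1"] jc by simp
  moreover have "i - 1 \<le> ?a"
  proof -
    obtain r where r: "r \<le> k" "s ! r = i - 1" using C(1)[of "i - 1"] i by (metis Suc_pred' diff_le_self less_or_eq_imp_le n_not_Suc_n order_trans)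
    have mon: "s ! p \<le> s ! q" if "p \<le> q" "q \<le> k" for p q
      using mono_maps_nth[OF D(1)] that by (auto simp: mono_fn_def)
    have "r < j"
    proof (rule ccontr)
      assume "\<not> r < j"
      then have "i \<le> s ! r" using mon[of j r] r D(6) by simp
      with r i show False by simp
    qed
    then show ?thesis using mon[of r "j - 1"] r D by simp
  qed
  ultimately have a: "?a = i - 1 \<or> ?a = i" by auto
  have f1: "mono_fn 2 k (\<lambda>q. j - 1 + q)" "mono_fn 1 k (\<lambda>q. j - 1 + q)" "mono_fn 2 1 (\<lambda>q. min q 1)"
    using D by (auto simp: mono_fn_def)
  have l1: "tab 2 (\<lambda>q. j - 1 + q) = [j - 1, j, j + 1]" "tab 2 (\<lambda>q. min q 1) = [0,1,1]" using D by (simp_all add: tab2)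
  have "act Y k [j - 1, j, j + 1] y = ac Y k 2 (\<lambda>q. j - 1 + q) y" unfolding ac_def l1 ..
  also have "\<dots> = ac Y k 2 ((\<lambda>q. j - 1 + q) \<circ> (\<lambda>q. min q 1)) y"
    by (rule squash_invariant[OF Y D(2,7,10) f1(1) mono_fn_comp[OF f1(3,2)]])
      (use D in \<open>auto simp: squash_def min_def\<close>)
  also have "\<dots> = ac Y 1 2 (\<lambda>q. min q 1) (ac Y k 1 (\<lambda>q. j - 1 + q) y)"
    by (rule ac_ac[symmetric, OF Y f1(3,2) D(2)])
  also have "\<dots> = act Y 1 [0,1,1] (ac Y k 1 (\<lambda>q. j - 1 + q) y)" unfolding ac_def[of Y 1 2] l1(2) ..
  finally have ye: "act Y k [j - 1, j, j + 1] y = act Y 1 [0,1,1] (ac Y k 1 (\<lambda>q. j - 1 + q) y)" .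
  have "map ((!) s) [j - 1, j, j + 1] = [?a, i, i + 1]" using D(6) C(3) jc by simp
  then show ?thesis
    using S1[OF ac_cells[OF Y f1(2) D(2)] a] ye unfolding j_def[symmetric] by (simp add: jc del: One_nat_def)
qed

theorem extend:
  "\<exists>R. R0 \<subseteq> R \<and> pmap W Z S R \<and> (\<forall>k s y. s \<in> mono_maps k n \<longrightarrow> y \<in> cells Y k \<longrightarrow> (k, s, y) \<in> pdom R)"
proof -
  have "\<exists>R. R0 \<subseteq> R \<and> pmap W Z S R \<and> M \<subseteq> pdom R"
  proof (rule extend_pmap[OF Z W R0, where j = piv and \<rho> = rk])
    fix k x assume "(k, x) \<in> M"
    then obtain s y where x: "x = (s, y)" and m: "(k, s, y) \<in> M" by (cases x) auto
    note D = MD[OF m]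
    note F = M_face[OF m]
    show "x \<in> cells W k \<and> \<not> degenerate W k x \<and> 2 \<le> k \<and> 0 < piv k x \<and> piv k x < k"
      using D by (simp add: x piv_def)
    show "\<not> degenerate W (k - 1) (face W k (piv k x) x) \<and>
        (k - 1, face W k (piv k x) x) \<notin> pdom R0 \<and> (k - 1, face W k (piv k x) x) \<notin> M"
      using F pdom_R0_iff[OF F(1,2)] by (simp add: x piv_def ac_sprod ac_simplex)
    show "act W k [piv k x - 1, piv k x, piv k x + 1] x \<in> S"
      using M_triangle[OF m] by (simp add: x piv_def)
    fix l assume "l \<le> k" "l \<noteq> piv k x"
    then show "\<exists>k' x' \<theta>. \<theta> \<in> mono_maps (k - 1) k' \<and> face W k l x = act W k' \<theta> x' \<and>
        ((k', x') \<in> pdom R0 \<or> (k', x') \<in> M \<and> rk k' x' < rk k x)"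
      using M_faces[OF m] by (simp add: x piv_def)
  next
    fix k c c' assume m: "(k, c) \<in> M" "(k, c') \<in> M" and eq: "face W k (piv k c) c = face W k (piv k c') c'"
    obtain s y s1 y1 where c: "c = (s, y)" "c' = (s1, y1)" by (cases c, cases c')
    note F = M_face[OF m(1)[unfolded c]] and G = M_face[OF m(2)[unfolded c]]
    note D = MD[OF m(1)[unfolded c]] and E = MD[OF m(2)[unfolded c]]
    have e: "tab (k - 1) (\<lambda>q. s ! delta (cross i s - 1) q) = tab (k - 1) (\<lambda>q. s1 ! delta (cross i s1 - 1) q)"
      "face Y k (cross i s - 1) y = face Y k (cross i s1 - 1) y1"
      using eq by (simp_all add: c piv_def ac_sprod ac_simplex)
    have j: "cross i s - 1 = cross i s1 - 1" using F(3) G(3) e(1) by simp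
    have "s = s1"
    proof (rule mono_maps_eqI[OF D(1) E(1)])
      fix q assume q: "q \<le> k"
      show "s ! q = s1 ! q" unfolding F(9)[OF q] G(9)[OF q] e(1) unfolding j ..
    qed
    moreover have "y = y1" using F(8) G(8) e(2) j by simp
    ultimately show "c = c'" by (simp add: c)
  next
    \<comment> \<open>The deleted face determines the 3-simplex, so \<open>S2\<close> applies with
      that face as the given triangle.\<close>
    fix x l assume mx: "(3, x) \<in> M" and fS: "face W 3 (piv 3 x) x \<in> S" and l: "l \<le> (3::nat)"
    obtain s y where x: "x = (s, y)" by (cases x)
    have m: "(3, s, y) \<in> M" using mx x by simp
    note D = MD[OF m]
    note F = M_face[OF m]
    define j where "j = cross i s - 1"
    define s' where "s' = tab 2 (\<lambda>q. s ! delta j q)"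
    define z where "z = face Y 3 j y"
    have sS: "(s', z) \<in> S" using fS by (simp add: x piv_def ac_sprod ac_simplex s'_def z_def j_def)
    have F': "s' \<in> mono_maps 2 n" "z \<in> cells Y 2" "cross i s' = j" "s' \<notin> cells (horn n i) 2"
      "y = ac Y 2 3 (sigma j) z" "\<And>q. q \<le> 3 \<Longrightarrow> s ! q = (if q = j then i else s' ! sigma j q)"
      using F by (simp_all add: s'_def z_def j_def)
    note C = covers[OF F'(1,4), unfolded F'(3)]
    have "s = tab 3 (\<lambda>q. if q = j then i else s' ! sigma j q)"
      using F'(6) length_mono_maps[OF D(1)] by (intro nth_equalityI) (auto simp: less_Suc_eq_le)
    moreover have "face Y 3 l y = ac Y 2 2 (sigma j \<circ> delta l) z"
      unfolding F'(5) using ac_ac[OF Y delta_mono[of 2 l] sigma_mono[of j 2] F'(2)] C(2) by simp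
    moreover have "s' ! (j - 1) \<le> i" using C(4)[of "j - 1"] C(6) by simp
    ultimately show "face W 3 l x \<in> S"
      using S2[OF sS F'(1,4,2) C(6,2) _ C(3) l] by (simp add: x ac_sprod ac_simplex)
  qed
  then obtain R where R: "R0 \<subseteq> R" "pmap W Z S R" "M \<subseteq> pdom R" by blast
  have "(k, s, y) \<in> pdom R" if sy: "s \<in> mono_maps k n" "y \<in> cells Y k" for k s y
  proof -
    obtain m k' x \<theta> where g: "m \<le> k" "m < k \<longleftrightarrow> degenerate W k (s, y)" "\<theta> \<in> mono_maps k k'"
      "(s, y) = act W k' \<theta> x" "(k', x) \<in> pdom R0 \<or> (k', x) \<in> M \<and> k' \<le> Suc m"
      by (rule generated[OF sy])
    then have "(k', x) \<in> pdom R" using R by (auto simp: pdom_def)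
    then show ?thesis using pdom_act[OF R(2) g(3)] g(4) by simp
  qed
  with R show ?thesis by blast
qed

end

section \<open>Saturation properties\<close>

lemma act_list: "simplicial_set X \<Longrightarrow> x \<in> cells X n \<Longrightarrow> \<theta> \<in> mono_maps m n \<Longrightarrow> sorted \<psi> \<Longrightarrow> \<psi> \<noteq> [] \<Longrightarrow>
    set \<psi> \<subseteq> {..m} \<Longrightarrow> act X m \<psi> (act X n \<theta> x) = act X n (map ((!) \<theta>) \<psi>) x"
  by (rule act_act[where l = "length \<psi> - 1"]) (auto simp: mono_maps_def)

lemma tab3: "tab 3 f = [f 0, f 1, f 2, f 3]"
  by (simp add: tab_def numeral_3_eq_3 numeral_2_eq_2)

lemma list_in_mono_maps: "length \<theta> = Suc m \<Longrightarrow> sorted \<theta> \<Longrightarrow> set \<theta> \<subseteq> {..n} \<Longrightarrow> \<theta> \<in> mono_maps m n"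
  by (simp add: mono_maps_def)

lemma degenerate_simplex:
  assumes "s \<in> mono_maps m n"
  shows "degenerate (simplex n) m s \<longleftrightarrow> \<not> distinct s"
proof
  assume "degenerate (simplex n) m s"
  then obtain p where p: "p < m" "tab m (\<lambda>q. s ! squash p q) = s"
    using degenerate_iff[OF simplicial_simplex, of s n m] assms by (auto simp: ac_simplex)
  then have "tab m (\<lambda>q. s ! squash p q) ! Suc p = s ! Suc p" by simp
  then have "s ! p = s ! Suc p" using p by (simp add: squash_def)
  then show "\<not> distinct s" using p length_mono_maps[OF assms] 
    by (metis Suc_less_eq less_SucI n_not_Suc_n nth_eq_iff_index_eq)
next
  assume "\<not> distinct s"
  then show "degenerate (simplex n) m s"
    using degenerate_act[OF simplicial_simplex, of "[0..<Suc n]" n n s m] assms map_nth_id[OF assms]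
    by (simp del: upt_Suc)
qed

lemma inf_bicategory_four_simplex:
  assumes C: "inf_bicategory C" and x: "x \<in> cells C 4"
    and t: "act C 4 [0,2,4] x \<in> thin C" "act C 4 [1,2,3] x \<in> thin C" "act C 4 [0,1,3] x \<in> thin C"
      "act C 4 [1,3,4] x \<in> thin C" "act C 4 [0,1,2] x \<in> thin C"
  shows "act C 4 [0,3,4] x \<in> thin C" "act C 4 [0,1,4] x \<in> thin C"
proof -
  let ?T = "{[0,2,4], [1,2,3], [0,1,3], [1,3,4], [0,1,2]} :: nat list set"
  let ?T' = "?T \<union> {[0,3,4], [0,1,4]}"
  have CS: "simplicial_set C" "scaled_sset C" using C by (auto simp: inf_bicategory_def scaled_sset_def)
  have ext: "has_extensions C (scale (simplex 4) ?T) (scale (simplex 4) ?T')"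
    using C unfolding inf_bicategory_def Let_def by blast
  define f where "f = (\<lambda>k. \<lambda>s\<in>mono_maps k 4. act C 4 s x)"
  have f: "f \<in> smaps (simplex 4) C" unfolding f_def by (rule yoneda[OF CS(1) x])
  have "f \<in> sc_maps (scale (simplex 4) ?T) C"
    unfolding sc_maps_def
  proof (intro CollectI conjI ballI)
    show "f \<in> smaps (scale (simplex 4) ?T) C"
      using f smaps_cong[of "scale (simplex 4) ?T" "simplex 4" C C] by simp
    fix \<sigma> assume s: "\<sigma> \<in> thin (scale (simplex 4) ?T)"
    then have m: "\<sigma> \<in> mono_maps 2 4" by simp
    show "f 2 \<sigma> \<in> thin C"
    proof (cases "\<sigma> \<in> ?T")
      case True
      then have "act C 4 \<sigma> x \<in> thin C" using t by blast
      then show ?thesis using m by (simp add: f_def)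
    next
      case False
      then have "degenerate (simplex 4) 2 \<sigma>" using s by simp
      then show ?thesis using smaps_degenerate[OF f, of \<sigma> 2] smaps_cells[OF f, of \<sigma> 2] m CS(2)
        by (simp add: scaled_sset_def)
    qed
  qed
  then have "\<exists>g\<in>sc_maps (scale (simplex 4) ?T') C. \<forall>k. \<forall>s\<in>cells (scale (simplex 4) ?T) k. g k s = f k s"
    using ext unfolding has_extensions_def by blast
  then obtain g where g: "g \<in> sc_maps (scale (simplex 4) ?T') C"
    and gf: "\<And>k s. s \<in> mono_maps k 4 \<Longrightarrow> g k s = f k s" by auto
  have "act C 4 \<sigma> x \<in> thin C" if "\<sigma> \<in> mono_maps 2 4" "\<sigma> \<in> {[0,3,4], [0,1,4]}" for \<sigma>
  proof -
    have "g 2 \<sigma> \<in> thin C" using g that unfolding sc_maps_def by (simp del: insert_iff) blast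
    then show ?thesis using gf[OF that(1)] that(1) by (simp add: f_def)
  qed
  moreover have "[0,3,4] \<in> mono_maps 2 4" "[0,1,4] \<in> mono_maps 2 4" by (simp_all add: mono_maps_def)
  ultimately show "act C 4 [0,3,4] x \<in> thin C" "act C 4 [0,1,4] x \<in> thin C" by blast+
qed

lemma degenerate_thin:
  assumes "scaled_sset Z" "x \<in> cells Z k" "\<theta> \<in> mono_maps 2 k" "\<not> distinct \<theta>"
  shows "act Z k \<theta> x \<in> thin Z"
  using degenerate_act[of Z x k \<theta> 2] act_cells[of Z \<theta> 2 k x] assms by (auto simp: scaled_sset_def)

lemma inf_bicategory_inner_fib:
  assumes C: "inf_bicategory C"
  shows "inner_fib C"
  unfolding inner_fib_def
proof (intro conjI ballI impI)
  show sc: "scaled_sset C" using C by (simp add: inf_bicategory_def)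
  then have CS: "simplicial_set C" by (simp add: scaled_sset_def)
  show "\<forall>n i. 2 \<le> n \<and> 0 < i \<and> i < n \<longrightarrow>
        has_extensions C (scale (horn n i) {[i - 1, i, i + 1]}) (scale (simplex n) {[i - 1, i, i + 1]})"
    using C by (simp add: inf_bicategory_def)
  fix \<rho> assume r: "\<rho> \<in> cells C 3" and t: "act C 3 [0,1,2] \<rho> \<in> thin C \<and> act C 3 [1,2,3] \<rho> \<in> thin C"
  note simps = act_list[OF CS r] list_in_mono_maps
  have dg: "act C 3 \<theta> \<rho> \<in> thin C" if "\<theta> \<in> mono_maps 2 3" "\<not> distinct \<theta>" for \<theta>
    using degenerate_thin[OF sc r that] .
  show "act C 3 [0,1,3] \<rho> \<in> thin C \<longleftrightarrow> act C 3 [0,2,3] \<rho> \<in> thin C"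
  proof
    assume a: "act C 3 [0,1,3] \<rho> \<in> thin C"
    \<comment> \<open>Doubling the vertex 1 turns the conclusion (0,3,4) of the axiom into (0,2,3)
      and its hypothesis (0,2,4) into (0,1,3); the other hypotheses are given or degenerate.\<close>
    have x: "act C 3 [0,1,1,2,3] \<rho> \<in> cells C 4" by (rule act_cells[OF CS _ r]) (simp add: list_in_mono_maps)
    from inf_bicategory_four_simplex(1)[OF C x] show "act C 3 [0,2,3] \<rho> \<in> thin C"
      using a t dg[of "[1,1,2]"] dg[of "[0,1,1]"] by (simp add: simps)
  next
    assume a: "act C 3 [0,2,3] \<rho> \<in> thin C"
    \<comment> \<open>Doubling the vertex 2 exchanges the roles: (0,1,4) becomes (0,1,3), and
      (0,2,4) becomes (0,2,3).\<close>
    have x: "act C 3 [0,1,2,2,3] \<rho> \<in> cells C 4" by (rule act_cells[OF CS _ r]) (simp add: list_in_mono_maps)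
    from inf_bicategory_four_simplex(2)[OF C x] show "act C 3 [0,1,3] \<rho> \<in> thin C"
      using a t dg[of "[1,2,2]"] by (simp add: simps)
  qed
qed

text \<open>A simplex of the horn may miss several vertices and then lies in several of the
  prescribed faces. By \<open>compat\<close> any two of them give it the same value, through their
  common face of codimension two, so the omitted vertex can be chosen freely by
  \<open>pick\<close>.\<close>

lemma horn_of_faces:
  assumes X: "simplicial_set X" and n: "2 \<le> n"
    and y: "\<And>l. l \<le> n \<Longrightarrow> l \<noteq> j \<Longrightarrow> y l \<in> cells X (n - 1)"
    and compat: "\<And>k l. k < l \<Longrightarrow> l \<le> n \<Longrightarrow> k \<noteq> j \<Longrightarrow> l \<noteq> j \<Longrightarrow> face X (n - 1) k (y l) = face X (n - 1) (l - 1) (y k)"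
  obtains h where "h \<in> smaps (horn n j) X"
    "\<And>l m s. l \<le> n \<Longrightarrow> l \<noteq> j \<Longrightarrow> s \<in> mono_maps m n \<Longrightarrow> l \<notin> set s \<Longrightarrow>
      h m s = act X (n - 1) (map (\<lambda>v. if v < l then v else v - 1) s) (y l)"
proof -
  define pr :: "nat \<Rightarrow> nat \<Rightarrow> nat" where "pr l v = (if v < l then v else v - 1)" for l v
  have prm: "map (pr l) s \<in> mono_maps m (n - 1)" if s: "s \<in> mono_maps m n" and l: "l \<le> n" "l \<notin> set s" for l m s
  proof -
    have "l \<notin> (!) s ` {..m}" using l(2) length_mono_maps[OF s] by (auto simp: less_Suc_eq_le)
    then have "mono_fn m (n - 1) (\<lambda>q. pr l (s ! q))"
      using avoid_factor(1)[OF mono_maps_nth[OF s] l(1)] n unfolding pr_def by simp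
    moreover have "map (pr l) s = tab m (\<lambda>q. pr l (s ! q))"
      using length_mono_maps[OF s] by (intro nth_equalityI) (auto simp: less_Suc_eq_le)
    ultimately show ?thesis by (simp add: tab_in_iff)
  qed
  have eq: "act X (n - 1) (map (pr l) s) (y l) = act X (n - 1) (map (pr k) s) (y k)"
    if s: "s \<in> mono_maps m n" and k: "k < l" "l \<le> n" "k \<noteq> j" "l \<noteq> j" "k \<notin> set s" "l \<notin> set s" for k l m s
  proof -
    have n1: "0 < n - 1" using n by simp
    define g where "g = (\<lambda>q. pr k (pr l (s ! q)))"
    have sl: "map (pr l) s \<in> mono_maps m (n - 1)" and sk: "map (pr k) s \<in> mono_maps m (n - 1)"
      using prm s k by auto
    have kl: "k \<notin> set (map (pr l) s)"
    proof
      assume "k \<in> set (map (pr l) s)"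
      then obtain v where v: "v \<in> set s" "k = pr l v" by auto
      then have "v \<noteq> k" "v \<noteq> l" using k by auto
      with v k show False by (auto simp: pr_def split: if_splits)
    qed
    have lk: "l - 1 \<notin> set (map (pr k) s)"
    proof
      assume "l - 1 \<in> set (map (pr k) s)"
      then obtain v where v: "v \<in> set s" "l - 1 = pr k v" by auto
      then have "v \<noteq> k" "v \<noteq> l" using k by auto
      with v k show False by (auto simp: pr_def split: if_splits)
    qed
    have A: "act X (n - 1) (map (pr l) s) (y l) = ac X (n - 1 - 1) m (\<lambda>q. if map (pr l) s ! q < k then map (pr l) s ! q else map (pr l) s ! q - 1) (face X (n - 1) k (y l))"
      by (rule act_avoid_face(1)[OF X y sl _ n1 kl]) (use k in auto)
    have B: "act X (n - 1) (map (pr k) s) (y k) = ac X (n - 1 - 1) m (\<lambda>q. if map (pr k) s ! q < l - 1 then map (pr k) s ! q else map (pr k) s ! q - 1) (face X (n - 1) (l - 1) (y k))"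
      by (rule act_avoid_face(1)[OF X y sk _ n1 lk]) (use k in auto)
    have "(if map (pr l) s ! q < k then map (pr l) s ! q else map (pr l) s ! q - 1) =
      (if map (pr k) s ! q < l - 1 then map (pr k) s ! q else map (pr k) s ! q - 1)" if q: "q \<le> m" for q
    proof -
      have "s ! q \<in> set s" using q length_mono_maps[OF s] by simp
      then have "s ! q \<noteq> k" "s ! q \<noteq> l" using k by auto
      then show ?thesis using q length_mono_maps[OF s] k by (auto simp: pr_def)
    qed
    then show ?thesis unfolding A B compat[OF k(1-4)] by (intro ac_cong) blast
  qed
  have eq': "act X (n - 1) (map (pr l) s) (y l) = act X (n - 1) (map (pr k) s) (y k)"
    if "s \<in> mono_maps m n" "k \<le> n" "l \<le> n" "k \<noteq> j" "l \<noteq> j" "k \<notin> set s" "l \<notin> set s" for k l m s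
    using eq[OF that(1), of k l] eq[OF that(1), of l k] that by (cases "k = l"; cases "k < l") auto
  define pick where "pick s = (SOME l. l \<le> n \<and> l \<noteq> j \<and> l \<notin> set s)" for s :: "nat list"
  define h where "h m = (\<lambda>s\<in>cells (horn n j) m. act X (n - 1) (map (pr (pick s)) s) (y (pick s)))" for m
  have pk: "pick s \<le> n \<and> pick s \<noteq> j \<and> pick s \<notin> set s" if "s \<in> cells (horn n j) m" for s m
    unfolding pick_def by (rule someI_ex) (use that in \<open>auto simp: horn_cells\<close>)
  have h: "h m s = act X (n - 1) (map (pr l) s) (y l)"
    if "l \<le> n" "l \<noteq> j" "s \<in> mono_maps m n" "l \<notin> set s" for l m s
  proof -
    have s: "s \<in> cells (horn n j) m" using that by (auto simp: horn_cells)
    show ?thesis using pk[OF s] eq'[OF that(3), of l "pick s"] that s by (simp add: h_def)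
  qed
  have "h \<in> smaps (horn n j) X"
  proof (rule smapsI)
    fix m s assume s: "s \<in> cells (horn n j) m"
    show "h m s \<in> cells X m"
      using pk[OF s] s prm[of s m "pick s"] y[of "pick s"] act_cells[OF X, of _ m "n - 1"] unfolding h_def by (auto simp: horn_cells)
  next
    fix m k \<theta> s assume th: "\<theta> \<in> mono_maps m k" and s: "s \<in> cells (horn n j) k"
    have sm: "s \<in> mono_maps k n" using s by (simp add: horn_cells)
    note p = pk[OF s]
    have ps: "pick s \<notin> set (map ((!) s) \<theta>)" using p set_map_nth[OF th sm] by blast
    have "h m (map ((!) s) \<theta>) = act X (n - 1) (map (pr (pick s)) (map ((!) s) \<theta>)) (y (pick s))"
      using h[OF _ _ mono_maps_comp[OF th sm] ps] p by simp
    also have "map (pr (pick s)) (map ((!) s) \<theta>) = map ((!) (map (pr (pick s)) s)) \<theta>"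
    proof (rule nth_equalityI)
      fix q assume q: "q < length (map (pr (pick s)) (map ((!) s) \<theta>))"
      then have "\<theta> ! q \<in> set \<theta>" by simp
      then have "\<theta> ! q < length s" using th length_mono_maps[OF sm] by (auto simp: mono_maps_def)
      then show "map (pr (pick s)) (map ((!) s) \<theta>) ! q = map ((!) (map (pr (pick s)) s)) \<theta> ! q" using q by simp
    qed simp
    also have "act X (n - 1) \<dots> (y (pick s)) = act X k \<theta> (act X (n - 1) (map (pr (pick s)) s) (y (pick s)))"
      using act_act[OF X th prm[OF sm] y] p by simp
    also have "act X (n - 1) (map (pr (pick s)) s) (y (pick s)) = h k s"
      by (rule h[symmetric, OF _ _ sm]) (use p in auto)
    finally show "h m (act (horn n j) k \<theta> s) = act X k \<theta> (h k s)" by simp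
  qed (simp add: h_def)
  then show thesis using that h unfolding pr_def by blast
qed

lemma fill_faces:
  assumes Z: "inner_fib Z" and n: "2 \<le> n" "0 < j" "j < n"
    and y: "\<And>l. l \<le> n \<Longrightarrow> l \<noteq> j \<Longrightarrow> y l \<in> cells Z (n - 1)"
    and compat: "\<And>k l. k < l \<Longrightarrow> l \<le> n \<Longrightarrow> k \<noteq> j \<Longrightarrow> l \<noteq> j \<Longrightarrow> face Z (n - 1) k (y l) = face Z (n - 1) (l - 1) (y k)"
    and t: "3 \<le> n \<Longrightarrow> \<exists>l\<le>n. l \<notin> {j - 1, j, j + 1} \<and>
        act Z (n - 1) (map (\<lambda>v. if v < l then v else v - 1) [j - 1, j, j + 1]) (y l) \<in> thin Z"
  shows "\<exists>x\<in>cells Z n. (\<forall>l\<le>n. l \<noteq> j \<longrightarrow> face Z n l x = y l) \<and> act Z n [j - 1, j, j + 1] x \<in> thin Z"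
proof -
  have Zs: "simplicial_set Z" by (rule inner_fib_simplicial[OF Z])
  obtain h where h: "h \<in> smaps (horn n j) Z"
    and hy: "\<And>l m s. l \<le> n \<Longrightarrow> l \<noteq> j \<Longrightarrow> s \<in> mono_maps m n \<Longrightarrow> l \<notin> set s \<Longrightarrow>
      h m s = act Z (n - 1) (map (\<lambda>v. if v < l then v else v - 1) s) (y l)"
    using horn_of_faces[where X = Z and n = n and j = j and y = y, OF Zs n(1) y compat] by blast
  have m: "[j - 1, j, j + 1] \<in> mono_maps 2 n" using n by (auto simp: mono_maps_def)
  have "h 2 [j - 1, j, j + 1] \<in> thin Z" if hc: "[j - 1, j, j + 1] \<in> cells (horn n j) 2"
  proof -
    obtain l where "l \<le> n" "l \<notin> {j - 1, j, j + 1}" using hc by (auto simp: horn_cells)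
    then have "3 \<le> n" using n by auto
    from t[OF this] obtain l where l: "l \<le> n" "l \<notin> {j - 1, j, j + 1}"
      "act Z (n - 1) (map (\<lambda>v. if v < l then v else v - 1) [j - 1, j, j + 1]) (y l) \<in> thin Z" by blast
    then show ?thesis using hy[of l, OF _ _ m] by simp
  qed
  from horn_fill[OF Z n h this] obtain x where x: "x \<in> cells Z n"
    and xh: "\<And>k s. s \<in> cells (horn n j) k \<Longrightarrow> act Z n s x = h k s" and xt: "act Z n [j - 1, j, j + 1] x \<in> thin Z" by blast
  have "face Z n l x = y l" if l: "l \<le> n" "l \<noteq> j" for l
  proof -
    have ms: "tab (n - 1) (delta l) \<in> mono_maps (n - 1) n" using delta_mono'[of n l] n by (simp add: tab_in_iff)
    have ls: "l \<notin> set (tab (n - 1) (delta l))" by (auto simp: set_tab delta_def)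
    have "face Z n l x = h (n - 1) (tab (n - 1) (delta l))"
      unfolding ac_def by (rule xh) (use ms ls l in \<open>auto simp: horn_cells\<close>)
    also have "\<dots> = act Z (n - 1) (map (\<lambda>v. if v < l then v else v - 1) (tab (n - 1) (delta l))) (y l)"
      by (rule hy[OF l ms ls])
    also have "map (\<lambda>v. if v < l then v else v - 1) (tab (n - 1) (delta l)) = [0..<Suc (n - 1)]"
      by (rule nth_equalityI) (auto simp: less_Suc_eq_le delta_def simp del: upt_Suc)
    also have "act Z (n - 1) \<dots> (y l) = y l" by (rule act_id[OF Zs y[OF l]])
    finally show ?thesis .
  qed
  then show ?thesis using x xt by blast
qed

section \<open>Fillers in dimensions three and four\<close>

lemma delta_tabs:
  "tab (3 - 1) (delta 0) = [1,2,3]" "tab (3 - 1) (delta 1) = [0,2,3]" "tab (3 - 1) (delta 2) = [0,1,3]" "tab (3 - 1) (delta 3) = [0,1,2]"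
  "tab (2 - 1) (delta 0) = [1,2]" "tab (2 - 1) (delta 1) = [0,2]" "tab (2 - 1) (delta 2) = [0,1]"
  "tab (4 - 1) (delta 0) = [1,2,3,4]" "tab (4 - 1) (delta 1) = [0,2,3,4]" "tab (4 - 1) (delta 2) = [0,1,3,4]"
  "tab (4 - 1) (delta 3) = [0,1,2,4]" "tab (4 - 1) (delta 4) = [0,1,2,3]"
  by (simp_all add: tab2 tab3 delta_def) (simp_all add: tab_def delta_def)

lemma fill_three_1:
  assumes Z: "inner_fib Z" and c: "a \<in> thin Z" "b \<in> cells Z 2" "d \<in> cells Z 2"
    and e: "act Z 2 [0,1] a = act Z 2 [0,1] b" "act Z 2 [1,2] a = act Z 2 [0,1] d" "act Z 2 [1,2] b = act Z 2 [0,2] d"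
  shows "\<exists>\<rho>\<in>cells Z 3. act Z 3 [0,1,2] \<rho> = a \<and> act Z 3 [0,1,3] \<rho> = b \<and> act Z 3 [1,2,3] \<rho> = d"
proof -
  have a: "a \<in> cells Z 2" using thin_cells[OF inner_fib_scaled[OF Z] c(1)] .
  define y where "y l = (if l = 0 then d else if l = (2::nat) then b else a)" for l
  have "\<exists>x\<in>cells Z 3. (\<forall>l\<le>3. l \<noteq> 1 \<longrightarrow> face Z 3 l x = y l) \<and> act Z 3 [1 - 1, 1, 1 + 1] x \<in> thin Z"
  proof (rule fill_faces[OF Z])
    fix k l :: nat assume kl: "k < l" "l \<le> 3" "k \<noteq> 1" "l \<noteq> 1"
    then have "(k = 0 \<and> l = 2) \<or> (k = 0 \<and> l = 3) \<or> (k = 2 \<and> l = 3)" by auto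
    then show "face Z (3 - 1) k (y l) = face Z (3 - 1) (l - 1) (y k)"
      using e delta_tabs by (elim disjE) (simp_all add: y_def ac_def)
  next
    show "\<exists>l\<le>3. l \<notin> {1 - 1, 1, 1 + 1} \<and>
        act Z (3 - 1) (map (\<lambda>v. if v < l then v else v - 1) [1 - 1, 1, 1 + 1]) (y l) \<in> thin Z"
    proof (intro exI[of _ 3] conjI)
      have "act Z 2 [0,1,2] a = a" using act_id[OF inner_fib_simplicial[OF Z] a] by (simp add: numeral_2_eq_2)
      then show "act Z (3 - 1) (map (\<lambda>v. if v < 3 then v else v - 1) [1 - 1, 1, 1 + 1]) (y 3) \<in> thin Z"
        using c(1) by (simp add: y_def numeral_2_eq_2)
    qed auto
  qed (use a c in \<open>auto simp: y_def\<close>)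
  then obtain x where x: "x \<in> cells Z 3" "\<And>l. l \<le> 3 \<Longrightarrow> l \<noteq> 1 \<Longrightarrow> face Z 3 l x = y l" by blast
  show ?thesis
    using x(1) x(2)[of 0] x(2)[of 2] x(2)[of 3] unfolding ac_def delta_tabs by (intro bexI[of _ x]) (simp_all add: y_def)
qed

lemma fill_three_2:
  assumes Z: "inner_fib Z" and c: "a \<in> cells Z 2" "f \<in> cells Z 2" "d \<in> thin Z"
    and e: "act Z 2 [0,2] a = act Z 2 [0,1] f" "act Z 2 [1,2] a = act Z 2 [0,1] d" "act Z 2 [1,2] f = act Z 2 [1,2] d"
  shows "\<exists>\<rho>\<in>cells Z 3. act Z 3 [0,1,2] \<rho> = a \<and> act Z 3 [0,2,3] \<rho> = f \<and> act Z 3 [1,2,3] \<rho> = d"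
proof -
  have d: "d \<in> cells Z 2" using thin_cells[OF inner_fib_scaled[OF Z] c(3)] .
  define y where "y l = (if l = 0 then d else if l = (1::nat) then f else a)" for l
  have "\<exists>x\<in>cells Z 3. (\<forall>l\<le>3. l \<noteq> 2 \<longrightarrow> face Z 3 l x = y l) \<and> act Z 3 [2 - 1, 2, 2 + 1] x \<in> thin Z"
  proof (rule fill_faces[OF Z])
    fix k l :: nat assume kl: "k < l" "l \<le> 3" "k \<noteq> 2" "l \<noteq> 2"
    then have "(k = 0 \<and> l = 1) \<or> (k = 0 \<and> l = 3) \<or> (k = 1 \<and> l = 3)" by auto
    then show "face Z (3 - 1) k (y l) = face Z (3 - 1) (l - 1) (y k)"
      using e delta_tabs by (elim disjE) (simp_all add: y_def ac_def)
  next
    show "\<exists>l\<le>3. l \<notin> {2 - 1, 2, 2 + 1} \<and>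
        act Z (3 - 1) (map (\<lambda>v. if v < l then v else v - 1) [2 - 1, 2, 2 + 1]) (y l) \<in> thin Z"
    proof (intro exI[of _ 0] conjI)
      have "act Z 2 [0,1,2] d = d" using act_id[OF inner_fib_simplicial[OF Z] d] by (simp add: numeral_2_eq_2)
      then show "act Z (3 - 1) (map (\<lambda>v. if v < 0 then v else v - 1) [2 - 1, 2, 2 + 1]) (y 0) \<in> thin Z"
        using c(3) by (simp add: y_def numeral_2_eq_2)
    qed auto
  qed (use d c in \<open>auto simp: y_def\<close>)
  then obtain x where x: "x \<in> cells Z 3" "\<And>l. l \<le> 3 \<Longrightarrow> l \<noteq> 2 \<Longrightarrow> face Z 3 l x = y l" by blast
  show ?thesis
    using x(1) x(2)[of 0] x(2)[of 1] x(2)[of 3] unfolding ac_def delta_tabs by (intro bexI[of _ x]) (simp_all add: y_def)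
qed

text \<open>Triangle (0,1,2) is recovered as (0,1,4) in a 4-simplex whose vertex 4 is a second copy of vertex 2,
  reached from 3 by the inverse of the edge (2,3).\<close>

lemma outer_saturation:
  assumes Z: "inner_fib Z" and r: "\<rho> \<in> cells Z 3"
    and t: "act Z 3 [0,1,3] \<rho> \<in> thin Z" "act Z 3 [0,2,3] \<rho> \<in> thin Z" "act Z 3 [1,2,3] \<rho> \<in> thin Z"
    and \<tau>: "\<tau> \<in> thin Z" "act Z 2 [0,1] \<tau> = act Z 3 [2,3] \<rho>" "act Z 2 [0,2] \<tau> = act Z 3 [2,2] \<rho>"
  shows "act Z 3 [0,1,2] \<rho> \<in> thin Z"
proof -
  have Zs: "simplicial_set Z" and sc: "scaled_sset Z" using Z by (auto simp: inner_fib_def scaled_sset_def)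
  have tc: "\<tau> \<in> cells Z 2" by (rule thin_cells[OF sc \<tau>(1)])
  note simps = act_list[OF Zs r] act_list[OF Zs tc] list_in_mono_maps
  have c2: "act Z 3 \<theta> \<rho> \<in> cells Z 2" if "length \<theta> = 3" "sorted \<theta>" "set \<theta> \<subseteq> {..3}" for \<theta>
    by (rule act_cells[OF Zs _ r]) (use that in \<open>simp add: mono_maps_def\<close>)
  have "\<exists>\<kappa>\<in>cells Z 3. act Z 3 [0,1,2] \<kappa> = act Z 3 [0,2,3] \<rho> \<and> act Z 3 [0,1,3] \<kappa> = act Z 3 [0,2,2] \<rho> \<and> act Z 3 [1,2,3] \<kappa> = \<tau>"
    by (rule fill_three_1[OF Z t(2) c2 tc]) (use \<tau> in \<open>simp_all add: simps\<close>)
  then obtain \<kappa> where k: "\<kappa> \<in> cells Z 3" "act Z 3 [0,1,2] \<kappa> = act Z 3 [0,2,3] \<rho>"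
    "act Z 3 [0,1,3] \<kappa> = act Z 3 [0,2,2] \<rho>" "act Z 3 [1,2,3] \<kappa> = \<tau>" by blast
  have "\<exists>\<mu>\<in>cells Z 3. act Z 3 [0,1,2] \<mu> = act Z 3 [1,2,3] \<rho> \<and> act Z 3 [0,1,3] \<mu> = act Z 3 [1,2,2] \<rho> \<and> act Z 3 [1,2,3] \<mu> = \<tau>"
    by (rule fill_three_1[OF Z t(3) c2 tc]) (use \<tau> in \<open>simp_all add: simps\<close>)
  then obtain \<mu> where m: "\<mu> \<in> cells Z 3" "act Z 3 [0,1,2] \<mu> = act Z 3 [1,2,3] \<rho>"
    "act Z 3 [0,1,3] \<mu> = act Z 3 [1,2,2] \<rho>" "act Z 3 [1,2,3] \<mu> = \<tau>" by blast
  have dg: "act Z 3 [0,2,2] \<rho> \<in> thin Z" "act Z 3 [1,2,2] \<rho> \<in> thin Z"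
    by (rule degenerate_thin[OF sc r]; simp add: list_in_mono_maps)+
  have k023: "act Z 3 [0,2,3] \<kappa> \<in> thin Z" using inner_fib_sat[OF Z k(1)] k t \<tau> dg by simp
  have m023: "act Z 3 [0,2,3] \<mu> \<in> thin Z" using inner_fib_sat[OF Z m(1)] m t \<tau> dg by simp
  have \<nu>: "act Z 3 [0,1,2,2] \<rho> \<in> cells Z 3" by (rule act_cells[OF Zs _ r]) (simp add: list_in_mono_maps)
  define y where "y l = (if l = 0 then \<mu> else if l = (1::nat) then \<kappa> else if l = 3 then act Z 3 [0,1,2,2] \<rho> else \<rho>)" for l
  have "\<exists>x\<in>cells Z 4. (\<forall>l\<le>4. l \<noteq> 2 \<longrightarrow> face Z 4 l x = y l) \<and> act Z 4 [2 - 1, 2, 2 + 1] x \<in> thin Z"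
  proof (rule fill_faces[OF Z])
    fix k' l :: nat assume kl: "k' < l" "l \<le> 4" "k' \<noteq> 2" "l \<noteq> 2"
    then have "(k' = 0 \<and> l = 1) \<or> (k' = 0 \<and> l = 3) \<or> (k' = 0 \<and> l = 4) \<or> (k' = 1 \<and> l = 3) \<or> (k' = 1 \<and> l = 4) \<or> (k' = 3 \<and> l = 4)" by auto
    then show "face Z (4 - 1) k' (y l) = face Z (4 - 1) (l - 1) (y k')"
      using k m delta_tabs by (elim disjE) (simp_all add: y_def ac_def simps)
  next
    show "\<exists>l\<le>4. l \<notin> {2 - 1, 2, 2 + 1} \<and>
        act Z (4 - 1) (map (\<lambda>v. if v < l then v else v - 1) [2 - 1, 2, 2 + 1]) (y l) \<in> thin Z"
      using t(3) by (intro exI[of _ 4] conjI) (auto simp: y_def)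
  qed (use r k m \<nu> in \<open>auto simp: y_def\<close>)
  then obtain x where x: "x \<in> cells Z 4" "\<And>l. l \<le> 4 \<Longrightarrow> l \<noteq> 2 \<Longrightarrow> face Z 4 l x = y l" by blast
  have f: "act Z 4 [1,2,3,4] x = \<mu>" "act Z 4 [0,2,3,4] x = \<kappa>" "act Z 4 [0,1,2,4] x = act Z 3 [0,1,2,2] \<rho>" "act Z 4 [0,1,2,3] x = \<rho>"
    using x(2)[of 0] x(2)[of 1] x(2)[of 3] x(2)[of 4] unfolding ac_def delta_tabs by (simp_all add: y_def)
  note simpx = act_list[OF Zs x(1)] list_in_mono_maps
  \<comment> \<open>The triangles (0,1,3), (0,3,4) and (1,3,4) of \<open>x\<close> are thin, by
    hypothesis and through \<kappa> and \<mu>, hence so is (0,1,4). As the edge (2,4) is degenerate,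
    that is the original (0,1,2).\<close>
  define w where "w = act Z 4 [0,1,3,4] x"
  have w: "w \<in> cells Z 3" unfolding w_def by (rule act_cells[OF Zs _ x(1)]) (simp add: list_in_mono_maps)
  have "act Z 3 [0,1,3] (act Z 4 [0,1,2,3] x) \<in> thin Z" "act Z 3 [0,2,3] (act Z 4 [0,2,3,4] x) \<in> thin Z"
    "act Z 3 [0,2,3] (act Z 4 [1,2,3,4] x) \<in> thin Z" unfolding f by fact+
  then have "act Z 3 [0,1,2] w \<in> thin Z" "act Z 3 [0,2,3] w \<in> thin Z" "act Z 3 [1,2,3] w \<in> thin Z"
    unfolding w_def by (simp_all add: simpx)
  then have "act Z 3 [0,1,3] w \<in> thin Z" using inner_fib_sat[OF Z w] by blast
  moreover have "act Z 3 [0,1,3] w = act Z 3 [0,1,3] (act Z 4 [0,1,2,4] x)" unfolding w_def by (simp add: simpx)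
  moreover have "act Z 3 [0,1,3] (act Z 4 [0,1,2,4] x) = act Z 3 [0,1,2] \<rho>" unfolding f by (simp add: simps)
  ultimately show ?thesis by simp
qed

text \<open>The opposite of the saturation axiom for 4-simplices.  Two further copies 1 and 2 of the vertex 0 are inserted,
  with a new edge (1,6) composed of (1,5) and (5,6); the axiom applies to (0,1,2,3,6).\<close>

lemma opposite_four_simplex:
  assumes C: "inf_bicategory C" and x: "x \<in> cells C 4"
    and t: "act C 4 [0,2,4] x \<in> thin C" "act C 4 [1,3,4] x \<in> thin C" "act C 4 [2,3,4] x \<in> thin C"
      "act C 4 [0,1,3] x \<in> thin C" "act C 4 [1,2,4] x \<in> thin C"
  shows "act C 4 [0,3,4] x \<in> thin C"
proof -
  have Z: "inner_fib C" by (rule inf_bicategory_inner_fib[OF C])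
  have Zs: "simplicial_set C" and sc: "scaled_sset C" using Z by (auto simp: inner_fib_def scaled_sset_def)
  \<comment> \<open>Vertices 0, 1, 2 are copies of 0, and 3 to 6 stand for 1 to 4. Simplices without
    the edge (1,6) take their value from \<open>x\<close> along \<open>r\<close>; those containing
    it are new.\<close>
  define r where "r = [0,0,0,1,2,3,4::nat]"
  have r: "r \<in> mono_maps 6 4" by (simp add: r_def mono_maps_def)
  let ?K = "\<lambda>s::nat list. \<not> {1,6} \<subseteq> set s"
  define R0 where "R0 = {(m, s, act C 4 (map ((!) r) s) x) | m s. s \<in> mono_maps m 6 \<and> ?K s}"
  define S where "S = {s. s \<in> mono_maps 2 6 \<and> ?K s \<and> act C 4 (map ((!) r) s) x \<in> thin C} \<union> {[1,5,6]}"
  \<comment> \<open>Each cell is attached along the horn at its last vertex but one: 5 in the first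
    eight cells, 4 in the remaining four. The latter come later, since faces of theirs such as
    (1,4,6) arise from the first group. The aim is the 5-simplex at the end of each group.\<close>
  define M :: "(nat \<times> nat list) set" where "M = {(2,[1,5,6]), (3,[1,4,5,6]), (3,[1,3,5,6]), (4,[1,3,4,5,6]), (3,[0,1,5,6]), (4,[0,1,4,5,6]),
    (4,[0,1,3,5,6]), (5,[0,1,3,4,5,6]), (3,[1,2,4,6]), (4,[1,2,3,4,6]), (4,[0,1,2,4,6]), (5,[0,1,2,3,4,6])}"
  let ?W = "simplex 6"
  have pd: "(m, s) \<in> pdom R0 \<longleftrightarrow> s \<in> mono_maps m 6 \<and> ?K s" for m s by (auto simp: pdom_def R0_def)
  have R0: "pmap ?W C S R0"
    unfolding pmap_def
  proof (intro conjI allI impI)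
    fix k s y assume "(k, s, y) \<in> R0"
    then show "s \<in> cells ?W k" "y \<in> cells C k"
      using act_cells[OF Zs mono_maps_comp[OF _ r] x] by (auto simp: R0_def)
  next
    fix m k \<theta> s y assume th: "\<theta> \<in> mono_maps m k" and "(k, s, y) \<in> R0"
    then have s: "s \<in> mono_maps k 6" "?K s" "y = act C 4 (map ((!) r) s) x" by (auto simp: R0_def)
    have "act C k \<theta> y = act C 4 (map ((!) (map ((!) r) s)) \<theta>) x"
      unfolding s(3) by (rule act_act[OF Zs th mono_maps_comp[OF s(1) r] x])
    also have "map ((!) (map ((!) r) s)) \<theta> = map ((!) r) (map ((!) s) \<theta>)"
      using th length_mono_maps[OF s(1)] by (auto simp: mono_maps_def)
    finally show "(m, act ?W k \<theta> s, act C k \<theta> y) \<in> R0"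
      using mono_maps_comp[OF th s(1)] set_map_nth[OF th s(1)] s(2) unfolding R0_def by auto
  qed (auto simp: R0_def S_def)
  have f3: "tab (Suc 0) f = [f 0, f 1]" "tab 2 f = [f 0, f 1, f 2]" "tab 3 f = [f 0, f 1, f 2, f 3]" "tab 4 f = [f 0, f 1, f 2, f 3, f 4]" for f
    by (simp_all add: tab_def eval_nat_numeral)
  have Mfacts: "c \<in> mono_maps n 6 \<and> distinct c \<and> 2 \<le> n \<and> n \<le> 5 \<and>
      face ?W n (n - 1) c \<in> mono_maps (n - 1) 6 \<and> distinct (face ?W n (n - 1) c) \<and>
      \<not> ?K (face ?W n (n - 1) c) \<and> (n - 1, face ?W n (n - 1) c) \<notin> M \<and>
      c = butlast (face ?W n (n - 1) c) @ [if 2 \<in> set (face ?W n (n - 1) c) then 4 else 5, 6]"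
    if "(n, c) \<in> M" for n c
    using that unfolding M_def
    by (elim insertE emptyE) (simp_all add: ac_simplex f3 delta_def mono_maps_def)
  define rho where "rho n c = n + (if 2 \<in> set c then 10 else 0)" for n :: nat and c :: "nat list"
  have "\<exists>R. R0 \<subseteq> R \<and> pmap ?W C S R \<and> M \<subseteq> pdom R"
  proof (rule extend_pmap[OF Z simplicial_simplex R0, where j = "\<lambda>n c. n - 1" and \<rho> = rho])
    fix n c assume m: "(n, c) \<in> M"
    note F = Mfacts[OF m]
    show "c \<in> cells ?W n \<and> \<not> degenerate ?W n c \<and> 2 \<le> n \<and> 0 < n - 1 \<and> n - 1 < n"
      using F degenerate_simplex[of c n 6] by auto
    show "\<not> degenerate ?W (n - 1) (face ?W n (n - 1) c) \<and> (n - 1, face ?W n (n - 1) c) \<notin> pdom R0 \<and>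
        (n - 1, face ?W n (n - 1) c) \<notin> M"
      using F degenerate_simplex[of "face ?W n (n - 1) c" "n - 1" 6] unfolding pd by blast
    show "act ?W n [n - 1 - 1, n - 1, n - 1 + 1] c \<in> S"
      using m t unfolding M_def S_def r_def by (elim insertE emptyE) (simp_all add: mono_maps_def)
    fix l assume "l \<le> n" "l \<noteq> n - 1"
    moreover have "l = 0 \<or> l = 1 \<or> l = 2 \<or> l = 3 \<or> l = 4 \<or> l = 5" using \<open>l \<le> n\<close> F by linarith
    ultimately have "(n - 1, face ?W n l c) \<in> pdom R0 \<or> (n - 1, face ?W n l c) \<in> M \<and> rho (n - 1) (face ?W n l c) < rho n c \<or>
        (let d = butlast (face ?W n l c) @ [5,6] in (n, d) \<in> M \<and> rho n d < rho n c \<and> face ?W n l c = face ?W n (n - 1) d)"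
      using m unfolding M_def
      by (elim insertE emptyE disjE) (simp_all add: ac_simplex f3 delta_def mono_maps_def pd rho_def Let_def)
    moreover have "face ?W n l c = act ?W (n - 1) [0..<Suc (n - 1)] (face ?W n l c)"
      by (rule act_id[symmetric, OF simplicial_simplex]) (rule ac_cells[OF simplicial_simplex delta_mono'], use F in auto)
    moreover have "tab (n - 1) (delta (n - 1)) \<in> mono_maps (n - 1) n" using delta_mono'[of n "n - 1"] F by (simp add: tab_in_iff)
    ultimately show "\<exists>k y \<theta>. \<theta> \<in> mono_maps (n - 1) k \<and> face ?W n l c = act ?W k \<theta> y \<and>
        ((k, y) \<in> pdom R0 \<or> (k, y) \<in> M \<and> rho k y < rho n c)"
      unfolding Let_def by (metis ac_def id_mono_maps)
  next
    fix n c c' assume m: "(n, c) \<in> M" "(n, c') \<in> M" and e: "face ?W n (n - 1) c = face ?W n (n - 1) c'"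
    show "c = c'" using Mfacts[OF m(1)] Mfacts[OF m(2)] unfolding e by metis
  next
    fix c l assume m: "(3, c) \<in> M" and "face ?W 3 (3 - 1) c \<in> S"
    moreover have "face ?W 3 (3 - 1) c \<notin> S"
      using m unfolding M_def S_def by (elim insertE emptyE) (simp_all add: ac_simplex f3 delta_def)
    ultimately show "face ?W 3 l c \<in> S" by simp
  qed
  then obtain R where R: "R0 \<subseteq> R" "pmap ?W C S R" "M \<subseteq> pdom R" by blast
  note RD = pmapD[OF R(2)]
  have "(5, [0,1,2,3,4,6]) \<in> M" "(5, [0,1,3,4,5,6]) \<in> M" by (simp_all add: M_def)
  then obtain u v where u: "(5, [0,1,2,3,4,6], u) \<in> R" and v: "(5, [0,1,3,4,5,6], v) \<in> R"
    using R(3) unfolding pdom_def by blast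
  have uc: "u \<in> cells C 5" and vc: "v \<in> cells C 5" using RD(2) u v by auto
  have uR: "(2, map ((!) [0,1,2,3,4,6]) \<theta>, act C 5 \<theta> u) \<in> R" and vR: "(2, map ((!) [0,1,3,4,5,6]) \<theta>, act C 5 \<theta> v) \<in> R"
    if "\<theta> \<in> mono_maps 2 5" for \<theta> using RD(4)[OF that u] RD(4)[OF that v] by simp_all
  have tu: "act C 5 \<theta> u \<in> thin C" if "map ((!) [0,1,2,3,4,6]) \<theta> \<in> S" "\<theta> \<in> mono_maps 2 5" for \<theta>
    by (rule RD(5)[OF uR[OF that(2)] that(1)])
  have tv: "act C 5 \<theta> v \<in> thin C" if "map ((!) [0,1,3,4,5,6]) \<theta> \<in> S" "\<theta> \<in> mono_maps 2 5" for \<theta>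
    by (rule RD(5)[OF vR[OF that(2)] that(1)])
  have old: "s \<in> S" if "s \<in> mono_maps 2 6" "?K s" "act C 4 (map ((!) r) s) x \<in> thin C" for s using that by (simp add: S_def)
  have dg: "act C 4 \<theta> x \<in> thin C" if "\<theta> \<in> mono_maps 2 4" "\<not> distinct \<theta>" for \<theta> by (rule degenerate_thin[OF sc x that])
  note simpu = act_list[OF Zs uc] act_list[OF Zs vc] list_in_mono_maps
  \<comment> \<open>Vertices 1, 3, 5, 6: as (1,3,5), (3,5,6) and (1,5,6) are thin, so is
    (1,3,6).\<close>
  have w1: "act C 5 [1,2,4,5] v \<in> cells C 3" by (rule act_cells[OF Zs _ vc]) (simp add: list_in_mono_maps)
  have a: "act C 5 [1,2,4] v \<in> thin C" "act C 5 [2,4,5] v \<in> thin C"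
    by (rule tv[OF old]; use t in \<open>simp add: r_def list_in_mono_maps\<close>)+
  have b: "act C 5 [1,4,5] v \<in> thin C" by (rule tv) (simp_all add: S_def list_in_mono_maps)
  have "act C 5 [1,2,5] v \<in> thin C" using inner_fib_sat[OF Z w1] a b by (simp add: simpu)
  moreover have "(2, [1,3,6], act C 5 [1,2,5] v) \<in> R" "(2, [1,3,6], act C 5 [1,3,5] u) \<in> R"
    using uR[of "[1,3,5]"] vR[of "[1,2,5]"] by (simp_all add: list_in_mono_maps)
  ultimately have u136: "act C 5 [1,3,5] u \<in> thin C" using RD(3) by metis
  \<comment> \<open>Vertices 0, 1, 2, 3, 6: all hypotheses of the axiom are degenerate except
    (1,3,6), and its conclusion gives (0,1,6).\<close>
  have w2: "act C 5 [0,1,2,3,5] u \<in> cells C 4" by (rule act_cells[OF Zs _ uc]) (simp add: list_in_mono_maps)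
  have d: "act C 5 [0,2,5] u \<in> thin C" "act C 5 [1,2,3] u \<in> thin C" "act C 5 [0,1,3] u \<in> thin C" "act C 5 [0,1,2] u \<in> thin C"
    by (rule tu[OF old]; use dg in \<open>simp add: r_def list_in_mono_maps\<close>)+
  have "act C 5 [0,1,5] u \<in> thin C"
    using inf_bicategory_four_simplex(2)[OF C w2] d u136 by (simp add: simpu)
  moreover have "(2, [0,1,6], act C 5 [0,1,5] v) \<in> R" "(2, [0,1,6], act C 5 [0,1,5] u) \<in> R"
    using uR[of "[0,1,5]"] vR[of "[0,1,5]"] by (simp_all add: list_in_mono_maps)
  ultimately have v016: "act C 5 [0,1,5] v \<in> thin C" using RD(3) by metis
  \<comment> \<open>Vertices 0, 1, 5, 6: thinness passes from (0,1,6) to (0,5,6), whose value is the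
    triangle (0,3,4) of \<open>x\<close>.\<close>
  have w3: "act C 5 [0,1,4,5] v \<in> cells C 3" by (rule act_cells[OF Zs _ vc]) (simp add: list_in_mono_maps)
  have e: "act C 5 [0,1,4] v \<in> thin C" by (rule tv[OF old]; use dg in \<open>simp add: r_def list_in_mono_maps\<close>)
  have "act C 5 [0,4,5] v \<in> thin C" using inner_fib_sat[OF Z w3] b e v016 by (simp add: simpu)
  moreover have "(2, [0,5,6], act C 5 [0,4,5] v) \<in> R" using vR[of "[0,4,5]"] by (simp add: list_in_mono_maps)
  moreover have "(2, [0,5,6], act C 4 (map ((!) r) [0,5,6]) x) \<in> R0"
    unfolding R0_def by (intro CollectI exI[of _ 2] exI[of _ "[0,5,6]"]) (simp add: mono_maps_def)
  then have "(2, [0,5,6], act C 4 [0,3,4] x) \<in> R" using R(1) by (auto simp: r_def)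
  ultimately show ?thesis using RD(3) by metis
qed

section \<open>Invertible edges\<close>

definition tri :: "('a, 'z) sset_scheme \<Rightarrow> 'a \<Rightarrow> 'a \<Rightarrow> 'a \<Rightarrow> bool" where
  "tri Q a b c \<longleftrightarrow> (\<exists>\<sigma>\<in>cells Q 2. act Q 2 [0,1] \<sigma> = a \<and> act Q 2 [1,2] \<sigma> = b \<and> act Q 2 [0,2] \<sigma> = c)"

text \<open>Associativity of a composition that is a relation, because composites are determined
  only up to homotopy. The letters a, b, c, d, e, f are the edges 01, 12, 02, 23, 13, 03 of a
  3-simplex.\<close>

definition assoc_tri :: "('a, 'z) sset_scheme \<Rightarrow> bool" where
  "assoc_tri Q \<longleftrightarrow> (\<forall>a b c d e f. tri Q a b c \<longrightarrow> tri Q b d e \<longrightarrow> (tri Q a e f \<longleftrightarrow> tri Q c d f))"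

lemma assoc_triD: "assoc_tri Q \<Longrightarrow> tri Q a b c \<Longrightarrow> tri Q b d e \<Longrightarrow> tri Q a e f \<longleftrightarrow> tri Q c d f"
  unfolding assoc_tri_def by blast

section \<open>Constant simplices and the composition relation\<close>

lemma const_cell_cells: "simplicial_set X \<Longrightarrow> x \<in> cells X 0 \<Longrightarrow> const_cell X n x \<in> cells X n"
  unfolding const_cell_def by (rule act_cells[OF _ replicate_mono_maps]) auto

lemma const_cell_act:
  assumes "simplicial_set X" "x \<in> cells X 0" "\<theta> \<in> mono_maps m n"
  shows "act X n \<theta> (const_cell X n x) = const_cell X m x"
proof -
  have "map ((!) (replicate (Suc n) 0)) \<theta> = replicate (Suc m) (0::nat)"
    using assms(3) length_mono_maps[OF assms(3)]
    by (intro nth_equalityI) (auto simp: mono_maps_def subset_iff less_Suc_eq_le simp del: replicate_Suc)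
  then show ?thesis unfolding const_cell_def
    using act_act[OF assms(1,3) replicate_mono_maps[of 0 0 n] assms(2)] by (simp del: replicate_Suc)
qed

lemma const_cell_smaps: "f \<in> smaps X Y \<Longrightarrow> x \<in> cells X 0 \<Longrightarrow> f n (const_cell X n x) = const_cell Y n (f 0 x)"
  unfolding const_cell_def by (rule smaps_act) (simp_all add: replicate_mono_maps del: replicate_Suc)

lemma const_cell_0: "simplicial_set X \<Longrightarrow> x \<in> cells X 0 \<Longrightarrow> const_cell X 0 x = x"
  using act_id[of X x 0] by (simp add: const_cell_def)

lemma edge_ends:
  assumes X: "simplicial_set X" and f: "f \<in> cells X 1"
  shows "src X f \<in> cells X 0" "tgt X f \<in> cells X 0"
    "const_cell X n (src X f) = act X 1 (replicate (Suc n) 0) f" "const_cell X n (tgt X f) = act X 1 (replicate (Suc n) 1) f"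
proof -
  have m: "[v] \<in> mono_maps 0 1" if "v \<le> 1" for v using that by (simp add: mono_maps_def)
  show "src X f \<in> cells X 0" "tgt X f \<in> cells X 0"
    unfolding src_def tgt_def by (rule act_cells[OF X m f]; simp)+
  have "act X 0 (replicate (Suc n) 0) (act X 1 [v] f) = act X 1 (replicate (Suc n) v) f" if "v \<le> 1" for v
    using act_act[OF X replicate_mono_maps[of 0 0 n] m[OF that] f] by simp
  then show "const_cell X n (src X f) = act X 1 (replicate (Suc n) 0) f" "const_cell X n (tgt X f) = act X 1 (replicate (Suc n) 1) f"
    unfolding const_cell_def src_def tgt_def by simp_all
qed

lemma tri_ends:
  assumes X: "simplicial_set X" and t: "tri X a b c"
  shows "a \<in> cells X 1" "b \<in> cells X 1" "c \<in> cells X 1" "src X c = src X a" "src X b = tgt X a" "tgt X c = tgt X b"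
proof -
  obtain \<sigma> where s: "\<sigma> \<in> cells X 2" "act X 2 [0,1] \<sigma> = a" "act X 2 [1,2] \<sigma> = b" "act X 2 [0,2] \<sigma> = c"
    using t by (auto simp: tri_def)
  have m: "[0,1] \<in> mono_maps 1 2" "[1,2] \<in> mono_maps 1 2" "[0,2] \<in> mono_maps 1 2" by (simp_all add: mono_maps_def)
  show "a \<in> cells X 1" "b \<in> cells X 1" "c \<in> cells X 1"
    using act_cells[OF X m(1) s(1)] act_cells[OF X m(2) s(1)] act_cells[OF X m(3) s(1)] s by auto
  show "src X c = src X a" "src X b = tgt X a" "tgt X c = tgt X b"
    unfolding src_def tgt_def s(2-4)[symmetric] by (simp_all add: act_list[OF X s(1)] list_in_mono_maps)
qed

lemma tri_left: "simplicial_set X \<Longrightarrow> f \<in> cells X 1 \<Longrightarrow> tri X (const_cell X 1 (src X f)) f f"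
  unfolding tri_def using act_id[of X f 1] edge_ends(3)[of X f 1] act_cells[of X "[0,0,1]" 2 1 f]
  by (intro bexI[of _ "act X 1 [0,0,1] f"]) (simp_all add: act_list list_in_mono_maps)

lemma tri_right: "simplicial_set X \<Longrightarrow> f \<in> cells X 1 \<Longrightarrow> tri X f (const_cell X 1 (tgt X f)) f"
  unfolding tri_def using act_id[of X f 1] edge_ends(4)[of X f 1] act_cells[of X "[0,1,1]" 2 1 f]
  by (intro bexI[of _ "act X 1 [0,1,1] f"]) (simp_all add: act_list list_in_mono_maps)

lemma src_const: "simplicial_set X \<Longrightarrow> x \<in> cells X 0 \<Longrightarrow> src X (const_cell X 1 x) = x \<and> tgt X (const_cell X 1 x) = x"
  unfolding src_def tgt_def using const_cell_act[of X x "[0]" 0 1] const_cell_act[of X x "[1]" 0 1] const_cell_0[of X x]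
  by (simp add: mono_maps_def)

lemma edge_homotopic_tri: "edge_homotopic Q f g \<longleftrightarrow> tri Q f (const_cell Q 1 (tgt Q f)) g"
  by (auto simp: edge_homotopic_def tri_def)

lemma ho_comp_tri: "ho_comp Q P R = {c. \<exists>a\<in>P. \<exists>b\<in>R. tri Q a b c}"
  by (auto simp: ho_comp_def tri_def)

text \<open>The class of the identity is its own inverse; that a composite of two of its members
  stays in the class takes two uses of associativity.\<close>

lemma identity_ho_iso:
  assumes Q: "simplicial_set Q" "assoc_tri Q" and x: "x \<in> cells Q 0"
  shows "ho_iso Q (const_cell Q 1 x)"
proof -
  let ?e = "const_cell Q 1 x"
  have e: "?e \<in> cells Q 1" "src Q ?e = x" "tgt Q ?e = x"
    using const_cell_cells[OF Q(1) x] src_const[OF Q(1) x] by auto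
  have cl: "ho_class Q ?e = {g. tri Q ?e ?e g}" unfolding ho_class_def edge_homotopic_tri e ..
  have ee: "tri Q ?e ?e ?e" using tri_left[OF Q(1) e(1)] e by simp
  have "ho_comp Q (ho_class Q ?e) (ho_class Q ?e) = ho_class Q ?e"
  proof (intro set_eqI iffI)
    fix k assume "k \<in> ho_comp Q (ho_class Q ?e) (ho_class Q ?e)"
    then obtain g h where g: "tri Q ?e ?e g" and h: "tri Q ?e ?e h" and k: "tri Q g h k"
      unfolding ho_comp_tri cl by blast
    have "tri Q ?e h h" using tri_left[OF Q(1)] tri_ends[OF Q(1) h] e by metis
    then have "tri Q ?e h k" using assoc_triD[OF Q(2) g _] k by blast
    then have "tri Q ?e ?e k" using assoc_triD[OF Q(2) ee h] by blast
    then show "k \<in> ho_class Q ?e" unfolding cl by blast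
  next
    fix k assume "k \<in> ho_class Q ?e"
    then show "k \<in> ho_comp Q (ho_class Q ?e) (ho_class Q ?e)" using ee unfolding ho_comp_tri cl by blast
  qed
  then show ?thesis
    unfolding ho_iso_def ho_id_def e(2,3) using e
    by (intro conjI bexI[of _ "ho_class Q ?e"]) (auto simp: ho_hom_def)
qed

text \<open>Data witnessing that the class of \<open>e\<close> has an inverse; unlike \<open>ho_iso\<close> they are preserved by all maps.\<close>

definition weak_inv :: "('a, 'z) sset_scheme \<Rightarrow> 'a \<Rightarrow> bool" where
  "weak_inv Q e \<longleftrightarrow> (\<exists>x\<in>cells Q 0. \<exists>y\<in>cells Q 0. \<exists>g e1 g1 g2 e2. src Q e = x \<and> tgt Q e = y \<and> src Q g = y \<and> tgt Q g = x \<and>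
     tri Q e (const_cell Q 1 y) e1 \<and> tri Q g (const_cell Q 1 x) g1 \<and> tri Q e1 g1 (const_cell Q 1 x) \<and>
     tri Q g (const_cell Q 1 x) g2 \<and> tri Q e (const_cell Q 1 y) e2 \<and> tri Q g2 e2 (const_cell Q 1 y))"

definition two_inv :: "('a, 'z) sset_scheme \<Rightarrow> 'a \<Rightarrow> bool" where
  "two_inv Q e \<longleftrightarrow> (\<exists>g. tri Q e g (const_cell Q 1 (src Q e)) \<and> tri Q g e (const_cell Q 1 (tgt Q e)))"

lemma ho_iso_weak_inv:
  assumes Q: "simplicial_set Q" and e: "ho_iso Q e"
  shows "weak_inv Q e"
proof -
  have ec: "e \<in> cells Q 1" using e by (simp add: ho_iso_def)
  define x y where "x = src Q e" "y = tgt Q e"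
  have xy: "x \<in> cells Q 0" "y \<in> cells Q 0" using edge_ends[OF Q ec] by (auto simp: x_y_def)
  obtain P where P: "P \<in> ho_hom Q y x" "ho_comp Q (ho_class Q e) P = ho_id Q x" "ho_comp Q P (ho_class Q e) = ho_id Q y"
    using e by (auto simp: ho_iso_def x_y_def)
  then obtain g where g: "P = ho_class Q g" "g \<in> cells Q 1" "src Q g = y" "tgt Q g = x" by (auto simp: ho_hom_def)
  have "const_cell Q 1 v \<in> ho_id Q v" if "v \<in> cells Q 0" for v
    using tri_left[OF Q const_cell_cells[OF Q that]] src_const[OF Q that]
    by (simp add: ho_id_def ho_class_def edge_homotopic_tri)
  then have "const_cell Q 1 x \<in> ho_comp Q (ho_class Q e) P" "const_cell Q 1 y \<in> ho_comp Q P (ho_class Q e)"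
    using P xy by auto
  then obtain e1 g1 g2 e2 where t: "tri Q e (const_cell Q 1 y) e1" "tri Q g (const_cell Q 1 x) g1" "tri Q e1 g1 (const_cell Q 1 x)"
      "tri Q g (const_cell Q 1 x) g2" "tri Q e (const_cell Q 1 y) e2" "tri Q g2 e2 (const_cell Q 1 y)"
    unfolding ho_comp_tri ho_class_def g(1) edge_homotopic_tri g(4) x_y_def(2)[symmetric] by blast
  show ?thesis
    unfolding weak_inv_def
    by (rule bexI[OF _ xy(1)], rule bexI[OF _ xy(2)], rule exI[of _ g], rule exI[of _ e1],
        rule exI[of _ g1], rule exI[of _ g2], rule exI[of _ e2])
      (intro conjI t g(3,4) x_y_def[symmetric])
qed

text \<open>Each auxiliary edge differs from \<open>e\<close> or \<open>g\<close> by an identity,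
  and associativity lets identities be moved and cancelled; \<open>g1\<close> ends up as a two-sided
  inverse of \<open>e\<close>.\<close>

lemma weak_inv_two_inv:
  assumes Q: "simplicial_set Q" "assoc_tri Q" and e: "weak_inv Q e"
  shows "two_inv Q e"
proof -
  obtain x y g e1 g1 g2 e2 where xy: "x \<in> cells Q 0" "y \<in> cells Q 0" "src Q e = x" "tgt Q e = y" "src Q g = y" "tgt Q g = x"
    and t: "tri Q e (const_cell Q 1 y) e1" "tri Q g (const_cell Q 1 x) g1" "tri Q e1 g1 (const_cell Q 1 x)"
      "tri Q g (const_cell Q 1 x) g2" "tri Q e (const_cell Q 1 y) e2" "tri Q g2 e2 (const_cell Q 1 y)"
    using e unfolding weak_inv_def by blast
  note E = tri_ends[OF Q(1)]
  note A = assoc_triD[OF Q(2)]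
  have L: "tri Q (const_cell Q 1 v) f f" if "f \<in> cells Q 1" "src Q f = v" for f v using tri_left[OF Q(1) that(1)] that by simp
  have R: "tri Q f (const_cell Q 1 v) f" if "f \<in> cells Q 1" "tgt Q f = v" for f v using tri_right[OF Q(1) that(1)] that by simp
  have sc: "src Q (const_cell Q 1 v) = v" "tgt Q (const_cell Q 1 v) = v" if "v \<in> cells Q 0" for v
    using src_const[OF Q(1) that] by auto
  have g1: "g1 \<in> cells Q 1" "src Q g1 = y" "tgt Q g1 = x" using E[OF t(2)] xy sc by auto
  have e2: "e2 \<in> cells Q 1" "src Q e2 = x" "tgt Q e2 = y" using E[OF t(5)] xy sc by auto
  have ec: "e \<in> cells Q 1" using E[OF t(1)] by simp
  have 1: "tri Q e g1 (const_cell Q 1 x)" using A[OF t(1) L[OF g1(1,2)]] t(3) by blast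
  have 2: "tri Q g e2 (const_cell Q 1 y)" using A[OF t(4) L[OF e2(1,2)]] t(6) by blast
  have 3: "tri Q g1 e2 (const_cell Q 1 y)" using A[OF t(2) L[OF e2(1,2)]] 2 by blast
  have 4: "tri Q (const_cell Q 1 x) e e2" using A[OF L[OF ec xy(3)] R[OF ec xy(4)]] t(5) by blast
  have "tri Q g1 e (const_cell Q 1 y)" using A[OF R[OF g1(1,3)] 4] 3 by blast
  with 1 show ?thesis unfolding two_inv_def xy by blast
qed

lemma tri_smaps: "f \<in> smaps X Y \<Longrightarrow> tri X a b c \<Longrightarrow> tri Y (f 1 a) (f 1 b) (f 1 c)"
proof -
  assume f: "f \<in> smaps X Y" and "tri X a b c"
  then obtain \<sigma> where s: "\<sigma> \<in> cells X 2" "act X 2 [0,1] \<sigma> = a" "act X 2 [1,2] \<sigma> = b" "act X 2 [0,2] \<sigma> = c"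
    by (auto simp: tri_def)
  have m: "[0,1] \<in> mono_maps 1 2" "[1,2] \<in> mono_maps 1 2" "[0,2] \<in> mono_maps 1 2" by (simp_all add: mono_maps_def)
  show ?thesis
    unfolding tri_def s(2-4)[symmetric] using smaps_act[OF f s(1)] smaps_cells[OF f s(1)] m
    by (intro bexI[of _ "f 2 \<sigma>"]) simp_all
qed

lemma src_smaps: "f \<in> smaps X Y \<Longrightarrow> e \<in> cells X 1 \<Longrightarrow> src Y (f 1 e) = f 0 (src X e) \<and> tgt Y (f 1 e) = f 0 (tgt X e)"
  unfolding src_def tgt_def using smaps_act[of f X Y e 1 "[0]" 0] smaps_act[of f X Y e 1 "[1]" 0]
  by (simp add: mono_maps_def)

lemma weak_inv_smaps:
  assumes X: "simplicial_set X" and f: "f \<in> smaps X Y" and e: "weak_inv X e"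
  shows "weak_inv Y (f 1 e)"
proof -
  obtain x y g e1 g1 g2 e2 where xy: "x \<in> cells X 0" "y \<in> cells X 0" "src X e = x" "tgt X e = y" "src X g = y" "tgt X g = x"
    and t: "tri X e (const_cell X 1 y) e1" "tri X g (const_cell X 1 x) g1" "tri X e1 g1 (const_cell X 1 x)"
      "tri X g (const_cell X 1 x) g2" "tri X e (const_cell X 1 y) e2" "tri X g2 e2 (const_cell X 1 y)"
    using e unfolding weak_inv_def by blast
  have ec: "e \<in> cells X 1" "g \<in> cells X 1" using tri_ends[OF X t(1)] tri_ends[OF X t(2)] by auto
  have c: "const_cell Y 1 (f 0 v) = f 1 (const_cell X 1 v)" if "v \<in> cells X 0" for v
    using const_cell_smaps[OF f that] by simp
  show ?thesis
    unfolding weak_inv_def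
    by (rule bexI[OF _ smaps_cells[OF f xy(1)]], rule bexI[OF _ smaps_cells[OF f xy(2)]], rule exI[of _ "f 1 g"], rule exI[of _ "f 1 e1"],
        rule exI[of _ "f 1 g1"], rule exI[of _ "f 1 g2"], rule exI[of _ "f 1 e2"])
      (unfold c[OF xy(1)] c[OF xy(2)], intro conjI tri_smaps[OF f] t smaps_cells[OF f] xy(1,2),
        use xy ec src_smaps[OF f] in simp_all)
qed

lemma distinct_mono_maps_id:
  assumes "\<theta> \<in> mono_maps n n" "distinct \<theta>"
  shows "\<theta> = [0..<Suc n]"
proof (rule mono_maps_eqI[OF assms(1) id_mono_maps])
  fix q assume q: "q \<le> n"
  have "inj_on ((!) \<theta>) {..n}"
    using assms(2) length_mono_maps[OF assms(1)] by (auto simp: inj_on_def nth_eq_iff_index_eq less_Suc_eq_le)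
  then show "\<theta> ! q = [0..<Suc n] ! q"
    using inj_mono_id[OF mono_maps_nth[OF assms(1)] _ q] q by (simp add: nth_upt less_Suc_eq_le del: upt_Suc)
qed

text \<open>Below dimension 2 all triangles of a simplex are degenerate, and in dimension 2 only the
  identity operator gives a possibly nondegenerate one.\<close>

lemma thin_core_cells:
  assumes Z: "scaled_sset Z"
  shows "cells (thin_core Z) 2 = thin Z" "cells (thin_core Z) 1 = cells Z 1" "cells (thin_core Z) 0 = cells Z 0"
proof -
  have Zs: "simplicial_set Z" using Z by (simp add: scaled_sset_def)
  have small: "\<not> distinct \<theta>" if "\<theta> \<in> mono_maps 2 n" "n < 2" for \<theta> n
  proof
    assume "distinct \<theta>"
    then have "card (set \<theta>) = Suc 2" using length_mono_maps[OF that(1)] distinct_card by metis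
    moreover have "set \<theta> \<subseteq> {..n}" using that(1) by (simp add: mono_maps_def)
    then have "card (set \<theta>) \<le> card {..n}" by (rule card_mono[OF finite_atMost])
    ultimately show False using that(2) by simp
  qed
  have "act Z n \<theta> x \<in> thin Z" if "x \<in> cells Z n" "\<theta> \<in> mono_maps 2 n" "n < 2" for n x \<theta>
    by (rule degenerate_thin[OF Z that(1,2) small[OF that(2,3)]])
  then have "cells (thin_core Z) n = cells Z n" if "n < 2" for n using that unfolding thin_core_def sset.simps by blast
  then show "cells (thin_core Z) 1 = cells Z 1" "cells (thin_core Z) 0 = cells Z 0" by simp_all
  have "act Z 2 \<theta> x \<in> thin Z" if "\<theta> \<in> mono_maps 2 2" "x \<in> thin Z" for \<theta> x
  proof (cases "distinct \<theta>")
    case True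
    have "\<theta> = [0..<Suc 2]" by (rule distinct_mono_maps_id[OF that(1) True])
    then show ?thesis using act_id[OF Zs thin_cells[OF Z that(2)]] that by metis
  next
    case False
    then show ?thesis using degenerate_thin[OF Z thin_cells[OF Z that(2)] that(1)] by simp
  qed
  then have "x \<in> cells (thin_core Z) 2" if "x \<in> thin Z" for x
    using that thin_cells[OF Z that] unfolding thin_core_def sset.simps by blast
  moreover have "x \<in> thin Z" if "x \<in> cells (thin_core Z) 2" for x
  proof -
    have x: "x \<in> cells Z 2" "\<And>\<theta>. \<theta> \<in> mono_maps 2 2 \<Longrightarrow> act Z 2 \<theta> x \<in> thin Z"
      using that unfolding thin_core_def sset.simps by blast+
    then show ?thesis using act_id[OF Zs x(1)] x(2)[OF id_mono_maps] by metis
  qed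
  ultimately show "cells (thin_core Z) 2 = thin Z" by blast
qed

lemma thin_core_act [simp]: "act (thin_core Z) = act Z"
  by (simp add: thin_core_def)

lemma const_cell_thin_core: "const_cell (thin_core Z) = const_cell Z"
  by (simp add: const_cell_def fun_eq_iff)

lemma src_thin_core: "src (thin_core Z) = src Z" "tgt (thin_core Z) = tgt Z"
  by (simp_all add: src_def tgt_def fun_eq_iff)

lemma thin_core_simplicial: "scaled_sset Z \<Longrightarrow> simplicial_set (thin_core Z)"
proof (rule simplicial_subset[of Z])
  fix m n \<theta> x assume Z: "scaled_sset Z" and "\<theta> \<in> mono_maps m n" "x \<in> cells (thin_core Z) n"
  then show "act Z n \<theta> x \<in> cells (thin_core Z) m"
    using act_act[of Z _ 2 m \<theta> n x] mono_maps_comp[of _ 2 m \<theta> n] act_cells[of Z \<theta> m n x]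
    by (auto simp: thin_core_def scaled_sset_def)
qed (auto simp: thin_core_def scaled_sset_def)

lemma tri_thin_core: "scaled_sset Z \<Longrightarrow> tri (thin_core Z) a b c \<longleftrightarrow>
    (\<exists>\<sigma>\<in>thin Z. act Z 2 [0,1] \<sigma> = a \<and> act Z 2 [1,2] \<sigma> = b \<and> act Z 2 [0,2] \<sigma> = c)"
  by (simp add: tri_def thin_core_cells)

text \<open>Three thin triangles form an inner horn of dimension 3, and saturation makes the
  triangle that is filled in thin as well.\<close>

lemma thin_core_assoc:
  assumes Z: "inner_fib Z"
  shows "assoc_tri (thin_core Z)"
  unfolding assoc_tri_def
proof (intro allI impI)
  fix a b c d e f assume t1: "tri (thin_core Z) a b c" and t2: "tri (thin_core Z) b d e"
  note sc = inner_fib_scaled[OF Z]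
  note Zs = inner_fib_simplicial[OF Z]
  obtain \<sigma> where s: "\<sigma> \<in> thin Z" "act Z 2 [0,1] \<sigma> = a" "act Z 2 [1,2] \<sigma> = b" "act Z 2 [0,2] \<sigma> = c"
    using t1 tri_thin_core[OF sc] by blast
  obtain \<tau> where t: "\<tau> \<in> thin Z" "act Z 2 [0,1] \<tau> = b" "act Z 2 [1,2] \<tau> = d" "act Z 2 [0,2] \<tau> = e"
    using t2 tri_thin_core[OF sc] by blast
  note cells = thin_cells[OF sc]
  show "tri (thin_core Z) a e f \<longleftrightarrow> tri (thin_core Z) c d f"
  proof
    assume "tri (thin_core Z) a e f"
    then obtain \<upsilon> where u: "\<upsilon> \<in> thin Z" "act Z 2 [0,1] \<upsilon> = a" "act Z 2 [1,2] \<upsilon> = e" "act Z 2 [0,2] \<upsilon> = f"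
      using tri_thin_core[OF sc] by blast
    obtain \<rho> where r: "\<rho> \<in> cells Z 3" "act Z 3 [0,1,2] \<rho> = \<sigma>" "act Z 3 [0,1,3] \<rho> = \<upsilon>" "act Z 3 [1,2,3] \<rho> = \<tau>"
      using fill_three_1[OF Z s(1) cells[OF u(1)] cells[OF t(1)]] s t u by auto
    have "act Z 3 [0,2,3] \<rho> \<in> thin Z" using inner_fib_sat[OF Z r(1)] r s t u by simp
    moreover have "act Z 2 [0,1] (act Z 3 [0,2,3] \<rho>) = c" "act Z 2 [1,2] (act Z 3 [0,2,3] \<rho>) = d" "act Z 2 [0,2] (act Z 3 [0,2,3] \<rho>) = f"
      unfolding s(4)[symmetric] t(3)[symmetric] u(4)[symmetric] r(2-4)[symmetric]
      by (simp_all add: act_list[OF Zs r(1)] list_in_mono_maps)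
    ultimately show "tri (thin_core Z) c d f" using tri_thin_core[OF sc] by blast
  next
    assume "tri (thin_core Z) c d f"
    then obtain \<upsilon> where u: "\<upsilon> \<in> thin Z" "act Z 2 [0,1] \<upsilon> = c" "act Z 2 [1,2] \<upsilon> = d" "act Z 2 [0,2] \<upsilon> = f"
      using tri_thin_core[OF sc] by blast
    obtain \<rho> where r: "\<rho> \<in> cells Z 3" "act Z 3 [0,1,2] \<rho> = \<sigma>" "act Z 3 [0,2,3] \<rho> = \<upsilon>" "act Z 3 [1,2,3] \<rho> = \<tau>"
      using fill_three_2[OF Z cells[OF s(1)] cells[OF u(1)] t(1)] s t u by auto
    have "act Z 3 [0,1,3] \<rho> \<in> thin Z" using inner_fib_sat[OF Z r(1)] r s t u by simp
    moreover have "act Z 2 [0,1] (act Z 3 [0,1,3] \<rho>) = a" "act Z 2 [1,2] (act Z 3 [0,1,3] \<rho>) = e" "act Z 2 [0,2] (act Z 3 [0,1,3] \<rho>) = f"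
      unfolding s(2)[symmetric] t(4)[symmetric] u(4)[symmetric] r(2-4)[symmetric]
      by (simp_all add: act_list[OF Zs r(1)] list_in_mono_maps)
    ultimately show "tri (thin_core Z) a e f" using tri_thin_core[OF sc] by blast
  qed
qed

lemma invertible_const: "inner_fib Z \<Longrightarrow> x \<in> cells Z 0 \<Longrightarrow> invertible Z (const_cell Z 1 x)"
  unfolding invertible_def const_cell_thin_core[symmetric]
  by (rule identity_ho_iso) (simp_all add: thin_core_simplicial thin_core_assoc thin_core_cells inner_fib_scaled)

lemma invertible_two_inv: "inner_fib Z \<Longrightarrow> invertible Z e \<Longrightarrow> two_inv (thin_core Z) e"
  unfolding invertible_def
  by (rule weak_inv_two_inv) (auto intro: thin_core_simplicial thin_core_assoc inner_fib_scaled ho_iso_weak_inv)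

section \<open>Quasi-categories\<close>

definition quasi_cat :: "('a, 'z) sset_scheme \<Rightarrow> bool" where
  "quasi_cat Q \<longleftrightarrow> simplicial_set Q \<and> (\<forall>n i. 0 < i \<longrightarrow> i < n \<longrightarrow>
     (\<forall>h\<in>smaps (horn n i) Q. \<exists>g\<in>smaps (simplex n) Q. \<forall>k. \<forall>s\<in>cells (horn n i) k. g k s = h k s))"

text \<open>With the maximal scaling the composition relation of the thin core is that of the
  quasi-category, so associativity in the latter is a case of
  \<open>thin_core_assoc\<close>.\<close>

lemma quasi_cat_inner_fib:
  assumes Q: "quasi_cat Q"
  shows "inner_fib (scale Q UNIV)"
proof -
  have Qs: "simplicial_set Q" using Q by (simp add: quasi_cat_def)
  have S: "simplicial_set (scale Q UNIV)" using Qs simplicial_set_cong[of "scale Q UNIV" Q] by simp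
  have m: "sc_maps (scale X T) (scale Q UNIV) = smaps X Q" for X :: "nat list sset" and T
    using smaps_cong[of "scale X T" X "scale Q UNIV" Q] smaps_cells[of _ X Q _ 2] by (auto simp: sc_maps_def)
  have "has_extensions (scale Q UNIV) (scale (horn n i) {[i - 1, i, i + 1]}) (scale (simplex n) {[i - 1, i, i + 1]})"
    if "2 \<le> n \<and> 0 < i \<and> i < n" for n i
    using Q that unfolding has_extensions_def m quasi_cat_def by simp
  then show ?thesis
    unfolding inner_fib_def scaled_sset_def using S act_cells[OF Qs, of _ 2 3] by (auto simp: list_in_mono_maps)
qed

lemma quasi_cat_identity:
  assumes Q: "quasi_cat Q" and x: "x \<in> cells Q 0"
  shows "ho_iso Q (const_cell Q 1 x)"
proof -
  have F: "inner_fib (scale Q UNIV)" by (rule quasi_cat_inner_fib[OF Q])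
  have "tri (thin_core (scale Q UNIV)) = tri Q"
    using tri_thin_core[OF inner_fib_scaled[OF F]] by (auto simp: tri_def fun_eq_iff)
  then have "assoc_tri Q" using thin_core_assoc[OF F] by (simp add: assoc_tri_def)
  then show ?thesis using identity_ho_iso[of Q x] Q x by (simp add: quasi_cat_def)
qed

section \<open>Triangles detected by the Gray product\<close>

lemma act_012: "simplicial_set X \<Longrightarrow> x \<in> cells X 2 \<Longrightarrow> act X 2 [0,1,2] x = x"
  using act_id[of X x 2] by (simp add: numeral_2_eq_2)

lemma smaps_saturation:
  assumes E: "inner_fib E" and F: "F \<in> smaps W E" and w: "w \<in> cells W 3"
    and t: "F 2 (act W 3 [0,1,2] w) \<in> thin E" "F 2 (act W 3 [1,2,3] w) \<in> thin E"
  shows "F 2 (act W 3 [0,1,3] w) \<in> thin E \<longleftrightarrow> F 2 (act W 3 [0,2,3] w) \<in> thin E"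
proof -
  have "F 2 (act W 3 \<theta> w) = act E 3 \<theta> (F 3 w)" if "\<theta> \<in> mono_maps 2 3" for \<theta> by (rule smaps_act[OF F w that])
  then show ?thesis using inner_fib_sat[OF E smaps_cells[OF F w]] t by (simp add: list_in_mono_maps)
qed

lemma degenerate_triangle_cases:
  assumes X: "simplicial_set X" and x: "x \<in> cells X 2" "degenerate X 2 x"
  shows "x = act X 1 [0,0,1] (act X 2 [0,2] x) \<or> x = act X 1 [0,1,1] (act X 2 [0,2] x)"
proof -
  obtain p where p: "p < 2" "act X 2 (tab 2 (squash p)) x = x" using degenerate_iff[OF X x(1)] x(2) by (auto simp: ac_def)
  have t: "tab 2 (squash 0) = [0,0,2]" "tab 2 (squash 1) = [0,1,1]" by (simp_all add: tab2 squash_def)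
  have "p = 0 \<or> p = 1" using p by auto
  then show ?thesis
  proof
    assume "p = 0"
    then have e: "act X 2 [0,0,2] x = x" using p t by simp
    then show ?thesis using x X by (intro disjI1) (simp add: act_list list_in_mono_maps)
  next
    assume p1: "p = 1"
    then have e: "act X 2 [0,1,1] x = x" using p t by simp
    have "act X 1 [0,1,1] (act X 2 [0,2] x) = act X 1 [0,1,1] (act X 2 [0,2] (act X 2 [0,1,1] x))" by (simp only: e)
    also have "\<dots> = act X 2 [0,1,1] x" using x X by (simp add: act_list list_in_mono_maps act_cells)
    finally show ?thesis using e by simp
  qed
qed

lemma degenerates_along_1:
  assumes X: "scaled_sset X" and x: "x \<in> cells X 2" "degenerates_along X 1 x"
  shows "\<exists>f\<in>cells X 1. x = act X 1 [0,1,1] f"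
proof -
  have Xs: "simplicial_set X" using X by (simp add: scaled_sset_def)
  have f: "act X 2 [0,2] x \<in> cells X 1" by (rule act_cells[OF Xs _ x(1)]) (simp add: list_in_mono_maps)
  consider "x = act X 1 [0,0,1] (act X 2 [0,2] x)" | "x = act X 1 [0,1,1] (act X 2 [0,2] x)"
    using degenerate_triangle_cases[OF Xs x(1)] x(2) by (auto simp: degenerates_along_def)
  then show ?thesis
  proof cases
    case 1
    \<comment> \<open>Here \<open>f\<close> is also the edge (1,2) of the triangle, hence
      degenerate, and on a degenerate edge the two degeneracies coincide.\<close>
    define f where "f = act X 2 [0,2] x"
    have xf: "x = act X 1 [0,0,1] f" "f \<in> cells X 1" using 1 \<open>act X 2 [0,2] x \<in> cells X 1\<close> by (simp_all add: f_def)
    have "act X 2 [1, 1 + 1] x = f" unfolding xf(1) using act_id[OF Xs xf(2)] by (simp add: act_list[OF Xs xf(2), unfolded One_nat_def] list_in_mono_maps)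
    then have "degenerate X 1 f" using x(2) by (simp add: degenerates_along_def)
    then have "act X 1 (tab 1 (squash 0)) f = f" using degenerate_iff[OF Xs xf(2)] by (auto simp: ac_def)
    moreover have "tab 1 (squash 0) = [0,0]" by (simp add: tab_def squash_def)
    ultimately have f0: "act X 1 [0,0] f = f" by simp
    have "x = act X 1 [0,0,1] (act X 1 [0,0] f)" unfolding f0 by (rule xf(1))
    also have "\<dots> = act X 1 [0,1,1] (act X 1 [0,0] f)" by (simp add: act_list[OF Xs xf(2), unfolded One_nat_def] list_in_mono_maps)
    finally show ?thesis using f0 xf(2) by auto
  next
    case 2 then show ?thesis using f by auto
  qed
qed

lemma degenerates_along_0:
  assumes X: "scaled_sset X" and x: "x \<in> cells X 2" "degenerates_along X 0 x"
  shows "\<exists>f\<in>cells X 1. x = act X 1 [0,0,1] f"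
proof -
  have Xs: "simplicial_set X" using X by (simp add: scaled_sset_def)
  have f: "act X 2 [0,2] x \<in> cells X 1" by (rule act_cells[OF Xs _ x(1)]) (simp add: list_in_mono_maps)
  consider "x = act X 1 [0,0,1] (act X 2 [0,2] x)" | "x = act X 1 [0,1,1] (act X 2 [0,2] x)"
    using degenerate_triangle_cases[OF Xs x(1)] x(2) by (auto simp: degenerates_along_def)
  then show ?thesis
  proof cases
    case 1 then show ?thesis using f by auto
  next
    case 2
    define f where "f = act X 2 [0,2] x"
    have xf: "x = act X 1 [0,1,1] f" "f \<in> cells X 1" using 2 \<open>act X 2 [0,2] x \<in> cells X 1\<close> by (simp_all add: f_def)
    have "act X 2 [0, 0 + 1] x = f" unfolding xf(1) using act_id[OF Xs xf(2)] by (simp add: act_list[OF Xs xf(2), unfolded One_nat_def] list_in_mono_maps)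
    then have "degenerate X 1 f" using x(2) by (simp add: degenerates_along_def)
    then have "act X 1 (tab 1 (squash 0)) f = f" using degenerate_iff[OF Xs xf(2)] by (auto simp: ac_def)
    moreover have "tab 1 (squash 0) = [0,0]" by (simp add: tab_def squash_def)
    ultimately have f0: "act X 1 [0,0] f = f" by simp
    have "x = act X 1 [0,1,1] (act X 1 [0,0] f)" unfolding f0 by (rule xf(1))
    also have "\<dots> = act X 1 [0,0,1] (act X 1 [0,0] f)" by (simp add: act_list[OF Xs xf(2), unfolded One_nat_def] list_in_mono_maps)
    finally show ?thesis using f0 xf(2) by auto
  qed
qed

lemma degenerates_along_intro:
  assumes X: "simplicial_set X" and f: "f \<in> cells X 1"
  shows "degenerates_along X 1 (act X 1 [0,1,1] f)" "degenerates_along X 0 (act X 1 [0,0,1] f)"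
  unfolding degenerates_along_def
  using degenerate_act[OF X f, of "[0,1,1]" 2] degenerate_act[OF X f, of "[0,0,1]" 2]
    degenerate_act[OF X f, of "[1,1]" 1] degenerate_act[OF X f, of "[0,0]" 1]
  by (simp_all add: list_in_mono_maps act_list[OF X f, unfolded One_nat_def])

lemma gray_sel [simp]: "cells (gray C D) n = cells C n \<times> cells D n"
  "act (gray C D) n \<theta> (x, y) = (act C n \<theta> x, act D n \<theta> y)"
  by (simp_all add: gray_def)

lemma prod_simeq_sel [simp]: "cells (prod_simeq C D) n = cells C n \<times> cells D n"
  "act (prod_simeq C D) n \<theta> (x, y) = (act C n \<theta> x, act D n \<theta> y)"
  by (simp_all add: prod_simeq_def)

text \<open>Degenerating along an edge pins down which degeneracy occurs. A degenerate triangle of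
  the product is degenerate in the same way in both components, so it falls under one of the two
  clauses.\<close>

lemma thin_gray:
  assumes C: "scaled_sset C" and D: "scaled_sset D"
  shows "thin (gray C D) = {(\<alpha>, \<beta>). (\<exists>f\<in>cells C 1. \<alpha> = act C 1 [0,1,1] f) \<and> \<beta> \<in> thin D \<or>
      \<alpha> \<in> thin C \<and> (\<exists>g\<in>cells D 1. \<beta> = act D 1 [0,0,1] g)}" (is "_ = ?R")
proof -
  have Cs: "simplicial_set C" and Ds: "simplicial_set D" using C D by (auto simp: scaled_sset_def)
  have a: "act C 1 [0,1,1] f \<in> thin C" if "f \<in> cells C 1" for f by (rule degenerate_thin[OF C that]) (auto simp: list_in_mono_maps)
  have a': "act C 1 [0,0,1] f \<in> thin C" if "f \<in> cells C 1" for f by (rule degenerate_thin[OF C that]) (auto simp: list_in_mono_maps)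
  have b: "act D 1 [0,0,1] f \<in> thin D" if "f \<in> cells D 1" for f by (rule degenerate_thin[OF D that]) (auto simp: list_in_mono_maps)
  have b': "act D 1 [0,1,1] f \<in> thin D" if "f \<in> cells D 1" for f by (rule degenerate_thin[OF D that]) (auto simp: list_in_mono_maps)
  show ?thesis
  proof (intro equalityI subsetI)
    fix \<sigma> assume s: "\<sigma> \<in> thin (gray C D)"
    obtain \<alpha> \<beta> where [simp]: "\<sigma> = (\<alpha>, \<beta>)" by (cases \<sigma>)
    have c: "\<alpha> \<in> cells C 2" "\<beta> \<in> cells D 2" using s by (simp_all add: gray_def)
    consider "\<alpha> \<in> thin C" "\<beta> \<in> thin D" "degenerates_along C 1 \<alpha> \<or> degenerates_along D 0 \<beta>" | "degenerate (sprod C D) 2 (\<alpha>, \<beta>)"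
      using s by (auto simp: gray_def)
    then show "\<sigma> \<in> ?R"
    proof cases
      case 1 then show ?thesis using degenerates_along_1[OF C c(1)] degenerates_along_0[OF D c(2)] by auto
    next
      case 2
      have e: "act C 2 [0,2] \<alpha> \<in> cells C 1" "act D 2 [0,2] \<beta> \<in> cells D 1"
        using c Cs Ds by (auto intro!: act_cells simp: list_in_mono_maps)
      have "(\<alpha>, \<beta>) \<in> cells (sprod C D) 2" using c by simp
      from degenerate_triangle_cases[OF simplicial_sprod[OF Cs Ds] this 2]
      consider "\<alpha> = act C 1 [0,0,1] (act C 2 [0,2] \<alpha>)" "\<beta> = act D 1 [0,0,1] (act D 2 [0,2] \<beta>)"
        | "\<alpha> = act C 1 [0,1,1] (act C 2 [0,2] \<alpha>)" "\<beta> = act D 1 [0,1,1] (act D 2 [0,2] \<beta>)" by auto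
      then show ?thesis
      proof cases
        case 1
        then have "\<alpha> \<in> thin C" using a'[OF e(1)] by metis
        with 1 e show ?thesis by auto
      next
        case 2
        then have "\<beta> \<in> thin D" using b'[OF e(2)] by metis
        with 2 e show ?thesis by auto
      qed
    qed
  next
    fix \<sigma> assume "\<sigma> \<in> ?R"
    then show "\<sigma> \<in> thin (gray C D)"
      using thin_cells[OF C] thin_cells[OF D] degenerates_along_intro[OF Cs] degenerates_along_intro[OF Ds] a b
      by (auto simp: gray_def)
  qed
qed

lemma two_inv_triangles:
  assumes X: "inner_fib X" and e: "two_inv (thin_core X) e"
  obtains \<sigma> \<tau> where "e \<in> cells X 1" "\<sigma> \<in> thin X" "\<tau> \<in> thin X" "act X 2 [0,1] \<sigma> = e" "act X 2 [1,2] \<sigma> = act X 2 [0,1] \<tau>"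
    "act X 2 [0,2] \<sigma> = act X 1 [0,0] e" "act X 2 [1,2] \<tau> = e" "act X 2 [0,2] \<tau> = act X 1 [1,1] e"
proof -
  note sc = inner_fib_scaled[OF X]
  have Xs: "simplicial_set X" by (rule inner_fib_simplicial[OF X])
  obtain g where g: "tri (thin_core X) e g (const_cell X 1 (src X e))" "tri (thin_core X) g e (const_cell X 1 (tgt X e))"
    using e by (auto simp: two_inv_def const_cell_thin_core src_thin_core)
  have ec: "e \<in> cells X 1" using tri_ends(1)[OF thin_core_simplicial[OF sc] g(1)] thin_core_cells[OF sc] by simp
  have k: "const_cell X 1 (src X e) = act X 1 [0,0] e" "const_cell X 1 (tgt X e) = act X 1 [1,1] e"
    using edge_ends(3,4)[OF Xs ec, of 1] by simp_all
  show thesis using g ec that unfolding tri_thin_core[OF sc] k by metis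
qed

text \<open>\<open>A\<close> is a parameter object with \<open>TA\<close> as its thin triangles. For
  \<open>A\<close> a simplex, \<open>TA\<close> will be its degenerate triangles or all of them,
  which treats the simplices and the thin triangles of the functor bicategory alike.
  \<open>G1\<close> and \<open>G2\<close> express that Gray-thin triangles are respected.\<close>

locale gray_map =
  fixes A :: "('a, 'r) sset_scheme" and TA :: "'a set" and C :: "'c scaled" and D :: "'d scaled" and E :: "'e scaled"
    and F :: "nat \<Rightarrow> 'a \<times> 'c \<times> 'd \<Rightarrow> 'e"
  assumes A: "simplicial_set A" "TA \<subseteq> cells A 2" "\<And>k \<theta> x. x \<in> cells A k \<Longrightarrow> \<theta> \<in> mono_maps 2 k \<Longrightarrow> \<not> distinct \<theta> \<Longrightarrow> act A k \<theta> x \<in> TA"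
    and C: "inner_fib C" and D: "inner_fib D" and E: "inf_bicategory E"
    and F: "F \<in> smaps (sprod A (sprod C D)) E"
    and G1: "\<And>s f \<beta>. s \<in> TA \<Longrightarrow> f \<in> cells C 1 \<Longrightarrow> \<beta> \<in> thin D \<Longrightarrow> F 2 (s, act C 1 [0,1,1] f, \<beta>) \<in> thin E"
    and G2: "\<And>s \<alpha> g. s \<in> TA \<Longrightarrow> \<alpha> \<in> thin C \<Longrightarrow> g \<in> cells D 1 \<Longrightarrow> F 2 (s, \<alpha>, act D 1 [0,0,1] g) \<in> thin E"
begin

abbreviation "W \<equiv> sprod A (sprod C D)"

lemma Cs: "simplicial_set C" "scaled_sset C" using C by (auto simp: inner_fib_def scaled_sset_def)
lemma Ds: "simplicial_set D" "scaled_sset D" using D by (auto simp: inner_fib_def scaled_sset_def)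

lemma G1': "s \<in> TA \<Longrightarrow> x \<in> cells C n \<Longrightarrow> i \<le> j \<Longrightarrow> j \<le> n \<Longrightarrow> \<beta> \<in> thin D \<Longrightarrow> F 2 (s, act C n [i,j,j] x, \<beta>) \<in> thin E"
  using G1[of s "act C n [i,j] x" \<beta>] act_cells[OF Cs(1), of "[i,j]" 1 n x] act_list[OF Cs(1), of x n "[i,j]" 1 "[0,1,1]"]
  by (simp add: list_in_mono_maps)

lemma G2': "s \<in> TA \<Longrightarrow> \<alpha> \<in> thin C \<Longrightarrow> x \<in> cells D n \<Longrightarrow> i \<le> j \<Longrightarrow> j \<le> n \<Longrightarrow> F 2 (s, \<alpha>, act D n [i,i,j] x) \<in> thin E"
  using G2[of s \<alpha> "act D n [i,j] x"] act_cells[OF Ds(1), of "[i,j]" 1 n x] act_list[OF Ds(1), of x n "[i,j]" 1 "[0,0,1]"]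
  by (simp add: list_in_mono_maps)

lemma degA: "x \<in> cells A k \<Longrightarrow> length \<theta> = 3 \<Longrightarrow> sorted \<theta> \<Longrightarrow> set \<theta> \<subseteq> {..k} \<Longrightarrow> \<not> distinct \<theta> \<Longrightarrow> act A k \<theta> x \<in> TA"
  by (rule A(3)) (simp_all add: list_in_mono_maps)
lemma degC: "x \<in> cells C k \<Longrightarrow> length \<theta> = 3 \<Longrightarrow> sorted \<theta> \<Longrightarrow> set \<theta> \<subseteq> {..k} \<Longrightarrow> \<not> distinct \<theta> \<Longrightarrow> act C k \<theta> x \<in> thin C"
  by (rule degenerate_thin[OF Cs(2)]) (simp_all add: list_in_mono_maps)
lemma degD: "x \<in> cells D k \<Longrightarrow> length \<theta> = 3 \<Longrightarrow> sorted \<theta> \<Longrightarrow> set \<theta> \<subseteq> {..k} \<Longrightarrow> \<not> distinct \<theta> \<Longrightarrow> act D k \<theta> x \<in> thin D"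
  by (rule degenerate_thin[OF Ds(2)]) (simp_all add: list_in_mono_maps)

lemma sat:
  assumes "s \<in> cells A 3" "\<alpha> \<in> cells C 3" "\<beta> \<in> cells D 3"
    and "F 2 (act A 3 [0,1,2] s, act C 3 [0,1,2] \<alpha>, act D 3 [0,1,2] \<beta>) \<in> thin E"
    and "F 2 (act A 3 [1,2,3] s, act C 3 [1,2,3] \<alpha>, act D 3 [1,2,3] \<beta>) \<in> thin E"
  shows "F 2 (act A 3 [0,1,3] s, act C 3 [0,1,3] \<alpha>, act D 3 [0,1,3] \<beta>) \<in> thin E \<longleftrightarrow>
    F 2 (act A 3 [0,2,3] s, act C 3 [0,2,3] \<alpha>, act D 3 [0,2,3] \<beta>) \<in> thin E"
  using smaps_saturation[OF inf_bicategory_inner_fib[OF E] F, of "(s, \<alpha>, \<beta>)"] assms by simp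

lemma cells_A: "x \<in> cells A k \<Longrightarrow> length \<theta> = Suc m \<Longrightarrow> sorted \<theta> \<Longrightarrow> set \<theta> \<subseteq> {..k} \<Longrightarrow> act A k \<theta> x \<in> cells A m"
  by (rule act_cells[OF A(1)]) (simp_all add: list_in_mono_maps)
lemma cells_C: "x \<in> cells C k \<Longrightarrow> length \<theta> = Suc m \<Longrightarrow> sorted \<theta> \<Longrightarrow> set \<theta> \<subseteq> {..k} \<Longrightarrow> act C k \<theta> x \<in> cells C m"
  by (rule act_cells[OF Cs(1)]) (simp_all add: list_in_mono_maps)
lemma cells_D: "x \<in> cells D k \<Longrightarrow> length \<theta> = Suc m \<Longrightarrow> sorted \<theta> \<Longrightarrow> set \<theta> \<subseteq> {..k} \<Longrightarrow> act D k \<theta> x \<in> cells D m"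
  by (rule act_cells[OF Ds(1)]) (simp_all add: list_in_mono_maps)

text \<open>The chain u, inverse, u is assembled into a 3-simplex \<delta> of \<open>D\<close> with
  thin faces and degenerate edges (0,2) and (1,3). Running along \<delta> at the source of
  \<open>f\<close> and traversing \<open>f\<close> at the end gives a 4-simplex whose triangle
  (0,1,4) is the wanted half of the square.\<close>

lemma square_inv_right:
  assumes u: "two_inv (thin_core D) u" and f: "f \<in> cells C 1" and a: "a \<in> cells A 0"
  shows "F 2 (act A 0 [0,0,0] a, act C 1 [0,0,1] f, act D 1 [0,1,1] u) \<in> thin E"
proof -
  obtain \<sigma> \<tau> where s: "u \<in> cells D 1" "\<sigma> \<in> thin D" "\<tau> \<in> thin D" "act D 2 [0,1] \<sigma> = u" "act D 2 [1,2] \<sigma> = act D 2 [0,1] \<tau>"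
    "act D 2 [0,2] \<sigma> = act D 1 [0,0] u" "act D 2 [1,2] \<tau> = u" "act D 2 [0,2] \<tau> = act D 1 [1,1] u"
    using two_inv_triangles[OF D u] by blast
  have uu: "act D 1 [0,1] u = u" using act_id[OF Ds(1) s(1)] by simp
  note lu = act_list[OF Ds(1) s(1), unfolded One_nat_def] list_in_mono_maps
  have B: "act D 1 [0,1,1] u \<in> cells D 2" by (rule cells_D[OF s(1)]) auto
  obtain \<delta> where d: "\<delta> \<in> cells D 3" "act D 3 [0,1,2] \<delta> = \<sigma>" "act D 3 [0,1,3] \<delta> = act D 1 [0,1,1] u" "act D 3 [1,2,3] \<delta> = \<tau>"
    using fill_three_1[OF D s(2) B thin_cells[OF Ds(2) s(3)]] s uu by (auto simp: lu)
  note ld = act_list[OF Ds(1) d(1), unfolded One_nat_def] list_in_mono_maps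
  have d013: "act D 3 [0,1,3] \<delta> \<in> thin D" using degD[OF s(1), of "[0,1,1]"] d by simp
  have d023: "act D 3 [0,2,3] \<delta> \<in> thin D" using inner_fib_sat[OF D d(1)] d s d013 by simp
  have e02: "act D 3 [0,2,2] \<delta> = act D 1 [0,0,0] u"
  proof -
    have "act D 3 [0,2,2] \<delta> = act D 2 [0,2,2] (act D 3 [0,1,2] \<delta>)" by (simp add: ld)
    also have "\<dots> = act D 1 [0,1,1] (act D 2 [0,2] \<sigma>)"
      using act_list[OF Ds(1) thin_cells[OF Ds(2) s(2)], unfolded One_nat_def] d by (simp add: list_in_mono_maps)
    finally show ?thesis unfolding s(6) by (simp add: lu)
  qed
  have e13: "act D 3 [1,3,3] \<delta> = act D 1 [1,1,1] u"
  proof -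
    have "act D 3 [1,3,3] \<delta> = act D 2 [0,2,2] (act D 3 [1,2,3] \<delta>)" by (simp add: ld)
    also have "\<dots> = act D 1 [0,1,1] (act D 2 [0,2] \<tau>)"
      using act_list[OF Ds(1) thin_cells[OF Ds(2) s(3)], unfolded One_nat_def] d by (simp add: list_in_mono_maps)
    finally show ?thesis unfolding s(8) by (simp add: lu)
  qed
  note la = act_list[OF A(1) a, unfolded One_nat_def] list_in_mono_maps
  note lf = act_list[OF Cs(1) f, unfolded One_nat_def] list_in_mono_maps
  have ta: "act A 0 [0,0,0] a \<in> TA" by (rule degA[OF a]) auto
  have tf: "act C 1 [0,0,1] f \<in> thin C" by (rule degC[OF f]) auto
  \<comment> \<open>The comparison simplex runs along the edge (0,2) of \<delta>, then
    \<open>f\<close>, then the edge (2,3). Because the first of these is degenerate, its face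
    (0,1,2) is Gray-thin.\<close>
  have x024: "F 2 (act A 0 [0,0,0] a, act C 1 [0,0,1] f, act D 3 [0,2,3] \<delta>) \<in> thin E"
    using sat[OF cells_A[OF a, of "[0,0,0,0]" 3] cells_C[OF f, of "[0,0,1,1]" 3] cells_D[OF d(1), of "[0,2,2,3]" 3]]
      G2'[OF ta tf s(1), of 0 0] G1'[OF ta f _ _ degD[OF d(1), of "[2,2,3]"], of 0 1] G1'[OF ta f _ _ d023, of 0 1] e02
    by (simp add: la lf ld)
  define w where "w = F 4 (act A 0 [0,0,0,0,0] a, act C 1 [0,0,0,0,1] f, act D 3 [0,1,2,3,3] \<delta>)"
  have wc: "(act A 0 [0,0,0,0,0] a, act C 1 [0,0,0,0,1] f, act D 3 [0,1,2,3,3] \<delta>) \<in> cells W 4"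
    using cells_A[OF a, of "[0,0,0,0,0]" 4] cells_C[OF f, of "[0,0,0,0,1]" 4] cells_D[OF d(1), of "[0,1,2,3,3]" 4] by simp
  have wE: "w \<in> cells E 4" unfolding w_def by (rule smaps_cells[OF F wc])
  have wa: "act E 4 \<theta> w = F 2 (act A 0 (map ((!) [0,0,0,0,0]) \<theta>) a, act C 1 (map ((!) [0,0,0,0,1]) \<theta>) f, act D 3 (map ((!) [0,1,2,3,3]) \<theta>) \<delta>)"
    if "length \<theta> = 3" "sorted \<theta>" "set \<theta> \<subseteq> {..4}" for \<theta>
  proof -
    have "\<theta> \<noteq> []" using that by auto
    then show ?thesis unfolding w_def using smaps_act[OF F wc, of \<theta> 2] that by (simp add: la lf ld)
  qed
  have "act E 4 [0,1,4] w \<in> thin E"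
    by (rule inf_bicategory_four_simplex(2)[OF E])
      (use wE x024 G1'[OF ta f _ _ s(3), of 0 0] G1'[OF ta f _ _ d013, of 0 0]
        G2'[OF ta tf s(1), of 1 1] G1'[OF ta f _ _ s(2), of 0 0] e13 d in \<open>simp_all add: wa\<close>)
  then show ?thesis using d(3) by (simp add: wa)
qed

text \<open>The mirror image: the chain e, inverse, e in \<open>C\<close> comes after
  \<open>u\<close>, and the wanted triangle is (0,3,4), the conclusion of the opposite saturation
  property.\<close>

lemma square_inv_left:
  assumes e: "two_inv (thin_core C) e" and u: "u \<in> cells D 1" and a: "a \<in> cells A 0"
  shows "F 2 (act A 0 [0,0,0] a, act C 1 [0,0,1] e, act D 1 [0,1,1] u) \<in> thin E"
proof -
  obtain \<sigma> \<tau> where s: "e \<in> cells C 1" "\<sigma> \<in> thin C" "\<tau> \<in> thin C" "act C 2 [0,1] \<sigma> = e" "act C 2 [1,2] \<sigma> = act C 2 [0,1] \<tau>"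
    "act C 2 [0,2] \<sigma> = act C 1 [0,0] e" "act C 2 [1,2] \<tau> = e" "act C 2 [0,2] \<tau> = act C 1 [1,1] e"
    using two_inv_triangles[OF C e] by blast
  have ee: "act C 1 [0,1] e = e" using act_id[OF Cs(1) s(1)] by simp
  note le = act_list[OF Cs(1) s(1), unfolded One_nat_def] list_in_mono_maps
  have B: "act C 1 [0,0,1] e \<in> cells C 2" by (rule cells_C[OF s(1)]) auto
  obtain \<gamma> where g: "\<gamma> \<in> cells C 3" "act C 3 [0,1,2] \<gamma> = \<sigma>" "act C 3 [0,2,3] \<gamma> = act C 1 [0,0,1] e" "act C 3 [1,2,3] \<gamma> = \<tau>"
    using fill_three_2[OF C thin_cells[OF Cs(2) s(2)] B s(3)] s ee by (auto simp: le)
  note lg = act_list[OF Cs(1) g(1), unfolded One_nat_def] list_in_mono_maps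
  have g023: "act C 3 [0,2,3] \<gamma> \<in> thin C" using degC[OF s(1), of "[0,0,1]"] g by simp
  have g013: "act C 3 [0,1,3] \<gamma> \<in> thin C" using inner_fib_sat[OF C g(1)] g s g023 by simp
  have e02: "act C 3 [0,0,2] \<gamma> = act C 1 [0,0,0] e"
  proof -
    have "act C 3 [0,0,2] \<gamma> = act C 2 [0,0,2] (act C 3 [0,1,2] \<gamma>)" by (simp add: lg)
    also have "\<dots> = act C 1 [0,0,1] (act C 2 [0,2] \<sigma>)"
      using act_list[OF Cs(1) thin_cells[OF Cs(2) s(2)], unfolded One_nat_def] g by (simp add: list_in_mono_maps)
    finally show ?thesis unfolding s(6) by (simp add: le)
  qed
  have e13: "act C 3 [1,1,3] \<gamma> = act C 1 [1,1,1] e"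
  proof -
    have "act C 3 [1,1,3] \<gamma> = act C 2 [0,0,2] (act C 3 [1,2,3] \<gamma>)" by (simp add: lg)
    also have "\<dots> = act C 1 [0,0,1] (act C 2 [0,2] \<tau>)"
      using act_list[OF Cs(1) thin_cells[OF Cs(2) s(3)], unfolded One_nat_def] g by (simp add: list_in_mono_maps)
    finally show ?thesis unfolding s(8) by (simp add: le)
  qed
  note la = act_list[OF A(1) a, unfolded One_nat_def] list_in_mono_maps
  note lu = act_list[OF Ds(1) u, unfolded One_nat_def] list_in_mono_maps
  have ta: "act A 0 [0,0,0] a \<in> TA" by (rule degA[OF a]) auto
  have tu: "act D 1 [0,1,1] u \<in> thin D" "act D 1 [0,0,1] u \<in> thin D" by (rule degD[OF u]; auto)+
  have x024: "F 2 (act A 0 [0,0,0] a, act C 3 [0,1,3] \<gamma>, act D 1 [0,1,1] u) \<in> thin E"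
    using sat[OF cells_A[OF a, of "[0,0,0,0]" 3] cells_C[OF g(1), of "[0,1,1,3]" 3] cells_D[OF u, of "[0,0,1,1]" 3]]
      G1'[OF ta g(1) _ _ tu(2), of 0 1] G2'[OF ta g013 u, of 0 1] G1'[OF ta s(1) _ _ tu(1), of 1 1] e13
    by (simp add: la lu lg)
  define w where "w = F 4 (act A 0 [0,0,0,0,0] a, act C 3 [0,0,1,2,3] \<gamma>, act D 1 [0,1,1,1,1] u)"
  have wc: "(act A 0 [0,0,0,0,0] a, act C 3 [0,0,1,2,3] \<gamma>, act D 1 [0,1,1,1,1] u) \<in> cells W 4"
    using cells_A[OF a, of "[0,0,0,0,0]" 4] cells_C[OF g(1), of "[0,0,1,2,3]" 4] cells_D[OF u, of "[0,1,1,1,1]" 4] by simp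
  have wE: "w \<in> cells E 4" unfolding w_def by (rule smaps_cells[OF F wc])
  have wa: "act E 4 \<theta> w = F 2 (act A 0 (map ((!) [0,0,0,0,0]) \<theta>) a, act C 3 (map ((!) [0,0,1,2,3]) \<theta>) \<gamma>, act D 1 (map ((!) [0,1,1,1,1]) \<theta>) u)"
    if "length \<theta> = 3" "sorted \<theta>" "set \<theta> \<subseteq> {..4}" for \<theta>
  proof -
    have "\<theta> \<noteq> []" using that by auto
    then show ?thesis unfolding w_def using smaps_act[OF F wc, of \<theta> 2] that by (simp add: la lu lg)
  qed
  have "act E 4 [0,3,4] w \<in> thin E"
    by (rule opposite_four_simplex[OF E])
      (use wE x024 G2'[OF ta g023 u, of 1 1] G2'[OF ta s(3) u, of 1 1]
        G1'[OF ta s(1) _ _ tu(1), of 0 0] G2'[OF ta g013 u, of 1 1] e02 g in \<open>simp_all add: wa\<close>)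
  then show ?thesis using g(3) by (simp add: wa)
qed

lemma thin_if_two_inv:
  assumes s: "s \<in> TA" and \<alpha>: "\<alpha> \<in> thin C" and \<beta>: "\<beta> \<in> thin D"
    and inv: "two_inv (thin_core C) (act C 2 [1,2] \<alpha>) \<or> two_inv (thin_core D) (act D 2 [0,1] \<beta>)"
  shows "F 2 (s, \<alpha>, \<beta>) \<in> thin E"
proof -
  have sc: "s \<in> cells A 2" and ac: "\<alpha> \<in> cells C 2" and bc: "\<beta> \<in> cells D 2"
    using s A(2) thin_cells[OF Cs(2) \<alpha>] thin_cells[OF Ds(2) \<beta>] by auto
  define t e u where "t = act A 2 [1,2] s" "e = act C 2 [1,2] \<alpha>" "u = act D 2 [0,1] \<beta>"
  have t: "t \<in> cells A 1" unfolding t_e_u_def by (rule cells_A[OF sc]) auto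
  have e: "e \<in> cells C 1" unfolding t_e_u_def by (rule cells_C[OF ac]) auto
  have u: "u \<in> cells D 1" unfolding t_e_u_def by (rule cells_D[OF bc]) auto
  have t0: "act A 1 [0] t \<in> cells A 0" by (rule cells_A[OF t]) auto
  have "F 2 (act A 0 [0,0,0] (act A 1 [0] t), act C 1 [0,0,1] e, act D 1 [0,1,1] u) \<in> thin E"
    using inv square_inv_left[OF _ u t0] square_inv_right[OF _ e t0] unfolding t_e_u_def by blast
  then have 1: "F 2 (act A 1 [0,0,0] t, act C 1 [0,0,1] e, act D 1 [0,1,1] u) \<in> thin E"
    by (simp add: act_list[OF A(1) t, unfolded One_nat_def] list_in_mono_maps)
  note lt = act_list[OF A(1) t, unfolded One_nat_def] act_list[OF Cs(1) e, unfolded One_nat_def] act_list[OF Ds(1) u, unfolded One_nat_def] list_in_mono_maps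
  note ls = act_list[OF A(1) sc, unfolded One_nat_def] act_list[OF Cs(1) ac, unfolded One_nat_def] act_list[OF Ds(1) bc, unfolded One_nat_def] act_012[OF A(1) sc, unfolded One_nat_def] act_012[OF Cs(1) ac, unfolded One_nat_def] act_012[OF Ds(1) bc, unfolded One_nat_def] list_in_mono_maps
  have ta: "act A 1 [0,0,1] t \<in> TA" by (rule degA[OF t]) auto
  \<comment> \<open>The parameter edge \<open>t\<close> is attached at the end: the previous
    triangle is the face (0,1,2) of a 3-simplex, the new one its face (0,1,3).\<close>
  have 2: "F 2 (act A 1 [0,0,1] t, act C 1 [0,0,1] e, act D 1 [0,1,1] u) \<in> thin E"
    using sat[OF cells_A[OF t, of "[0,0,0,1]" 3] cells_C[OF e, of "[0,0,1,1]" 3] cells_D[OF u, of "[0,1,1,1]" 3]] 1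
      G1'[OF ta e _ _ degD[OF u, of "[1,1,1]"], of 0 1] G1'[OF ta e _ _ degD[OF u, of "[0,1,1]"], of 0 1]
    by (simp add: lt)
  have ta1: "act A 2 [0,1,1] s \<in> TA" "act A 2 [1,2,2] s \<in> TA" "act A 2 [0,2,2] s \<in> TA" by (rule degA[OF sc]; auto)+
  \<comment> \<open>The first edges of \<open>s\<close> and \<alpha> are put in front. As
    \<open>e\<close> is the edge (1,2) of \<alpha>, the previous triangle is now the face
    (1,2,3).\<close>
  have 3: "F 2 (s, \<alpha>, act D 1 [0,1,1] u) \<in> thin E"
    using sat[OF cells_A[OF sc, of "[0,1,1,2]" 3] cells_C[OF ac, of "[0,1,1,2]" 3] cells_D[OF u, of "[0,0,1,1]" 3]] 2
      G1'[OF ta1(1) ac _ _ degD[OF u, of "[0,0,1]"], of 0 1] G2'[OF s \<alpha> u, of 0 1]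
    by (simp add: lt ls t_e_u_def(1,2))
  \<comment> \<open>The last edge of \<beta> is appended, with the previous triangle as the face
    (0,1,2).\<close>
  show ?thesis
    using sat[OF cells_A[OF sc, of "[0,1,2,2]" 3] cells_C[OF ac, of "[0,1,2,2]" 3] cells_D[OF bc, of "[0,1,1,2]" 3]] 3
      G1'[OF ta1(2) ac _ _ degD[OF bc, of "[1,1,2]"], of 1 2] G1'[OF ta1(3) ac _ _ \<beta>, of 0 2]
    by (simp add: ls t_e_u_def(3))
qed

end

section \<open>Functor bicategories\<close>

lemma thin_act_endo:
  assumes Z: "scaled_sset Z" and x: "x \<in> thin Z" and \<theta>: "\<theta> \<in> mono_maps 2 2"
  shows "act Z 2 \<theta> x \<in> thin Z"
proof -
  have "x \<in> cells (thin_core Z) 2" using x thin_core_cells(1)[OF Z] by simp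
  then show ?thesis using \<theta> unfolding thin_core_def sset.simps by blast
qed

section \<open>The internal hom of simplicial sets\<close>

lemma sFun_sel [simp]: "cells (sFun X Y) n = smaps (sprod (simplex n) X) Y" "act (sFun X Y) n \<theta> F = fun_act X n \<theta> F"
  by (simp_all add: sFun_def)

lemma fun_act_eval:
  assumes "\<theta> \<in> mono_maps m n" "s \<in> mono_maps k m" "x \<in> cells X k"
  shows "fun_act X n \<theta> F k (s, x) = F k (map ((!) \<theta>) s, x)"
  using assms length_mono_maps[OF assms(1)] by (simp add: fun_act_def scomp_def)

lemma fun_act_smaps:
  assumes X: "simplicial_set X" and F: "F \<in> smaps (sprod (simplex n) X) Y" and \<theta>: "\<theta> \<in> mono_maps m n"
  shows "fun_act X n \<theta> F \<in> smaps (sprod (simplex m) X) Y"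
proof (rule smapsI)
  fix k w assume "w \<in> cells (sprod (simplex m) X) k"
  then obtain s x where w: "w = (s, x)" "s \<in> mono_maps k m" "x \<in> cells X k" by auto
  show "fun_act X n \<theta> F k w \<in> cells Y k"
    unfolding w(1) fun_act_eval[OF \<theta> w(2,3)] by (rule smaps_cells[OF F]) (use mono_maps_comp[OF w(2) \<theta>] w in simp)
next
  fix k w assume "w \<notin> cells (sprod (simplex m) X) k"
  then show "fun_act X n \<theta> F k w = undefined" using length_mono_maps[OF \<theta>] by (auto simp: fun_act_def scomp_def)
next
  fix l k \<psi> w assume psi: "\<psi> \<in> mono_maps l k" and "w \<in> cells (sprod (simplex m) X) k"
  then obtain s x where w: "w = (s, x)" "s \<in> mono_maps k m" "x \<in> cells X k" by auto
  have "fun_act X n \<theta> F l (act (sprod (simplex m) X) k \<psi> w) = F l (map ((!) \<theta>) (map ((!) s) \<psi>), act X k \<psi> x)"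
    unfolding w(1) using fun_act_eval[OF \<theta> mono_maps_comp[OF psi w(2)] act_cells[OF X psi w(3)]] by simp
  also have "map ((!) \<theta>) (map ((!) s) \<psi>) = map ((!) (map ((!) \<theta>) s)) \<psi>"
    using psi length_mono_maps[OF w(2)] by (auto simp: mono_maps_def)
  also have "F l (map ((!) (map ((!) \<theta>) s)) \<psi>, act X k \<psi> x) = act Y k \<psi> (F k (map ((!) \<theta>) s, x))"
    using smaps_act[OF F _ psi, of "(map ((!) \<theta>) s, x)"] mono_maps_comp[OF w(2) \<theta>] w by simp
  finally show "fun_act X n \<theta> F l (act (sprod (simplex m) X) k \<psi> w) = act Y k \<psi> (fun_act X n \<theta> F k w)"
    unfolding w(1) fun_act_eval[OF \<theta> w(2,3)] .
qed

lemma simplicial_sFun: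
  assumes X: "simplicial_set X"
  shows "simplicial_set (sFun X Y)"
  unfolding simplicial_set_def sFun_sel
proof (intro conjI allI ballI)
  fix m n \<theta> F assume "\<theta> \<in> mono_maps m n" "F \<in> smaps (sprod (simplex n) X) Y"
  then show "fun_act X n \<theta> F \<in> smaps (sprod (simplex m) X) Y" by (rule fun_act_smaps[OF X, rotated])
next
  fix n F assume F: "F \<in> smaps (sprod (simplex n) X) Y"
  show "fun_act X n [0..<Suc n] F = F"
  proof (rule smaps_eqI[OF fun_act_smaps[OF X F id_mono_maps] F])
    fix k w assume "w \<in> cells (sprod (simplex n) X) k"
    then obtain s x where w: "w = (s, x)" "s \<in> mono_maps k n" "x \<in> cells X k" by auto
    show "fun_act X n [0..<Suc n] F k w = F k w"
      unfolding w(1) fun_act_eval[OF id_mono_maps w(2,3)] map_nth_id[OF w(2)] ..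
  qed
next
  fix l m n \<psi> \<theta> F assume psi: "\<psi> \<in> mono_maps l m" and th: "\<theta> \<in> mono_maps m n" and F: "F \<in> smaps (sprod (simplex n) X) Y"
  note G = fun_act_smaps[OF X F th]
  show "fun_act X m \<psi> (fun_act X n \<theta> F) = fun_act X n (map ((!) \<theta>) \<psi>) F"
  proof (rule smaps_eqI[OF fun_act_smaps[OF X G psi] fun_act_smaps[OF X F mono_maps_comp[OF psi th]]])
    fix k w assume "w \<in> cells (sprod (simplex l) X) k"
    then obtain s x where w: "w = (s, x)" "s \<in> mono_maps k l" "x \<in> cells X k" by auto
    have "map ((!) \<theta>) (map ((!) \<psi>) s) = map ((!) (map ((!) \<theta>) \<psi>)) s"
      using w(2) length_mono_maps[OF psi] by (auto simp: mono_maps_def)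
    then show "fun_act X m \<psi> (fun_act X n \<theta> F) k w = fun_act X n (map ((!) \<theta>) \<psi>) F k w"
      unfolding w(1) fun_act_eval[OF psi w(2,3)] fun_act_eval[OF th mono_maps_comp[OF w(2) psi] w(3)]
        fun_act_eval[OF mono_maps_comp[OF psi th] w(2,3)] by (rule arg_cong)
  qed
qed

section \<open>The internal hom of scaled simplicial sets\<close>

lemma smaps_sc_prod: "smaps (sc_prod (scale A T) X) Y = smaps (sprod A X) Y"
  by (rule smaps_cong) (simp_all add: sc_prod_def sprod_def fun_eq_iff)

lemma FunSc_cells: "G \<in> cells (FunSc X Y) n \<longleftrightarrow> G \<in> smaps (sprod (simplex n) X) Y \<and>
    (\<forall>s\<in>mono_maps 2 n. \<not> distinct s \<longrightarrow> (\<forall>x\<in>thin X. G 2 (s, x) \<in> thin Y))"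
  by (auto simp: FunSc_def sc_maps_def smaps_sc_prod degenerate_simplex)

lemma FunSc_thin: "G \<in> thin (FunSc X Y) \<longleftrightarrow> G \<in> smaps (sprod (simplex 2) X) Y \<and>
    (\<forall>s\<in>mono_maps 2 2. \<forall>x\<in>thin X. G 2 (s, x) \<in> thin Y)"
  by (auto simp: FunSc_def sc_maps_def smaps_sc_prod)

lemma FunSc_act [simp]: "act (FunSc X Y) = fun_act X"
  by (simp add: FunSc_def)

lemma not_distinct_comp: "\<not> distinct s \<Longrightarrow> s \<in> mono_maps k m \<Longrightarrow> \<theta> \<in> mono_maps m n \<Longrightarrow> \<not> distinct (map ((!) \<theta>) s)"
  using distinct_map by blast

lemma small_not_distinct:
  assumes "\<theta> \<in> mono_maps k n" "n < k"
  shows "\<not> distinct \<theta>"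
proof
  assume "distinct \<theta>"
  then have "card (set \<theta>) = Suc k" using length_mono_maps[OF assms(1)] distinct_card by metis
  moreover have "set \<theta> \<subseteq> {..n}" using assms(1) by (simp add: mono_maps_def)
  then have "card (set \<theta>) \<le> card {..n}" by (rule card_mono[OF finite_atMost])
  ultimately show False using assms(2) by simp
qed

text \<open>An endomorphism of [2] other than the identity yields a degenerate triangle, on which
  every cell satisfies the condition already. Thinness is thus tested on \<theta> alone.\<close>

lemma FunSc_thin_act:
  assumes G: "G \<in> cells (FunSc X Y) n" and X: "scaled_sset X" and \<theta>: "\<theta> \<in> mono_maps 2 n"
  shows "fun_act X n \<theta> G \<in> thin (FunSc X Y) \<longleftrightarrow> (\<forall>x\<in>thin X. G 2 (\<theta>, x) \<in> thin Y)"
proof -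
  have Xs: "simplicial_set X" using X by (simp add: scaled_sset_def)
  have Gs: "G \<in> smaps (sprod (simplex n) X) Y"
    and Gd: "\<And>s x. s \<in> mono_maps 2 n \<Longrightarrow> \<not> distinct s \<Longrightarrow> x \<in> thin X \<Longrightarrow> G 2 (s, x) \<in> thin Y"
    using G by (auto simp: FunSc_cells)
  have ev: "fun_act X n \<theta> G 2 (s, x) = G 2 (map ((!) \<theta>) s, x)" if "s \<in> mono_maps 2 2" "x \<in> thin X" for s x
    by (rule fun_act_eval[OF \<theta> that(1) thin_cells[OF X that(2)]])
  have id: "map ((!) \<theta>) [0..<Suc 2] = \<theta>" by (rule map_id_nth[OF \<theta>])
  show ?thesis
  proof
    assume "fun_act X n \<theta> G \<in> thin (FunSc X Y)"
    then have "fun_act X n \<theta> G 2 ([0..<Suc 2], x) \<in> thin Y" if "x \<in> thin X" for x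
      using that id_mono_maps[of 2] unfolding FunSc_thin by blast
    then show "\<forall>x\<in>thin X. G 2 (\<theta>, x) \<in> thin Y" using ev[OF id_mono_maps] unfolding id by metis
  next
    assume a: "\<forall>x\<in>thin X. G 2 (\<theta>, x) \<in> thin Y"
    have "G 2 (map ((!) \<theta>) s, x) \<in> thin Y" if s: "s \<in> mono_maps 2 2" "x \<in> thin X" for s x
    proof (cases "distinct s")
      case True
      show ?thesis unfolding distinct_mono_maps_id[OF s(1) True] id using a s by blast
    next
      case False
      show ?thesis by (rule Gd[OF mono_maps_comp[OF s(1) \<theta>] not_distinct_comp[OF False s(1) \<theta>] s(2)])
    qed
    then show "fun_act X n \<theta> G \<in> thin (FunSc X Y)"
      unfolding FunSc_thin using fun_act_smaps[OF Xs Gs \<theta>] ev by simp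
  qed
qed

lemma FunSc_scaled:
  assumes X: "scaled_sset X"
  shows "scaled_sset (FunSc X Y)"
proof -
  have Xs: "simplicial_set X" using X by (simp add: scaled_sset_def)
  have S: "simplicial_set (FunSc X Y)"
  proof (rule simplicial_subset[OF simplicial_sFun[OF Xs, of Y]])
    show "act (FunSc X Y) = act (sFun X Y)" by (simp add: FunSc_def sFun_def)
    show "cells (FunSc X Y) n \<subseteq> cells (sFun X Y) n" for n by (auto simp: FunSc_cells)
    fix m n \<theta> G assume th: "\<theta> \<in> mono_maps m n" and G: "G \<in> cells (FunSc X Y) n"
    have "fun_act X n \<theta> G 2 (s, x) \<in> thin Y" if s: "s \<in> mono_maps 2 m" "\<not> distinct s" "x \<in> thin X" for s x
      unfolding fun_act_eval[OF th s(1) thin_cells[OF X s(3)]]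
      using G mono_maps_comp[OF s(1) th] not_distinct_comp[OF s(2,1) th] s(3) by (auto simp: FunSc_cells)
    then show "act (sFun X Y) n \<theta> G \<in> cells (FunSc X Y) m"
      using G fun_act_smaps[OF Xs _ th] by (auto simp: FunSc_cells)
  qed
  moreover have "thin (FunSc X Y) \<subseteq> cells (FunSc X Y) 2" by (auto simp: FunSc_cells FunSc_thin)
  moreover have "G \<in> thin (FunSc X Y)" if dg: "degenerate (FunSc X Y) 2 G" for G
  proof -
    obtain m \<theta> H where m: "m < 2" "\<theta> \<in> mono_maps 2 m" "H \<in> cells (FunSc X Y) m" "G = fun_act X m \<theta> H"
      using dg by (auto simp: degenerate_def)
    show ?thesis
      unfolding m(4) FunSc_thin_act[OF m(3) X m(2)] using m(2,3) small_not_distinct[OF m(2,1)] by (auto simp: FunSc_cells)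
  qed
  ultimately show ?thesis by (auto simp: scaled_sset_def)
qed

text \<open>The total single-valued relation obtained from \<open>extend\<close> becomes a family of
  functions, which is extensional as \<open>smaps\<close> demands.\<close>

lemma prism_extend_map:
  assumes "prism_extension Z Y n i S R0 Y0"
  shows "\<exists>F\<in>smaps (sprod (simplex n) Y) Z. (\<forall>k w y. (k, w, y) \<in> R0 \<longrightarrow> F k w = y) \<and>
    (\<forall>s y. (s, y) \<in> S \<longrightarrow> s \<in> mono_maps 2 n \<longrightarrow> y \<in> cells Y 2 \<longrightarrow> F 2 (s, y) \<in> thin Z)"
proof -
  interpret prism_extension Z Y n i S R0 Y0 by fact
  obtain R where R: "R0 \<subseteq> R" "pmap W Z S R" and tot: "\<And>k s y. s \<in> mono_maps k n \<Longrightarrow> y \<in> cells Y k \<Longrightarrow> (k, s, y) \<in> pdom R"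
    using extend by blast
  note RD = pmapD[OF R(2)]
  define F where "F k = (\<lambda>w\<in>cells W k. THE y. (k, w, y) \<in> R)" for k
  have FR: "(k, w, F k w) \<in> R" if "w \<in> cells W k" for k w
  proof -
    have "(k, w) \<in> pdom R" using tot that by (cases w) auto
    then obtain y where y: "(k, w, y) \<in> R" by (auto simp: pdom_def)
    have "\<exists>!y. (k, w, y) \<in> R" proof (rule ex1I)
      show "(k, w, y) \<in> R" by (rule y)
      show "y' = y" if "(k, w, y') \<in> R" for y' by (rule RD(3)[OF that y])
    qed
    from theI'[OF this] show ?thesis using that by (simp add: F_def)
  qed
  have Feq: "F k w = y" if "(k, w, y) \<in> R" for k w y using FR[OF RD(1)[OF that]] that RD(3) by blast
  have "F \<in> smaps W Z"
  proof (rule smapsI)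
    fix k w assume "w \<in> cells W k"
    then show "F k w \<in> cells Z k" using RD(2)[OF FR] by blast
  next
    fix m k \<theta> w assume "\<theta> \<in> mono_maps m k" "w \<in> cells W k"
    then show "F m (act W k \<theta> w) = act Z k \<theta> (F k w)" using Feq[OF RD(4)[OF _ FR]] by blast
  qed (simp add: F_def)
  moreover have "F 2 (s, y) \<in> thin Z" if "(s, y) \<in> S" "s \<in> mono_maps 2 n" "y \<in> cells Y 2" for s y
    using RD(5)[OF FR that(1)] that by simp
  ultimately show ?thesis using Feq R(1) by blast
qed

text \<open>Converse to \<open>horn_fill\<close>: by the Yoneda lemma a simplex extending the horn
  is an extension of the map.\<close>

lemma inner_fibI:
  assumes Z: "scaled_sset Z"
    and fill: "\<And>n i h. 2 \<le> n \<Longrightarrow> 0 < i \<Longrightarrow> i < n \<Longrightarrow> h \<in> smaps (horn n i) Z \<Longrightarrow>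
      ([i - 1, i, i + 1] \<in> cells (horn n i) 2 \<Longrightarrow> h 2 [i - 1, i, i + 1] \<in> thin Z) \<Longrightarrow>
      \<exists>y\<in>cells Z n. (\<forall>k. \<forall>s\<in>cells (horn n i) k. act Z n s y = h k s) \<and> act Z n [i - 1, i, i + 1] y \<in> thin Z"
    and sat: "\<And>\<rho>. \<rho> \<in> cells Z 3 \<Longrightarrow> act Z 3 [0,1,2] \<rho> \<in> thin Z \<Longrightarrow> act Z 3 [1,2,3] \<rho> \<in> thin Z \<Longrightarrow>
        act Z 3 [0,1,3] \<rho> \<in> thin Z \<longleftrightarrow> act Z 3 [0,2,3] \<rho> \<in> thin Z"
  shows "inner_fib Z"
  unfolding inner_fib_def
proof (intro conjI allI impI ballI)
  have Zs: "simplicial_set Z" using Z by (simp add: scaled_sset_def)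
  fix n i :: nat assume ni: "2 \<le> n \<and> 0 < i \<and> i < n"
  let ?T = "{[i - 1, i, i + 1]}"
  show "has_extensions Z (scale (horn n i) ?T) (scale (simplex n) ?T)"
    unfolding has_extensions_def
  proof
    fix h assume h: "h \<in> sc_maps (scale (horn n i) ?T) Z"
    then have hs: "h \<in> smaps (horn n i) Z"
      using smaps_cong[of "scale (horn n i) ?T" "horn n i" Z Z] by (simp add: sc_maps_def)
    have "h 2 [i - 1, i, i + 1] \<in> thin Z" if "[i - 1, i, i + 1] \<in> cells (horn n i) 2" using h that by (simp add: sc_maps_def)
    then obtain y where y: "y \<in> cells Z n" "\<And>k s. s \<in> cells (horn n i) k \<Longrightarrow> act Z n s y = h k s" "act Z n [i - 1, i, i + 1] y \<in> thin Z"
      using fill[OF _ _ _ hs] ni by blast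
    define g where "g = (\<lambda>k. \<lambda>s\<in>mono_maps k n. act Z n s y)"
    have gs: "g \<in> smaps (simplex n) Z" unfolding g_def by (rule yoneda[OF Zs y(1)])
    have "g \<in> sc_maps (scale (simplex n) ?T) Z"
      unfolding sc_maps_def
    proof (intro CollectI conjI ballI)
      show "g \<in> smaps (scale (simplex n) ?T) Z" using gs smaps_cong[of "scale (simplex n) ?T" "simplex n" Z Z] by simp
      fix \<sigma> assume "\<sigma> \<in> thin (scale (simplex n) ?T)"
      then show "g 2 \<sigma> \<in> thin Z"
        using y smaps_cells[OF gs, of \<sigma> 2] smaps_degenerate[OF gs, of \<sigma> 2] Z by (auto simp: g_def scaled_sset_def)
    qed
    moreover have "g k s = h k s" if "s \<in> cells (horn n i) k" for k s using y(2)[OF that] that by (simp add: g_def horn_cells)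
    ultimately show "\<exists>g\<in>sc_maps (scale (simplex n) ?T) Z. \<forall>k. \<forall>x\<in>cells (scale (horn n i) ?T) k. g k x = h k x" by auto
  qed
qed (use Z sat in auto)

text \<open>A repeated entry leaves at most two values, and these must cover the n vertices other
  than \<open>i\<close>.\<close>

lemma covering_triangle:
  assumes s: "s \<in> mono_maps 2 n" "s \<notin> cells (horn n i) 2" and i: "0 < i" "i < n" and nd: "\<not> distinct s"
  shows "n = 2 \<and> i = 1 \<and> (s = [0,0,2] \<or> s = [0,2,2])"
proof -
  obtain a b c where abc: "s = [a,b,c]"
    using length_mono_maps[OF s(1)] by (auto simp: length_Suc_conv numeral_2_eq_2)
  have m: "a \<le> b" "b \<le> c" "c \<le> n" using s(1) by (auto simp: abc mono_maps_def)
  have cov: "v \<in> {a,b,c}" if "v \<le> n" "v \<noteq> i" for v using s that by (auto simp: horn_cells abc)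
  have a0: "a = 0" using cov[of 0] m i by auto
  have cn: "c = n" using cov[of n] m i by auto
  have b: "b = 0 \<or> b = n" using nd m a0 cn by (auto simp: abc)
  have "n = 2"
  proof (rule ccontr)
    assume "n \<noteq> 2"
    then have "3 \<le> n" using i by simp
    then show False using cov[of 1] cov[of 2] a0 cn b by (cases "i = 1") auto
  qed
  then show ?thesis using i b a0 cn by (auto simp: abc)
qed

text \<open>A map from the horn to the functor bicategory is uncurried to a partial map on the horn
  times \<open>X\<close>, extended over the prism with empty \<open>Y0\<close>, and curried back.
  Saturation is inherited by doubling the middle vertex of a thin triangle of \<open>X\<close>,
  which gives the faces (0,1,2) and (1,2,3) degenerate \<open>X\<close>-components.\<close>

theorem FunSc_inner_fib:
  assumes X: "scaled_sset X" and E: "inner_fib E"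
  shows "inner_fib (FunSc X E)"
proof (rule inner_fibI[OF FunSc_scaled[OF X]])
  have Xs: "simplicial_set X" using X by (simp add: scaled_sset_def)
  have Es: "simplicial_set E" "scaled_sset E" using E by (auto simp: inner_fib_def scaled_sset_def)
  fix \<rho> assume r: "\<rho> \<in> cells (FunSc X E) 3" and t: "act (FunSc X E) 3 [0,1,2] \<rho> \<in> thin (FunSc X E)" "act (FunSc X E) 3 [1,2,3] \<rho> \<in> thin (FunSc X E)"
  have m: "[0,1,2] \<in> mono_maps 2 3" "[1,2,3] \<in> mono_maps 2 3" "[0,1,3] \<in> mono_maps 2 3" "[0,2,3] \<in> mono_maps 2 3" by (simp_all add: mono_maps_def)
  note T = FunSc_thin_act[OF r X]
  have t': "\<rho> 2 ([0,1,2], x) \<in> thin E" "\<rho> 2 ([1,2,3], x) \<in> thin E" if "x \<in> thin X" for x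
    using t that unfolding FunSc_act T[OF m(1)] T[OF m(2)] by blast+
  have rs: "\<rho> \<in> smaps (sprod (simplex 3) X) E" using r by (simp add: FunSc_cells)
  have "\<rho> 2 ([0,1,3], x) \<in> thin E \<longleftrightarrow> \<rho> 2 ([0,2,3], x) \<in> thin E" if x: "x \<in> thin X" for x
  proof -
    have xc: "x \<in> cells X 2" by (rule thin_cells[OF X x])
    have w: "([0,1,2,3], act X 2 [0,1,1,2] x) \<in> cells (sprod (simplex 3) X) 3"
      using act_cells[OF Xs, of "[0,1,1,2]" 3 2 x] xc by (simp add: list_in_mono_maps)
    have "act X 2 [0,1,1] x \<in> thin X" "act X 2 [1,1,2] x \<in> thin X" by (rule degenerate_thin[OF X xc]; simp add: list_in_mono_maps)+
    then show ?thesis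
      using smaps_saturation[OF E rs w] t' act_012[OF Xs xc, unfolded One_nat_def] by (simp add: act_list[OF Xs xc] list_in_mono_maps)
  qed
  then show "act (FunSc X E) 3 [0,1,3] \<rho> \<in> thin (FunSc X E) \<longleftrightarrow> act (FunSc X E) 3 [0,2,3] \<rho> \<in> thin (FunSc X E)"
    unfolding FunSc_act T[OF m(3)] T[OF m(4)] by blast
next
  have Xs: "simplicial_set X" using X by (simp add: scaled_sset_def)
  have Es: "simplicial_set E" "scaled_sset E" using E by (auto simp: inner_fib_def scaled_sset_def)
  fix n i h assume n: "2 \<le> n" "0 < i" "i < (n::nat)" and h: "h \<in> smaps (horn n i) (FunSc X E)"
    and ht: "[i - 1, i, i + 1] \<in> cells (horn n i) 2 \<Longrightarrow> h 2 [i - 1, i, i + 1] \<in> thin (FunSc X E)"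
  let ?H = "horn n i" and ?t = "[i - 1, i, i + 1]"
  have hc: "h k s \<in> smaps (sprod (simplex k) X) E" if "s \<in> cells ?H k" for k s
    using smaps_cells[OF h that] by (simp add: FunSc_cells)
  have hm: "s \<in> mono_maps k n" if "s \<in> cells ?H k" for k s using that by (simp add: horn_cells)
  \<comment> \<open>The uncurried map: the value of \<open>h\<close> at \<open>s\<close> is
    evaluated on the top simplex of the standard k-simplex.\<close>
  define u where "u k s x = h k s k ([0..<Suc k], x)" for k s x
  have ha: "h m (map ((!) s) \<theta>) m (p, x) = h k s m (map ((!) \<theta>) p, x)"
    if "s \<in> cells ?H k" "\<theta> \<in> mono_maps l k" "m' = m" "p \<in> mono_maps m l" "x \<in> cells X m" "l = m" for k s \<theta> l m p x m'
    using smaps_act[OF h that(1,2)] fun_act_eval[OF that(2,4,5), of "h k s"] that(6) by simp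
  have uh: "u m (map ((!) s) p) x = h k s m (p, x)" if "s \<in> cells ?H k" "p \<in> mono_maps m k" "x \<in> cells X m" for k s m p x
    using ha[OF that(1,2) refl id_mono_maps that(3) refl] map_id_nth[OF that(2)] unfolding u_def by simp
  define R0 where "R0 = {(k, (s, x), u k s x) | k s x. s \<in> cells ?H k \<and> x \<in> cells X k}"
  \<comment> \<open>The non-distinct lists make the extension a cell of \<open>FunSc X E\<close>;
    the triangle around \<open>i\<close> makes the corresponding face thin there.\<close>
  define S where "S = {(s, x). (\<not> distinct s \<or> s = ?t) \<and> x \<in> thin X}"
  have pm: "pmap (sprod (simplex n) X) E S R0"
    unfolding pmap_def
  proof (intro conjI allI impI)
    fix k w y assume "(k, w, y) \<in> R0"
    then obtain s x where w: "w = (s, x)" "y = u k s x" "s \<in> cells ?H k" "x \<in> cells X k" by (auto simp: R0_def)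
    show "w \<in> cells (sprod (simplex n) X) k" using w hm by simp
    show "y \<in> cells E k" unfolding w u_def by (rule smaps_cells[OF hc[OF w(3)]]) (use w in \<open>simp del: upt_Suc\<close>)
  next
    fix m k \<theta> w y assume th: "\<theta> \<in> mono_maps m k" and "(k, w, y) \<in> R0"
    then obtain s x where w: "w = (s, x)" "y = u k s x" "s \<in> cells ?H k" "x \<in> cells X k" by (auto simp: R0_def)
    have "act E k \<theta> y = h k s m (\<theta>, act X k \<theta> x)"
      using smaps_act[OF hc[OF w(3)] _ th, of "([0..<Suc k], x)"] w map_nth_id[OF th] by (simp add: u_def del: upt_Suc)
    then have "act E k \<theta> y = u m (map ((!) s) \<theta>) (act X k \<theta> x)" using uh[OF w(3) th act_cells[OF Xs th w(4)]] by simp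
    then show "(m, act (sprod (simplex n) X) k \<theta> w, act E k \<theta> y) \<in> R0"
      using horn_act_closed[OF th w(3)] act_cells[OF Xs th w(4)] unfolding R0_def w(1) by auto
  next
    fix w y assume "(2, w, y) \<in> R0" "w \<in> S"
    then obtain s x where w: "y = u 2 s x" "s \<in> cells ?H 2" "\<not> distinct s \<or> s = ?t" "x \<in> thin X" by (auto simp: R0_def S_def)
    have "h 2 s \<in> thin (FunSc X E)"
    proof (cases "distinct s")
      case True
      then show ?thesis using ht w by simp
    next
      case False
      have "degenerate ?H 2 s"
        using degenerate_act[OF simplicial_horn w(2) id_mono_maps] degenerate_iff[OF simplicial_horn w(2)]
          degenerate_iff[OF simplicial_simplex, of s n 2] degenerate_simplex[OF hm[OF w(2)]] hm[OF w(2)] False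
        by (simp add: ac_def)
      then show ?thesis
        using smaps_degenerate[OF h w(2)] smaps_cells[OF h w(2)] FunSc_scaled[OF X, of E] by (simp add: scaled_sset_def)
    qed
    then show "y \<in> thin E" using w id_mono_maps[of 2] unfolding FunSc_thin u_def by blast
  qed (auto simp: R0_def)
  have "prism_extension E X n i S R0 (\<lambda>_. {})"
  proof
    show "pmap (sprod (simplex n) X) E S R0" by fact
  next
    fix k s y assume "s \<in> mono_maps k n" "y \<in> cells X k"
    then show "(k, s, y) \<in> pdom R0 \<longleftrightarrow> s \<in> cells ?H k \<or> y \<in> {}" by (auto simp: R0_def pdom_def)
  next
    fix a y assume y: "y \<in> cells X 1" and a: "a = i - 1 \<or> a = i"
    have "act X 1 [0,1,1] y \<in> thin X" by (rule degenerate_thin[OF X y]) (auto simp: list_in_mono_maps)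
    then show "([a, i, i + 1], act X 1 [0,1,1] y) \<in> S" using a by (auto simp: S_def)
  next
    fix s y j l assume sS: "(s, y) \<in> S" and s: "s \<in> mono_maps 2 n" "s \<notin> cells ?H 2" and "y \<in> cells X 2"
      and j: "0 < j" "j \<le> 2" "s ! (j - 1) \<le> i" "s ! j = Suc i" and l: "l \<le> (3::nat)"
    have "mono_fn 2 2 (sigma j \<circ> delta l)" using mono_fn_comp[OF delta_mono[of 2 l] sigma_mono[OF j(2)]] by simp
    then have y': "ac X 2 2 (sigma j \<circ> delta l) y \<in> thin X"
      unfolding ac_def by (intro thin_act_endo[OF X]) (use sS in \<open>auto simp: S_def tab_in_iff\<close>)
    have l4: "l = 0 \<or> l = 1 \<or> l = 2 \<or> l = 3" using l by auto
    have j2: "j = 1 \<or> j = 2" using j by auto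
    let ?s = "tab 2 (\<lambda>q. tab 3 (\<lambda>q. if q = j then i else s ! sigma j q) ! delta l q)"
    have "\<not> distinct ?s \<or> ?s = ?t"
    proof (cases "distinct s")
      case True
      then have st: "s = ?t" using sS by (simp add: S_def)
      then have "j = 2" using j2 j n by auto
      then show ?thesis using l4 n unfolding st by (elim disjE) (simp_all add: tab2 tab3 delta_def sigma_def)
    next
      case False
      from covering_triangle[OF s n(2,3) False] have c: "n = 2" "i = 1" "s = [0,0,2] \<or> s = [0,2,2]" by auto
      show ?thesis using c(3) l4 j2 j unfolding c(1,2) by (elim disjE) (simp_all add: tab2 tab3 delta_def sigma_def)
    qed
    then show "(?s, ac X 2 2 (sigma j \<circ> delta l) y) \<in> S" using y' by (simp add: S_def)
  qed (use E Xs n in auto)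
  from prism_extend_map[OF this] obtain G where G: "G \<in> smaps (sprod (simplex n) X) E"
    and GR: "\<And>k w y. (k, w, y) \<in> R0 \<Longrightarrow> G k w = y"
    and GS: "\<And>s y. (s, y) \<in> S \<Longrightarrow> s \<in> mono_maps 2 n \<Longrightarrow> y \<in> cells X 2 \<Longrightarrow> G 2 (s, y) \<in> thin E" by blast
  have Gc: "G \<in> cells (FunSc X E) n"
    unfolding FunSc_cells using G GS thin_cells[OF X] by (auto simp: S_def)
  have tm: "?t \<in> mono_maps 2 n" using n by (auto simp: mono_maps_def)
  have Gt: "act (FunSc X E) n ?t G \<in> thin (FunSc X E)"
    unfolding FunSc_act FunSc_thin_act[OF Gc X tm] using GS[OF _ tm] thin_cells[OF X] by (auto simp: S_def)
  have Gh: "act (FunSc X E) n s G = h k s" if s: "s \<in> cells ?H k" for k s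
    unfolding FunSc_act
  proof (rule smaps_eqI[OF fun_act_smaps[OF Xs G hm[OF s]] hc[OF s]])
    fix m w assume "w \<in> cells (sprod (simplex k) X) m"
    then obtain p x where w: "w = (p, x)" "p \<in> mono_maps m k" "x \<in> cells X m" by auto
    have "(m, (map ((!) s) p, x), u m (map ((!) s) p) x) \<in> R0"
      unfolding R0_def using horn_act_closed[OF w(2) s] w(3) by blast
    then have "G m (map ((!) s) p, x) = u m (map ((!) s) p) x" by (rule GR)
    then show "fun_act X n s G m w = h k s m w"
      unfolding w(1) fun_act_eval[OF hm[OF s] w(2,3)] uh[OF s w(2,3)] .
  qed
  show "\<exists>y\<in>cells (FunSc X E) n. (\<forall>k. \<forall>s\<in>cells ?H k. act (FunSc X E) n s y = h k s) \<and> act (FunSc X E) n ?t y \<in> thin (FunSc X E)"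
    using Gc Gt Gh by blast
qed

section \<open>Exponentials of mapping categories\<close>

lemma Hom_cells: "f \<in> cells (Hom C x y) n \<longleftrightarrow> f \<in> smaps (sprod (simplex n) (simplex 1)) C \<and>
    (\<forall>k. \<forall>s\<in>mono_maps k n. f k (s, replicate (Suc k) 0) = const_cell C k x) \<and>
    (\<forall>k. \<forall>s\<in>mono_maps k n. f k (s, replicate (Suc k) 1) = const_cell C k y) \<and>
    (\<forall>i j. i \<le> j \<and> j \<le> n \<longrightarrow> f 2 ([i,i,j], [0,1,1]) \<in> thin C)"
  by (simp add: Hom_def)

lemma Hom_act [simp]: "act (Hom C x y) = fun_act (simplex 1)"
  by (simp add: Hom_def)

lemma map_nth_replicate: "\<theta> \<in> mono_maps m k \<Longrightarrow> map ((!) (replicate (Suc k) v)) \<theta> = replicate (Suc m) v"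
  using length_mono_maps[of \<theta> m k]
  by (intro nth_equalityI) (auto simp: mono_maps_def subset_iff less_Suc_eq_le simp del: replicate_Suc)

lemma simplicial_Hom: "simplicial_set (Hom C x y)"
proof (rule simplicial_subset[OF simplicial_sFun[OF simplicial_simplex, of 1 C]])
  show "act (Hom C x y) = act (sFun (simplex 1) C)" by (simp add: Hom_def sFun_def)
  show "cells (Hom C x y) n \<subseteq> cells (sFun (simplex 1) C) n" for n by (auto simp: Hom_cells)
  fix m n \<theta> f assume th: "\<theta> \<in> mono_maps m n" and f: "f \<in> cells (Hom C x y) n"
  have mon: "\<theta> ! i \<le> \<theta> ! j \<and> \<theta> ! j \<le> n" if "i \<le> j" "j \<le> m" for i j
    using mono_maps_nth[OF th] that by (auto simp: mono_fn_def)
  have r: "replicate (Suc k) v \<in> cells (simplex 1) k" if "v \<le> 1" for k v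
    using that replicate_mono_maps by simp
  have thin: "fun_act (simplex 1) n \<theta> f 2 ([i,i,j], [0,1,1]) \<in> thin C" if "i \<le> j" "j \<le> m" for i j
    using fun_act_eval[OF th, of "[i,i,j]" 2 "[0,1,1]" "simplex 1" f] that f mon[OF that]
    by (simp add: Hom_cells list_in_mono_maps)
  show "act (sFun (simplex 1) C) n \<theta> f \<in> cells (Hom C x y) m"
  proof -
    have fs: "f \<in> smaps (sprod (simplex n) (simplex 1)) C"
      and f0: "\<And>k s. s \<in> mono_maps k n \<Longrightarrow> f k (s, replicate (Suc k) 0) = const_cell C k x"
      and f1: "\<And>k s. s \<in> mono_maps k n \<Longrightarrow> f k (s, replicate (Suc k) 1) = const_cell C k y"
      using f unfolding Hom_cells by blast+
    have "fun_act (simplex 1) n \<theta> f k (s, replicate (Suc k) 0) = const_cell C k x"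
      "fun_act (simplex 1) n \<theta> f k (s, replicate (Suc k) 1) = const_cell C k y" if s: "s \<in> mono_maps k m" for k s
      unfolding fun_act_eval[OF th s r[OF zero_le]] fun_act_eval[OF th s r[OF order_refl]]
      by (rule f0 f1, rule mono_maps_comp[OF s th])+
    then show ?thesis
      unfolding Hom_cells sFun_sel using fun_act_smaps[OF simplicial_simplex fs th] thin by blast
  qed
qed

text \<open>The definition prescribes thinness only for [i,i,j] over [0,1,1]. The general triangle
  is compared with these in the 3-simplex with vertices (0,0), (0,1), (1,1), (2,1), whose face
  (1,2,3) is constant at \<open>y\<close>.\<close>

lemma Hom_thin:
  assumes C: "inner_fib C" and f: "f \<in> cells (Hom C x y) 2"
  shows "f 2 ([0,1,2], [0,1,1]) \<in> thin C"
proof -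
  have fs: "f \<in> smaps (sprod (simplex 2) (simplex 1)) C" using f by (simp add: Hom_cells)
  have Cs: "simplicial_set C" "scaled_sset C" using C by (auto simp: inner_fib_def scaled_sset_def)
  have w: "([0,0,1,2], [0,1,1,1]) \<in> cells (sprod (simplex 2) (simplex 1)) 3" by (simp add: list_in_mono_maps)
  have t: "f 2 ([0,0,1], [0,1,1]) \<in> thin C" "f 2 ([0,0,2], [0,1,1]) \<in> thin C" using f by (simp_all add: Hom_cells)
  have ones: "[1] = replicate (Suc 0) (1::nat)" "[1,1,1] = replicate (Suc 2) (1::nat)" by (simp_all add: numeral_2_eq_2)
  have f1: "f k (s, replicate (Suc k) 1) = const_cell C k y" if "s \<in> mono_maps k 2" for k s
    using f that unfolding Hom_cells by blast
  have y0: "f 0 ([0], [1]) \<in> cells C 0" by (rule smaps_cells[OF fs]) (simp add: list_in_mono_maps)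
  have "act C 0 [0,0,0] (f 0 ([0], [1])) = f 2 ([0,0,0], [1,1,1])"
    using smaps_act[OF fs, of "([0], [1])" 0 "[0,0,0]" 2] by (simp add: list_in_mono_maps)
  also have "\<dots> = f 2 ([0,1,2], [1,1,1])"
    unfolding ones(2) using f1[of "[0,0,0]" 2] f1[of "[0,1,2]" 2] by (simp add: list_in_mono_maps del: replicate_Suc)
  finally have "f 2 ([0,1,2], [1,1,1]) = act C 0 [0,0,0] (f 0 ([0], [1]))" by simp
  then have "f 2 ([0,1,2], [1,1,1]) \<in> thin C"
    using degenerate_thin[OF Cs(2) y0, of "[0,0,0]"] by (simp add: list_in_mono_maps)
  then show ?thesis using smaps_saturation[OF C fs w] t by simp
qed

text \<open>The exponential is formed by filling \<open>\<Lambda>\<^sup>n\<^sub>i \<times> A \<times> \<Delta>\<^sup>1 \<union> \<Delta>\<^sup>n \<times> A \<times> \<partial>\<Delta>\<^sup>1\<close>, where \<open>A\<close> is the mapping category.\<close>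

theorem Hom_exponential_quasi_cat:
  fixes C :: "'a scaled" and x y :: 'a
  assumes C: "inner_fib C" and xy: "x \<in> cells C 0" "y \<in> cells C 0"
  defines "A \<equiv> Hom C x y"
  shows "quasi_cat (sFun A A)"
  unfolding quasi_cat_def
proof (intro conjI allI impI ballI)
  have As: "simplicial_set A" unfolding A_def by (rule simplicial_Hom)
  have Cs: "simplicial_set C" "scaled_sset C" using C by (auto simp: inner_fib_def scaled_sset_def)
  show Qs: "simplicial_set (sFun A A)" by (rule simplicial_sFun[OF As])
  let ?I = "simplex 1"
  define Y where "Y = sprod A ?I"
  have Ys: "simplicial_set Y" unfolding Y_def by (rule simplicial_sprod[OF As simplicial_simplex])
  fix n i h assume i: "0 < i" "i < (n::nat)" and h: "h \<in> smaps (horn n i) (sFun A A)"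
  let ?H = "horn n i"
  have hm: "s \<in> mono_maps k n" if "s \<in> cells ?H k" for k s using that by (simp add: horn_cells)
  have hc: "h k s \<in> smaps (sprod (simplex k) A) A" if "s \<in> cells ?H k" for k s using smaps_cells[OF h that] by simp
  have hA: "h k s m (p, a) \<in> cells A m" if "s \<in> cells ?H k" "p \<in> mono_maps m k" "a \<in> cells A m" for k s m p a
    by (rule smaps_cells[OF hc[OF that(1)]]) (use that in simp)
  have As2: "f \<in> smaps (sprod (simplex k) ?I) C" if "f \<in> cells A k" for f k using that by (simp add: A_def Hom_cells)
  \<comment> \<open>Uncurried twice: the arguments are a simplex of the horn, one of
    \<open>A\<close> and one of the interval.\<close>
  define u where "u k s a t = h k s k ([0..<Suc k], a) k ([0..<Suc k], t)" for k s a t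
  have Aeval: "act A k \<theta> f m (p, t) = f m (map ((!) \<theta>) p, t)"
    if "\<theta> \<in> mono_maps l k" "p \<in> mono_maps m l" "t \<in> mono_maps m 1" for f k \<theta> l m p t
    using fun_act_eval[OF that(1,2), of t ?I f] that(3) by (simp add: A_def)
  have uh: "u l (map ((!) s) (map ((!) p) q)) (act A m q a) t = h k s m (p, a) l (q, t)"
    if s: "s \<in> cells ?H k" and p: "p \<in> mono_maps m k" and a: "a \<in> cells A m" and q: "q \<in> mono_maps l m" and t: "t \<in> mono_maps l 1"
    for k s m p a l q t
  proof -
    have pq: "map ((!) p) q \<in> mono_maps l k" by (rule mono_maps_comp[OF q p])
    have aq: "act A m q a \<in> cells A l" by (rule act_cells[OF As q a])
    have "h l (map ((!) s) (map ((!) p) q)) l ([0..<Suc l], act A m q a) = fun_act A k (map ((!) p) q) (h k s) l ([0..<Suc l], act A m q a)"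
      using smaps_act[OF h s pq] by simp
    also have "\<dots> = h k s l (map ((!) p) q, act A m q a)"
      using fun_act_eval[OF pq id_mono_maps aq, of "h k s"] map_id_nth[OF pq] by simp
    also have "\<dots> = act A m q (h k s m (p, a))"
      using smaps_act[OF hc[OF s] _ q, of "(p, a)"] p a by simp
    finally have "u l (map ((!) s) (map ((!) p) q)) (act A m q a) t = act A m q (h k s m (p, a)) l ([0..<Suc l], t)"
      by (simp add: u_def)
    also have "\<dots> = h k s m (p, a) l (q, t)" using Aeval[OF q id_mono_maps t] map_id_nth[OF q] by simp
    finally show ?thesis .
  qed
  let ?r = "\<lambda>k v. replicate (Suc k) (v::nat)"
  have cc: "const_cell C k x \<in> cells C k" "const_cell C k y \<in> cells C k" for k
    using const_cell_cells[OF Cs(1)] xy by auto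
  have u0: "u k s a (?r k 0) = const_cell C k x" "u k s a (?r k 1) = const_cell C k y" if "s \<in> cells ?H k" "a \<in> cells A k" for k s a
    using hA[OF that(1) id_mono_maps that(2)] id_mono_maps[of k] unfolding u_def A_def Hom_cells by blast+
  define R1 where "R1 = {(k, (s, (a, t)), u k s a t) | k s a t. s \<in> cells ?H k \<and> a \<in> cells A k \<and> t \<in> mono_maps k 1}"
  define R2 where "R2 = {(k, (s, (a, ?r k 0)), const_cell C k x) | k s a. s \<in> mono_maps k n \<and> a \<in> cells A k}"
  define R3 where "R3 = {(k, (s, (a, ?r k 1)), const_cell C k y) | k s a. s \<in> mono_maps k n \<and> a \<in> cells A k}"
  \<comment> \<open>The interval coordinate is constant on the edge (1,2). This depends on neither
    \<open>s\<close> nor \<open>a\<close>, is stable under the insertions in \<open>S2\<close>, and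
    includes the triangles over [0,1,1] that a mapping category requires to be thin. On the initial
    domain such triangles are thin by \<open>Hom_thin\<close> or constant.\<close>
  define S :: "(nat list \<times> (nat \<Rightarrow> nat list \<times> nat list \<Rightarrow> 'a) \<times> nat list) set" where "S = {(s, (a, t)). t ! 1 = t ! 2}"
  define Y0 where "Y0 k = {(a, t). a \<in> cells A k \<and> (t = ?r k 0 \<or> t = ?r k 1)}" for k
  have rm: "?r k 0 \<in> mono_maps k 1" "?r k 1 \<in> mono_maps k 1" for k by (rule replicate_mono_maps; simp)+
  have uc: "u k s a t \<in> cells C k" if "s \<in> cells ?H k" "a \<in> cells A k" "t \<in> mono_maps k 1" for k s a t
    unfolding u_def by (rule smaps_cells[OF As2[OF hA[OF that(1) id_mono_maps that(2)]]]) (use that id_mono_maps in simp)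
  have ua: "act C k \<theta> (u k s a t) = u m (map ((!) s) \<theta>) (act A k \<theta> a) (map ((!) t) \<theta>)"
    if "s \<in> cells ?H k" "a \<in> cells A k" "t \<in> mono_maps k 1" "\<theta> \<in> mono_maps m k" for k s a t m \<theta>
  proof -
    have "act C k \<theta> (u k s a t) = h k s k ([0..<Suc k], a) m (\<theta>, map ((!) t) \<theta>)"
      using smaps_act[OF As2[OF hA[OF that(1) id_mono_maps that(2)]] _ that(4), of "([0..<Suc k], t)"] that id_mono_maps map_nth_id[OF that(4)]
      by (simp add: u_def del: upt_Suc)
    then show ?thesis
      using uh[OF that(1) id_mono_maps that(2,4) mono_maps_comp[OF that(4,3)], unfolded map_nth_id[OF that(4)]] by simp
  qed
  have cthin: "const_cell C 2 v \<in> thin C" if "v \<in> cells C 0" for v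
    using degenerate_thin[OF Cs(2) that, of "?r 2 0"] replicate_mono_maps[of 0 0 2] by (simp add: const_cell_def numeral_2_eq_2)
  have pm: "pmap (sprod (simplex n) Y) C S (R1 \<union> R2 \<union> R3)"
    unfolding pmap_def
  proof (intro conjI allI impI)
    fix k w z assume "(k, w, z) \<in> R1 \<union> R2 \<union> R3"
    then show "w \<in> cells (sprod (simplex n) Y) k" "z \<in> cells C k"
      using hm uc rm cc unfolding R1_def R2_def R3_def Y_def by (auto simp del: replicate_Suc)
  next
    fix k w z z' assume a: "(k, w, z) \<in> R1 \<union> R2 \<union> R3" "(k, w, z') \<in> R1 \<union> R2 \<union> R3"
    obtain s a t where w: "w = (s, (a, t))" by (cases w) auto
    have neq: "?r k 0 \<noteq> ?r k 1" by simp
    \<comment> \<open>The three pieces overlap where \<open>t\<close> is constant; there the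
      simplices of a mapping category are constant at \<open>x\<close> or \<open>y\<close>.\<close>
    define val where "val = (if t = ?r k 0 then const_cell C k x else if t = ?r k 1 then const_cell C k y else u k s a t)"
    have "z = val" if "(k, w, z) \<in> R1 \<union> R2 \<union> R3" for z
      using that u0 neq unfolding R1_def R2_def R3_def w val_def by (auto simp del: replicate_Suc)
    with a show "z = z'" by blast
  next
    fix m k \<theta> w z assume th: "\<theta> \<in> mono_maps m k" and a: "(k, w, z) \<in> R1 \<union> R2 \<union> R3"
    obtain s a t where w: "w = (s, (a, t))" by (cases w) auto
    have e: "act (sprod (simplex n) Y) k \<theta> w = (map ((!) s) \<theta>, (act A k \<theta> a, map ((!) t) \<theta>))"
      by (simp add: w Y_def)
    have ra: "map ((!) (?r k v)) \<theta> = ?r m v" for v by (rule map_nth_replicate[OF th])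
    from a consider "(k, w, z) \<in> R1" | "(k, w, z) \<in> R2" | "(k, w, z) \<in> R3" by blast
    then show "(m, act (sprod (simplex n) Y) k \<theta> w, act C k \<theta> z) \<in> R1 \<union> R2 \<union> R3"
    proof cases
      case 1
      then have f: "s \<in> cells ?H k" "a \<in> cells A k" "t \<in> mono_maps k 1" "z = u k s a t" by (auto simp: R1_def w)
      have "(m, act (sprod (simplex n) Y) k \<theta> w, act C k \<theta> z) \<in> R1"
        unfolding e f(4) ua[OF f(1-3) th] R1_def
        using horn_act_closed[OF th f(1)] act_cells[OF As th f(2)] mono_maps_comp[OF th f(3)] by blast
      then show ?thesis by blast
    next
      case 2
      then have f: "s \<in> mono_maps k n" "a \<in> cells A k" "t = ?r k 0" "z = const_cell C k x" by (auto simp: R2_def w)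
      have "(m, act (sprod (simplex n) Y) k \<theta> w, act C k \<theta> z) \<in> R2"
        unfolding e f(3,4) ra const_cell_act[OF Cs(1) xy(1) th] R2_def
        using mono_maps_comp[OF th f(1)] act_cells[OF As th f(2)] by blast
      then show ?thesis by blast
    next
      case 3
      then have f: "s \<in> mono_maps k n" "a \<in> cells A k" "t = ?r k 1" "z = const_cell C k y" by (auto simp: R3_def w)
      have "(m, act (sprod (simplex n) Y) k \<theta> w, act C k \<theta> z) \<in> R3"
        unfolding e f(3,4) ra const_cell_act[OF Cs(1) xy(2) th] R3_def
        using mono_maps_comp[OF th f(1)] act_cells[OF As th f(2)] by blast
      then show ?thesis by blast
    qed
  next
    fix w z assume a: "(2, w, z) \<in> R1 \<union> R2 \<union> R3" and "w \<in> S"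
    obtain s a t where w: "w = (s, (a, t))" by (cases w) auto
    have t12: "t ! 1 = t ! 2" using \<open>w \<in> S\<close> by (simp add: S_def w)
    from a consider "(2, w, z) \<in> R1" | "z = const_cell C 2 x \<or> z = const_cell C 2 y" by (auto simp: R2_def R3_def)
    then show "z \<in> thin C"
    proof cases
      case 1
      then have f: "s \<in> cells ?H 2" "a \<in> cells A 2" "t \<in> mono_maps 2 1" "z = u 2 s a t" by (auto simp: R1_def w)
      obtain p q r where pqr: "t = [p,q,r]" using length_mono_maps[OF f(3)] by (auto simp: length_Suc_conv numeral_2_eq_2)
      have "q = r" using t12 by (simp add: pqr)
      moreover have "p \<le> q" "q \<le> 1" using f(3) by (auto simp: pqr mono_maps_def)
      ultimately have "t = [0,0,0] \<or> t = [1,1,1] \<or> t = [0,1,1]" by (auto simp: pqr)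
      moreover have "[0,0,0] = ?r 2 0" "[1,1,1] = ?r 2 1" by (simp_all add: numeral_2_eq_2)
      ultimately consider "t = ?r 2 0" | "t = ?r 2 1" | "t = [0,1,1]" by argo
      then show ?thesis
      proof cases
        case 1 then show ?thesis using u0(1)[OF f(1,2)] f(4) cthin[OF xy(1)] by simp
      next
        case 2 then show ?thesis using u0(2)[OF f(1,2)] f(4) cthin[OF xy(2)] by simp
      next
        case 3
        have "[0..<Suc 2] = [0,1,2]" by (simp add: numeral_2_eq_2)
        then show ?thesis
          using Hom_thin[OF C hA[OF f(1) id_mono_maps f(2), unfolded A_def]] f(4) 3 by (simp add: u_def A_def del: upt_Suc)
      qed
    qed (use cthin xy in auto)
  qed
  have "prism_extension C Y n i S (R1 \<union> R2 \<union> R3) Y0"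
  proof
    show "pmap (sprod (simplex n) Y) C S (R1 \<union> R2 \<union> R3)" by fact
  next
    fix m k \<theta> w assume th: "\<theta> \<in> mono_maps m k" and "w \<in> Y0 k"
    then show "act Y k \<theta> w \<in> Y0 m"
      using act_cells[OF As th] map_nth_replicate[OF th, of "0::nat"] map_nth_replicate[OF th, of "1::nat"]
      by (auto simp: Y0_def Y_def simp del: replicate_Suc)
  next
    fix k s w assume s: "s \<in> mono_maps k n" and w: "w \<in> cells Y k"
    obtain a t where at: "w = (a, t)" by (cases w)
    have "a \<in> cells A k" "t \<in> mono_maps k 1" using w by (auto simp: at Y_def)
    then show "(k, s, w) \<in> pdom (R1 \<union> R2 \<union> R3) \<longleftrightarrow> s \<in> cells ?H k \<or> w \<in> Y0 k"
      using s unfolding pdom_def R1_def R2_def R3_def Y0_def at by blast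
  next
    fix b w assume "w \<in> cells Y 1"
    then obtain a t where at: "w = (a, t)" by (cases w) 
    show "([b, i, i + 1], act Y 1 [0,1,1] w) \<in> S" by (simp add: at Y_def S_def)
  next
    fix s w j l assume sS: "(s, w) \<in> S" and wc: "w \<in> cells Y 2" and j: "0 < j" "j \<le> (2::nat)" and l: "l \<le> (3::nat)"
    obtain a t where at: "w = (a, t)" by (cases w)
    have "t ! 1 = t ! 2" using sS by (simp add: S_def at)
    \<comment> \<open>As \<open>j\<close> is positive, the positions 1 and 2 never move to
      0.\<close>
    moreover have "sigma j (delta l 1) = 1 \<or> sigma j (delta l 1) = 2" "sigma j (delta l 2) = 1 \<or> sigma j (delta l 2) = 2"
      using j by (auto simp: sigma_def delta_def)
    ultimately have "t ! sigma j (delta l 1) = t ! sigma j (delta l 2)" by metis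
    then show "(tab 2 (\<lambda>q. tab 3 (\<lambda>q. if q = j then i else s ! sigma j q) ! delta l q), ac Y 2 2 (sigma j \<circ> delta l) w) \<in> S"
      by (simp add: at Y_def S_def ac_sprod ac_simplex)
  qed (use C Ys i in auto)
  from prism_extend_map[OF this] obtain F where F: "F \<in> smaps (sprod (simplex n) Y) C"
    and FR: "\<And>k w z. (k, w, z) \<in> R1 \<union> R2 \<union> R3 \<Longrightarrow> F k w = z"
    and FS: "\<And>s w. (s, w) \<in> S \<Longrightarrow> s \<in> mono_maps 2 n \<Longrightarrow> w \<in> cells Y 2 \<Longrightarrow> F 2 (s, w) \<in> thin C" by blast
  \<comment> \<open>Currying back: the pair (s, a) is first restricted along
    \<open>p\<close>.\<close>
  define G where "G k = (\<lambda>(s, a)\<in>cells (sprod (simplex n) A) k. \<lambda>m. \<lambda>(p, t)\<in>cells (sprod (simplex k) ?I) m.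
      F m (map ((!) s) p, (act A k p a, t)))" for k
  have Gev: "G k (s, a) m (p, t) = F m (map ((!) s) p, (act A k p a, t))"
    if "s \<in> mono_maps k n" "a \<in> cells A k" "p \<in> mono_maps m k" "t \<in> mono_maps m 1" for k s a m p t
    using that by (simp add: G_def)
  have GA: "G k (s, a) \<in> cells A k" if s: "s \<in> mono_maps k n" and a: "a \<in> cells A k" for k s a
    unfolding A_def Hom_cells
  proof (intro conjI allI ballI impI)
    show "G k (s, a) \<in> smaps (sprod (simplex k) ?I) C"
    proof (rule smapsI)
      fix m w assume "w \<in> cells (sprod (simplex k) ?I) m"
      then obtain p t where w: "w = (p, t)" "p \<in> mono_maps m k" "t \<in> mono_maps m 1" by auto
      show "G k (s, a) m w \<in> cells C m"
        unfolding w(1) Gev[OF s a w(2,3)] by (rule smaps_cells[OF F])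
          (use mono_maps_comp[OF w(2) s] act_cells[OF As w(2) a] w in \<open>simp add: Y_def\<close>)
      fix l \<psi> assume psi: "\<psi> \<in> mono_maps l m"
      have eq: "map ((!) s) (map ((!) p) \<psi>) = map ((!) (map ((!) s) p)) \<psi>"
        using psi length_mono_maps[OF w(2)] by (auto simp: mono_maps_def)
      have "G k (s, a) l (act (sprod (simplex k) ?I) m \<psi> w) = F l (map ((!) s) (map ((!) p) \<psi>), (act A k (map ((!) p) \<psi>) a, map ((!) t) \<psi>))"
        unfolding w(1) using Gev[OF s a mono_maps_comp[OF psi w(2)] mono_maps_comp[OF psi w(3)]] by simp
      also have "\<dots> = F l (act (sprod (simplex n) Y) m \<psi> (map ((!) s) p, (act A k p a, t)))"
        unfolding eq using act_act[OF As psi w(2) a] by (simp add: Y_def)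
      also have "\<dots> = act C m \<psi> (F m (map ((!) s) p, (act A k p a, t)))"
        by (rule smaps_act[OF F _ psi]) (use mono_maps_comp[OF w(2) s] act_cells[OF As w(2) a] w in \<open>simp add: Y_def\<close>)
      finally show "G k (s, a) l (act (sprod (simplex k) ?I) m \<psi> w) = act C m \<psi> (G k (s, a) m w)"
        unfolding w(1) Gev[OF s a w(2,3)] .
    next
      fix m w assume "w \<notin> cells (sprod (simplex k) ?I) m"
      then show "G k (s, a) m w = undefined" using s a by (simp add: G_def)
    qed
    fix m p assume p: "p \<in> mono_maps m k"
    have "(m, (map ((!) s) p, (act A k p a, ?r m 0)), const_cell C m x) \<in> R2"
      "(m, (map ((!) s) p, (act A k p a, ?r m 1)), const_cell C m y) \<in> R3"
      unfolding R2_def R3_def using mono_maps_comp[OF p s] act_cells[OF As p a] by blast+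
    then show "G k (s, a) m (p, ?r m 0) = const_cell C m x" "G k (s, a) m (p, ?r m 1) = const_cell C m y"
      unfolding Gev[OF s a p rm(1)] Gev[OF s a p rm(2)] using FR by blast+
  next
    fix b c assume bc: "b \<le> c \<and> c \<le> k"
    then have p: "[b,b,c] \<in> mono_maps 2 k" by (simp add: list_in_mono_maps)
    have t: "[0,1,1] \<in> mono_maps 2 1" by (simp add: list_in_mono_maps)
    show "G k (s, a) 2 ([b,b,c], [0,1,1]) \<in> thin C"
      unfolding Gev[OF s a p t] using mono_maps_comp[OF p s] act_cells[OF As p a] t
      by (intro FS) (auto simp: S_def Y_def)
  qed
  have Aeq: "f = g" if "f \<in> cells A k" "g \<in> cells A k" "\<And>m p t. p \<in> mono_maps m k \<Longrightarrow> t \<in> mono_maps m 1 \<Longrightarrow> f m (p, t) = g m (p, t)" for f g k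
    by (rule smaps_eqI[OF As2[OF that(1)] As2[OF that(2)]]) (use that(3) in auto)
  have Gs: "G \<in> smaps (sprod (simplex n) A) A"
  proof (rule smapsI)
    fix k w assume "w \<in> cells (sprod (simplex n) A) k"
    then obtain s a where w: "w = (s, a)" "s \<in> mono_maps k n" "a \<in> cells A k" by auto
    show "G k w \<in> cells A k" using GA w by simp
    fix m \<theta> assume th: "\<theta> \<in> mono_maps m k"
    have sth: "map ((!) s) \<theta> \<in> mono_maps m n" and ath: "act A k \<theta> a \<in> cells A m"
      using mono_maps_comp[OF th w(2)] act_cells[OF As th w(3)] by auto
    have "G m (map ((!) s) \<theta>, act A k \<theta> a) = act A k \<theta> (G k (s, a))"
    proof (rule Aeq[OF GA[OF sth ath] act_cells[OF As th GA[OF w(2,3)]]])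
      fix l p t assume p: "p \<in> mono_maps l m" and t: "t \<in> mono_maps l 1"
      have eq: "map ((!) (map ((!) s) \<theta>)) p = map ((!) s) (map ((!) \<theta>) p)"
        using p length_mono_maps[OF th] by (auto simp: mono_maps_def)
      show "G m (map ((!) s) \<theta>, act A k \<theta> a) l (p, t) = act A k \<theta> (G k (s, a)) l (p, t)"
        unfolding Gev[OF sth ath p t] Aeval[OF th p t] Gev[OF w(2,3) mono_maps_comp[OF p th] t] eq act_act[OF As p th w(3)] ..
    qed
    then show "G m (act (sprod (simplex n) A) k \<theta> w) = act A k \<theta> (G k w)" by (simp add: w)
  qed (simp add: G_def)
  have Gh: "fun_act A n s G = h k s" if s: "s \<in> cells ?H k" for k s
  proof (rule smaps_eqI[OF fun_act_smaps[OF As Gs hm[OF s]] hc[OF s]])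
    fix m w assume "w \<in> cells (sprod (simplex k) A) m"
    then obtain p a where w: "w = (p, a)" "p \<in> mono_maps m k" "a \<in> cells A m" by auto
    have sp: "map ((!) s) p \<in> mono_maps m n" by (rule mono_maps_comp[OF w(2) hm[OF s]])
    have "G m (map ((!) s) p, a) = h k s m (p, a)"
    proof (rule Aeq[OF GA[OF sp w(3)] hA[OF s w(2,3)]])
      fix l q t assume q: "q \<in> mono_maps l m" and t: "t \<in> mono_maps l 1"
      have eq: "map ((!) (map ((!) s) p)) q = map ((!) s) (map ((!) p) q)"
        using q length_mono_maps[OF w(2)] by (auto simp: mono_maps_def)
      have "(l, (map ((!) s) (map ((!) p) q), (act A m q a, t)), u l (map ((!) s) (map ((!) p) q)) (act A m q a) t) \<in> R1"
        unfolding R1_def using horn_act_closed[OF mono_maps_comp[OF q w(2)] s] act_cells[OF As q w(3)] t by blast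
      then have "F l (map ((!) s) (map ((!) p) q), (act A m q a, t)) = u l (map ((!) s) (map ((!) p) q)) (act A m q a) t"
        using FR by blast
      then show "G m (map ((!) s) p, a) l (q, t) = h k s m (p, a) l (q, t)"
        unfolding Gev[OF sp w(3) q t] eq uh[OF s w(2,3) q t] .
    qed
    then show "fun_act A n s G m w = h k s m w" unfolding w(1) fun_act_eval[OF hm[OF s] w(2,3)] .
  qed
  have "G \<in> cells (sFun A A) n" using Gs by simp
  from yoneda[OF Qs this] show "\<exists>g\<in>smaps (simplex n) (sFun A A). \<forall>k. \<forall>s\<in>cells ?H k. g k s = h k s"
    by (rule bexI[rotated]) (use Gh hm in auto)
qed

section \<open>Natural transformations\<close>

lemma sprod_cong: "cells X = cells X' \<Longrightarrow> act X = act X' \<Longrightarrow> sprod A X = sprod A X'"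
  by (simp add: sprod_def)

lemma fun_act_cong: "cells X = cells X' \<Longrightarrow> act X = act X' \<Longrightarrow> fun_act X = fun_act X'"
  by (intro ext) (simp add: fun_act_def sprod_cong[of X X'])

lemma scale_scaled: "simplicial_set X \<Longrightarrow> scaled_sset (scale X T)"
  using simplicial_set_cong[of "scale X T" X] degenerate_cong[of "scale X T" X] by (auto simp: scaled_sset_def)

lemma sc_prod_scaled:
  assumes C: "scaled_sset C" and D: "scaled_sset D"
  shows "scaled_sset (sc_prod C D)"
proof -
  have s: "simplicial_set (sprod C D)" using C D by (auto simp: scaled_sset_def intro: simplicial_sprod)
  then have S: "simplicial_set (sc_prod C D)" using simplicial_set_cong[of "sc_prod C D" "sprod C D"] by (simp add: sc_prod_def)
  have "(\<alpha>, \<beta>) \<in> thin C \<times> thin D" if dg: "degenerate (sc_prod C D) 2 (\<alpha>, \<beta>)" for \<alpha> \<beta>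
  proof -
    obtain m \<theta> a b where m: "m < 2" "\<theta> \<in> mono_maps 2 m" "a \<in> cells C m" "b \<in> cells D m"
      "\<alpha> = act C m \<theta> a" "\<beta> = act D m \<theta> b" using dg by (auto simp: degenerate_def)
    then show ?thesis
      using degenerate_thin[OF C m(3,2)] degenerate_thin[OF D m(4,2)] small_not_distinct[OF m(2,1)] by simp
  qed
  then show ?thesis using S thin_cells[OF C] thin_cells[OF D] by (auto simp: scaled_sset_def)
qed

text \<open>As \<open>x\<close> is an arbitrary triangle, the transformation is known to be thin
  only where both components are degenerate. Two prisms still carry thinness from the end at 1 to
  [0,1,1] and on to [0,0,1]; reaching [0,0,0] means cancelling a component of the
  transformation.\<close>

lemma FunSc_edge_lax:
  assumes X: "scaled_sset X" and E: "inner_fib E" and e: "e \<in> cells (FunSc X E) 1" and x: "x \<in> cells X 2"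
    and t: "e 2 ([1,1,1], x) \<in> thin E"
  shows "e 2 ([0,1,1], x) \<in> thin E" "e 2 ([0,0,1], x) \<in> thin E"
proof -
  have Xs: "simplicial_set X" using X by (simp add: scaled_sset_def)
  have es: "e \<in> smaps (sprod (simplex 1) X) E" using e by (simp add: FunSc_cells)
  have dg: "e 2 (s, act X 2 \<theta> x) \<in> thin E"
    if "s \<in> mono_maps 2 1" "\<theta> \<in> mono_maps 2 2" "\<not> distinct s" "\<not> distinct \<theta>" for s \<theta>
    using e degenerate_thin[OF X x that(2,4)] that unfolding FunSc_cells by blast
  note l = act_list[OF Xs x] act_012[OF Xs x, unfolded One_nat_def] list_in_mono_maps
  have c: "act X 2 \<theta> x \<in> cells X 3" if "\<theta> \<in> mono_maps 3 2" for \<theta> by (rule act_cells[OF Xs that x])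
  have w1: "([0,1,1,1], act X 2 [0,0,1,2] x) \<in> cells (sprod (simplex 1) X) 3" using c by (simp add: list_in_mono_maps)
  show 1: "e 2 ([0,1,1], x) \<in> thin E"
    using smaps_saturation[OF E es w1] dg[of "[0,1,1]" "[0,0,1]"] dg[of "[0,1,1]" "[0,0,2]"] t by (simp add: l)
  have w2: "([0,0,1,1], act X 2 [0,1,1,2] x) \<in> cells (sprod (simplex 1) X) 3" using c by (simp add: list_in_mono_maps)
  show 2: "e 2 ([0,0,1], x) \<in> thin E"
    using smaps_saturation[OF E es w2] dg[of "[0,0,1]" "[0,1,1]"] dg[of "[0,1,1]" "[1,1,2]"] 1 by (simp add: l)
qed

text \<open>In the 3-simplex \<rho> the triangle \<open>x\<close> at the source is followed by the
  component of \<open>e\<close> at the last vertex of \<open>x\<close>. Evaluating \<sigma> at that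
  vertex gives a thin triangle that cancels the component, so \<open>outer_saturation\<close>
  applies.\<close>

lemma FunSc_edge_inv:
  assumes X: "scaled_sset X" and E: "inner_fib E" and e: "e \<in> cells (FunSc X E) 1" and x: "x \<in> cells X 2"
    and t: "e 2 ([1,1,1], x) \<in> thin E" and inv: "two_inv (thin_core (FunSc X E)) e"
  shows "e 2 ([0,0,0], x) \<in> thin E"
proof -
  have Xs: "simplicial_set X" using X by (simp add: scaled_sset_def)
  have es: "e \<in> smaps (sprod (simplex 1) X) E" using e by (simp add: FunSc_cells)
  have dg: "e 2 (s, act X 2 \<theta> x) \<in> thin E"
    if "s \<in> mono_maps 2 1" "\<theta> \<in> mono_maps 2 2" "\<not> distinct s" "\<not> distinct \<theta>" for s \<theta>
    using e degenerate_thin[OF X x that(2,4)] that unfolding FunSc_cells by blast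
  note l = act_list[OF Xs x] act_012[OF Xs x, unfolded One_nat_def] list_in_mono_maps
  obtain \<sigma> where s: "\<sigma> \<in> thin (FunSc X E)" "fun_act X 2 [0,1] \<sigma> = e" "fun_act X 2 [0,2] \<sigma> = fun_act X 1 [0,0] e"
    using two_inv_triangles[OF FunSc_inner_fib[OF X E] inv] by (metis FunSc_act)
  have ss: "\<sigma> \<in> smaps (sprod (simplex 2) X) E" using s(1) by (simp add: FunSc_thin)
  define v where "v = act X 2 [2,2,2] x"
  define v1 where "v1 = act X 2 [2,2] x"
  have v: "v \<in> thin X" unfolding v_def by (rule degenerate_thin[OF X x]) (simp_all add: list_in_mono_maps)
  have v1: "v1 \<in> cells X 1" unfolding v1_def by (rule act_cells[OF Xs _ x]) (simp add: list_in_mono_maps)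
  have vv: "act X 2 [0,1] v = v1" "act X 2 [0,2] v = v1" by (simp_all add: v_def v1_def l)
  define \<tau> where "\<tau> = \<sigma> 2 ([0,1,2], v)"
  have wv: "([0,1,2], v) \<in> cells (sprod (simplex 2) X) 2" using thin_cells[OF X v] by (simp add: list_in_mono_maps)
  have \<tau>: "\<tau> \<in> thin E" using s(1) v unfolding FunSc_thin \<tau>_def by (auto simp: list_in_mono_maps)
  have m: "[0,1] \<in> mono_maps 1 2" "[0,2] \<in> mono_maps 1 2" "[0,1] \<in> mono_maps 1 1" "[0,0] \<in> mono_maps 1 1" by (simp_all add: mono_maps_def)
  have t01: "act E 2 [0,1] \<tau> = e 1 ([0,1], v1)"
    using smaps_act[OF ss wv m(1)] fun_act_eval[OF m(1,3) v1, of \<sigma>] s(2) vv by (simp add: \<tau>_def)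
  have t02: "act E 2 [0,2] \<tau> = e 1 ([0,0], v1)"
    using smaps_act[OF ss wv m(2)] fun_act_eval[OF m(2,3) v1, of \<sigma>] fun_act_eval[OF m(4,3) v1, of e] s(3) vv by (simp add: \<tau>_def)
  define \<rho> where "\<rho> = e 3 ([0,0,0,1], act X 2 [0,1,2,2] x)"
  have w: "([0,0,0,1], act X 2 [0,1,2,2] x) \<in> cells (sprod (simplex 1) X) 3"
    using act_cells[OF Xs, of "[0,1,2,2]" 3 2 x] x by (simp add: list_in_mono_maps)
  have r: "\<rho> \<in> cells E 3" unfolding \<rho>_def by (rule smaps_cells[OF es w])
  have ra: "act E 3 \<theta> \<rho> = e k (map ((!) [0,0,0,1]) \<theta>, act X 2 (map ((!) [0,1,2,2]) \<theta>) x)" if "\<theta> \<in> mono_maps k 3" for \<theta> k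
    unfolding \<rho>_def using smaps_act[OF es w that] act_act[OF Xs that _ x, of "[0,1,2,2]"] by (simp add: list_in_mono_maps)
  have "act E 3 [0,1,2] \<rho> \<in> thin E"
  proof (rule outer_saturation[OF E r])
    show "act E 3 [0,1,3] \<rho> \<in> thin E" "act E 3 [0,2,3] \<rho> \<in> thin E" "act E 3 [1,2,3] \<rho> \<in> thin E"
      using FunSc_edge_lax(2)[OF X E e x t] dg[of "[0,0,1]" "[0,2,2]"] dg[of "[0,0,1]" "[1,2,2]"]
      by (simp_all add: ra[where k = 2] l)
    show "\<tau> \<in> thin E" by fact
    show "act E 2 [0,1] \<tau> = act E 3 [2,3] \<rho>" "act E 2 [0,2] \<tau> = act E 3 [2,2] \<rho>"
      unfolding t01 t02 v1_def by (simp_all add: ra[where k = 1] list_in_mono_maps)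
  qed
  then show ?thesis by (simp add: ra[where k = 2] l)
qed

lemma FunSc_vertex_cells: "G \<in> cells (FunSc X Y) 0 \<longleftrightarrow> G \<in> smaps (sprod (simplex 0) X) Y \<and> (\<forall>x\<in>thin X. G 2 ([0,0,0], x) \<in> thin Y)"
proof -
  have *: "s \<in> mono_maps 2 0 \<longleftrightarrow> s = [0,0,0]" for s
  proof
    assume "s \<in> mono_maps 2 0"
    then show "s = [0,0,0]" by (auto simp: mono_maps_def numeral_2_eq_2 length_Suc_conv)
  qed (simp add: mono_maps_def)
  then have "mono_maps 2 0 = {[0,0,0]}" by blast
  then show ?thesis unfolding FunSc_cells by simp
qed

text \<open>
  Thinness on \<open>X'\<close> passes from the end points of a transformation to its components by \<open>FunSc_edge_lax\<close>, so
  the larger scaling imposes no further condition on the simplices of the mapping category.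
\<close>

lemma Hom_FunSc_eq:
  assumes X: "scaled_sset X" and E: "inner_fib E" and same: "cells X' = cells X" "act X' = act X" and sub: "thin X \<subseteq> thin X'"
    and c': "thin X' \<subseteq> cells X 2" and \<phi>: "\<phi> \<in> cells (FunSc X' E) 0" and \<psi>: "\<psi> \<in> cells (FunSc X' E) 0"
  shows "Hom (FunSc X' E) \<phi> \<psi> = Hom (FunSc X E) \<phi> \<psi>"
proof -
  have Xs: "simplicial_set X" using X by (simp add: scaled_sset_def)
  let ?Z = "FunSc X E" and ?Z' = "FunSc X' E" and ?I = "simplex 1"
  have fa: "fun_act X' = fun_act X" by (rule fun_act_cong[OF same])
  have act: "act ?Z' = act ?Z" by (simp add: FunSc_def fa)
  have sp: "sprod (simplex n) X' = sprod (simplex n) X" for n by (rule sprod_cong[OF same])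
  have sub0: "cells ?Z' n \<subseteq> cells ?Z n" for n using sub unfolding FunSc_cells sp subset_iff by blast
  have subt: "thin ?Z' \<subseteq> thin ?Z" using sub unfolding FunSc_thin sp subset_iff by blast
  have cc: "const_cell ?Z' = const_cell ?Z" by (intro ext) (simp add: const_cell_def fa)
  have "f \<in> cells (Hom ?Z' \<phi> \<psi>) n \<longleftrightarrow> f \<in> cells (Hom ?Z \<phi> \<psi>) n" for f n
  proof
    assume f: "f \<in> cells (Hom ?Z' \<phi> \<psi>) n"
    have "f \<in> smaps (sprod (simplex n) ?I) ?Z"
    proof (rule smapsI)
      show "f k w \<in> cells ?Z k" if "w \<in> cells (sprod (simplex n) ?I) k" for k w
        using f smaps_cells[of f _ ?Z' w k] that sub0 unfolding Hom_cells by blast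
      show "f k w = undefined" if "w \<notin> cells (sprod (simplex n) ?I) k" for k w
        using f smaps_ext[of f] that unfolding Hom_cells by blast
      show "f m (act (sprod (simplex n) ?I) k \<theta> w) = act ?Z k \<theta> (f k w)"
        if "\<theta> \<in> mono_maps m k" "w \<in> cells (sprod (simplex n) ?I) k" for m k \<theta> w
        using f smaps_act[of f _ ?Z' w k \<theta> m] that unfolding Hom_cells act by blast
    qed
    then show "f \<in> cells (Hom ?Z \<phi> \<psi>) n" using f subt unfolding Hom_cells cc by blast
  next
    assume f: "f \<in> cells (Hom ?Z \<phi> \<psi>) n"
    then have fs: "f \<in> smaps (sprod (simplex n) ?I) ?Z"
      and f0: "\<And>k s. s \<in> mono_maps k n \<Longrightarrow> f k (s, replicate (Suc k) 0) = const_cell ?Z k \<phi>"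
      and f1: "\<And>k s. s \<in> mono_maps k n \<Longrightarrow> f k (s, replicate (Suc k) 1) = const_cell ?Z k \<psi>"
      and ft: "\<And>i j. i \<le> j \<Longrightarrow> j \<le> n \<Longrightarrow> f 2 ([i,i,j], [0,1,1]) \<in> thin ?Z"
      unfolding Hom_cells by blast+
    have ct: "const_cell ?Z 1 \<chi> 2 (s, x) \<in> thin E" "const_cell ?Z 0 \<chi> 2 ([0,0,0], x) \<in> thin E"
      if x: "x \<in> thin X'" and s: "s \<in> mono_maps 2 1" and \<chi>: "\<chi> \<in> cells ?Z' 0" for x s \<chi>
    proof -
      have xc: "x \<in> cells X 2" using x c' by blast
      have m: "[0,0] \<in> mono_maps 1 0" "[0] \<in> mono_maps 0 0" "[0,0,0] \<in> mono_maps 2 0" by (simp_all add: mono_maps_def)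
      have rep: "replicate (Suc 1) 0 = [0,0::nat]" "replicate (Suc 0) 0 = [0::nat]" by simp_all
      have t: "\<chi> 2 ([0,0,0], x) \<in> thin E" using \<chi> x by (simp add: FunSc_vertex_cells)
      have "map ((!) [0,0]) s = [0,0,0::nat]"
      proof -
        have "map ((!) [0,0]) s \<in> mono_maps 2 0" by (rule mono_maps_comp[OF s m(1)])
        then show ?thesis by (auto simp: mono_maps_def numeral_2_eq_2 length_Suc_conv)
      qed
      then show "const_cell ?Z 1 \<chi> 2 (s, x) \<in> thin E"
        unfolding const_cell_def rep FunSc_act using fun_act_eval[OF m(1) s xc, of \<chi>] t by simp
      show "const_cell ?Z 0 \<chi> 2 ([0,0,0], x) \<in> thin E"
        unfolding const_cell_def rep FunSc_act using fun_act_eval[OF m(2,3) xc, of \<chi>] t by simp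
    qed
    \<comment> \<open>Over [0,0] and [1,1] the transformation is the identity of \<phi> or \<psi>.
      Over [0,1] it ends at \<psi>, which is compatible with the larger scaling, so
      \<open>FunSc_edge_lax\<close> applies.\<close>
    have edge: "f 1 (p, t) 2 (s, x) \<in> thin E"
      if p: "p \<in> mono_maps 1 n" and t: "t \<in> mono_maps 1 1" and s: "s = [0,0,1] \<or> s = [0,1,1]" and x: "x \<in> thin X'" for p t s x
    proof -
      have xc: "x \<in> cells X 2" using x c' by blast
      have sm: "s \<in> mono_maps 2 1" using s by (auto simp: mono_maps_def)
      have rep: "replicate (Suc 1) v = [v,v]" "replicate (Suc 0) v = [v]" for v :: nat by simp_all
      obtain a b where ab: "t = [a,b]" using length_mono_maps[OF t] by (auto simp: length_Suc_conv)
      have "a \<le> b" "b \<le> 1" using t by (auto simp: ab mono_maps_def)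
      then consider "t = [0,0]" | "t = [1,1]" | "t = [0,1]" unfolding ab by (cases a; cases b) auto
      then show ?thesis
      proof cases
        case 1
        then show ?thesis using f0[OF p] ct(1)[OF x sm \<phi>] unfolding rep by simp
      next
        case 2
        then show ?thesis using f1[OF p] ct(1)[OF x sm \<psi>] unfolding rep by simp
      next
        case 3
        have w: "(p, t) \<in> cells (sprod (simplex n) ?I) 1" using p t by simp
        have h: "f 1 (p, t) \<in> cells ?Z 1" by (rule smaps_cells[OF fs w])
        have m: "[1] \<in> mono_maps 0 1" "[0,0,0] \<in> mono_maps 2 0" by (simp_all add: mono_maps_def)
        have "fun_act X 1 [1] (f 1 (p, t)) = f 0 (map ((!) p) [1], [1])"
          using smaps_act[OF fs w m(1)] 3 by simp
        also have "\<dots> = const_cell ?Z 0 \<psi>" using f1[OF mono_maps_comp[OF m(1) p]] unfolding rep .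
        finally have "f 1 (p, t) 2 ([1,1,1], x) = const_cell ?Z 0 \<psi> 2 ([0,0,0], x)"
          using fun_act_eval[OF m xc, of "f 1 (p, t)"] by simp
        then have "f 1 (p, t) 2 ([1,1,1], x) \<in> thin E" using ct(2)[OF x sm \<psi>] by simp
        then show ?thesis using FunSc_edge_lax[OF X E h xc] s by auto
      qed
    qed
    have cell: "f k (p, t) \<in> cells ?Z' k" if p: "p \<in> mono_maps k n" and t: "t \<in> mono_maps k 1" for k p t
    proof -
      have w: "(p, t) \<in> cells (sprod (simplex n) ?I) k" using p t by simp
      have h: "f k (p, t) \<in> cells ?Z k" by (rule smaps_cells[OF fs w])
      have "f k (p, t) 2 (q, x) \<in> thin E" if q: "q \<in> mono_maps 2 k" "\<not> distinct q" and x: "x \<in> thin X'" for q x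
      proof -
        have xc: "x \<in> cells X 2" using x c' by blast
        obtain a b c where abc: "q = [a,b,c]" using length_mono_maps[OF q(1)] by (auto simp: length_Suc_conv numeral_2_eq_2)
        have r: "[a,c] \<in> mono_maps 1 k" using q(1) by (auto simp: abc mono_maps_def)
        \<comment> \<open>A triangle with a repeated entry factors through its long edge, so the
          edges of the cell decide.\<close>
        obtain s where s: "s = [0,0,1] \<or> s = [0,1,1]" "q = map ((!) [a,c]) s"
        proof -
          have "a = b \<or> b = c" using q by (auto simp: abc mono_maps_def)
          then have "q = map ((!) [a,c]) [0,0,1] \<or> q = map ((!) [a,c]) [0,1,1]" by (auto simp: abc)
          then show thesis using that[of "[0,0,1]"] that[of "[0,1,1]"] by blast
        qed
        have sm: "s \<in> mono_maps 2 1" using s by (auto simp: mono_maps_def)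
        have "f k (p, t) 2 (q, x) = fun_act X k [a,c] (f k (p, t)) 2 (s, x)"
          using fun_act_eval[OF r sm xc, of "f k (p, t)"] s(2) by simp
        also have "fun_act X k [a,c] (f k (p, t)) = f 1 (map ((!) p) [a,c], map ((!) t) [a,c])"
          using smaps_act[OF fs w r] by simp
        finally show ?thesis
          using edge[OF mono_maps_comp[OF r p] mono_maps_comp[OF r t] s(1) x] by simp
      qed
      then show ?thesis using h by (auto simp: FunSc_cells sp)
    qed
    have fs': "f \<in> smaps (sprod (simplex n) ?I) ?Z'"
    proof (rule smapsI)
      show "f k w \<in> cells ?Z' k" if "w \<in> cells (sprod (simplex n) ?I) k" for k w using cell that by (cases w) simp
      show "f k w = undefined" if "w \<notin> cells (sprod (simplex n) ?I) k" for k w using smaps_ext[OF fs that] .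
      show "f m (act (sprod (simplex n) ?I) k \<theta> w) = act ?Z' k \<theta> (f k w)"
        if "\<theta> \<in> mono_maps m k" "w \<in> cells (sprod (simplex n) ?I) k" for m k \<theta> w
        using smaps_act[OF fs that(2,1)] unfolding act .
    qed
    have "f 2 ([i,i,j], [0,1,1]) \<in> thin ?Z'" if ij: "i \<le> j" "j \<le> n" for i j
    proof -
      define G where "G = f 2 ([i,i,j], [0,1,1])"
      have Gc: "G \<in> cells ?Z' 2" unfolding G_def by (rule cell) (use ij in \<open>simp_all add: list_in_mono_maps\<close>)
      have Gs: "G \<in> smaps (sprod (simplex 2) X) E" using Gc by (simp add: FunSc_cells sp)
      have Gt: "G 2 (q, y) \<in> thin E" if "q \<in> mono_maps 2 2" "y \<in> thin X" for q y
        using ft[OF ij] that unfolding G_def[symmetric] FunSc_thin by blast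
      have "G 2 (q, x) \<in> thin E" if q: "q \<in> mono_maps 2 2" and x: "x \<in> thin X'" for q x
      proof (cases "distinct q")
        case False then show ?thesis using Gc q x by (simp add: FunSc_cells)
      next
        case True
        have xc: "x \<in> cells X 2" using x c' by blast
        have "[0..<Suc 2] = [0,1,2]" by (simp add: numeral_2_eq_2)
        then have q012: "q = [0,1,2]" using distinct_mono_maps_id[OF q True] by metis
        note l = act_list[OF Xs xc] act_012[OF Xs xc, unfolded One_nat_def] list_in_mono_maps
        \<comment> \<open>The first vertex of \<open>x\<close> is doubled: two faces have degenerate
          \<open>X\<close>-component, and the face over [1,1,2] is thin because \<open>G\<close> is
          already a cell for the larger scaling.\<close>
        have w: "([0,1,1,2], act X 2 [0,0,1,2] x) \<in> cells (sprod (simplex 2) X) 3"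
          using act_cells[OF Xs _ xc, of "[0,0,1,2]" 3] by (simp add: list_in_mono_maps)
        have d: "act X 2 \<theta> x \<in> thin X" if "\<theta> \<in> mono_maps 2 2" "\<not> distinct \<theta>" for \<theta> by (rule degenerate_thin[OF X xc that])
        have t: "G 2 ([0,1,1], act X 2 [0,0,1] x) \<in> thin E" "G 2 ([0,1,2], act X 2 [0,0,2] x) \<in> thin E"
          by (rule Gt d; simp add: list_in_mono_maps d)+
        have "G 2 ([1,1,2], x) \<in> thin E" using Gc x by (simp add: FunSc_cells list_in_mono_maps)
        then show ?thesis unfolding q012 using smaps_saturation[OF E Gs w] t by (simp add: l)
      qed
      then show ?thesis using Gs unfolding G_def[symmetric] FunSc_thin sp by blast
    qed
    then show "f \<in> cells (Hom ?Z' \<phi> \<psi>) n" unfolding Hom_cells cc using fs' f0 f1 by blast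
  qed
  then have "cells (Hom ?Z' \<phi> \<psi>) = cells (Hom ?Z \<phi> \<psi>)" by blast
  then show ?thesis by (simp add: Hom_def)
qed

section \<open>Comparison of the scalings\<close>

text \<open>Maps are extensional families, so restricting along an identity of underlying simplicial
  sets returns literally the same family.\<close>

lemma restriction_same:
  assumes "cells X = cells P" "cells X' = cells P" "act X = act P" "act X' = act P" "F \<in> cells (FunSc X' Y) n"
  shows "restriction (sid P) X X' Y n F = F"
proof -
  have F: "F \<in> smaps (sprod (simplex n) X') Y" using assms(5) by (simp add: FunSc_cells)
  have "restriction (sid P) X X' Y n F = scomp (sprod (simplex n) X) F (\<lambda>k (s, x). (s, sid P k x))"
    using assms(5) by (simp add: restriction_def)
  also have "\<dots> = F"
  proof (intro ext)
    fix k w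
    show "scomp (sprod (simplex n) X) F (\<lambda>k (s, x). (s, sid P k x)) k w = F k w"
      using smaps_ext[OF F, of w k] assms by (cases w) (auto simp: scomp_def sid_def)
  qed
  finally show ?thesis .
qed

lemma scomp_sid: "f \<in> smaps X Y \<Longrightarrow> scomp X (sid Y) f = f"
proof (intro ext)
  fix n x assume f: "f \<in> smaps X Y"
  show "scomp X (sid Y) f n x = f n x"
    using smaps_cells[OF f, of x n] smaps_ext[OF f, of x n] by (cases "x \<in> cells X n") (simp_all add: scomp_def sid_def)
qed

lemma sid_smaps: "sid X \<in> smaps X X" if "simplicial_set X"
  using act_cells[OF that] by (intro smapsI) (auto simp: sid_def)

text \<open>The identity is its own inverse, and the two required isomorphisms are identity edges of
  the exponential, covered by \<open>quasi_cat_identity\<close>.\<close>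

lemma quasi_cat_sid_equivalence:
  assumes A: "simplicial_set A" "quasi_cat (sFun A A)"
  shows "cat_equivalence A A (sid A)"
proof -
  have s: "sid A \<in> smaps A A" by (rule sid_smaps[OF A(1)])
  have c: "scomp A (sid A) (sid A) = sid A" by (rule scomp_sid[OF s])
  let ?v = "as_vertex A (sid A)"
  have v: "?v \<in> cells (sFun A A) 0"
    unfolding sFun_sel
  proof (rule smapsI)
    fix m n \<theta> w assume "\<theta> \<in> mono_maps m n" "w \<in> cells (sprod (simplex 0) A) n"
    then obtain p a where w: "w = (p, a)" "p \<in> mono_maps n 0" "a \<in> cells A n" and th: "\<theta> \<in> mono_maps m n" by auto
    show "?v m (act (sprod (simplex 0) A) n \<theta> w) = act A n \<theta> (?v n w)"
      using mono_maps_comp[OF th w(2)] act_cells[OF A(1) th w(3)] w by (simp add: as_vertex_def scomp_def sid_def)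
  qed (auto simp: as_vertex_def scomp_def sid_def)
  have "simplicial_set (sFun A A)" using A(2) by (simp add: quasi_cat_def)
  then have "isomorphic_objects (sFun A A) ?v ?v"
    unfolding isomorphic_objects_def using quasi_cat_identity[OF A(2) v] src_const[OF _ v] by blast
  then show ?thesis unfolding cat_equivalence_def by (intro conjI s bexI[OF _ s]) (simp_all add: c)
qed

theorem theorem3p7:
  fixes C :: "'c scaled" and D :: "'d scaled" and E :: "'e scaled"
  assumes "inf_bicategory C" and "inf_bicategory D" and "inf_bicategory E"
  shows "sc_iso (FunSc (prod_simeq C D) E) (FunSc (gray C D) E) (simeq_to_gray C D E) \<and>
    fully_faithful (FunSc (gray C D) E) (Fun_oplax (sc_prod C D) E) (gray_to_oplax C D E) \<and>
    essential_image (FunSc (gray C D) E) (Fun_oplax (sc_prod C D) E) (gray_to_oplax C D E) =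
      as_vertex (sc_prod C D) `
        {\<phi> \<in> oplax_functors (sc_prod C D) E.
           (\<forall>x \<in> cells C 0. restrict_left_vertex C D \<phi> x \<in> sc_maps D E) \<and>
           (\<forall>y \<in> cells D 0. restrict_right_vertex C D \<phi> y \<in> sc_maps C E) \<and>
           (\<forall>f \<in> cells C 1. \<forall>g \<in> cells D 1.
              \<phi> 2 (act C 1 [0,1,1] f, act D 1 [0,0,1] g) \<in> thin E)}"
proof -
  have Ci: "inner_fib C" and Di: "inner_fib D" and Ei: "inner_fib E" using assms inf_bicategory_inner_fib by auto
  have Csc: "scaled_sset C" and Dsc: "scaled_sset D" and Esc: "scaled_sset E" using Ci Di Ei by (auto intro: inner_fib_scaled)
  have Cs: "simplicial_set C" and Ds: "simplicial_set D" and Es: "simplicial_set E" using Ci Di Ei by (auto intro: inner_fib_simplicial)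
  let ?P = "sprod C D" and ?Q = "sc_prod C D"
  define G where "G = gray C D"
  define H where "H = prod_simeq C D"
  define L where "L = oplax_source ?Q"
  have Ps: "simplicial_set ?P" by (rule simplicial_sprod[OF Cs Ds])
  have Qsc: "scaled_sset ?Q" by (rule sc_prod_scaled[OF Csc Dsc])
  have Qs: "simplicial_set ?Q" using Qsc by (simp add: scaled_sset_def)
  have cQ: "cells ?Q = cells ?P" "act ?Q = act ?P" by (simp_all add: sc_prod_def)
  have cG: "cells G = cells ?P" "act G = act ?P" by (simp_all add: G_def gray_def)
  have cH: "cells H = cells ?P" "act H = act ?P" by (simp_all add: H_def prod_simeq_def)
  have cL: "cells L = cells ?P" "act L = act ?P" by (simp_all add: L_def oplax_source_def cQ)
  have Gsc: "scaled_sset G" unfolding G_def gray_def by (rule scale_scaled[OF Ps])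
  have Lsc: "scaled_sset L" unfolding L_def oplax_source_def by (rule scale_scaled[OF Qs])
  have spG: "sprod (simplex n) G = sprod (simplex n) ?P" and spH: "sprod (simplex n) H = sprod (simplex n) ?P"
    and spL: "sprod (simplex n) L = sprod (simplex n) ?P" for n
    using sprod_cong cG cH cL by metis+
  have deg: "degenerate ?Q 2 = degenerate ?P 2" using degenerate_cong[OF cQ] by blast
  have thG: "thin G = {(\<alpha>, \<beta>). (\<exists>f\<in>cells C 1. \<alpha> = act C 1 [0,1,1] f) \<and> \<beta> \<in> thin D \<or>
      \<alpha> \<in> thin C \<and> (\<exists>g\<in>cells D 1. \<beta> = act D 1 [0,0,1] g)}" unfolding G_def by (rule thin_gray[OF Csc Dsc])
  \<comment> \<open>Degenerate edges are invertible, so Gray-thin triangles belong to the scaling of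
    \<open>prod_simeq\<close>.\<close>
  have GH: "thin G \<subseteq> thin H"
  proof
    fix w assume w: "w \<in> thin G"
    obtain \<alpha> \<beta> where [simp]: "w = (\<alpha>, \<beta>)" by (cases w)
    have wc: "\<alpha> \<in> cells C 2" "\<beta> \<in> cells D 2" using thin_cells[OF Gsc w] cG by auto
    have "\<alpha> \<in> thin C \<and> \<beta> \<in> thin D \<and> (invertible C (act C 2 [1,2] \<alpha>) \<or> invertible D (act D 2 [0,1] \<beta>))"
    proof -
      consider f where "f \<in> cells C 1" "\<alpha> = act C 1 [0,1,1] f" "\<beta> \<in> thin D"
        | g where "g \<in> cells D 1" "\<beta> = act D 1 [0,0,1] g" "\<alpha> \<in> thin C" using w by (auto simp: thG)
      then show ?thesis
      proof cases
        case 1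
        have "act C 2 [1,2] \<alpha> = const_cell C 1 (tgt C f)"
          using edge_ends(4)[OF Cs 1(1), of 1] act_list[OF Cs 1(1), of "[0,1,1]" 2 "[1,2]"] 1(2) by (simp add: list_in_mono_maps)
        moreover have "\<alpha> \<in> thin C" unfolding 1(2) by (rule degenerate_thin[OF Csc 1(1)]) (simp_all add: list_in_mono_maps)
        ultimately show ?thesis using invertible_const[OF Ci edge_ends(2)[OF Cs 1(1)]] 1(3) by simp
      next
        case 2
        have "act D 2 [0,1] \<beta> = const_cell D 1 (src D g)"
          using edge_ends(3)[OF Ds 2(1), of 1] act_list[OF Ds 2(1), of "[0,0,1]" 2 "[0,1]"] 2(2) by (simp add: list_in_mono_maps)
        moreover have "\<beta> \<in> thin D" unfolding 2(2) by (rule degenerate_thin[OF Dsc 2(1)]) (simp_all add: list_in_mono_maps)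
        ultimately show ?thesis using invertible_const[OF Di edge_ends(1)[OF Ds 2(1)]] 2(3) by simp
      qed
    qed
    then show "w \<in> thin H" using wc by (simp add: H_def prod_simeq_def)
  qed
  \<comment> \<open>Invertibility in the product is projected in the form \<open>weak_inv\<close>
    and then upgraded in each factor.\<close>
  have proj: "two_inv (thin_core C) (fst e) \<and> two_inv (thin_core D) (snd e)" if "invertible ?Q e" for e
  proof -
    have wi: "weak_inv (thin_core ?Q) e"
      using ho_iso_weak_inv[OF thin_core_simplicial[OF Qsc]] that by (simp add: invertible_def)
    have ec: "e \<in> cells (thin_core ?Q) 1" using that by (simp add: invertible_def ho_iso_def)
    define f1 where "f1 n = (\<lambda>w\<in>cells (thin_core ?Q) n. fst w)" for n
    define f2 where "f2 n = (\<lambda>w\<in>cells (thin_core ?Q) n. snd w)" for n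
    have cl: "act ?Q n \<theta> w \<in> cells (thin_core ?Q) m" if "\<theta> \<in> mono_maps m n" "w \<in> cells (thin_core ?Q) n" for m n \<theta> w
      using act_cells[OF thin_core_simplicial[OF Qsc] that] by simp
    have f1: "f1 \<in> smaps (thin_core ?Q) (thin_core C)" and f2: "f2 \<in> smaps (thin_core ?Q) (thin_core D)"
      using cl by (auto intro!: smapsI simp: f1_def f2_def) (auto simp: thin_core_def)
    have "weak_inv (thin_core C) (f1 1 e)" "weak_inv (thin_core D) (f2 1 e)"
      using weak_inv_smaps[OF thin_core_simplicial[OF Qsc] f1 wi] weak_inv_smaps[OF thin_core_simplicial[OF Qsc] f2 wi] by auto
    then show ?thesis
      using weak_inv_two_inv[OF thin_core_simplicial[OF Csc] thin_core_assoc[OF Ci], of "fst e"]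
        weak_inv_two_inv[OF thin_core_simplicial[OF Dsc] thin_core_assoc[OF Di], of "snd e"] ec
      by (simp add: f1_def f2_def)
  qed
  \<comment> \<open>Respecting Gray-thin triangles implies respecting both other scalings: an oplax
    triangle has its edge (0,1) or (1,2) invertible in the product, hence (0,1) invertible in
    \<open>D\<close> or (1,2) invertible in \<open>C\<close>.\<close>
  have key: "F 2 (s, w) \<in> thin E"
    if F: "F \<in> smaps (sprod (simplex n) ?P) E" and g: "\<And>s x. s \<in> TA \<Longrightarrow> x \<in> thin G \<Longrightarrow> F 2 (s, x) \<in> thin E"
      and TA: "TA \<subseteq> mono_maps 2 n" "\<And>s. s \<in> mono_maps 2 n \<Longrightarrow> \<not> distinct s \<Longrightarrow> s \<in> TA"
      and s: "s \<in> TA" and w: "w \<in> thin H \<union> thin L" for F n TA s w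
  proof -
    interpret gray_map "simplex n" TA C D E F
    proof
      fix k \<theta> x assume "x \<in> cells (simplex n) k" "\<theta> \<in> mono_maps 2 k" "\<not> distinct \<theta>"
      then show "act (simplex n) k \<theta> x \<in> TA" using TA(2) mono_maps_comp not_distinct_comp by auto
    next
      show "F 2 (s, act C 1 [0,1,1] f, \<beta>) \<in> thin E" if "s \<in> TA" "f \<in> cells C 1" "\<beta> \<in> thin D" for s f \<beta>
        by (rule g[OF that(1)]) (use that in \<open>auto simp: thG\<close>)
      show "F 2 (s, \<alpha>, act D 1 [0,0,1] h) \<in> thin E" if "s \<in> TA" "\<alpha> \<in> thin C" "h \<in> cells D 1" for s \<alpha> h
        by (rule g[OF that(1)]) (use that in \<open>auto simp: thG\<close>)
    qed (use F TA assms(3) Ci Di simplicial_simplex in auto)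
    obtain \<alpha> \<beta> where [simp]: "w = (\<alpha>, \<beta>)" by (cases w)
    have "w \<in> thin G \<or> \<alpha> \<in> thin C \<and> \<beta> \<in> thin D \<and> (two_inv (thin_core C) (act C 2 [1,2] \<alpha>) \<or> two_inv (thin_core D) (act D 2 [0,1] \<beta>))"
    proof (cases "degenerate ?P 2 w")
      case True
      then have "w \<in> thin G" using w by (auto simp: G_def gray_def H_def prod_simeq_def L_def oplax_source_def cQ)
      then show ?thesis by simp
    next
      case False
      from w consider "w \<in> thin H" | "w \<in> thin L" by blast
      then show ?thesis
      proof cases
        case 1
        then show ?thesis using False invertible_two_inv[OF Ci] invertible_two_inv[OF Di] by (auto simp: H_def prod_simeq_def)
      next
        case 2
        then have "w \<in> thin ?Q" "invertible ?Q (act ?Q 2 [0,1] w) \<or> invertible ?Q (act ?Q 2 [1,2] w)"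
          using False deg by (auto simp: L_def oplax_source_def)
        then show ?thesis using proj[of "act ?Q 2 [0,1] w"] proj[of "act ?Q 2 [1,2] w"] by auto
      qed
    qed
    then show ?thesis using thin_if_two_inv[OF s] g[OF s] by auto
  qed
  let ?Zg = "FunSc G E" and ?Zo = "FunSc L E"
  have subH: "F \<in> cells (FunSc H E) n" "F \<in> cells ?Zo n" if "F \<in> cells ?Zg n" for F n
    using that key[of F n "{s \<in> mono_maps 2 n. \<not> distinct s}"] unfolding FunSc_cells spG spH spL by auto
  have subHt: "F \<in> thin (FunSc H E)" "F \<in> thin ?Zo" if "F \<in> thin ?Zg" for F
    using that key[of F 2 "mono_maps 2 2"] unfolding FunSc_thin spG spH spL by auto
  have supH: "F \<in> cells ?Zg n" if "F \<in> cells (FunSc H E) n" for F n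
    using that GH unfolding FunSc_cells spG spH by blast
  have supHt: "F \<in> thin ?Zg" if "F \<in> thin (FunSc H E)" for F
    using that GH unfolding FunSc_thin spG spH by blast
  have fa: "fun_act H = fun_act G" "fun_act L = fun_act G" using fun_act_cong cG cH cL by metis+
  have HG: "FunSc H E = ?Zg"
  proof -
    have "cells (FunSc H E) = cells ?Zg" using supH subH(1) by blast
    moreover have "thin (FunSc H E) = thin ?Zg" using supHt subHt(1) by blast
    moreover have "act (FunSc H E) = act ?Zg" by (simp add: fa)
    ultimately show ?thesis by simp
  qed
  have Zgsc: "scaled_sset ?Zg" by (rule FunSc_scaled[OF Gsc])
  have Zgs: "simplicial_set ?Zg" using Zgsc by (simp add: scaled_sset_def)
  have Zoi: "inner_fib ?Zo" by (rule FunSc_inner_fib[OF Lsc Ei])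
  have Zos: "simplicial_set ?Zo" by (rule inner_fib_simplicial[OF Zoi])
  \<comment> \<open>Both scalings define the same functor bicategory, so the comparison isomorphism
    is literally the identity.\<close>
  have sg: "simeq_to_gray C D E = sid ?Zg"
  proof (rule ext, rule ext)
    fix n F
    show "simeq_to_gray C D E n F = sid ?Zg n F"
    proof (cases "F \<in> cells ?Zg n")
      case True
      then have F: "F \<in> cells (FunSc H E) n" using HG by simp
      show ?thesis
        using restriction_same[OF cG(1) cH(1) cG(2) cH(2) F] True unfolding simeq_to_gray_def G_def H_def by (simp add: sid_def)
    next
      case False
      then show ?thesis using HG unfolding simeq_to_gray_def restriction_def G_def H_def by (simp add: sid_def)
    qed
  qed
  have "sid ?Zg \<in> sc_maps ?Zg ?Zg" using sid_smaps[OF Zgs] thin_cells[OF Zgsc] by (simp add: sc_maps_def sid_def)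
  then have A1: "sc_iso (FunSc (prod_simeq C D) E) (FunSc (gray C D) E) (simeq_to_gray C D E)"
    unfolding sg G_def[symmetric] H_def[symmetric] HG sc_iso_def using scomp_sid[OF sid_smaps[OF Zgs]] by blast
  have go: "gray_to_oplax C D E = sid ?Zg"
  proof (rule ext, rule ext)
    fix n F
    show "gray_to_oplax C D E n F = sid ?Zg n F"
    proof (cases "F \<in> cells ?Zg n")
      case True
      have "inv_into (cells ?Zg n) (sid ?Zg n) F = F" using True by (intro inv_into_f_eq) (auto simp: inj_on_def sid_def)
      then have "sc_inverse (FunSc (prod_simeq C D) E) (FunSc (gray C D) E) (simeq_to_gray C D E) n F = F"
        using True unfolding sg G_def[symmetric] H_def[symmetric] HG sc_inverse_def by simp
      moreover have "F \<in> cells (FunSc H E) n" using True HG by simp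
      then have "simeq_to_oplax C D E n F = F"
        using restriction_same[OF cL(1) cH(1) cL(2) cH(2)] unfolding simeq_to_oplax_def L_def H_def by blast
      ultimately show ?thesis using True unfolding gray_to_oplax_def G_def[symmetric] scomp_def by (simp add: sid_def)
    next
      case False
      then show ?thesis unfolding gray_to_oplax_def G_def[symmetric] scomp_def by (simp add: sid_def)
    qed
  qed
  have Lthin: "thin L \<subseteq> cells L 2" using Lsc by (simp add: scaled_sset_def)
  have incl: "sid ?Zg \<in> sc_maps ?Zg ?Zo"
  proof -
    have "act ?Zo = act ?Zg" by (simp add: fa)
    then have "sid ?Zg \<in> smaps ?Zg ?Zo"
      using subH(2) act_cells[OF Zgs] by (intro smapsI) (auto simp: sid_def)
    then show ?thesis using subHt(2) thin_cells[OF Zgsc] by (auto simp: sc_maps_def sid_def)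
  qed
  \<comment> \<open>\<open>Hom_FunSc_eq\<close> compares nested scalings, but the oplax scaling need
    not lie in the Gray one. The union contains it and, by \<open>key\<close>, has the same functor
    bicategory as the Gray scaling.\<close>
  define K where "K = scale ?P (thin G \<union> thin L)"
  have cK: "cells K = cells ?P" "act K = act ?P" by (simp_all add: K_def)
  have thK: "thin K = thin G \<union> thin L"
  proof -
    have "thin G \<union> thin L \<subseteq> cells ?P 2" using Lthin thin_cells[OF Gsc] cL cG by auto
    moreover have "w \<in> thin G" if "w \<in> cells ?P 2" "degenerate ?P 2 w" for w using that by (simp add: G_def gray_def)
    ultimately show ?thesis unfolding K_def scale_sel by blast
  qed
  have spK: "sprod (simplex n) K = sprod (simplex n) ?P" for n by (rule sprod_cong[OF cK])
  have KG: "FunSc K E = ?Zg"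
  proof -
    have "cells (FunSc K E) n = cells ?Zg n" for n
      using subH(2)[of _ n] unfolding set_eq_iff FunSc_cells spG spL spK thK by blast
    then have "cells (FunSc K E) = cells ?Zg" by blast
    moreover have "thin (FunSc K E) = thin ?Zg"
      using subHt(2) unfolding set_eq_iff FunSc_thin spG spL spK thK by blast
    moreover have "act (FunSc K E) = act ?Zg" using fun_act_cong[of K G] cK cG by simp
    ultimately show ?thesis by simp
  qed
  have A2: "fully_faithful (FunSc (gray C D) E) (Fun_oplax ?Q E) (gray_to_oplax C D E)"
    unfolding go G_def[symmetric] Fun_oplax_def L_def[symmetric] fully_faithful_def
  proof (intro conjI incl ballI)
    fix \<phi> \<psi> assume p: "\<phi> \<in> cells ?Zg 0" "\<psi> \<in> cells ?Zg 0"
    define A where "A = Hom ?Zo \<phi> \<psi>"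
    have HA: "Hom ?Zg \<phi> \<psi> = A"
      unfolding A_def KG[symmetric]
      by (rule Hom_FunSc_eq[OF Lsc Ei]) (use p cK cL thK Lthin thin_cells[OF Gsc] cG KG in auto)
    have As: "simplicial_set A" unfolding A_def by (rule simplicial_Hom)
    have q: "quasi_cat (sFun A A)"
      unfolding A_def by (rule Hom_exponential_quasi_cat[OF Zoi]) (use p subH(2) in auto)
    have "Hom_map ?Zg (sid ?Zg) \<phi> \<psi> = sid A"
    proof (rule ext, rule ext)
      fix n f
      show "Hom_map ?Zg (sid ?Zg) \<phi> \<psi> n f = sid A n f"
      proof (cases "f \<in> cells A n")
        case True
        then have "f \<in> smaps (sprod (simplex n) (simplex 1)) ?Zg" using HA by (metis Hom_cells)
        then show ?thesis using True HA scomp_sid by (simp add: Hom_map_def sid_def[of A])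
      next
        case False
        then show ?thesis using HA by (simp add: Hom_map_def sid_def[of A])
      qed
    qed
    moreover have "sid ?Zg 0 \<phi> = \<phi>" "sid ?Zg 0 \<psi> = \<psi>" using p by (simp_all add: sid_def)
    ultimately show "cat_equivalence (Hom ?Zg \<phi> \<psi>) (Hom ?Zo (sid ?Zg 0 \<phi>) (sid ?Zg 0 \<psi>)) (Hom_map ?Zg (sid ?Zg) \<phi> \<psi>)"
      using quasi_cat_sid_equivalence[OF As q] HA by (simp add: A_def)
  qed
  have vert: "y \<in> cells ?Zg 0 \<longleftrightarrow> y \<in> cells ?Zo 0 \<and> (\<forall>x\<in>thin G. y 2 ([0,0,0], x) \<in> thin E)" for y
    using subH(2)[of y 0] unfolding FunSc_vertex_cells spG spL by blast
  \<comment> \<open>The image is already closed under equivalence: an invertible transformation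
    carries thinness on Gray triangles from its target to its source by
    \<open>FunSc_edge_inv\<close>.\<close>
  have ei: "essential_image ?Zg ?Zo (sid ?Zg) = cells ?Zg 0"
  proof (intro equalityI subsetI)
    fix y assume "y \<in> essential_image ?Zg ?Zo (sid ?Zg)"
    then obtain x e where y: "y \<in> cells ?Zo 0" and x: "x \<in> cells ?Zg 0" and e: "invertible ?Zo e" "src ?Zo e = y" "tgt ?Zo e = x"
      by (auto simp: essential_image_def sid_def)
    have inv: "two_inv (thin_core ?Zo) e" by (rule invertible_two_inv[OF Zoi e(1)])
    have ec: "e \<in> cells ?Zo 1"
      using e(1) thin_core_cells(2)[OF inner_fib_scaled[OF Zoi]] by (simp add: invertible_def ho_iso_def)
    have m: "[v] \<in> mono_maps 0 1" "[0,0,0] \<in> mono_maps 2 0" if "v \<le> 1" for v using that by (simp_all add: mono_maps_def)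
    have "y 2 ([0,0,0], w) \<in> thin E" if w: "w \<in> thin G" for w
    proof -
      have wc: "w \<in> cells L 2" using thin_cells[OF Gsc w] cG cL by simp
      have ev: "fun_act L 1 [v] e 2 ([0,0,0], w) = e 2 ([v,v,v], w)" if "v \<le> 1" for v
        using fun_act_eval[OF m[OF that] wc, of e] by simp
      have "e 2 ([1,1,1], w) \<in> thin E"
      proof -
        have "x 2 ([0,0,0], w) \<in> thin E" using x w unfolding vert by blast
        then show ?thesis using ev[of 1] e(3) unfolding tgt_def FunSc_act by simp
      qed
      from FunSc_edge_inv[OF Lsc Ei ec wc this inv] show ?thesis
        using ev[of 0] e(2) unfolding src_def FunSc_act by simp
    qed
    then show "y \<in> cells ?Zg 0" using y vert by blast
  next
    fix y assume y: "y \<in> cells ?Zg 0"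
    then have yo: "y \<in> cells ?Zo 0" by (rule subH(2))
    show "y \<in> essential_image ?Zg ?Zo (sid ?Zg)"
      unfolding essential_image_def
      using y yo invertible_const[OF Zoi yo] src_const[OF Zos yo]
      by (intro CollectI conjI bexI[of _ y] exI[of _ "const_cell ?Zo 1 y"]) (simp_all add: sid_def)
  qed
  define \<Phi> where "\<Phi> = {\<phi> \<in> oplax_functors ?Q E.
           (\<forall>x \<in> cells C 0. restrict_left_vertex C D \<phi> x \<in> sc_maps D E) \<and>
           (\<forall>y \<in> cells D 0. restrict_right_vertex C D \<phi> y \<in> sc_maps C E) \<and>
           (\<forall>f \<in> cells C 1. \<forall>g \<in> cells D 1.
              \<phi> 2 (act C 1 [0,1,1] f, act D 1 [0,0,1] g) \<in> thin E)}"
  have smL: "smaps L E = smaps ?P E" by (rule smaps_cong[OF cL refl refl])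
  have opl: "\<phi> \<in> oplax_functors ?Q E \<longleftrightarrow> \<phi> \<in> smaps ?P E \<and> (\<forall>w\<in>thin L. \<phi> 2 w \<in> thin E)" for \<phi>
    unfolding oplax_functors_def L_def[symmetric] sc_maps_def smL by blast
  have left: "restrict_left_vertex C D \<phi> x n d = \<phi> n (const_cell C n x, d)" if "d \<in> cells D n" for \<phi> x n d
    using that by (simp add: restrict_left_vertex_def scomp_def)
  have right: "restrict_right_vertex C D \<phi> y n c = \<phi> n (c, const_cell D n y)" if "c \<in> cells C n" for \<phi> y n c
    using that by (simp add: restrict_right_vertex_def scomp_def)
  have av: "as_vertex ?Q \<phi> n (s, w) = \<phi> n w" if "s \<in> mono_maps n 0" "w \<in> cells ?P n" for \<phi> n s w
    using that by (cases w) (simp add: as_vertex_def scomp_def)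
  have avs: "as_vertex ?Q \<phi> \<in> smaps (sprod (simplex 0) ?P) E" if "\<phi> \<in> smaps ?P E" for \<phi>
  proof (rule smapsI)
    fix n w assume "w \<in> cells (sprod (simplex 0) ?P) n"
    then obtain s x where w: "w = (s, x)" "s \<in> mono_maps n 0" "x \<in> cells ?P n" by auto
    show "as_vertex ?Q \<phi> n w \<in> cells E n" unfolding w(1) av[OF w(2,3)] by (rule smaps_cells[OF that w(3)])
    fix m \<theta> assume th: "\<theta> \<in> mono_maps m n"
    have "as_vertex ?Q \<phi> m (map ((!) s) \<theta>, act ?P n \<theta> x) = \<phi> m (act ?P n \<theta> x)"
      by (rule av[OF mono_maps_comp[OF th w(2)] act_cells[OF Ps th w(3)]])
    then show "as_vertex ?Q \<phi> m (act (sprod (simplex 0) ?P) n \<theta> w) = act E n \<theta> (as_vertex ?Q \<phi> n w)"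
      unfolding w(1) av[OF w(2,3)] using smaps_act[OF that w(3) th] by simp
  next
    fix n w assume "w \<notin> cells (sprod (simplex 0) ?P) n"
    then show "as_vertex ?Q \<phi> n w = undefined" by (cases w) (auto simp: as_vertex_def scomp_def)
  qed
  have z3: "[0,0,0] \<in> mono_maps 2 0" by (simp add: mono_maps_def)
  have "as_vertex ?Q ` \<Phi> = cells ?Zg 0"
  proof (intro equalityI subsetI)
    fix y assume "y \<in> as_vertex ?Q ` \<Phi>"
    then obtain \<phi> where y: "y = as_vertex ?Q \<phi>" and \<phi>: "\<phi> \<in> \<Phi>" by blast
    have ps: "\<phi> \<in> smaps ?P E" and pL: "\<And>w. w \<in> thin L \<Longrightarrow> \<phi> 2 w \<in> thin E"
      and p1: "\<And>x \<beta>. x \<in> cells C 0 \<Longrightarrow> \<beta> \<in> thin D \<Longrightarrow> \<phi> 2 (const_cell C 2 x, \<beta>) \<in> thin E"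
      and p2: "\<And>x \<alpha>. x \<in> cells D 0 \<Longrightarrow> \<alpha> \<in> thin C \<Longrightarrow> \<phi> 2 (\<alpha>, const_cell D 2 x) \<in> thin E"
      and p3: "\<And>f g. f \<in> cells C 1 \<Longrightarrow> g \<in> cells D 1 \<Longrightarrow> \<phi> 2 (act C 1 [0,1,1] f, act D 1 [0,0,1] g) \<in> thin E"
    proof -
      show "\<phi> \<in> smaps ?P E" "\<And>w. w \<in> thin L \<Longrightarrow> \<phi> 2 w \<in> thin E" using \<phi> unfolding \<Phi>_def opl by blast+
      show "\<phi> 2 (const_cell C 2 x, \<beta>) \<in> thin E" if "x \<in> cells C 0" "\<beta> \<in> thin D" for x \<beta>
      proof -
        have "restrict_left_vertex C D \<phi> x \<in> sc_maps D E" using \<phi> that unfolding \<Phi>_def by blast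
        then have "restrict_left_vertex C D \<phi> x 2 \<beta> \<in> thin E" using that(2) unfolding sc_maps_def by blast
        then show ?thesis unfolding left[OF thin_cells[OF Dsc that(2)]] .
      qed
      show "\<phi> 2 (\<alpha>, const_cell D 2 x) \<in> thin E" if "x \<in> cells D 0" "\<alpha> \<in> thin C" for x \<alpha>
      proof -
        have "restrict_right_vertex C D \<phi> x \<in> sc_maps C E" using \<phi> that unfolding \<Phi>_def by blast
        then have "restrict_right_vertex C D \<phi> x 2 \<alpha> \<in> thin E" using that(2) unfolding sc_maps_def by blast
        then show ?thesis unfolding right[OF thin_cells[OF Csc that(2)]] .
      qed
      show "\<phi> 2 (act C 1 [0,1,1] f, act D 1 [0,0,1] g) \<in> thin E" if "f \<in> cells C 1" "g \<in> cells D 1" for f g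
        using \<phi> that unfolding \<Phi>_def by blast
    qed
    \<comment> \<open>\<open>f\<close> is traversed before \<beta>: the other three faces are
      covered by (i) at the target of \<open>f\<close> and by (ii) for the edges (0,1) and (0,2) of
      \<beta>.\<close>
    have G1: "\<phi> 2 (act C 1 [0,1,1] f, \<beta>) \<in> thin E" if f: "f \<in> cells C 1" and \<beta>: "\<beta> \<in> thin D" for f \<beta>
    proof -
      have bc: "\<beta> \<in> cells D 2" by (rule thin_cells[OF Dsc \<beta>])
      note l = act_list[OF Cs f, unfolded One_nat_def] act_list[OF Ds bc] act_012[OF Ds bc, unfolded One_nat_def] list_in_mono_maps
      have e: "act D 2 [0,1] \<beta> \<in> cells D 1" "act D 2 [0,2] \<beta> \<in> cells D 1" by (rule act_cells[OF Ds _ bc]; simp add: list_in_mono_maps)+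
      have w: "(act C 1 [0,1,1,1] f, act D 2 [0,0,1,2] \<beta>) \<in> cells ?P 3"
        using act_cells[OF Cs _ f, of "[0,1,1,1]" 3] act_cells[OF Ds _ bc, of "[0,0,1,2]" 3] by (simp add: list_in_mono_maps)
      have "act C 1 [1,1,1] f = const_cell C 2 (tgt C f)" using edge_ends(4)[OF Cs f, of 2] by (simp add: numeral_2_eq_2)
      then show ?thesis
        using smaps_saturation[OF Ei ps w] p3[OF f e(1)] p3[OF f e(2)] p1[OF edge_ends(2)[OF Cs f] \<beta>] by (simp add: l)
    qed
    \<comment> \<open>Dually \<open>g\<close> is traversed after \<alpha>, with (i) at the source of
      \<open>g\<close> and (ii) for the edges (0,2) and (1,2) of \<alpha>.\<close>
    have G2: "\<phi> 2 (\<alpha>, act D 1 [0,0,1] g) \<in> thin E" if g: "g \<in> cells D 1" and \<alpha>: "\<alpha> \<in> thin C" for g \<alpha>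
    proof -
      have ac: "\<alpha> \<in> cells C 2" by (rule thin_cells[OF Csc \<alpha>])
      note l = act_list[OF Ds g, unfolded One_nat_def] act_list[OF Cs ac] act_012[OF Cs ac, unfolded One_nat_def] list_in_mono_maps
      have e: "act C 2 [0,2] \<alpha> \<in> cells C 1" "act C 2 [1,2] \<alpha> \<in> cells C 1" by (rule act_cells[OF Cs _ ac]; simp add: list_in_mono_maps)+
      have w: "(act C 2 [0,1,2,2] \<alpha>, act D 1 [0,0,0,1] g) \<in> cells ?P 3"
        using act_cells[OF Ds _ g, of "[0,0,0,1]" 3] act_cells[OF Cs _ ac, of "[0,1,2,2]" 3] by (simp add: list_in_mono_maps)
      have "act D 1 [0,0,0] g = const_cell D 2 (src D g)" using edge_ends(3)[OF Ds g, of 2] by (simp add: numeral_2_eq_2)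
      then show ?thesis
        using smaps_saturation[OF Ei ps w] p3[OF e(1) g] p3[OF e(2) g] p2[OF edge_ends(1)[OF Ds g] \<alpha>] by (simp add: l)
    qed
    have t: "y 2 ([0,0,0], w) \<in> thin E" if "w \<in> thin G \<union> thin L" for w
    proof -
      have "w \<in> cells ?P 2" using that subsetD[OF Lthin] thin_cells[OF Gsc] unfolding cL cG by blast
      moreover have "\<phi> 2 w \<in> thin E" using that G1 G2 pL unfolding thG by blast
      ultimately show ?thesis unfolding y by (simp only: av[OF z3])
    qed
    show "y \<in> cells ?Zg 0" unfolding FunSc_vertex_cells spG using avs[OF ps] t y by blast
  next
    fix y assume y: "y \<in> cells ?Zg 0"
    have ys: "y \<in> smaps (sprod (simplex 0) ?P) E" and yt: "\<And>w. w \<in> thin G \<Longrightarrow> y 2 ([0,0,0], w) \<in> thin E"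
      using y unfolding FunSc_vertex_cells spG by blast+
    have yL: "y 2 ([0,0,0], w) \<in> thin E" if "w \<in> thin L" for w
      using subH(2)[OF y] that unfolding FunSc_vertex_cells by blast
    have m0: "s \<in> mono_maps n 0 \<longleftrightarrow> s = replicate (Suc n) 0" for s n
    proof
      assume s: "s \<in> mono_maps n 0"
      show "s = replicate (Suc n) 0"
        by (rule mono_maps_eqI[OF s replicate_mono_maps[OF order_refl]])
          (use mono_maps_nth[OF s] in \<open>auto simp: mono_fn_def less_Suc_eq_le simp del: replicate_Suc\<close>)
    qed (simp add: replicate_mono_maps del: replicate_Suc)
    \<comment> \<open>The point has exactly one simplex in each dimension; evaluating there turns a
      vertex of the functor bicategory back into a map.\<close>
    define \<phi> where "\<phi> n = (\<lambda>w\<in>cells ?P n. y n (replicate (Suc n) 0, w))" for n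
    have \<phi>s: "\<phi> \<in> smaps ?P E"
    proof (rule smapsI)
      fix n w assume w: "w \<in> cells ?P n"
      have w': "(replicate (Suc n) 0, w) \<in> cells (sprod (simplex 0) ?P) n" using w m0 by simp
      show "\<phi> n w \<in> cells E n" using smaps_cells[OF ys w'] w by (simp add: \<phi>_def del: replicate_Suc)
      fix m \<theta> assume th: "\<theta> \<in> mono_maps m n"
      show "\<phi> m (act ?P n \<theta> w) = act E n \<theta> (\<phi> n w)"
        using smaps_act[OF ys w' th] act_cells[OF Ps th w] w map_nth_replicate[OF th, of "0::nat"]
        by (simp add: \<phi>_def del: replicate_Suc sprod_cells)
    qed (simp add: \<phi>_def)
    have yv: "y = as_vertex ?Q \<phi>"
    proof (rule smaps_eqI[OF ys avs[OF \<phi>s]])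
      fix n w assume "w \<in> cells (sprod (simplex 0) ?P) n"
      then obtain s x where w: "w = (s, x)" "s \<in> mono_maps n 0" "x \<in> cells ?P n" by auto
      show "y n w = as_vertex ?Q \<phi> n w"
        unfolding w(1) av[OF w(2,3)] using w m0[of s n] by (simp add: \<phi>_def del: replicate_Suc sprod_cells)
    qed
    have r3: "replicate (Suc 2) 0 = [0,0,0::nat]" by (simp add: numeral_2_eq_2)
    have \<phi>2: "\<phi> 2 w \<in> thin E" if "w \<in> thin G \<union> thin L" for w
    proof -
      have "w \<in> cells ?P 2" using that subsetD[OF Lthin] thin_cells[OF Gsc] unfolding cL cG by blast
      then have "\<phi> 2 w = y 2 ([0,0,0], w)" unfolding \<phi>_def r3 by simp
      moreover have "y 2 ([0,0,0], w) \<in> thin E" using that by (elim UnE) (rule yt yL, assumption)+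
      ultimately show ?thesis by (simp only:)
    qed
    \<comment> \<open>A constant triangle degenerates along either short edge, so condition (i) is
      an instance of Gray thinness.\<close>
    have cd: "const_cell C 2 x = act C 1 [0,1,1] (const_cell C 1 x)" if "x \<in> cells C 0" for x
      using const_cell_act[OF Cs that, of "[0,1,1]" 2 1] by (simp add: list_in_mono_maps)
    have dd: "const_cell D 2 x = act D 1 [0,0,1] (const_cell D 1 x)" if "x \<in> cells D 0" for x
      using const_cell_act[OF Ds that, of "[0,0,1]" 2 1] by (simp add: list_in_mono_maps)
    have "\<phi> \<in> \<Phi>"
      unfolding \<Phi>_def opl
    proof (intro CollectI conjI ballI \<phi>s)
      show "\<phi> 2 w \<in> thin E" if "w \<in> thin L" for w using \<phi>2 that by blast
    next
      fix x assume x: "x \<in> cells C 0"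
      have k: "(const_cell C n x, d) \<in> cells ?P n" if "d \<in> cells D n" for n d using that const_cell_cells[OF Cs x] by simp
      have "restrict_left_vertex C D \<phi> x \<in> smaps D E"
      proof (rule smapsI)
        fix n d assume d: "d \<in> cells D n"
        show "restrict_left_vertex C D \<phi> x n d \<in> cells E n" unfolding left[OF d] by (rule smaps_cells[OF \<phi>s k[OF d]])
        fix m \<theta> assume th: "\<theta> \<in> mono_maps m n"
        show "restrict_left_vertex C D \<phi> x m (act D n \<theta> d) = act E n \<theta> (restrict_left_vertex C D \<phi> x n d)"
          unfolding left[OF d] left[OF act_cells[OF Ds th d]] using smaps_act[OF \<phi>s k[OF d] th] const_cell_act[OF Cs x th] by simp
      qed (simp add: restrict_left_vertex_def scomp_def)
      moreover have "restrict_left_vertex C D \<phi> x 2 \<beta> \<in> thin E" if "\<beta> \<in> thin D" for \<beta>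
        unfolding left[OF thin_cells[OF Dsc that]] cd[OF x]
        by (rule \<phi>2) (use that const_cell_cells[OF Cs x] in \<open>auto simp: thG\<close>)
      ultimately show "restrict_left_vertex C D \<phi> x \<in> sc_maps D E" by (simp add: sc_maps_def)
    next
      fix x assume x: "x \<in> cells D 0"
      have k: "(d, const_cell D n x) \<in> cells ?P n" if "d \<in> cells C n" for n d using that const_cell_cells[OF Ds x] by simp
      have "restrict_right_vertex C D \<phi> x \<in> smaps C E"
      proof (rule smapsI)
        fix n d assume d: "d \<in> cells C n"
        show "restrict_right_vertex C D \<phi> x n d \<in> cells E n" unfolding right[OF d] by (rule smaps_cells[OF \<phi>s k[OF d]])
        fix m \<theta> assume th: "\<theta> \<in> mono_maps m n"
        show "restrict_right_vertex C D \<phi> x m (act C n \<theta> d) = act E n \<theta> (restrict_right_vertex C D \<phi> x n d)"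
          unfolding right[OF d] right[OF act_cells[OF Cs th d]] using smaps_act[OF \<phi>s k[OF d] th] const_cell_act[OF Ds x th] by simp
      qed (simp add: restrict_right_vertex_def scomp_def)
      moreover have "restrict_right_vertex C D \<phi> x 2 \<alpha> \<in> thin E" if "\<alpha> \<in> thin C" for \<alpha>
        unfolding right[OF thin_cells[OF Csc that]] dd[OF x]
        by (rule \<phi>2) (use that const_cell_cells[OF Ds x] in \<open>auto simp: thG\<close>)
      ultimately show "restrict_right_vertex C D \<phi> x \<in> sc_maps C E" by (simp add: sc_maps_def)
    next
      fix f g assume fg: "f \<in> cells C 1" "g \<in> cells D 1"
      have "act D 1 [0,0,1] g \<in> thin D" by (rule degenerate_thin[OF Dsc fg(2)]) (simp_all add: list_in_mono_maps)
      then show "\<phi> 2 (act C 1 [0,1,1] f, act D 1 [0,0,1] g) \<in> thin E"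
        by (intro \<phi>2) (use fg in \<open>auto simp: thG\<close>)
    qed
    then show "y \<in> as_vertex ?Q ` \<Phi>" using yv by blast
  qed
  then have "essential_image (FunSc (gray C D) E) (Fun_oplax ?Q E) (gray_to_oplax C D E) = as_vertex ?Q ` \<Phi>"
    unfolding go G_def[symmetric] Fun_oplax_def L_def[symmetric] ei by simp
  then show ?thesis using A1 A2 unfolding \<Phi>_def by blast
qed

end
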